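(* Let $n\ge2$ be an integer. Assume that the coupling operators $C_{i\,i-1}$, $i=2,\dots,n$, satisfy the Coupling hypothesis of order $n$ with operators $\Pi_i$ satisfying the Coupling observability hypothesis of order $n$, and that $\mathbf{B}_n^{*}$ satisfies the Admissibility and Observability hypotheses of index $n$. Let $T_n^{*}>0$ be the observability time defined in the context. (i) Let $\mathbf{B}_n^{*}(w_n,w_n')=B_n^{*}w_n'$ with $B_n\in\mathcal L(G_n,H)$, and set $X_{-(n-1)}^{*}=\big(\prod_{i=1}^nH_{n-i+1}\big)\times\big(\prod_{i=1}^nH_{n-i}\big)$. Then for all $T>T_n^{*}$ and all $Y_0\in X_{-(n-1)}^{*}$ there exists a control function $v_n\in L^2((0,T);G_n)$ such that the solution $Y=(y_1,\dots,y_n,y_1',\dots,y_n')$ of the control system with initial data $Y_0$ satisfies $Y(T)=0$. (ii) Let $\mathbf{B}_n^{*}(w_n,w_n')=B_n^{*}w_n$ with $B_n\in\mathcal L(G_n,H_2')$, and set $X_{(n-1)}^{*}=\big(\prod_{i=1}^nH_{n-i}\big)\times\big(\prod_{i=1}^nH_{n-i-1}\big)$. Then for all $T>T_n^{*}$ and all $Y_0\in X_{(n-1)}^{*}$ there exists a control function $v_n\in L^2((0,T);G_n)$ such that the solution $Y$ of the control system with initial data $Y_0$ satisfies $Y(T)=0$.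
   Context: Abstract setting. $H$ is a Hilbert space with norm $|\cdot|$ and scalar product $\langle\cdot,\cdot\rangle$. $A:D(A)\subset H\to H$ is a positive self-adjoint operator with compact resolvent such that, for some $\omega>0$, $|Au|\ge\omega|u|$ for all $u\in D(A)$. For $k\in\mathbb N$, $H_k=D(A^{k/2})$ with norm $|A^{k/2}\cdot|$ ($H_0=H$), and $H_{-k}=H_k'$ is the dual of $H_k$ with pivot space $H$, with norm $|A^{-k/2}\cdot|$. For $k\in\mathbb Z$ and a pair $W=(w,w')$, $e_k(W)=\frac12\big(|A^{k/2}w|^2+|A^{(k-1)/2}w'|^2\big)$. Coupling hypothesis of order $n$. For all $i\in\{2,\dots,n\}$: $C_{i\,i-1}$ is a bounded operator on $H$; $C_{i\,i-1}^{*}\in\mathcal L(H_k)$ for $k\in\{0,1,\dots,n-i+1\}$; $\|C_{i\,i-1}\|=\beta_i$ and $|C_{i\,i-1}w|^2\le\beta_i\langle C_{i\,i-1}w,w\rangle$ for all $w\in H$; there exists $\alpha_i>0$ such that $\alpha_i|\Pi_iw|^2\le\langle C_{i\,i-1}w,w\rangle$ for all $w\in H$. Coupling observability hypothesis of order $n$. For all $i\in\{2,\dots,n\}$: $\Pi_i\in\mathcal L(H)$ and there exists $T_{0,i}>0$ such that for all $T>T_{0,i}$ there exists $\gamma_i(T)>0$ such that all solutions $w$ of $w''+Aw=0$ satisfy $\int_0^T|\Pi_iw'|^2dt\ge\gamma_i(T)e_1(W)(0)$, where $W=(w,w')$. Admissibility hypothesis of index $n$. $G_n$ is a Hilbert space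 (identified with its dual), $\mathbf{B}_n^{*}\in\mathcal L(H_2\times H;G_n)$, and for all $T>0$ there exists $D_n(T)>0$ such that all solutions $w$ of $w''+Aw=f\in L^2([0,T];H)$ satisfy, with $W=(w,w')$, $$\int_0^T\|\mathbf{B}_n^{*}(w,w')\|_{G_n}^2dt\le D_n(T)\Big(e_1(W)(0)+e_1(W)(T)+\int_0^Te_1(W)(t)\,dt+\int_0^T|f|^2dt\Big).$$ Observations of solutions of lower regularity are understood by extension by density. Observability hypothesis of index $n$. There exists $T_{0,n}>0$ such that for all $T>T_{0,n}$ there exists $R_n(T)>0$ such that all solutions $w$ of $w''+Aw=0$ satisfy $\int_0^T\|\mathbf{B}_n^{*}(w,w')\|_{G_n}^2dt\ge R_n(T)e_1(W)(0)$. Dual bi-diagonal cascade system: $w_1''+Aw_1=0$, $w_i''+Aw_i+C_{i\,i-1}w_{i-1}=0$ ($2\le i\le n$); $W_i=(w_i,w_i')$. Observability time $T_n^{*}$: a time $T_n^{*}>0$ such that for all $i=1,\dots,n$ and all $T>T_n^{*}$ there exist constants $d_{i,n}(T)>0$ such that every solution of the dual cascade system with initial data in $H_1^n\times H^n$ satisfies $e_{1+i-n}(W_i)(0)\le d_{i,n}(T)\int_0^T\|\mathbf{B}_n^{*}(W_n)\|_{G_n}^2dt$, with $d_{i,n}(T)\le K/T^3$ for $i\le n-1$ and $d_{n,n}(T)\le K/T$, $K$ bounded with respect to $T$. (Under the hypotheses above such a time exists.) Control system: $$y_i''+Ay_i+C_{i+1\,i}^{*}y_{i+1}=0\ (1\le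 i\le n-1),\qquad y_n''+Ay_n=B_nv_n,\qquad (y_i,y_i')(0)=(y_i^0,y_i^1)\ (1\le i\le n),$$ with $Y_0=(y_1^0,\dots,y_n^0,y_1^1,\dots,y_n^1)$. Solutions are understood in the sense of transposition: $Y$ is continuous in time with values in the space of $Y_0$ and, for every $t\in[0,T]$ and every solution $(w_1,\dots,w_n)$ of the dual cascade system with data at time $t$ in the dual space ($(\prod_{i}H_{i-n})\times(\prod_iH_{i-n-1})$ in case (i), $(\prod_iH_{i-n+1})\times(\prod_iH_{i-n})$ in case (ii)), $$\int_0^t\langle v_n,B_n^{*}w_n\rangle_{G_n}ds=\sum_{k=1}^n\big(\langle y_k'(t),w_k(t)\rangle-\langle y_k(t),w_k'(t)\rangle\big)-\sum_{k=1}^n\big(\langle y_k^1,w_k(0)\rangle-\langle y_k^0,w_k'(0)\rangle\big),$$ with the appropriate duality pairings. *)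

theory Defs
  imports "HOL-Analysis.Analysis"
begin

section \<open>Unbounded operators as graphs\<close>

text \<open>
  An unbounded operator on the real Hilbert space \<open>'h\<close> is its graph, so products, powers and
  inverses are relational composition, iteration and converse.  A self-adjoint graph in the sense
  below is automatically linear, single-valued and closed: the adjoint relation of a densely
  defined relation has these properties.
\<close>

definition app :: "('a \<times> 'b) set \<Rightarrow> 'a \<Rightarrow> 'b" where
  "app R u = (THE v. (u, v) \<in> R)"

definition adj_graph :: "('h::real_inner \<times> 'h) set \<Rightarrow> ('h \<times> 'h) set" where
  "adj_graph A = {(u, v). \<forall>(x, y) \<in> A. y \<bullet> u = x \<bullet> v}"

definition self_adjoint :: "('h::real_inner \<times> 'h) set \<Rightarrow> bool" where
  "self_adjoint A \<longleftrightarrow> closure (Domain A) = UNIV \<and> adj_graph A = A"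

definition positive_op :: "('h::real_inner \<times> 'h) set \<Rightarrow> bool" where
  "positive_op A \<longleftrightarrow> (\<forall>(u, v) \<in> A. 0 \<le> v \<bullet> u)"

definition resolvent :: "('h::real_inner \<times> 'h) set \<Rightarrow> real \<Rightarrow> ('h \<times> 'h) set" where
  "resolvent A \<mu> = {(v - \<mu> *\<^sub>R u, u) | u v. (u, v) \<in> A}"

definition compact_op :: "('h::real_inner \<times> 'h) set \<Rightarrow> bool" where
  "compact_op R \<longleftrightarrow> single_valued R \<and> Domain R = UNIV \<and> compact (closure (R `` cball 0 1))"

definition admissible_generator :: "('h::real_inner \<times> 'h) set \<Rightarrow> bool" where
  "admissible_generator A \<longleftrightarrow>
     self_adjoint A \<and> positive_op A \<and> (\<exists>\<mu>. compact_op (resolvent A \<mu>)) \<and>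
     (\<exists>\<omega>>0. \<forall>(u, v) \<in> A. \<omega> * norm u \<le> norm v)"

text \<open>\<open>sqrt_op A\<close> is the unique positive self-adjoint square root; \<open>hpow A k\<close> is \<open>A\<^sup>k\<^sup>/\<^sup>2\<close>,
  for negative \<open>k\<close> an everywhere defined operator on \<open>'h\<close>.\<close>

definition sqrt_op :: "('h::real_inner \<times> 'h) set \<Rightarrow> ('h \<times> 'h) set" where
  "sqrt_op A = (THE S. self_adjoint S \<and> positive_op S \<and> S O S = A)"

definition hpow :: "('h::real_inner \<times> 'h) set \<Rightarrow> int \<Rightarrow> ('h \<times> 'h) set" where
  "hpow A k = (if 0 \<le> k then sqrt_op A ^^ nat k else (sqrt_op A ^^ nat (- k))\<inverse>)"

definition hdom :: "('h::real_inner \<times> 'h) set \<Rightarrow> int \<Rightarrow> 'h set" where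
  "hdom A k = Domain (hpow A k)"

definition hnorm :: "('h::real_inner \<times> 'h) set \<Rightarrow> int \<Rightarrow> 'h \<Rightarrow> real" where
  "hnorm A k u = norm (app (hpow A k) u)"

definition energy :: "('h::real_inner \<times> 'h) set \<Rightarrow> int \<Rightarrow> 'h \<Rightarrow> 'h \<Rightarrow> real" where
  "energy A k w w' = ((hnorm A k w)\<^sup>2 + (hnorm A (k - 1) w')\<^sup>2) / 2"

definition bounded_op :: "'a::real_vector set \<Rightarrow> ('a \<Rightarrow> real) \<Rightarrow> 'b::real_vector set \<Rightarrow>
    ('b \<Rightarrow> real) \<Rightarrow> ('a \<Rightarrow> 'b) \<Rightarrow> bool" where
  "bounded_op V p W q f \<longleftrightarrow>
     (\<forall>x\<in>V. f x \<in> W) \<and>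
     (\<forall>x\<in>V. \<forall>y\<in>V. f (x + y) = f x + f y) \<and>
     (\<forall>x\<in>V. \<forall>c. f (c *\<^sub>R x) = c *\<^sub>R f x) \<and>
     (\<exists>K. \<forall>x\<in>V. q (f x) \<le> K * p x)"


section \<open>The scale of spaces, including negative orders\<close>

text \<open>
  All spaces \<open>H\<^sub>k\<close>, \<open>k\<close> an integer, are realised as sets of functionals.  With pivot space
  \<open>H = H'\<close>, a vector \<open>u\<close> of \<open>H\<^sub>k\<close>, \<open>k \<ge> 0\<close>, is the functional \<open>inner u\<close>; \<open>riesz\<close> recovers the
  vector.  For \<open>k < 0\<close>, \<open>H\<^sub>k\<close> is the dual of \<open>H\<^sub>-\<^sub>k\<close>; functionals are set to \<open>0\<close> off \<open>H\<^sub>-\<^sub>k\<close> only to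
  make them determined by their values on \<open>H\<^sub>-\<^sub>k\<close>.  For \<open>k < 0\<close> the norm is the dual norm, which is
  the one obtained by extending \<open>A\<^sup>k\<^sup>/\<^sup>2\<close> from \<open>H\<close> to \<open>H\<^sub>k\<close>.
\<close>

definition riesz :: "('a::real_inner \<Rightarrow> real) \<Rightarrow> 'a" where
  "riesz f = (THE u. f = inner u)"

definition Hs :: "('h::real_inner \<times> 'h) set \<Rightarrow> int \<Rightarrow> ('h \<Rightarrow> real) set" where
  "Hs A k =
     (if 0 \<le> k then inner ` hdom A k
      else {f. bounded_op (hdom A (- k)) (hnorm A (- k)) UNIV abs f \<and> (\<forall>x. x \<notin> hdom A (- k) \<longrightarrow> f x = 0)})"

definition Hs_norm :: "('h::real_inner \<times> 'h) set \<Rightarrow> int \<Rightarrow> ('h \<Rightarrow> real) \<Rightarrow> real" where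
  "Hs_norm A k f =
     (if 0 \<le> k then hnorm A k (riesz f)
      else Sup {\<bar>f x\<bar> | x. x \<in> hdom A (- k) \<and> hnorm A (- k) x \<le> 1})"

text \<open>Duality pairing of \<open>f\<close> in \<open>H\<^sub>k\<close> with \<open>g\<close> in \<open>H\<^sub>-\<^sub>k\<close>.\<close>

definition pairing :: "int \<Rightarrow> ('h::real_inner \<Rightarrow> real) \<Rightarrow> ('h \<Rightarrow> real) \<Rightarrow> real" where
  "pairing k f g = (if 0 \<le> k then g (riesz f) else f (riesz g))"

definition Hs_continuous ::
    "('h::real_inner \<times> 'h) set \<Rightarrow> int \<Rightarrow> real \<Rightarrow> (real \<Rightarrow> 'h \<Rightarrow> real) \<Rightarrow> bool" where
  "Hs_continuous A k T f \<longleftrightarrow>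
     (\<forall>t\<in>{0..T}. f t \<in> Hs A k) \<and>
     (\<forall>t\<in>{0..T}. ((\<lambda>r. Hs_norm A k (\<lambda>x. f r x - f t x)) \<longlongrightarrow> 0) (at t within {0..T}))"


section \<open>Finite energy solutions of the wave equation and observations\<close>

text \<open>Square integrable functions with values in a possibly non-separable Hilbert space; the
  first conjunct is strong measurability, which the library's Bochner integral does not offer
  outside second countable spaces.\<close>

definition L2 :: "real \<Rightarrow> (real \<Rightarrow> 'a::real_normed_vector) set" where
  "L2 T = {f.
     (\<exists>s. (\<forall>m::nat. simple_function (lebesgue_on {0..T}) (s m)) \<and>
          (AE t in lebesgue_on {0..T}. (\<lambda>m. s m t) \<longlonglongrightarrow> f t)) \<and>
     integrable (lebesgue_on {0..T}) (\<lambda>t. (norm (f t))\<^sup>2)}"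

text \<open>\<open>w'' + A w = f\<close> on \<open>[0,T]\<close> in the weak sense, with \<open>(w, w')\<close> continuous in \<open>H\<^sub>1 \<times> H\<close>.\<close>

definition wave_solution :: "('h::real_inner \<times> 'h) set \<Rightarrow> real \<Rightarrow>
    (real \<Rightarrow> 'h) \<Rightarrow> (real \<Rightarrow> 'h) \<Rightarrow> (real \<Rightarrow> 'h) \<Rightarrow> bool" where
  "wave_solution A T w w' f \<longleftrightarrow>
     f \<in> L2 T \<and>
     (\<forall>t\<in>{0..T}. w t \<in> hdom A 1) \<and>
     continuous_on {0..T} (\<lambda>t. app (hpow A 1) (w t)) \<and>
     continuous_on {0..T} w' \<and>
     (\<forall>t\<in>{0..T}. (w has_vector_derivative w' t) (at t within {0..T})) \<and>
     (\<forall>(\<phi>, \<psi>) \<in> A. \<forall>t\<in>{0..T}.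
        w' t \<bullet> \<phi> = w' 0 \<bullet> \<phi> - (LINT s:{0..t}|lebesgue. w s \<bullet> \<psi>) + (LINT s:{0..t}|lebesgue. f s \<bullet> \<phi>))"

text \<open>Solutions regular enough for an observation operator defined on \<open>H\<^sub>2 \<times> H\<close> to be applied
  pointwise in time.\<close>

definition regular_solution :: "('h::real_inner \<times> 'h) set \<Rightarrow> real \<Rightarrow>
    (real \<Rightarrow> 'h) \<Rightarrow> (real \<Rightarrow> 'h) \<Rightarrow> (real \<Rightarrow> 'h) \<Rightarrow> bool" where
  "regular_solution A T w w' f \<longleftrightarrow>
     wave_solution A T w w' f \<and> (\<forall>t\<in>{0..T}. w t \<in> hdom A 2) \<and>
     continuous_on {0..T} (\<lambda>t. app (hpow A 2) (w t))"

text \<open>\<open>g\<close> is the observation \<open>B (w, w')\<close> of a finite energy solution, understood by extension by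
  density from regular solutions.\<close>

definition is_observation :: "('h::real_inner \<times> 'h) set \<Rightarrow> ('h \<times> 'h \<Rightarrow> 'g::real_inner) \<Rightarrow> real \<Rightarrow>
    (real \<Rightarrow> 'h) \<Rightarrow> (real \<Rightarrow> 'h) \<Rightarrow> (real \<Rightarrow> 'h) \<Rightarrow> (real \<Rightarrow> 'g) \<Rightarrow> bool" where
  "is_observation A B T w w' f g \<longleftrightarrow>
     wave_solution A T w w' f \<and> g \<in> L2 T \<and>
     (\<exists>u u' h. (\<forall>m::nat. regular_solution A T (u m) (u' m) (h m)) \<and>
        uniform_limit {0..T} (\<lambda>m t. app (hpow A 1) (u m t)) (\<lambda>t. app (hpow A 1) (w t)) sequentially \<and>
        uniform_limit {0..T} u' w' sequentially \<and>
        (\<lambda>m. LINT t:{0..T}|lebesgue. (norm (h m t - f t))\<^sup>2) \<longlonglongrightarrow> 0 \<and>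
        (\<lambda>m. LINT t:{0..T}|lebesgue. (norm (B (u m t, u' m t) - g t))\<^sup>2) \<longlonglongrightarrow> 0)"


section \<open>Hypotheses\<close>

text \<open>\<open>C i\<close> stands for the coupling operator with double index \<open>i, i-1\<close>.\<close>

definition coupling_hyp :: "('h::{real_inner, complete_space} \<times> 'h) set \<Rightarrow> nat \<Rightarrow>
    (nat \<Rightarrow> 'h \<Rightarrow> 'h) \<Rightarrow> (nat \<Rightarrow> 'h \<Rightarrow> 'h) \<Rightarrow> bool" where
  "coupling_hyp A n C P \<longleftrightarrow>
     (\<forall>i\<in>{2..n}.
        bounded_linear (C i) \<and>
        (\<forall>k\<in>{0..int n - int i + 1}.
           bounded_op (hdom A k) (hnorm A k) (hdom A k) (hnorm A k) (adjoint (C i))) \<and>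
        (\<exists>\<beta>. onorm (C i) = \<beta> \<and> (\<forall>w. (norm (C i w))\<^sup>2 \<le> \<beta> * (C i w \<bullet> w))) \<and>
        (\<exists>\<alpha>>0. \<forall>w. \<alpha> * (norm (P i w))\<^sup>2 \<le> C i w \<bullet> w))"

definition coupling_observability_hyp :: "('h::{real_inner, complete_space} \<times> 'h) set \<Rightarrow> nat \<Rightarrow>
    (nat \<Rightarrow> 'h \<Rightarrow> 'h) \<Rightarrow> bool" where
  "coupling_observability_hyp A n P \<longleftrightarrow>
     (\<forall>i\<in>{2..n}.
        bounded_linear (P i) \<and>
        (\<exists>T0>0. \<forall>T>T0. \<exists>\<gamma>>0. \<forall>w w'. wave_solution A T w w' (\<lambda>_. 0) \<longrightarrow>
           (LINT t:{0..T}|lebesgue. (norm (P i (w' t)))\<^sup>2) \<ge> \<gamma> * energy A 1 (w 0) (w' 0)))"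

definition admissibility_hyp :: "('h::{real_inner, complete_space} \<times> 'h) set \<Rightarrow>
    ('h \<times> 'h \<Rightarrow> 'g::{real_inner, complete_space}) \<Rightarrow> bool" where
  "admissibility_hyp A B \<longleftrightarrow>
     bounded_op (hdom A 2 \<times> UNIV) (\<lambda>(u, v). sqrt ((hnorm A 2 u)\<^sup>2 + (norm v)\<^sup>2)) UNIV norm B \<and>
     (\<forall>T>0. \<exists>D>0. \<forall>w w' f g. wave_solution A T w w' f \<and> is_observation A B T w w' f g \<longrightarrow>
        (LINT t:{0..T}|lebesgue. (norm (g t))\<^sup>2) \<le>
          D * (energy A 1 (w 0) (w' 0) + energy A 1 (w T) (w' T)
               + (LINT t:{0..T}|lebesgue. energy A 1 (w t) (w' t))
               + (LINT t:{0..T}|lebesgue. (norm (f t))\<^sup>2)))"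

definition observability_hyp :: "('h::{real_inner, complete_space} \<times> 'h) set \<Rightarrow>
    ('h \<times> 'h \<Rightarrow> 'g::{real_inner, complete_space}) \<Rightarrow> bool" where
  "observability_hyp A B \<longleftrightarrow>
     (\<exists>T0>0. \<forall>T>T0. \<exists>R>0. \<forall>w w' g.
        wave_solution A T w w' (\<lambda>_. 0) \<and> is_observation A B T w w' (\<lambda>_. 0) g \<longrightarrow>
        (LINT t:{0..T}|lebesgue. (norm (g t))\<^sup>2) \<ge> R * energy A 1 (w 0) (w' 0))"


section \<open>The dual cascade system\<close>

definition cascade_solution :: "('h::real_inner \<times> 'h) set \<Rightarrow> nat \<Rightarrow> (nat \<Rightarrow> 'h \<Rightarrow> 'h) \<Rightarrow> real \<Rightarrow>
    (nat \<Rightarrow> real \<Rightarrow> 'h) \<Rightarrow> (nat \<Rightarrow> real \<Rightarrow> 'h) \<Rightarrow> bool" where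
  "cascade_solution A n C T w w' \<longleftrightarrow>
     (\<forall>i\<in>{1..n}. wave_solution A T (w i) (w' i) (\<lambda>t. if i = 1 then 0 else - C i (w (i - 1) t)))"

definition observability_time :: "('h::{real_inner, complete_space} \<times> 'h) set \<Rightarrow> nat \<Rightarrow>
    (nat \<Rightarrow> 'h \<Rightarrow> 'h) \<Rightarrow> ('h \<times> 'h \<Rightarrow> 'g::{real_inner, complete_space}) \<Rightarrow> real \<Rightarrow> bool" where
  "observability_time A n C B Tstar \<longleftrightarrow>
     0 < Tstar \<and>
     (\<exists>(d :: nat \<Rightarrow> real \<Rightarrow> real) (K :: real \<Rightarrow> real). bounded (K ` {Tstar<..}) \<and>
        (\<forall>T>Tstar. \<forall>i\<in>{1..n}.
           0 < d i T \<and> d i T \<le> (if i = n then K T / T else K T / T ^ 3) \<and>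
           (\<forall>w w' g. cascade_solution A n C T w w' \<and>
              is_observation A B T (w n) (w' n) (\<lambda>t. if n = 1 then 0 else - C n (w (n - 1) t)) g \<longrightarrow>
              energy A (1 + int i - int n) (w i 0) (w' i 0)
                \<le> d i T * (LINT t:{0..T}|lebesgue. (norm (g t))\<^sup>2))))"

text \<open>
  Low regularity solutions: \<open>w i\<close> is continuous in \<open>H\<close> of order \<open>i - n - s + 1\<close> and \<open>w' i\<close> in
  order \<open>i - n - s\<close>, where \<open>s = 1\<close> for the data space of case (i) and \<open>s = 0\<close> for that of case (ii).
  Test vectors of order \<open>n - i + 2\<close> make every term meaningful for both values of \<open>s\<close>.
\<close>

definition dual_solution :: "('h::{real_inner, complete_space} \<times> 'h) set \<Rightarrow> nat \<Rightarrow> int \<Rightarrow>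
    (nat \<Rightarrow> 'h \<Rightarrow> 'h) \<Rightarrow> real \<Rightarrow> (nat \<Rightarrow> real \<Rightarrow> 'h \<Rightarrow> real) \<Rightarrow> (nat \<Rightarrow> real \<Rightarrow> 'h \<Rightarrow> real) \<Rightarrow> bool" where
  "dual_solution A n s C T w w' \<longleftrightarrow>
     (\<forall>i\<in>{1..n}.
        Hs_continuous A (int i - int n - s + 1) T (w i) \<and>
        Hs_continuous A (int i - int n - s) T (w' i) \<and>
        (\<forall>t\<in>{0..T}. \<forall>\<phi>\<in>hdom A (int n - int i + s).
           ((\<lambda>r. w i r \<phi>) has_real_derivative w' i t \<phi>) (at t within {0..T})) \<and>
        (\<forall>t\<in>{0..T}. \<forall>\<phi>\<in>hdom A (int n - int i + 2).
           ((\<lambda>r. w' i r \<phi>) has_real_derivative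
              (- w i t (app A \<phi>) - (if i = 1 then 0 else w (i - 1) t (adjoint (C i) \<phi>))))
             (at t within {0..T})))"


section \<open>The control system\<close>

text \<open>\<open>state_space A n 1\<close> and \<open>state_space A n 0\<close> are the spaces of initial data of cases (i)
  and (ii).\<close>

definition state_space :: "('h::real_inner \<times> 'h) set \<Rightarrow> nat \<Rightarrow> int \<Rightarrow>
    ((nat \<Rightarrow> 'h \<Rightarrow> real) \<times> (nat \<Rightarrow> 'h \<Rightarrow> real)) set" where
  "state_space A n s =
     {(y0, y1). \<forall>i\<in>{1..n}. y0 i \<in> Hs A (int n - int i + s) \<and> y1 i \<in> Hs A (int n - int i + s - 1)}"

text \<open>Solution by transposition; \<open>ob w w' g\<close> says that \<open>g\<close> is \<open>B\<^sub>n\<^sup>* w\<^sub>n\<close> for the dual solution \<open>(w, w')\<close>.\<close>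

definition transposition_solution :: "('h::{real_inner, complete_space} \<times> 'h) set \<Rightarrow> nat \<Rightarrow> int \<Rightarrow>
    (nat \<Rightarrow> 'h \<Rightarrow> 'h) \<Rightarrow>
    ((nat \<Rightarrow> real \<Rightarrow> 'h \<Rightarrow> real) \<Rightarrow> (nat \<Rightarrow> real \<Rightarrow> 'h \<Rightarrow> real) \<Rightarrow> (real \<Rightarrow> 'g::real_inner) \<Rightarrow> bool) \<Rightarrow>
    real \<Rightarrow> (nat \<Rightarrow> 'h \<Rightarrow> real) \<Rightarrow> (nat \<Rightarrow> 'h \<Rightarrow> real) \<Rightarrow> (real \<Rightarrow> 'g) \<Rightarrow>
    (nat \<Rightarrow> real \<Rightarrow> 'h \<Rightarrow> real) \<Rightarrow> (nat \<Rightarrow> real \<Rightarrow> 'h \<Rightarrow> real) \<Rightarrow> bool" where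
  "transposition_solution A n s C ob T y0 y1 v y y' \<longleftrightarrow>
     (\<forall>i\<in>{1..n}. Hs_continuous A (int n - int i + s) T (y i) \<and>
                Hs_continuous A (int n - int i + s - 1) T (y' i)) \<and>
     (\<forall>t\<in>{0..T}. \<forall>w w'. dual_solution A n s C T w w' \<longrightarrow>
        (\<exists>g. ob w w' g \<and>
           (LINT r:{0..t}|lebesgue. v r \<bullet> g r) =
             (\<Sum>k=1..n. pairing (int n - int k + s - 1) (y' k t) (w k t)
                       - pairing (int n - int k + s) (y k t) (w' k t))
           - (\<Sum>k=1..n. pairing (int n - int k + s - 1) (y1 k) (w k 0)
                       - pairing (int n - int k + s) (y0 k) (w' k 0))))"

text \<open>The solution exists and vanishes at time \<open>T\<close>.\<close>

definition driven_to_zero :: "('h::{real_inner, complete_space} \<times> 'h) set \<Rightarrow> nat \<Rightarrow> int \<Rightarrow>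
    (nat \<Rightarrow> 'h \<Rightarrow> 'h) \<Rightarrow>
    ((nat \<Rightarrow> real \<Rightarrow> 'h \<Rightarrow> real) \<Rightarrow> (nat \<Rightarrow> real \<Rightarrow> 'h \<Rightarrow> real) \<Rightarrow> (real \<Rightarrow> 'g::real_inner) \<Rightarrow> bool) \<Rightarrow>
    real \<Rightarrow> (nat \<Rightarrow> 'h \<Rightarrow> real) \<Rightarrow> (nat \<Rightarrow> 'h \<Rightarrow> real) \<Rightarrow> (real \<Rightarrow> 'g) \<Rightarrow> bool" where
  "driven_to_zero A n s C ob T y0 y1 v \<longleftrightarrow>
     (\<exists>y y'. transposition_solution A n s C ob T y0 y1 v y y') \<and>
     (\<forall>y y'. transposition_solution A n s C ob T y0 y1 v y y' \<longrightarrow>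
        (\<forall>i\<in>{1..n}. y i T = (\<lambda>_. 0) \<and> y' i T = (\<lambda>_. 0)))"

text \<open>In case (i), \<open>w\<^sub>n\<close> has values in \<open>H\<close> and \<open>B\<^sub>n\<^sup>*\<close> is bounded on \<open>H\<close>.\<close>

definition bounded_obs :: "('g::real_inner \<Rightarrow> 'h::real_inner) \<Rightarrow> nat \<Rightarrow>
    (nat \<Rightarrow> real \<Rightarrow> 'h \<Rightarrow> real) \<Rightarrow> (nat \<Rightarrow> real \<Rightarrow> 'h \<Rightarrow> real) \<Rightarrow> (real \<Rightarrow> 'g) \<Rightarrow> bool" where
  "bounded_obs Bn n w w' g \<longleftrightarrow> g = (\<lambda>t. adjoint Bn (riesz (w n t)))"

text \<open>In case (ii), \<open>B\<^sub>n\<close> maps into the dual of \<open>H\<^sub>2\<close>; its adjoint maps \<open>u\<close> in \<open>H\<^sub>2\<close> to the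
  representative of \<open>v \<mapsto> \<langle>B\<^sub>n v, u\<rangle>\<close>, and \<open>(w\<^sub>n, w\<^sub>n')\<close> is a finite energy solution.\<close>

definition bounded_into_dual :: "('h::real_inner \<times> 'h) set \<Rightarrow> int \<Rightarrow> ('g::real_inner \<Rightarrow> 'h \<Rightarrow> real) \<Rightarrow> bool" where
  "bounded_into_dual A k Bn \<longleftrightarrow>
     (\<forall>v. Bn v \<in> Hs A (- k)) \<and> (\<forall>u. linear (\<lambda>v. Bn v u)) \<and>
     (\<exists>K. \<forall>v. Hs_norm A (- k) (Bn v) \<le> K * norm v)"

definition dual_adjoint :: "('g::real_inner \<Rightarrow> 'h \<Rightarrow> real) \<Rightarrow> 'h \<Rightarrow> 'g" where
  "dual_adjoint Bn u = riesz (\<lambda>v. Bn v u)"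

definition unbounded_obs :: "('h::{real_inner, complete_space} \<times> 'h) set \<Rightarrow> (nat \<Rightarrow> 'h \<Rightarrow> 'h) \<Rightarrow>
    ('g::real_inner \<Rightarrow> 'h \<Rightarrow> real) \<Rightarrow> real \<Rightarrow> nat \<Rightarrow>
    (nat \<Rightarrow> real \<Rightarrow> 'h \<Rightarrow> real) \<Rightarrow> (nat \<Rightarrow> real \<Rightarrow> 'h \<Rightarrow> real) \<Rightarrow> (real \<Rightarrow> 'g) \<Rightarrow> bool" where
  "unbounded_obs A C Bn T n w w' g \<longleftrightarrow>
     is_observation A (\<lambda>(u, u'). dual_adjoint Bn u) T
       (\<lambda>t. riesz (w n t)) (\<lambda>t. riesz (w' n t))
       (\<lambda>t. if n = 1 then 0 else - C n (riesz (w (n - 1) t))) g"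

end

theory Submission
  imports Defs
begin

text \<open>The compact resolvent provides an eigenbasis \<open>e\<^sub>j\<close> with \<open>A e\<^sub>j = r\<^sub>j\<^sup>2 e\<^sub>j\<close>. In the scale of spaces \<open>H\<^sub>k\<close>,
  normalised by powers of \<open>A\<close>, both the dual and the control system become families of rotations of
  frequencies \<open>r\<^sub>j\<close> with bounded couplings, and testing the control system against the coordinates of
  the dual system gives the transposition identity. The observability inequality bounds the
  functional defined by \<open>Y\<^sub>0\<close> on dual solutions by the norm of their observation. Hence a
  minimising sequence of the associated quadratic functional is Cauchy in its observations, and its
  limit \<open>v\<close> is a control: the transposition identity shows that \<open>Y(T)\<close> is orthogonal to all final
  data with a single nonzero coordinate \<open>e\<^sub>j\<close>, so \<open>Y(T) = 0\<close>.\<close>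

text \<open>Two obstacles shape the proof. The observation operator is defined on
  \<open>H_2 x H\<close>, so the observation of a finite energy solution exists only as a limit.
  Admissibility makes spectral truncation a canonical approximation: every observation is an L2
  limit of finite combinations of modal vectors. Read by duality, the same inequality makes the
  Duhamel integrals of an L2 control converge in the energy space, so that Y exists. The second
  obstacle is a shift of order in case (i): the observability inequality observes
  \<open>w_n'\<close>, while the transposition identity contains the observation of
  \<open>w_n\<close> for data one order lower. Integrating the dual system once in time repairs
  this. The coupling hypothesis fits the scale: a bound for the adjoint of \<open>C i\<close> on
  orders up to n - i + 1 is what makes all couplings bounded after normalisation, for both data
  spaces. The observability inequality speaks of finite energy cascades, so the functional is
  minimised over these alone; they still reach enough final data to test Y(T). Vanishing is shown
  for an arbitrary transposition solution, which settles uniqueness at time T as well.\<close>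

section \<open>Compact symmetric operators\<close>

text \<open>The norm of \<open>R\<close> on \<open>V\<close> is attained. A maximising sequence of
  unit vectors is almost an eigenvector of the square of \<open>R\<close> for
  \<open>s\<^sup>2\<close>, and compactness turns it into a true one, \<open>z\<close>. Since
  \<open>R + s\<close> annihilates \<open>R z - s z\<close>, either \<open>z\<close> or that
  difference is an eigenvector of \<open>R\<close>. The maximality kept in the conclusion drives the
  totality argument of the next lemma.\<close>

lemma compact_symmetric_eigenvector:
  fixes R :: "'h::{real_inner, complete_space} \<Rightarrow> 'h"
  assumes R: "bounded_linear R" and sym: "\<And>x y. x \<bullet> R y = R x \<bullet> y"
    and cpt: "\<And>x :: nat \<Rightarrow> 'h. (\<And>m. norm (x m) \<le> 1) \<Longrightarrow> \<exists>l \<sigma>. strict_mono (\<sigma> :: nat \<Rightarrow> nat) \<and> (\<lambda>m. R (x (\<sigma> m))) \<longlonglongrightarrow> l"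
    and inj: "\<And>x. R x = 0 \<Longrightarrow> x = 0"
    and V: "subspace V" "closed V" "R ` V \<subseteq> V" "\<exists>x\<in>V. x \<noteq> 0"
  shows "\<exists>x\<in>V. \<exists>\<nu>. norm x = 1 \<and> R x = \<nu> *\<^sub>R x \<and> \<nu> \<noteq> 0 \<and> (\<forall>y\<in>V. norm (R y) \<le> \<bar>\<nu>\<bar> * norm y)"
proof -
  interpret R: bounded_linear R by fact
  obtain K where K: "\<And>x. norm (R x) \<le> norm x * K" using R.bounded by blast
  define S where "S = {norm (R y) | y. y \<in> V \<and> norm y = 1}"
  define s where "s = Sup S"
  obtain y0 where y0: "y0 \<in> V" "y0 \<noteq> 0" using V(4) by blast
  have unit: "y /\<^sub>R norm y \<in> V" if "y \<in> V" for y using that V(1) by (simp add: subspace_scale)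
  have bdd: "bdd_above S"
  proof (rule bdd_aboveI[where M=K])
    fix t assume "t \<in> S"
    then obtain y where y: "t = norm (R y)" "norm y = 1" unfolding S_def by blast
    show "t \<le> K" using K[of y] y by simp
  qed
  have Sne: "S \<noteq> {}" using unit[OF y0(1)] y0(2) unfolding S_def by force
  have le: "norm (R y) \<le> s * norm y" if "y \<in> V" for y
  proof (cases "y = 0")
    case False
    have "norm (R (y /\<^sub>R norm y)) \<in> S" unfolding S_def using unit[OF that] False by force
    then have "norm (R (y /\<^sub>R norm y)) \<le> s" unfolding s_def by (rule cSup_upper[OF _ bdd])
    then show ?thesis using False by (simp add: R.scaleR field_simps)
  qed (simp add: R.zero)
  have spos: "s > 0"
  proof -
    have "0 < norm (R y0)" using inj y0 by auto
    also have "\<dots> \<le> s * norm y0" using le y0 by blast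
    finally show ?thesis using y0 by (simp add: zero_less_mult_iff)
  qed
  have "\<exists>x. x \<in> V \<and> norm x = 1 \<and> s - inverse (real (Suc m)) < norm (R x)" for m
  proof -
    have "s - inverse (real (Suc m)) < Sup S" unfolding s_def[symmetric] by simp
    then show ?thesis using less_cSup_iff[OF Sne bdd] S_def by auto
  qed
  then obtain x where x: "\<And>m. x m \<in> V" "\<And>m. norm (x m) = 1"
      "\<And>m. s - inverse (real (Suc m)) < norm (R (x m))" by metis
  have up: "norm (R (x m)) \<le> s" for m using le[OF x(1)] x(2) by (metis mult.right_neutral)
  have lim: "(\<lambda>m. norm (R (x m))) \<longlonglongrightarrow> s"
  proof (rule tendsto_sandwich)
    show "(\<lambda>m. s - inverse (real (Suc m))) \<longlonglongrightarrow> s"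
      using tendsto_diff[OF tendsto_const LIMSEQ_inverse_real_of_nat, of s] by simp
    show "\<forall>\<^sub>F m in sequentially. s - inverse (real (Suc m)) \<le> norm (R (x m))"
      using x(3) by (intro always_eventually allI less_imp_le)
  qed (use up in auto)
  \<comment> \<open>By symmetry the mixed term of the expanded square is
    \<open>- 2 * s\<^sup>2\<close> times the squared norm of \<open>R (x m)\<close>; the bound
    \<open>le\<close> applied to \<open>R (x m)\<close> then leaves a quantity that vanishes along
    the maximising sequence.\<close>
  have est: "(norm (R (R (x m)) - s\<^sup>2 *\<^sub>R x m))\<^sup>2 \<le> s\<^sup>2 * (s\<^sup>2 - (norm (R (x m)))\<^sup>2)" for m
  proof -
    have "norm (R (R (x m))) \<le> s * norm (R (x m))" using le V(3) x(1) by blast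
    then have "(norm (R (R (x m))))\<^sup>2 \<le> (s * norm (R (x m)))\<^sup>2" by (rule power_mono) simp
    moreover have "R (R (x m)) \<bullet> x m = (norm (R (x m)))\<^sup>2"
      by (simp add: sym[symmetric] power2_norm_eq_inner)
    moreover have "x m \<bullet> x m = 1" using x(2)[of m] by (metis power2_norm_eq_inner one_power2)
    moreover have "(norm (R (R (x m)) - s\<^sup>2 *\<^sub>R x m))\<^sup>2
        = (norm (R (R (x m))))\<^sup>2 - 2 * s\<^sup>2 * (R (R (x m)) \<bullet> x m) + s\<^sup>2 * s\<^sup>2 * (x m \<bullet> x m)"
      unfolding power2_norm_eq_inner by (simp add: inner_diff inner_commute algebra_simps)
    ultimately show ?thesis by (simp add: power_mult_distrib algebra_simps)
  qed
  have lim0: "(\<lambda>m. R (R (x m)) - s\<^sup>2 *\<^sub>R x m) \<longlonglongrightarrow> 0"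
  proof -
    have "(\<lambda>m. s\<^sup>2 * (s\<^sup>2 - (norm (R (x m)))\<^sup>2)) \<longlonglongrightarrow> s\<^sup>2 * (s\<^sup>2 - s\<^sup>2)"
      by (intro tendsto_intros lim)
    then have "(\<lambda>m. s\<^sup>2 * (s\<^sup>2 - (norm (R (x m)))\<^sup>2)) \<longlonglongrightarrow> 0" by simp
    then have "(\<lambda>m. (norm (R (R (x m)) - s\<^sup>2 *\<^sub>R x m))\<^sup>2) \<longlonglongrightarrow> 0"
      by (rule tendsto_sandwich[OF _ _ tendsto_const, rotated 2]) (use est in auto)
    then have "(\<lambda>m. sqrt ((norm (R (R (x m)) - s\<^sup>2 *\<^sub>R x m))\<^sup>2)) \<longlonglongrightarrow> sqrt 0" by (rule tendsto_real_sqrt)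
    then show ?thesis by (simp add: tendsto_norm_zero_iff)
  qed
  obtain l \<sigma> where \<sigma>: "strict_mono \<sigma>" "(\<lambda>m. R (x (\<sigma> m))) \<longlonglongrightarrow> l" using cpt[of x] x(2) by auto
  define z where "z = R l /\<^sub>R s\<^sup>2"
  have lim0': "(\<lambda>m. R (R (x (\<sigma> m))) - s\<^sup>2 *\<^sub>R x (\<sigma> m)) \<longlonglongrightarrow> 0"
    using LIMSEQ_subseq_LIMSEQ[OF lim0 \<sigma>(1)] by (simp add: o_def)
  \<comment> \<open>The sequence itself converges because \<open>s\<^sup>2 *\<^sub>R x\<close>
    differs from the convergent \<open>R (R x)\<close> by a null sequence and \<open>s\<close> is
    not zero.\<close>
  have xz: "(\<lambda>m. x (\<sigma> m)) \<longlonglongrightarrow> z"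
  proof -
    have "(\<lambda>m. (R (R (x (\<sigma> m))) - (R (R (x (\<sigma> m))) - s\<^sup>2 *\<^sub>R x (\<sigma> m))) /\<^sub>R s\<^sup>2) \<longlonglongrightarrow> (R l - 0) /\<^sub>R s\<^sup>2"
      by (intro tendsto_intros R.tendsto \<sigma> lim0')
    then show ?thesis using spos by (simp add: z_def)
  qed
  have zV: "z \<in> V" using closed_sequentially[OF V(2) _ xz] x(1) by blast
  have z1: "norm z = 1" using tendsto_norm[OF xz] x(2) by (simp add: LIMSEQ_const_iff)
  have "(\<lambda>m. R (R (x (\<sigma> m))) - s\<^sup>2 *\<^sub>R x (\<sigma> m)) \<longlonglongrightarrow> R (R z) - s\<^sup>2 *\<^sub>R z"
    by (intro tendsto_intros R.tendsto xz)
  then have RR: "R (R z) = s\<^sup>2 *\<^sub>R z" using LIMSEQ_unique[OF lim0'] by fastforce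
  show ?thesis
  proof (cases "R z = s *\<^sub>R z")
    case True
    then show ?thesis using zV z1 spos le by (intro bexI[of _ z] exI[of _ s]) auto
  next
    case False
    define y where "y = R z - s *\<^sub>R z"
    have y: "y \<noteq> 0" "y \<in> V" unfolding y_def using False zV V by (auto simp: subspace_diff subspace_scale)
    have Ry: "R y = (- s) *\<^sub>R y" by (simp add: y_def R.diff R.scaleR RR algebra_simps power2_eq_square)
    show ?thesis
    proof (intro bexI[of _ "y /\<^sub>R norm y"] exI[of _ "- s"])
      show "norm (y /\<^sub>R norm y) = 1 \<and> R (y /\<^sub>R norm y) = - s *\<^sub>R (y /\<^sub>R norm y) \<and> - s \<noteq> 0
        \<and> (\<forall>y\<in>V. norm (R y) \<le> \<bar>- s\<bar> * norm y)"
        using y spos le by (auto simp: R.scaleR Ry)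
    qed (rule unit[OF y(2)])
  qed
qed

text \<open>Deflation: each step takes an eigenvector with largest \<open>\<bar>\<nu>\<bar>\<close>
  in the orthogonal complement of the previous ones, which \<open>R\<close> leaves invariant by
  symmetry. Together with injectivity, compactness forces the process to exhaust the space, so that
  a sequence is enough without any separability assumption.\<close>

lemma compact_symmetric_eigenbasis:
  fixes R :: "'h::{real_inner, complete_space} \<Rightarrow> 'h"
  assumes R: "bounded_linear R" and sym: "\<And>x y. x \<bullet> R y = R x \<bullet> y"
    and cpt: "\<And>x :: nat \<Rightarrow> 'h. (\<And>m. norm (x m) \<le> 1) \<Longrightarrow> \<exists>l \<sigma>. strict_mono (\<sigma> :: nat \<Rightarrow> nat) \<and> (\<lambda>m. R (x (\<sigma> m))) \<longlonglongrightarrow> l"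
    and inj: "\<And>x. R x = 0 \<Longrightarrow> x = 0"
  obtains e :: "nat \<Rightarrow> 'h" and \<nu> :: "nat \<Rightarrow> real"
  where "\<And>i j. i \<noteq> j \<Longrightarrow> e i \<bullet> e j = 0" "\<And>j. e j \<noteq> 0 \<Longrightarrow> norm (e j) = 1"
    "\<And>j. R (e j) = \<nu> j *\<^sub>R e j" "\<And>j. \<nu> j \<noteq> 0" "\<And>x. (\<And>j. x \<bullet> e j = 0) \<Longrightarrow> x = 0"
proof -
  interpret R: bounded_linear R by fact
  define V where "V X = {y. \<forall>z\<in>X. y \<bullet> z = 0}" for X :: "'h set"
  \<comment> \<open>Once the complement is trivial the process continues with the zero vector; its
    eigenvalue is an arbitrary nonzero number, so that \<open>\<nu>\<close> never vanishes.\<close>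
  define good where "good X p \<longleftrightarrow> (case p of (x, \<nu>) \<Rightarrow> x \<in> V X \<and> R x = \<nu> *\<^sub>R x \<and> \<nu> \<noteq> 0 \<and>
      (if V X = {0} then x = 0 else norm x = 1 \<and> (\<forall>y\<in>V X. norm (R y) \<le> \<bar>\<nu>\<bar> * norm y)))" for X p
  define pick where "pick X = (SOME p. good X p)" for X
  define S where "S = rec_nat {} (\<lambda>_ X. insert (fst (pick X)) X)"
  define e where "e k = fst (pick (S k))" for k
  define \<nu> where "\<nu> k = snd (pick (S k))" for k
  have S0: "S 0 = {}" and SS: "S (Suc k) = insert (e k) (S k)" for k by (simp_all add: S_def e_def)
  have S: "S k = e ` {..<k}" for k by (induction k) (auto simp: S0 SS lessThan_Suc)
  have V0: "0 \<in> V X" for X by (simp add: V_def)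
  have sub: "subspace (V X)" for X by (auto simp: subspace_def V_def inner_add_left)
  have clo: "closed (V X)" for X
  proof -
    have "V X = (\<Inter>z\<in>X. {y. y \<bullet> z = 0})" by (auto simp: V_def)
    then show ?thesis by (auto intro!: closed_INT closed_Collect_eq continuous_intros)
  qed
  have ex: "\<exists>p. good X p" if "R ` V X \<subseteq> V X" for X
  proof (cases "V X = {0}")
    case True
    then show ?thesis by (intro exI[of _ "(0, 1)"]) (simp add: good_def R.zero)
  next
    case False
    then have "\<exists>x\<in>V X. x \<noteq> 0" using V0[of X] by blast
    from compact_symmetric_eigenvector[OF R sym cpt inj sub clo that this]
    show ?thesis using False by (auto simp: good_def)
  qed
  have good: "good (S k) (e k, \<nu> k) \<and> R ` V (S k) \<subseteq> V (S k)" for k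
  proof (induction k)
    case 0
    have "R ` V (S 0) \<subseteq> V (S 0)" by (simp add: S0 V_def)
    then show ?case using someI_ex[OF ex[of "S 0"]] by (simp add: e_def \<nu>_def pick_def)
  next
    case (Suc k)
    have "R ` V (S (Suc k)) \<subseteq> V (S (Suc k))"
    proof
      fix y assume "y \<in> R ` V (S (Suc k))"
      then obtain x where x: "y = R x" "x \<in> V (S (Suc k))" by blast
      have "R x \<bullet> e k = 0"
        using Suc x(2) by (simp add: sym[symmetric] good_def V_def SS)
      moreover have "x \<in> V (S k)" using x(2) by (simp add: V_def SS)
      then have "R x \<in> V (S k)" using Suc by blast
      ultimately show "y \<in> V (S (Suc k))" by (simp add: x(1) V_def SS)
    qed
    then show ?case using someI_ex[OF ex[of "S (Suc k)"]] by (simp add: e_def \<nu>_def pick_def)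
  qed
  have lt: "e j \<bullet> e i = 0" if "i < j" for i j
    using good[of j] that by (auto simp: good_def V_def S)
  have orth: "e i \<bullet> e j = 0" if "i \<noteq> j" for i j
    using lt[of i j] lt[of j i] that by (cases i j rule: linorder_cases) (auto simp: inner_commute)
  have unit: "norm (e j) = 1" if "e j \<noteq> 0" for j
    using good[of j] that by (auto simp: good_def split: if_splits)
  have Re: "R (e j) = \<nu> j *\<^sub>R e j" "\<nu> j \<noteq> 0" for j using good[of j] by (auto simp: good_def)
  have tot: "x = 0" if x: "\<And>j. x \<bullet> e j = 0" for x
  proof (cases "\<exists>k. V (S k) = {0}")
    case True
    then obtain k where k: "V (S k) = {0}" by blast
    have "x \<in> V (S k)" using x by (auto simp: V_def S)
    then show ?thesis using k by blast
  next
    case False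
    have e1: "norm (e k) = 1" for k using good[of k] False by (auto simp: good_def)
    have xV: "x \<in> V (S k)" for k using x by (auto simp: V_def S)
    have bd: "norm (R x) \<le> \<bar>\<nu> k\<bar> * norm x" for k
      using good[of k] False xV by (auto simp: good_def)
    have "R x = 0"
    proof (rule ccontr)
      assume "R x \<noteq> 0"
      then have xp: "norm x > 0" "norm (R x) > 0" using R.zero by auto
      \<comment> \<open>If \<open>R x\<close> were nonzero, the maximality of each
        \<open>\<nu> k\<close> would bound all eigenvalues below by \<open>\<delta>\<close>. The
        vectors \<open>R (e k)\<close> would then be orthogonal with norms at least
        \<open>\<delta>\<close>, and no subsequence of them could be Cauchy.\<close>
      define \<delta> where "\<delta> = norm (R x) / norm x"
      have \<delta>: "\<delta> > 0" "\<And>k. \<delta> \<le> \<bar>\<nu> k\<bar>" unfolding \<delta>_def using xp bd by (auto simp: field_simps)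
      obtain l \<sigma> where \<sigma>: "strict_mono (\<sigma> :: nat \<Rightarrow> nat)" "(\<lambda>m. R (e (\<sigma> m))) \<longlonglongrightarrow> l"
        using cpt[of e] e1 by auto
      have "Cauchy (\<lambda>m. R (e (\<sigma> m)))" using \<sigma>(2) by (rule LIMSEQ_imp_Cauchy)
      then obtain M where M: "\<And>m n. m \<ge> M \<Longrightarrow> n \<ge> M \<Longrightarrow> dist (R (e (\<sigma> m))) (R (e (\<sigma> n))) < \<delta>"
        using \<delta>(1) unfolding Cauchy_def by meson
      define a b where "a = \<sigma> M" and "b = \<sigma> (Suc M)"
      have ab: "a \<noteq> b" unfolding a_def b_def using \<sigma>(1) by (simp add: strict_mono_eq)
      have "norm (R (e a) - R (e b)) < \<delta>" using M[of M "Suc M"] by (simp add: a_def b_def dist_norm)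
      then have "(norm (R (e a) - R (e b)))\<^sup>2 < \<delta>\<^sup>2" by (intro power_strict_mono) auto
      moreover have "(norm (R (e a) - R (e b)))\<^sup>2 = (\<nu> a)\<^sup>2 + (\<nu> b)\<^sup>2"
        using orth[OF ab] orth[OF ab[symmetric]] e1[of a] e1[of b]
        unfolding power2_norm_eq_inner Re norm_eq_1
        by (simp add: inner_diff power2_eq_square)
      moreover have "\<delta>\<^sup>2 \<le> (\<nu> a)\<^sup>2" using \<delta>(2)[of a] \<delta>(1) by (metis abs_of_pos abs_le_square_iff)
      ultimately show False using zero_le_power2[of "\<nu> b"] by linarith
    qed
    then show ?thesis by (rule inj)
  qed
  show ?thesis using that orth unit Re tot by blast
qed

section \<open>Self-adjoint graphs\<close>

lemma self_adjoint_iff: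
  "self_adjoint A \<Longrightarrow> (u, v) \<in> A \<longleftrightarrow> (\<forall>(x, y)\<in>A. y \<bullet> u = x \<bullet> v)"
  unfolding self_adjoint_def adj_graph_def by blast

lemma self_adjoint_add:
  assumes "self_adjoint A" "(u, v) \<in> A" "(u', v') \<in> A" shows "(u + u', v + v') \<in> A"
  using assms(2,3) unfolding self_adjoint_iff[OF assms(1)] by (fastforce simp: inner_add_right)

lemma self_adjoint_scaleR:
  assumes "self_adjoint A" "(u, v) \<in> A" shows "(c *\<^sub>R u, c *\<^sub>R v) \<in> A"
  using assms(2) unfolding self_adjoint_iff[OF assms(1)] by fastforce

text \<open>By linearity the difference of two values is a value at 0. Testing
  \<open>(0, v - v')\<close> against the graph shows that it is orthogonal to the dense
  domain.\<close>

lemma self_adjoint_single_valued: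
  assumes sa: "self_adjoint A" and uv: "(u, v) \<in> A" "(u, v') \<in> A" shows "v = v'"
proof -
  have "(u + (-1) *\<^sub>R u, v + (-1) *\<^sub>R v') \<in> A"
    by (intro self_adjoint_add self_adjoint_scaleR sa uv)
  then have *: "(0, v - v') \<in> A" by simp
  have "Domain A \<subseteq> {x. x \<bullet> (v - v') = 0}"
    using * unfolding self_adjoint_iff[OF sa] by auto
  moreover have "closed {x. x \<bullet> (v - v') = 0}" by (intro closed_Collect_eq continuous_intros)
  ultimately have "closure (Domain A) \<subseteq> {x. x \<bullet> (v - v') = 0}" by (rule closure_minimal)
  then have "(v - v') \<bullet> (v - v') = 0" using sa unfolding self_adjoint_def by blast
  then show ?thesis by simp
qed

lemma self_adjoint_app: "self_adjoint A \<Longrightarrow> (u, v) \<in> A \<Longrightarrow> app A u = v"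
  unfolding app_def by (rule the_equality) (auto dest: self_adjoint_single_valued)

text \<open>The resolvent at \<open>\<mu>\<close> inherits symmetry from \<open>A\<close> and is
  injective because \<open>A\<close> is single-valued, so it has an eigenbasis; an eigenvalue
  \<open>\<nu>\<close> of the resolvent corresponds to the eigenvalue
  \<open>1 / \<nu> + \<mu>\<close> of \<open>A\<close>. The numbers \<open>r\<close> are the square
  roots of the eigenvalues, that is, the frequencies of the wave equation.\<close>

lemma admissible_generator_eigenbasis:
  fixes A :: "('h::{real_inner, complete_space} \<times> 'h) set"
  assumes "admissible_generator A"
  obtains e :: "nat \<Rightarrow> 'h" and r :: "nat \<Rightarrow> real" and \<delta> :: real
  where "\<And>i j. i \<noteq> j \<Longrightarrow> e i \<bullet> e j = 0" "\<And>j. e j \<noteq> 0 \<Longrightarrow> norm (e j) = 1"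
    "\<And>x. (\<And>j. x \<bullet> e j = 0) \<Longrightarrow> x = 0"
    "\<And>j. (e j, (r j)\<^sup>2 *\<^sub>R e j) \<in> A" "0 < \<delta>" "\<And>j. \<delta> \<le> r j"
proof -
  obtain \<mu> \<omega> where sa: "self_adjoint A" and pos: "positive_op A" and c: "compact_op (resolvent A \<mu>)"
    and \<omega>: "\<omega> > 0" "\<And>u v. (u, v) \<in> A \<Longrightarrow> \<omega> * norm u \<le> norm v"
    using assms unfolding admissible_generator_def by blast
  define R where "R x = app (resolvent A \<mu>) x" for x
  have sv: "single_valued (resolvent A \<mu>)" and dom: "Domain (resolvent A \<mu>) = UNIV"
    and cc: "compact (closure (resolvent A \<mu> `` cball 0 1))" using c by (auto simp: compact_op_def)
  have Ru: "R x = u" if "(x, u) \<in> resolvent A \<mu>" for x u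
    unfolding R_def app_def using that sv by (auto simp: single_valued_def)
  have Rr: "(x, R x) \<in> resolvent A \<mu>" for x using dom Ru by blast
  have Rr_iff: "(x, u) \<in> resolvent A \<mu> \<longleftrightarrow> (u, x + \<mu> *\<^sub>R u) \<in> A" for x u
    unfolding resolvent_def by (auto simp: algebra_simps intro!: exI[of _ "x + \<mu> *\<^sub>R u"])
  have RA: "(R x, x + \<mu> *\<^sub>R R x) \<in> A" for x using Rr Rr_iff by blast
  have RI: "R x = u" if "(u, x + \<mu> *\<^sub>R u) \<in> A" for x u using that Rr_iff Ru by blast
  have lin: "R (x + y) = R x + R y" "R (a *\<^sub>R x) = a *\<^sub>R R x" for x y a
    using self_adjoint_add[OF sa RA[of x] RA[of y]] self_adjoint_scaleR[OF sa RA[of x], of a]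
    by (auto intro!: RI simp: algebra_simps)
  have "bounded (resolvent A \<mu> `` cball 0 1)"
    using bounded_subset[OF compact_imp_bounded[OF cc] closure_subset] .
  then obtain K where K: "\<And>y. y \<in> resolvent A \<mu> `` cball 0 1 \<Longrightarrow> norm y \<le> K" unfolding bounded_iff by blast
  have RK: "norm (R x) \<le> K" if "norm x \<le> 1" for x
    by (rule K) (use that Rr[of x] in \<open>auto intro!: ImageI[of x]\<close>)
  have bl: "bounded_linear R"
  proof (rule bounded_linear_intro[where K=K])
    fix x show "norm (R x) \<le> norm x * K"
    proof (cases "x = 0")
      case True then show ?thesis using lin(2)[of 0 x] by simp
    next
      case False
      then show ?thesis using RK[of "x /\<^sub>R norm x"] by (simp add: lin field_simps)
    qed
  qed (auto simp: lin)
  have sym: "x \<bullet> R y = R x \<bullet> y" for x y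
  proof -
    have "(x + \<mu> *\<^sub>R R x) \<bullet> R y = R x \<bullet> (y + \<mu> *\<^sub>R R y)"
      using RA[of y] RA[of x] unfolding self_adjoint_iff[OF sa, of "R y"] by blast
    then show ?thesis by (simp add: inner_add)
  qed
  have inj: "x = 0" if "R x = 0" for x
    using RA[of x] self_adjoint_scaleR[OF sa RA[of x], of 0] that self_adjoint_single_valued[OF sa, of 0 x 0] by simp
  have cpt: "\<exists>l \<sigma>. strict_mono (\<sigma> :: nat \<Rightarrow> nat) \<and> (\<lambda>m. R (x (\<sigma> m))) \<longlonglongrightarrow> l" if "\<And>m. norm (x m) \<le> 1" for x :: "nat \<Rightarrow> 'h"
  proof -
    have "R (x m) \<in> closure (resolvent A \<mu> `` cball 0 1)" for m
      using that[of m] Rr by (intro subsetD[OF closure_subset]) (auto intro!: ImageI[of "x m"])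
    then obtain l \<sigma> where "strict_mono (\<sigma> :: nat \<Rightarrow> nat)" "((\<lambda>m. R (x m)) \<circ> \<sigma>) \<longlonglongrightarrow> l"
      using cc[unfolded compact_eq_seq_compact_metric] by (metis seq_compactE)
    then show ?thesis unfolding o_def by blast 
  qed
  obtain e \<nu> where e: "\<And>i j. i \<noteq> j \<Longrightarrow> e i \<bullet> e j = (0::real)" "\<And>j. e j \<noteq> (0::'h) \<Longrightarrow> norm (e j) = 1"
    "\<And>j::nat. R (e j) = \<nu> j *\<^sub>R e j" "\<And>j. \<nu> j \<noteq> (0::real)" "\<And>x. (\<And>j. x \<bullet> e j = 0) \<Longrightarrow> x = 0"
    using compact_symmetric_eigenbasis[OF bl sym cpt inj] by metis
  \<comment> \<open>At padded indices any value makes \<open>(0, 0)\<close> an element of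
    \<open>A\<close>; \<open>\<omega>\<close> is chosen to keep the lower bound valid for all
    \<open>j\<close>.\<close>
  define l where "l j = (if e j = 0 then \<omega> else 1 / \<nu> j + \<mu>)" for j
  have eA: "(e j, l j *\<^sub>R e j) \<in> A" for j
  proof (cases "e j = 0")
    case True
    then show ?thesis using self_adjoint_scaleR[OF sa RA[of 0], of 0] by simp
  next
    case False
    have "(1 / \<nu> j) *\<^sub>R (e j + \<mu> *\<^sub>R R (e j)) = l j *\<^sub>R e j" "(1 / \<nu> j) *\<^sub>R R (e j) = e j"
      using e(4)[of j] False by (auto simp: e(3) l_def scaleR_add_right scaleR_add_left)
    then show ?thesis using self_adjoint_scaleR[OF sa RA[of "e j"], of "1 / \<nu> j"] by simp
  qed
  \<comment> \<open>Coercivity alone bounds the absolute value of \<open>l j\<close>; positivity of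
    \<open>A\<close> supplies the sign.\<close>
  have l: "\<omega> \<le> l j" for j
  proof (cases "e j = 0")
    case False
    have "0 \<le> (l j *\<^sub>R e j) \<bullet> e j" using pos eA[of j] unfolding positive_op_def by blast
    moreover have "e j \<bullet> e j > 0" using False by simp
    ultimately have "0 \<le> l j" by (simp add: zero_le_mult_iff)
    moreover have "\<omega> * norm (e j) \<le> norm (l j *\<^sub>R e j)" using \<omega>(2)[OF eA] .
    ultimately show ?thesis using False by simp
  qed (simp add: l_def)
  have "0 \<le> l j" for j using l[of j] \<omega>(1) by linarith
  then show ?thesis using that[of e "\<lambda>j. sqrt (l j)" "sqrt \<omega>"] e eA l \<omega>(1) by simp
qed

section \<open>Diagonal operators in an eigenbasis\<close>

text \<open>In finite dimension the sequence \<open>e\<close> is padded with zero vectors.\<close>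

locale eigenbasis =
  fixes A :: "('h::{real_inner, complete_space} \<times> 'h) set" and e :: "nat \<Rightarrow> 'h"
    and r :: "nat \<Rightarrow> real" and \<delta> :: real
  assumes sa: "self_adjoint A"
    and orth: "\<And>i j. i \<noteq> j \<Longrightarrow> e i \<bullet> e j = 0"
    and unit: "\<And>j. e j \<noteq> 0 \<Longrightarrow> norm (e j) = 1"
    and total: "\<And>x. (\<And>j. x \<bullet> e j = 0) \<Longrightarrow> x = 0"
    and eig: "\<And>j. (e j, (r j)\<^sup>2 *\<^sub>R e j) \<in> A"
    and delta_pos: "0 < \<delta>" and r_ge: "\<And>j. \<delta> \<le> r j"
begin

lemma r_pos: "0 < r j"
  using delta_pos r_ge[of j] by linarith

lemma vec_eqI: "(\<And>j. x \<bullet> e j = y \<bullet> e j) \<Longrightarrow> x = y"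
  using total[of "x - y"] by (simp add: inner_diff_left)

lemma inner_e: "e i \<bullet> e j = (if i = j \<and> e j \<noteq> 0 then 1 else 0)"
  using orth[of i j] unit[of j] by (auto simp: norm_eq_1)

lemma inner_sum_e:
  "(\<Sum>j<N. a j *\<^sub>R e j) \<bullet> e k = (if k < N \<and> e k \<noteq> 0 then a k else 0)"
proof -
  have "(\<Sum>j<N. a j *\<^sub>R e j) \<bullet> e k = (\<Sum>j<N. if j = k then (if e k \<noteq> 0 then a k else 0) else 0)"
    unfolding inner_sum_left by (rule sum.cong) (auto simp: inner_e)
  then show ?thesis by (auto simp: sum.delta)
qed

text \<open>The coefficients have to vanish where \<open>e\<close> is padded by zero, since
  otherwise the right-hand side would count terms that the vector does not contain.\<close>

lemma norm_sum_e:
  assumes "\<And>j. e j = 0 \<Longrightarrow> a j = 0" "finite F"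
  shows "(norm (\<Sum>j\<in>F. a j *\<^sub>R e j))\<^sup>2 = (\<Sum>j\<in>F. (a j)\<^sup>2)"
  using assms(2)
proof (induction F)
  case (insert i F)
  have "e i \<bullet> (\<Sum>j\<in>F. a j *\<^sub>R e j) = 0"
    unfolding inner_sum_right using insert by (intro sum.neutral) (auto simp: inner_e)
  moreover have "a i * a i * (e i \<bullet> e i) = (a i)\<^sup>2"
    using assms(1)[of i] by (auto simp: inner_e power2_eq_square)
  ultimately show ?case
    using insert unfolding power2_norm_eq_inner by (simp add: inner_add inner_commute mult.assoc)
qed simp

text \<open>The squared distance of two partial sums is the difference of two values of the bounded
  monotone sequence \<open>q\<close>, hence the partial sums are Cauchy.\<close>

lemma riesz_fischer:
  assumes a: "\<And>j. e j = 0 \<Longrightarrow> a j = 0" and bd: "\<And>N. (\<Sum>j<N. (a j)\<^sup>2) \<le> M\<^sup>2" and M: "0 \<le> M"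
  obtains x where "\<And>j. x \<bullet> e j = a j" "norm x \<le> M" "(\<lambda>N. \<Sum>j<N. a j *\<^sub>R e j) \<longlonglongrightarrow> x"
proof -
  define s where "s N = (\<Sum>j<N. a j *\<^sub>R e j)" for N :: nat
  define q where "q N = (\<Sum>j<N. (a j)\<^sup>2)" for N :: nat
  have "incseq q" unfolding q_def by (rule incseq_SucI) simp
  then have "convergent q" using bd unfolding q_def
    by (metis incseq_convergent convergentI)
  then have Cq: "Cauchy q" by (rule convergent_Cauchy)
  have diff: "(norm (s m - s n))\<^sup>2 = q m - q n" if "n \<le> m" for m n
  proof -
    have "s m - s n = (\<Sum>j=n..<m. a j *\<^sub>R e j)" "q m - q n = (\<Sum>j=n..<m. (a j)\<^sup>2)"
      unfolding s_def q_def using that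
      by (simp_all add: sum_diff_nat_ivl[where m=0, simplified atLeast0LessThan])
    then show ?thesis using norm_sum_e[of a "{n..<m}"] a by simp
  qed
  have "Cauchy s"
  proof (rule metric_CauchyI)
    fix \<epsilon> :: real assume \<epsilon>: "0 < \<epsilon>"
    obtain K where K: "\<And>m n. m \<ge> K \<Longrightarrow> n \<ge> K \<Longrightarrow> dist (q m) (q n) < \<epsilon>\<^sup>2"
      using Cq \<epsilon> unfolding Cauchy_def by (metis zero_less_power)
    have "dist (s m) (s n) < \<epsilon>" if "n \<le> m" "n \<ge> K" for m n
    proof -
      have "(norm (s m - s n))\<^sup>2 < \<epsilon>\<^sup>2" using diff[OF that(1)] K[of m n] that by (simp add: dist_real_def)
      then show ?thesis unfolding dist_norm using \<epsilon> by (metis power2_less_imp_less less_imp_le)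
    qed
    then show "\<exists>K. \<forall>m\<ge>K. \<forall>n\<ge>K. dist (s m) (s n) < \<epsilon>"
      by (metis dist_commute nle_le)
  qed
  then obtain x where x: "s \<longlonglongrightarrow> x" using Cauchy_convergent convergent_def by blast
  have "x \<bullet> e k = a k" for k
  proof (rule LIMSEQ_unique)
    show "(\<lambda>N. s N \<bullet> e k) \<longlonglongrightarrow> x \<bullet> e k" by (intro tendsto_intros x)
    have "\<forall>\<^sub>F N in sequentially. s N \<bullet> e k = a k"
      using eventually_gt_at_top[of k] by eventually_elim (use a in \<open>auto simp: s_def inner_sum_e\<close>)
    then show "(\<lambda>N. s N \<bullet> e k) \<longlonglongrightarrow> a k" by (rule tendsto_eventually)
  qed
  moreover have "norm x \<le> M"
  proof (rule LIMSEQ_le_const2[OF tendsto_norm[OF x]])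
    have "norm (s N) \<le> M" for N
      using norm_sum_e[of a "{..<N}"] a bd[of N] M unfolding s_def
      by (auto intro: power2_le_imp_le[of _ M])
    then show "\<exists>N. \<forall>n\<ge>N. norm (s n) \<le> M" by blast
  qed
  ultimately show ?thesis using that x unfolding s_def by blast
qed

definition proj :: "nat \<Rightarrow> 'h \<Rightarrow> 'h" where
  "proj N x = (\<Sum>j<N. (x \<bullet> e j) *\<^sub>R e j)"

lemma proj_coef: "proj N x \<bullet> e k = (if k < N then x \<bullet> e k else 0)"
  unfolding proj_def inner_sum_e by auto

lemma norm_proj: "(norm (proj N x))\<^sup>2 = (\<Sum>j<N. (x \<bullet> e j)\<^sup>2)"
  unfolding proj_def by (rule norm_sum_e) auto

lemma linear_proj: "linear (proj N)"
  unfolding proj_def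
  by (auto simp: linear_iff inner_add_left scaleR_add_left sum.distrib scaleR_sum_right)

lemma bessel: "(\<Sum>j<N. (x \<bullet> e j)\<^sup>2) \<le> (norm x)\<^sup>2"
proof -
  have "proj N x \<bullet> (x - proj N x) = (\<Sum>j<N. (x \<bullet> e j) * (e j \<bullet> (x - proj N x)))"
    unfolding proj_def[of N x] by (simp add: inner_sum_left)
  also have "\<dots> = 0" by (intro sum.neutral) (auto simp: inner_commute[of "e _"] inner_diff_left proj_coef)
  finally have "(norm x)\<^sup>2 = (norm (proj N x))\<^sup>2 + (norm (x - proj N x))\<^sup>2"
    unfolding power2_norm_eq_inner by (simp add: inner_diff inner_commute)
  then show ?thesis unfolding norm_proj by simp
qed

lemma norm_proj_le: "norm (proj N x) \<le> norm x"
  using bessel[of x N] unfolding norm_proj[symmetric] by (rule power2_le_imp_le) simp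

lemma bounded_linear_proj: "bounded_linear (proj N)"
  using linear_proj norm_proj_le by (intro bounded_linear_intro[where K=1]) (auto simp: linear_iff)

lemma proj_tendsto: "(\<lambda>N. proj N x) \<longlonglongrightarrow> x"
proof -
  obtain y where y: "\<And>j. y \<bullet> e j = x \<bullet> e j" "(\<lambda>N. \<Sum>j<N. (x \<bullet> e j) *\<^sub>R e j) \<longlonglongrightarrow> y"
    using riesz_fischer[of "\<lambda>j. x \<bullet> e j" "norm x"] bessel[of x] by (metis inner_zero_right norm_ge_zero)
  then show ?thesis using vec_eqI[of y x] by (simp add: proj_def)
qed

lemma norm_le_coef:
  assumes "\<And>N. (\<Sum>j<N. (x \<bullet> e j)\<^sup>2) \<le> M\<^sup>2" "0 \<le> M" shows "norm x \<le> M"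
proof (rule LIMSEQ_le_const2[OF tendsto_norm[OF proj_tendsto]])
  show "\<exists>N. \<forall>n\<ge>N. norm (proj n x) \<le> M"
    using assms power2_le_imp_le[of "norm (proj _ x)" M] by (auto simp: norm_proj)
qed

lemma inner_sums: "(\<lambda>j. (x \<bullet> e j) * (y \<bullet> e j)) sums (x \<bullet> y)"
proof -
  have "(\<lambda>N. proj N x \<bullet> y) \<longlonglongrightarrow> x \<bullet> y" by (intro tendsto_intros proj_tendsto)
  then show ?thesis
    unfolding sums_def proj_def by (simp add: inner_sum_left inner_commute[of "e _"])
qed

text \<open>The coefficients of the representing vector must be \<open>f (e j)\<close>. Testing
  \<open>f\<close> on its own truncated gradient \<open>x\<close>, where both \<open>f x\<close> and
  the squared norm of \<open>x\<close> equal \<open>S\<close>, bounds \<open>S\<close> by the square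
  of the norm of \<open>f\<close>.\<close>

lemma riesz_representation:
  fixes f :: "'h \<Rightarrow> real"
  assumes f: "bounded_linear f" obtains u where "f = inner u"
proof -
  interpret f: bounded_linear f by fact
  obtain K where K: "0 < K" "\<And>x. norm (f x) \<le> norm x * K" using f.pos_bounded by blast
  have z: "e j = 0 \<Longrightarrow> f (e j) = 0" for j by (simp add: f.zero)
  have bd: "(\<Sum>j<N. (f (e j))\<^sup>2) \<le> K\<^sup>2" for N
  proof -
    define S where "S = (\<Sum>j<N. (f (e j))\<^sup>2)"
    define x where "x = (\<Sum>j<N. f (e j) *\<^sub>R e j)"
    have S: "0 \<le> S" "(norm x)\<^sup>2 = S" "f x = S"
      unfolding S_def x_def using norm_sum_e[of "\<lambda>j. f (e j)" "{..<N}"] z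
      by (auto simp: f.sum f.scaleR power2_eq_square intro: sum_nonneg)
    have "S \<le> norm x * K" using K(2)[of x] S by simp
    then have "S * S \<le> (norm x * K) * (norm x * K)" using S(1) by (intro mult_mono) auto
    also have "\<dots> = S * K\<^sup>2" using S(2) by (simp add: power2_eq_square algebra_simps)
    finally show ?thesis using S(1) K(1) unfolding S_def[symmetric]
      by (cases "S = 0") (auto simp: mult_le_cancel_left)
  qed
  obtain u where u: "\<And>j. u \<bullet> e j = f (e j)"
    using riesz_fischer[of "\<lambda>j. f (e j)" K, OF z bd] K(1) by (metis less_imp_le)
  have "f x = u \<bullet> x" for x
  proof (rule LIMSEQ_unique)
    show "(\<lambda>N. f (proj N x)) \<longlonglongrightarrow> f x" by (intro f.tendsto proj_tendsto)
    have "f (proj N x) = (\<Sum>j<N. (x \<bullet> e j) * (u \<bullet> e j))" for N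
      unfolding proj_def by (simp add: f.sum f.scaleR u)
    then show "(\<lambda>N. f (proj N x)) \<longlonglongrightarrow> u \<bullet> x"
      using inner_sums[of x u] by (simp add: sums_def inner_commute)
  qed
  then show ?thesis using that by blast
qed

text \<open>\<open>adjoint\<close> is a choice among maps satisfying the adjoint identity; Riesz
  representation provides the existence that makes this choice meaningful.\<close>

lemma adjoint_inner:
  fixes f :: "'h \<Rightarrow> 'h"
  assumes "bounded_linear f" shows "f x \<bullet> y = x \<bullet> adjoint f y"
proof -
  have "\<exists>u. \<forall>x. f x \<bullet> y = x \<bullet> u" for y
  proof -
    have "bounded_linear (\<lambda>x. f x \<bullet> y)"
      using assms bounded_linear_compose bounded_linear_inner_left by blast
    from riesz_representation[OF this] show ?thesis by (metis inner_commute)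
  qed
  then have "\<exists>f'. \<forall>x y. f x \<bullet> y = x \<bullet> f' y" by metis
  then have "\<forall>x y. f x \<bullet> y = x \<bullet> adjoint f y" unfolding adjoint_def by (rule someI_ex)
  then show ?thesis by blast
qed

text \<open>The maximal multiplication operator: its domain is implicit and consists of those
  \<open>u\<close> whose multiplied coefficients are again the coefficients of a vector of
  H.\<close>

definition diag :: "(nat \<Rightarrow> real) \<Rightarrow> ('h \<times> 'h) set" where
  "diag m = {(u, v). \<forall>j. v \<bullet> e j = m j * (u \<bullet> e j)}"

lemma diag_e: "(e i, m i *\<^sub>R e i) \<in> diag m"
  by (auto simp: diag_def inner_e)

lemma diag_sum_e: "((\<Sum>j<N. a j *\<^sub>R e j), (\<Sum>j<N. (m j * a j) *\<^sub>R e j)) \<in> diag m"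
  by (auto simp: diag_def inner_sum_e)

lemma self_adjoint_diag: "self_adjoint (diag m)"
  unfolding self_adjoint_def
proof
  have "x \<in> closure (Domain (diag m))" for x
    unfolding closure_sequential
  proof (intro exI[of _ "\<lambda>N. proj N x"] conjI allI proj_tendsto)
    show "proj N x \<in> Domain (diag m)" for N unfolding proj_def using diag_sum_e[of "\<lambda>j. x \<bullet> e j" N m] by blast
  qed
  then show "closure (Domain (diag m)) = UNIV" by auto
  show "adj_graph (diag m) = diag m"
  proof (intro set_eqI iffI; clarify)
    fix u v assume "(u, v) \<in> adj_graph (diag m)"
    then have "(m j *\<^sub>R e j) \<bullet> u = e j \<bullet> v" for j using diag_e[of j m] unfolding adj_graph_def by blast
    then show "(u, v) \<in> diag m" by (auto simp: diag_def inner_commute)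
  next
    fix u v assume uv: "(u, v) \<in> diag m"
    have "y \<bullet> u = x \<bullet> v" if "(x, y) \<in> diag m" for x y
    proof (rule sums_unique2[OF inner_sums])
      show "(\<lambda>j. (y \<bullet> e j) * (u \<bullet> e j)) sums (x \<bullet> v)"
        using inner_sums[of x v] uv that by (simp add: diag_def algebra_simps)
    qed
    then show "(u, v) \<in> adj_graph (diag m)" unfolding adj_graph_def by blast
  qed
qed

text \<open>Testing an element of \<open>S\<close> against the eigenvectors gives \<open>S\<close>
  inside \<open>diag m\<close>. Passing to adjoints reverses the inclusion, and both sides are
  self-adjoint. Thus a self-adjoint operator is determined by a total family of
  eigenvectors.\<close>

lemma self_adjoint_eq_diag:
  assumes S: "self_adjoint S" and eS: "\<And>j. (e j, m j *\<^sub>R e j) \<in> S" shows "S = diag m"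
proof -
  have sub: "S \<subseteq> diag m"
  proof clarify
    fix u v assume "(u, v) \<in> S"
    then have "(m j *\<^sub>R e j) \<bullet> u = e j \<bullet> v" for j using eS[of j] self_adjoint_iff[OF S, of u v] by blast
    then show "(u, v) \<in> diag m" by (auto simp: diag_def inner_commute)
  qed
  have "adj_graph (diag m) \<subseteq> adj_graph S" using sub unfolding adj_graph_def by blast
  then show ?thesis using sub S self_adjoint_diag[of m] unfolding self_adjoint_def by blast
qed

lemma A_diag: "A = diag (\<lambda>j. (r j)\<^sup>2)"
  using self_adjoint_eq_diag[OF sa eig] .

text \<open>Domination of multipliers: if \<open>m'\<close> applied to \<open>u\<close> stays in H
  and \<open>m\<close> is bounded by a multiple of \<open>m'\<close>, then \<open>m\<close> applied
  to \<open>u\<close> stays in H with the same factor in the norm.\<close>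

lemma ex_mult:
  assumes b: "\<And>j. \<bar>m j\<bar> \<le> c * \<bar>m' j\<bar>" and w: "\<And>j. w \<bullet> e j = m' j * (u \<bullet> e j)" and c: "0 \<le> c"
  obtains v where "\<And>j. v \<bullet> e j = m j * (u \<bullet> e j)" "norm v \<le> c * norm w"
proof -
  have "(\<Sum>j<N. (m j * (u \<bullet> e j))\<^sup>2) \<le> (c * norm w)\<^sup>2" for N
  proof -
    have "(m j * (u \<bullet> e j))\<^sup>2 \<le> c\<^sup>2 * (w \<bullet> e j)\<^sup>2" for j
    proof -
      have "\<bar>m j * (u \<bullet> e j)\<bar> \<le> c * \<bar>m' j\<bar> * \<bar>u \<bullet> e j\<bar>"
        unfolding abs_mult using b by (intro mult_right_mono) auto
      also have "\<dots> = \<bar>c * (w \<bullet> e j)\<bar>" unfolding w using c by (simp add: abs_mult)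
      finally show ?thesis unfolding abs_le_square_iff by (simp add: power_mult_distrib)
    qed
    then have "(\<Sum>j<N. (m j * (u \<bullet> e j))\<^sup>2) \<le> c\<^sup>2 * (\<Sum>j<N. (w \<bullet> e j)\<^sup>2)"
      unfolding sum_distrib_left by (rule sum_mono)
    also have "\<dots> \<le> c\<^sup>2 * (norm w)\<^sup>2" by (intro mult_left_mono bessel) simp
    finally show ?thesis by (simp add: power_mult_distrib)
  qed
  moreover have "0 \<le> c * norm w" "\<And>j. e j = 0 \<Longrightarrow> m j * (u \<bullet> e j) = 0" using c by auto
  ultimately show ?thesis
    using riesz_fischer[of "\<lambda>j. m j * (u \<bullet> e j)" "c * norm w"] that by metis
qed

text \<open>The product of the multipliers could have a larger domain than the composition; the
  bound on \<open>m\<close> places the intermediate vector in H.\<close>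

lemma diag_O:
  assumes b: "\<And>j. \<bar>m j\<bar> \<le> c * \<bar>m' j * m j\<bar>" and c: "0 \<le> c"
  shows "diag m O diag m' = diag (\<lambda>j. m' j * m j)"
proof (intro set_eqI iffI; clarify)
  fix u v w assume "(u, v) \<in> diag m" "(v, w) \<in> diag m'"
  then show "(u, w) \<in> diag (\<lambda>j. m' j * m j)" by (simp add: diag_def)
next
  fix u w assume uw: "(u, w) \<in> diag (\<lambda>j. m' j * m j)"
  then have "w \<bullet> e j = (m' j * m j) * (u \<bullet> e j)" for j by (simp add: diag_def)
  then obtain v where "\<And>j. v \<bullet> e j = m j * (u \<bullet> e j)"
    using ex_mult[of m c "\<lambda>j. m' j * m j" w u, OF b _ c] by metis
  then show "(u, w) \<in> diag m O diag m'" using uw by (intro relcompI[of _ v]) (auto simp: diag_def)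
qed

lemma positive_diag: "positive_op (diag r)"
proof -
  have "0 \<le> v \<bullet> u" if "(u, v) \<in> diag r" for u v
  proof (rule sums_le[OF _ sums_zero inner_sums[of v u]])
    show "0 \<le> (v \<bullet> e j) * (u \<bullet> e j)" for j
      using that r_pos[of j] by (simp add: diag_def mult.assoc)
  qed
  then show ?thesis unfolding positive_op_def by blast
qed

lemma sqrt_diag: "sqrt_op A = diag r"
  unfolding sqrt_op_def
proof (rule the_equality)
  have "diag r O diag r = diag (\<lambda>j. r j * r j)"
  proof (rule diag_O[where c="1 / \<delta>"])
    show "\<bar>r j\<bar> \<le> 1 / \<delta> * \<bar>r j * r j\<bar>" for j
      using r_ge[of j] r_pos[of j] delta_pos by (simp add: field_simps)
  qed (use delta_pos in auto)
  then show "self_adjoint (diag r) \<and> positive_op (diag r) \<and> diag r O diag r = A"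
    using self_adjoint_diag positive_diag by (simp add: A_diag power2_eq_square)
  fix S assume S: "self_adjoint S \<and> positive_op S \<and> S O S = A"
  then have saS: "self_adjoint S" by blast
  show "S = diag r"
  proof (rule self_adjoint_eq_diag[OF saS])
    fix j
    have "(e j, (r j)\<^sup>2 *\<^sub>R e j) \<in> S O S" using S eig by blast
    then obtain x where x: "(e j, x) \<in> S" "(x, (r j)\<^sup>2 *\<^sub>R e j) \<in> S" by blast
    \<comment> \<open>Uniqueness of the positive root: \<open>S\<close> maps \<open>y\<close> to
      \<open>- r j\<close> times \<open>y\<close>, which contradicts positivity unless
      \<open>y = 0\<close>.\<close>
    define y where "y = x - r j *\<^sub>R e j"
    have "(x + (- r j) *\<^sub>R e j, (r j)\<^sup>2 *\<^sub>R e j + (- r j) *\<^sub>R x) \<in> S"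
      by (intro self_adjoint_add self_adjoint_scaleR saS x)
    moreover have "(r j)\<^sup>2 *\<^sub>R e j + (- r j) *\<^sub>R x = (- r j) *\<^sub>R y"
      by (simp add: y_def algebra_simps power2_eq_square)
    ultimately have "(y, (- r j) *\<^sub>R y) \<in> S" by (simp add: y_def)
    then have "0 \<le> ((- r j) *\<^sub>R y) \<bullet> y" using S unfolding positive_op_def by blast
    then have "y \<bullet> y \<le> 0" using r_pos[of j] by (simp add: mult_le_0_iff)
    then have "y = 0" by (metis inner_ge_zero inner_eq_zero_iff order_antisym)
    then show "(e j, r j *\<^sub>R e j) \<in> S" using x(1) by (simp add: y_def)
  qed
qed

lemma hpow_diag: "hpow A k = diag (\<lambda>j. r j powi k)"
proof -
  have pow: "diag r ^^ k = diag (\<lambda>j. r j ^ k)" for k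
  proof (induction k)
    case 0
    show ?case by (auto simp: diag_def intro: vec_eqI)
  next
    case (Suc k)
    have "diag (\<lambda>j. r j ^ k) O diag r = diag (\<lambda>j. r j * r j ^ k)"
    proof (rule diag_O[where c="1 / \<delta>"])
      show "\<bar>r j ^ k\<bar> \<le> 1 / \<delta> * \<bar>r j * r j ^ k\<bar>" for j
        using r_ge[of j] r_pos[of j] delta_pos by (simp add: field_simps abs_mult)
    qed (use delta_pos in auto)
    then show ?case using Suc by simp
  qed
  have "(diag (\<lambda>j. r j ^ nat (- k)))\<inverse> = diag (\<lambda>j. r j powi k)" if "k < 0"
    using that less_imp_neq[OF r_pos] by (auto simp: diag_def power_int_def field_simps)
  then show ?thesis unfolding hpow_def sqrt_diag pow by (auto simp: power_int_def)
qed

end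

section \<open>The scale of spaces\<close>

context eigenbasis
begin

abbreviation Lam :: "int \<Rightarrow> 'h \<Rightarrow> 'h" where
  "Lam k \<equiv> app (hpow A k)"

lemma hdom_iff: "u \<in> hdom A k \<longleftrightarrow> (\<exists>v. \<forall>j. v \<bullet> e j = r j powi k * (u \<bullet> e j))"
  unfolding hdom_def hpow_diag diag_def by auto

lemma LamI:
  assumes "\<And>j. v \<bullet> e j = r j powi k * (u \<bullet> e j)"
  shows "u \<in> hdom A k" "Lam k u = v"
proof -
  show "u \<in> hdom A k" using assms hdom_iff by blast
  have "(u, v) \<in> hpow A k" using assms by (simp add: hpow_diag diag_def)
  then show "Lam k u = v" using self_adjoint_app[OF self_adjoint_diag] by (metis hpow_diag)
qed

lemma Lam_coef: "u \<in> hdom A k \<Longrightarrow> Lam k u \<bullet> e j = r j powi k * (u \<bullet> e j)"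
  unfolding hdom_iff using LamI(2) by metis

lemma powi_split: "r j powi k = r j powi (k - l) * r j powi l"
  using r_pos[of j] power_int_add[of "r j" "k - l" l] by simp

lemma r_powi_nonpos: "k \<le> 0 \<Longrightarrow> r j powi k \<le> \<delta> powi k"
  using r_ge[of j] delta_pos r_pos[of j] by (simp add: power_int_def le_imp_inverse_le power_mono)

text \<open>The embedding constant comes from \<open>\<delta> \<le> r j\<close>: the ratio of the
  two multipliers has a nonpositive exponent and is largest at the smallest frequency.\<close>

lemma hdom_le:
  assumes "k \<le> l" "u \<in> hdom A l"
  shows "u \<in> hdom A k" "norm (Lam k u) \<le> \<delta> powi (k - l) * norm (Lam l u)"
proof -
  have d: "0 \<le> \<delta> powi (k - l)" using delta_pos by simp
  have "\<bar>r j powi k\<bar> \<le> \<delta> powi (k - l) * \<bar>r j powi l\<bar>" for j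
    unfolding powi_split[of j k l] abs_mult
    using r_powi_nonpos[of "k - l" j] assms(1) r_pos[of j] by (intro mult_right_mono) auto
  then obtain v where "\<And>j. v \<bullet> e j = r j powi k * (u \<bullet> e j)" "norm v \<le> \<delta> powi (k - l) * norm (Lam l u)"
    using ex_mult[of "\<lambda>j. r j powi k" "\<delta> powi (k - l)" "\<lambda>j. r j powi l" "Lam l u" u]
      Lam_coef[OF assms(2)] d by metis
  then show "u \<in> hdom A k" "norm (Lam k u) \<le> \<delta> powi (k - l) * norm (Lam l u)"
    using LamI[of v k u] by auto
qed

lemma hdom_0: "u \<in> hdom A 0" and Lam_0: "Lam 0 u = u"
  by (auto intro: LamI)

lemma hdom_nonpos: "k \<le> 0 \<Longrightarrow> u \<in> hdom A k"
  using hdom_le(1)[of k 0] hdom_0 by blast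

lemma norm_Lam_nonpos: "k \<le> 0 \<Longrightarrow> norm (Lam k u) \<le> \<delta> powi k * norm u"
  using hdom_le(2)[of k 0 u] hdom_0 by (simp add: Lam_0)

lemma hdom_Lam:
  assumes "u \<in> hdom A l" "u \<in> hdom A (k + l)"
  shows "Lam l u \<in> hdom A k" "Lam k (Lam l u) = Lam (k + l) u"
proof -
  have "Lam (k + l) u \<bullet> e j = r j powi k * (Lam l u \<bullet> e j)" for j
    using assms r_pos[of j] by (simp add: Lam_coef power_int_add)
  then show "Lam l u \<in> hdom A k" "Lam k (Lam l u) = Lam (k + l) u" using LamI by auto
qed

lemma Lam_Lam_neg: "u \<in> hdom A k \<Longrightarrow> Lam k u \<in> hdom A (- k) \<and> Lam (- k) (Lam k u) = u"
  using hdom_Lam[of u k "- k"] by (simp add: hdom_0 Lam_0)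

lemma Lam_neg_in: "0 \<le> k \<Longrightarrow> Lam (- k) u \<in> hdom A k"
  using Lam_Lam_neg[of u "- k"] hdom_nonpos by simp

lemma Lam_neg_Lam: "0 \<le> k \<Longrightarrow> Lam k (Lam (- k) u) = u"
  using Lam_Lam_neg[of u "- k"] hdom_nonpos by simp

lemma hdom_add: "u \<in> hdom A k \<Longrightarrow> v \<in> hdom A k \<Longrightarrow> u + v \<in> hdom A k"
  and Lam_add: "u \<in> hdom A k \<Longrightarrow> v \<in> hdom A k \<Longrightarrow> Lam k (u + v) = Lam k u + Lam k v"
  by (intro LamI[of "Lam k u + Lam k v"]; simp add: Lam_coef inner_add_left algebra_simps)+

lemma hdom_scaleR: "u \<in> hdom A k \<Longrightarrow> c *\<^sub>R u \<in> hdom A k"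
  and Lam_scaleR: "u \<in> hdom A k \<Longrightarrow> Lam k (c *\<^sub>R u) = c *\<^sub>R Lam k u"
  by (intro LamI[of "c *\<^sub>R Lam k u"]; simp add: Lam_coef)+

lemma hdom_diff: "u \<in> hdom A k \<Longrightarrow> v \<in> hdom A k \<Longrightarrow> u - v \<in> hdom A k"
  and Lam_diff: "u \<in> hdom A k \<Longrightarrow> v \<in> hdom A k \<Longrightarrow> Lam k (u - v) = Lam k u - Lam k v"
  by (intro LamI[of "Lam k u - Lam k v"]; simp add: Lam_coef inner_diff_left algebra_simps)+

lemma hdom_zero: "0 \<in> hdom A k" and Lam_zero: "Lam k 0 = 0"
  by (intro LamI[of 0]; simp)+

lemma hdom_e: "e j \<in> hdom A k" and Lam_e: "Lam k (e j) = (r j powi k) *\<^sub>R e j"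
  by (intro LamI[of "(r j powi k) *\<^sub>R e j"]; simp add: inner_e)+

lemma hdom_proj: "proj N u \<in> hdom A k"
  using diag_sum_e[of "\<lambda>j. u \<bullet> e j" N] unfolding hdom_def hpow_diag proj_def by blast

lemma Lam_proj: "u \<in> hdom A k \<Longrightarrow> Lam k (proj N u) = proj N (Lam k u)"
  by (intro LamI(2)) (simp add: proj_coef Lam_coef)

lemma Lam_sym: "u \<in> hdom A k \<Longrightarrow> v \<in> hdom A k \<Longrightarrow> Lam k u \<bullet> v = u \<bullet> Lam k v"
  using sums_unique2[OF inner_sums[of "Lam k u" v]] inner_sums[of u "Lam k v"]
  by (simp add: Lam_coef algebra_simps)

lemma bounded_linear_Lam: "k \<le> 0 \<Longrightarrow> bounded_linear (Lam k)"
  by (rule bounded_linear_intro[where K="\<delta> powi k"])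
     (simp_all add: Lam_add Lam_scaleR hdom_nonpos norm_Lam_nonpos mult.commute[of _ "\<delta> powi k"])

lemma A_iff: "(u, v) \<in> A \<longleftrightarrow> u \<in> hdom A 2 \<and> v = Lam 2 u"
proof -
  have "A = hpow A 2" unfolding hpow_diag using A_diag by simp
  then show ?thesis
    using self_adjoint_app[OF sa, of u v] by (metis A_diag Domain.cases DomainI hdom_def sa self_adjoint_app)
qed

lemma app_A: "u \<in> hdom A 2 \<Longrightarrow> app A u = Lam 2 u"
  using A_iff self_adjoint_app[OF sa] by blast

subsection \<open>Functionals\<close>

text \<open>\<open>dual k\<close> is the isometry \<open>A\<^sup>-\<^sup>k\<^sup>/\<^sup>2\<close> from \<open>H\<close> onto \<open>H\<^sub>k\<close>.\<close>

definition dual :: "int \<Rightarrow> 'h \<Rightarrow> 'h \<Rightarrow> real" where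
  "dual k x = (\<lambda>\<phi>. if \<phi> \<in> hdom A (- k) then x \<bullet> Lam (- k) \<phi> else 0)"

lemma dual_nonneg: "0 \<le> k \<Longrightarrow> dual k x = inner (Lam (- k) x)"
  unfolding dual_def using Lam_sym[of x "- k"] hdom_nonpos[of "- k"] by auto

lemma dual_diff: "dual k x \<phi> - dual k y \<phi> = dual k (x - y) \<phi>"
  unfolding dual_def by (simp add: inner_diff_left)

lemma dual_e: "dual k x (e j) = r j powi (- k) * (x \<bullet> e j)"
  unfolding dual_def by (simp add: hdom_e Lam_e)

lemma dual_zero: "dual k 0 = (\<lambda>_. 0)"
  unfolding dual_def by auto

lemma riesz_inner: "riesz (inner u) = u"
  unfolding riesz_def by (rule the_equality) (metis vector_eq_rdot)+

text \<open>Riesz representation relative to the norm of order \<open>k\<close>. The functional is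
  determined by its values on the \<open>e j\<close>, because truncations converge in that norm;
  being zero off the domain makes the equality one of functions.\<close>

lemma bounded_functional_dual:
  assumes f: "bounded_op (hdom A k) (hnorm A k) UNIV abs f" "\<And>x. x \<notin> hdom A k \<Longrightarrow> f x = 0"
  obtains x where "f = dual (- k) x"
proof -
  obtain K0 where K0: "\<And>x. x \<in> hdom A k \<Longrightarrow> \<bar>f x\<bar> \<le> K0 * hnorm A k x"
    using f(1) unfolding bounded_op_def by blast
  define K where "K = max K0 0"
  have K: "\<bar>f x\<bar> \<le> K * norm (Lam k x)" if "x \<in> hdom A k" for x
    using K0[OF that] unfolding K_def hnorm_def
    by (meson max.cobounded1 mult_right_mono norm_ge_zero order_trans)
  have add: "f (x + y) = f x + f y" if "x \<in> hdom A k" "y \<in> hdom A k" for x y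
    using f(1) that unfolding bounded_op_def by blast
  have scl: "f (c *\<^sub>R x) = c * f x" if "x \<in> hdom A k" for x c
    using f(1) that unfolding bounded_op_def by simp
  have f0: "f 0 = 0" using scl[of 0 0] hdom_zero by simp
  have sums: "(\<Sum>j<N. a j *\<^sub>R e j) \<in> hdom A k \<and> f (\<Sum>j<N. a j *\<^sub>R e j) = (\<Sum>j<N. a j * f (e j))
      \<and> Lam k (\<Sum>j<N. a j *\<^sub>R e j) = (\<Sum>j<N. (a j * r j powi k) *\<^sub>R e j)" for N a
    by (induction N) (auto simp: f0 hdom_zero Lam_zero add scl hdom_add hdom_scaleR hdom_e Lam_add Lam_scaleR Lam_e)
  define a where "a j = r j powi (- k) * f (e j)" for j
  have a0: "e j = 0 \<Longrightarrow> a j = 0" for j by (simp add: a_def f0)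
  have bd: "(\<Sum>j<N. (a j)\<^sup>2) \<le> K\<^sup>2" for N
  proof -
    define S where "S = (\<Sum>j<N. (a j)\<^sup>2)"
    have S0: "0 \<le> S" unfolding S_def by (simp add: sum_nonneg)
    \<comment> \<open>The weights are chosen so that \<open>f x\<close> and the squared norm of
      \<open>Lam k x\<close> are both \<open>S\<close>; the bound of \<open>f\<close> then gives
      \<open>S \<le> K\<^sup>2\<close>.\<close>
    define x where "x = (\<Sum>j<N. (a j * r j powi (- k)) *\<^sub>R e j)"
    have fx: "f x = S" unfolding x_def S_def using sums[of "\<lambda>j. a j * r j powi (- k)" N]
      by (simp add: a_def power2_eq_square mult.assoc)
    have Lx: "Lam k x = (\<Sum>j<N. a j *\<^sub>R e j)"
      unfolding x_def using sums[of "\<lambda>j. a j * r j powi (- k)" N] less_imp_neq[OF r_pos]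
      by (auto simp: power_int_minus field_simps intro!: sum.cong)
    have "(norm (Lam k x))\<^sup>2 = S" unfolding Lx S_def by (rule norm_sum_e) (auto simp: a0)
    moreover have "S \<le> K * norm (Lam k x)" using K[of x] sums fx S0 unfolding x_def by auto
    then have "S * S \<le> (K * norm (Lam k x)) * (K * norm (Lam k x))" using S0 by (intro mult_mono) auto
    ultimately have "S * S \<le> S * K\<^sup>2" by (simp add: power2_eq_square algebra_simps)
    then show ?thesis using S0 unfolding S_def[symmetric]
      by (cases "S = 0") (auto simp: mult_le_cancel_left)
  qed
  obtain x where x: "\<And>j. x \<bullet> e j = a j"
    using riesz_fischer[of a K, OF a0 bd] K_def by (metis max.cobounded2)
  have "f \<phi> = dual (- k) x \<phi>" for \<phi>
  proof (cases "\<phi> \<in> hdom A k")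
    case True
    have eq: "f (proj N \<phi>) = x \<bullet> proj N (Lam k \<phi>)" for N
    proof -
      have "f (proj N \<phi>) = (\<Sum>j<N. (\<phi> \<bullet> e j) * f (e j))" unfolding proj_def using sums[of "\<lambda>j. \<phi> \<bullet> e j" N] by blast
      also have "\<dots> = (\<Sum>j<N. (Lam k \<phi> \<bullet> e j) * (x \<bullet> e j))"
        unfolding x a_def Lam_coef[OF True] using less_imp_neq[OF r_pos]
        by (intro sum.cong) (auto simp: power_int_minus field_simps)
      finally show ?thesis unfolding proj_def by (simp add: inner_sum_right)
    qed
    have "(\<lambda>N. f (proj N \<phi>)) \<longlonglongrightarrow> x \<bullet> Lam k \<phi>" unfolding eq by (intro tendsto_intros proj_tendsto)
    moreover have "(\<lambda>N. f (proj N \<phi>)) \<longlonglongrightarrow> f \<phi>"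
    proof (rule LIM_zero_cancel, rule Lim_null_comparison)
      have "\<bar>f (proj N \<phi>) - f \<phi>\<bar> \<le> K * norm (proj N (Lam k \<phi>) - Lam k \<phi>)" for N
      proof -
        have "f (proj N \<phi> - \<phi>) = f (proj N \<phi>) - f \<phi>"
          using add[of "proj N \<phi> - \<phi>" \<phi>] True by (simp add: hdom_proj hdom_diff)
        then show ?thesis using K[of "proj N \<phi> - \<phi>"] True by (simp add: hdom_proj hdom_diff Lam_diff Lam_proj)
      qed
      then show "\<forall>\<^sub>F N in sequentially. norm (f (proj N \<phi>) - f \<phi>) \<le> K * norm (proj N (Lam k \<phi>) - Lam k \<phi>)"
        by simp
      have "(\<lambda>N. K * norm (proj N (Lam k \<phi>) - Lam k \<phi>)) \<longlonglongrightarrow> K * norm (Lam k \<phi> - Lam k \<phi>)"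
        by (intro tendsto_intros proj_tendsto)
      then show "(\<lambda>N. K * norm (proj N (Lam k \<phi>) - Lam k \<phi>)) \<longlonglongrightarrow> 0" by simp
    qed
    ultimately have "f \<phi> = x \<bullet> Lam k \<phi>" by (rule LIMSEQ_unique[rotated])
    then show ?thesis using True by (simp add: dual_def)
  next
    case False
    then show ?thesis using f(2) by (simp add: dual_def)
  qed
  then show ?thesis using that by blast
qed

lemma dual_bounded_op: "bounded_op (hdom A (- k)) (hnorm A (- k)) UNIV abs (dual k x)"
  unfolding bounded_op_def
proof (intro conjI ballI allI exI[of _ "norm x"] UNIV_I)
  show "\<bar>dual k x \<phi>\<bar> \<le> norm x * hnorm A (- k) \<phi>" if "\<phi> \<in> hdom A (- k)" for \<phi>
    using that unfolding dual_def hnorm_def by (simp add: Cauchy_Schwarz_ineq2)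
qed (auto simp: dual_def hdom_add Lam_add inner_add_right hdom_scaleR Lam_scaleR)

text \<open>One parametrisation by H for both branches of \<open>Hs\<close>, which removes all case
  distinctions on the sign of the order from here on.\<close>

lemma Hs_eq: "Hs A k = range (dual k)"
proof (cases "0 \<le> k")
  case True
  have "inner ` hdom A k = range (dual k)"
  proof (intro set_eqI iffI)
    fix f assume "f \<in> inner ` hdom A k"
    then obtain u where u: "u \<in> hdom A k" "f = inner u" by blast
    then have "f = dual k (Lam k u)" using True by (simp add: dual_nonneg Lam_Lam_neg)
    then show "f \<in> range (dual k)" by blast
  qed (use True in \<open>auto simp: dual_nonneg Lam_neg_in\<close>)
  then show ?thesis using True by (simp add: Hs_def)
next
  case False
  have "f \<in> range (dual k)" if "f \<in> Hs A k" for f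
  proof -
    have "bounded_op (hdom A (- k)) (hnorm A (- k)) UNIV abs f" "\<And>x. x \<notin> hdom A (- k) \<Longrightarrow> f x = 0"
      using that False unfolding Hs_def by auto
    then obtain x where "f = dual (- (- k)) x" by (rule bounded_functional_dual)
    then show ?thesis by simp
  qed
  moreover have "dual k x \<in> Hs A k" for x
    using False dual_bounded_op[of k x] unfolding Hs_def by (auto simp: dual_def)
  ultimately show ?thesis by auto
qed

lemma Hs_norm_dual: "Hs_norm A k (dual k x) = norm x"
proof (cases "0 \<le> k")
  case True
  then show ?thesis by (simp add: Hs_norm_def dual_nonneg riesz_inner hnorm_def Lam_neg_Lam)
next
  case False
  have "Sup {\<bar>dual k x \<phi>\<bar> | \<phi>. \<phi> \<in> hdom A (- k) \<and> hnorm A (- k) \<phi> \<le> 1} = norm x"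
  proof (rule cSup_eq_maximum)
    \<comment> \<open>The supremum in the dual norm is attained at the preimage of the direction of
      \<open>x\<close> under the isometry \<open>Lam (- k)\<close>.\<close>
    define \<phi> where "\<phi> = Lam k (x /\<^sub>R norm x)"
    have 1: "\<phi> \<in> hdom A (- k)" "Lam (- k) \<phi> = x /\<^sub>R norm x"
      unfolding \<phi>_def using Lam_neg_in[of "- k"] Lam_neg_Lam[of "- k"] False by auto
    have "\<bar>dual k x \<phi>\<bar> = norm x"
      unfolding dual_def using 1 by (cases "x = 0") (simp_all add: power2_norm_eq_inner[symmetric] power2_eq_square)
    moreover have "hnorm A (- k) \<phi> \<le> 1" unfolding hnorm_def 1 by (cases "x = 0") auto
    ultimately show "norm x \<in> {\<bar>dual k x \<phi>\<bar> | \<phi>. \<phi> \<in> hdom A (- k) \<and> hnorm A (- k) \<phi> \<le> 1}"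
      using 1(1) by force
    fix t assume "t \<in> {\<bar>dual k x \<phi>\<bar> | \<phi>. \<phi> \<in> hdom A (- k) \<and> hnorm A (- k) \<phi> \<le> 1}"
    then obtain \<phi> where \<phi>: "t = \<bar>x \<bullet> Lam (- k) \<phi>\<bar>" "norm (Lam (- k) \<phi>) \<le> 1"
      unfolding dual_def hnorm_def by auto
    have "t \<le> norm x * norm (Lam (- k) \<phi>)" unfolding \<phi>(1) by (rule Cauchy_Schwarz_ineq2)
    also have "\<dots> \<le> norm x * 1" by (intro mult_left_mono \<phi>) simp
    finally show "t \<le> norm x" by simp
  qed
  then show ?thesis using False by (simp add: Hs_norm_def)
qed

text \<open>The isometries onto spaces of opposite order are transposed to each other, so every
  duality pairing in the transposition identity becomes the inner product of the
  coordinates.\<close>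

lemma pairing_dual: "pairing k (dual k x) (dual (- k) y) = x \<bullet> y"
proof (cases "0 \<le> k")
  case True
  then show ?thesis unfolding pairing_def dual_nonneg[OF True] riesz_inner
    by (simp add: dual_def Lam_neg_in Lam_neg_Lam inner_commute)
next
  case False
  then have k: "0 \<le> - k" by simp
  show ?thesis using False Lam_neg_in[OF k] Lam_neg_Lam[OF k]
    unfolding pairing_def dual_nonneg[OF k] riesz_inner by (simp add: dual_def)
qed

lemma Hs_continuousI:
  assumes "continuous_on {0..T} x" "\<And>t. t \<in> {0..T} \<Longrightarrow> f t = dual k (x t)"
  shows "Hs_continuous A k T f"
  unfolding Hs_continuous_def
proof (intro conjI ballI)
  fix t assume t: "t \<in> {0..T}"
  show "f t \<in> Hs A k" using assms(2)[OF t] Hs_eq by auto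
  have "((\<lambda>s. norm (x s - x t)) \<longlongrightarrow> norm (x t - x t)) (at t within {0..T})"
    using assms(1) t unfolding continuous_on_def by (intro tendsto_intros) auto
  then show "((\<lambda>s. Hs_norm A k (\<lambda>\<phi>. f s \<phi> - f t \<phi>)) \<longlongrightarrow> 0) (at t within {0..T})"
  proof (subst tendsto_cong)
    show "\<forall>\<^sub>F s in at t within {0..T}. Hs_norm A k (\<lambda>\<phi>. f s \<phi> - f t \<phi>) = norm (x s - x t)"
      using assms(2) t unfolding eventually_at_filter by (auto simp: dual_diff Hs_norm_dual)
  qed simp
qed

lemma Hs_continuousE:
  assumes "Hs_continuous A k T f"
  obtains x where "continuous_on {0..T} x" "\<And>t. t \<in> {0..T} \<Longrightarrow> f t = dual k (x t)"
proof -
  have "\<forall>t\<in>{0..T}. \<exists>x. f t = dual k x" using assms Hs_eq unfolding Hs_continuous_def by fastforce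
  then obtain x where x: "\<And>t. t \<in> {0..T} \<Longrightarrow> f t = dual k (x t)" by metis
  have "continuous_on {0..T} x"
    unfolding continuous_on_def
  proof
    fix t assume t: "t \<in> {0..T}"
    have "((\<lambda>s. Hs_norm A k (\<lambda>\<phi>. f s \<phi> - f t \<phi>)) \<longlongrightarrow> 0) (at t within {0..T})"
      using assms t unfolding Hs_continuous_def by blast
    then have "((\<lambda>s. norm (x s - x t)) \<longlongrightarrow> 0) (at t within {0..T})"
    proof (rule tendsto_cong[THEN iffD1, rotated])
      show "\<forall>\<^sub>F s in at t within {0..T}. Hs_norm A k (\<lambda>\<phi>. f s \<phi> - f t \<phi>) = norm (x s - x t)"
        using x t unfolding eventually_at_filter by (auto simp: dual_diff Hs_norm_dual)
    qed
    then show "(x \<longlongrightarrow> x t) (at t within {0..T})" by (simp add: tendsto_norm_zero_iff LIM_zero_cancel)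
  qed
  then show ?thesis using that x by blast
qed

end

section \<open>Square integrable functions\<close>

lemma set_integral_lebesgue_on:
  "(LINT t:{0..T::real}|lebesgue. (f t :: real)) = integral\<^sup>L (lebesgue_on {0..T}) f"
  unfolding set_lebesgue_integral_def by (rule integral_restrict_space[symmetric]) simp

lemma set_integrable_lebesgue_on:
  "set_integrable lebesgue {a..b} (f :: real \<Rightarrow> real) \<longleftrightarrow> integrable (lebesgue_on {a..b}) f"
  unfolding set_integrable_def by (rule integrable_restrict_space[symmetric]) simp

text \<open>The discriminant argument behind the Cauchy-Schwarz inequality, stated for numbers
  because it serves twice: for the L2 inner product, and for the first variation at an approximate
  minimiser.\<close>

lemma quadratic_nonneg_imp:
  fixes a b d :: real
  assumes "\<And>c. 0 \<le> a + 2 * c * b + c\<^sup>2 * d" "0 \<le> d" shows "b\<^sup>2 \<le> a * d"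
proof (cases "d = 0")
  case True
  show ?thesis
  proof (cases "b = 0")
    case False
    \<comment> \<open>For \<open>d = 0\<close> and nonzero \<open>b\<close> this choice makes the
      affine function equal to -1.\<close>
    then show ?thesis using assms(1)[of "- (a + 1) / (2 * b)"] True by (simp add: field_simps)
  qed (use True in simp)
next
  case False
  then have "0 \<le> (a + 2 * (- b / d) * b + (- b / d)\<^sup>2 * d) * d"
    using assms(1)[of "- b / d"] assms(2) by (intro mult_nonneg_nonneg)
  also have "\<dots> = a * d - b\<^sup>2" using False by (simp add: field_simps power2_eq_square)
  finally show ?thesis by simp
qed

section \<open>Strong measurability by approximation with simple functions\<close>

definition strongly_measurable :: "real \<Rightarrow> (real \<Rightarrow> 'a::real_normed_vector) \<Rightarrow> bool" where
  "strongly_measurable T f \<longleftrightarrow> (\<exists>s. (\<forall>m::nat. simple_function (lebesgue_on {0..T}) (s m)) \<and>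
     (AE t in lebesgue_on {0..T}. (\<lambda>m. s m t) \<longlonglongrightarrow> f t))"

lemma L2_iff: "f \<in> L2 T \<longleftrightarrow> strongly_measurable T f \<and> integrable (lebesgue_on {0..T}) (\<lambda>t. (norm (f t))\<^sup>2)"
  by (simp add: L2_def strongly_measurable_def)

lemma strongly_measurable_compose2:
  assumes "strongly_measurable T f" "strongly_measurable T g"
    and h: "\<And>X Y x y. X \<longlonglongrightarrow> x \<Longrightarrow> Y \<longlonglongrightarrow> y \<Longrightarrow> (\<lambda>m::nat. h (X m) (Y m)) \<longlonglongrightarrow> h x y"
  shows "strongly_measurable T (\<lambda>t. h (f t) (g t))"
proof -
  obtain s where s: "\<And>m::nat. simple_function (lebesgue_on {0..T}) (s m)"
    "AE t in lebesgue_on {0..T}. (\<lambda>m. s m t) \<longlonglongrightarrow> f t"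
    using assms(1) unfolding strongly_measurable_def by blast
  obtain s' where s': "\<And>m::nat. simple_function (lebesgue_on {0..T}) (s' m)"
    "AE t in lebesgue_on {0..T}. (\<lambda>m. s' m t) \<longlonglongrightarrow> g t"
    using assms(2) unfolding strongly_measurable_def by blast
  show ?thesis
    unfolding strongly_measurable_def
  proof (intro exI[of _ "\<lambda>m t. h (s m t) (s' m t)"] conjI allI)
    show "simple_function (lebesgue_on {0..T}) (\<lambda>t. h (s m t) (s' m t))" for m
      by (rule simple_function_compose2) (rule s s')+
    show "AE t in lebesgue_on {0..T}. (\<lambda>m. h (s m t) (s' m t)) \<longlonglongrightarrow> h (f t) (g t)"
      using s(2) s'(2) by eventually_elim (rule h)
  qed
qed

lemma strongly_measurable_const: "strongly_measurable T (\<lambda>_. c)"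
  unfolding strongly_measurable_def by (rule exI[of _ "\<lambda>_ _. c"]) auto

text \<open>The pointwise limit of the simple functions is Borel measurable; \<open>f\<close> agrees
  with it off a null set, which does no harm for the complete Lebesgue measure.\<close>

lemma strongly_measurable_real:
  fixes f :: "real \<Rightarrow> real"
  assumes "strongly_measurable T f" shows "f \<in> borel_measurable (lebesgue_on {0..T})"
proof -
  obtain s where s: "\<And>m::nat. simple_function (lebesgue_on {0..T}) (s m)"
    "AE t in lebesgue_on {0..T}. (\<lambda>m. s m t) \<longlonglongrightarrow> f t"
    using assms unfolding strongly_measurable_def by blast
  define F where "F t = lim (\<lambda>m. s m t)" for t
  have "F \<in> borel_measurable (lebesgue_on {0..T})"
    unfolding F_def by (intro borel_measurable_lim_metric borel_measurable_simple_function s)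
  then have Fm: "(\<lambda>t. indicator {0..T} t *\<^sub>R F t) \<in> borel_measurable lebesgue"
    by (subst borel_measurable_restrict_space_iff[symmetric]) auto
  have "AE t in lebesgue_on {0..T}. F t = f t"
    using s(2) by eventually_elim (simp add: F_def limI)
  then have "AE t in lebesgue. indicator {0..T} t *\<^sub>R F t = indicator {0..T} t *\<^sub>R f t"
    by (subst (asm) AE_restrict_space_iff) (auto elim!: eventually_mono simp: indicator_def)
  then have "(\<lambda>t. indicator {0..T} t *\<^sub>R f t) \<in> borel_measurable lebesgue"
    by (rule borel_measurable_AE[OF Fm])
  then show ?thesis by (subst borel_measurable_restrict_space_iff) auto
qed

lemma strongly_measurable_add:
  "strongly_measurable T f \<Longrightarrow> strongly_measurable T g \<Longrightarrow> strongly_measurable T (\<lambda>t. f t + g t)"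
  by (rule strongly_measurable_compose2) (auto intro: tendsto_add)

lemma strongly_measurable_scaleR:
  "strongly_measurable T f \<Longrightarrow> strongly_measurable T (\<lambda>t. c *\<^sub>R f t)"
  by (rule strongly_measurable_compose2[OF _ strongly_measurable_const, of _ _ "\<lambda>x _. c *\<^sub>R x"])
     (auto intro: tendsto_intros)

lemma strongly_measurable_norm:
  "strongly_measurable T f \<Longrightarrow> strongly_measurable T (\<lambda>t. norm (f t))"
  by (rule strongly_measurable_compose2[OF _ strongly_measurable_const, of _ _ "\<lambda>x _. norm x"])
     (auto intro: tendsto_intros)

lemma strongly_measurable_inner:
  "strongly_measurable T f \<Longrightarrow> strongly_measurable T g \<Longrightarrow> strongly_measurable T (\<lambda>t. f t \<bullet> g t)"
  by (rule strongly_measurable_compose2) (auto intro: tendsto_inner)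

definition grid :: "nat \<Rightarrow> real \<Rightarrow> real" where
  "grid m t = of_int \<lfloor>real (Suc m) * t\<rfloor> / real (Suc m)"

lemma grid:
  assumes "t \<in> {0..T}"
  shows "grid m t \<in> {0..T}" "\<bar>grid m t - t\<bar> \<le> inverse (real (Suc m))"
proof -
  have 1: "real_of_int \<lfloor>real (Suc m) * t\<rfloor> \<le> real (Suc m) * t"
    "real (Suc m) * t < real_of_int \<lfloor>real (Suc m) * t\<rfloor> + 1" by linarith+
  have 2: "0 \<le> real_of_int \<lfloor>real (Suc m) * t\<rfloor>" using assms by simp
  have 3: "grid m t \<le> t" using 1(1) by (simp add: grid_def field_simps)
  show "grid m t \<in> {0..T}" using 2 3 assms by (auto simp: grid_def)
  have "t - grid m t = (real (Suc m) * t - real_of_int \<lfloor>real (Suc m) * t\<rfloor>) / real (Suc m)"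
    unfolding grid_def diff_divide_distrib by simp
  also have "\<dots> \<le> 1 / real (Suc m)" using 1(2) by (intro divide_right_mono) linarith+
  finally have "t - grid m t \<le> inverse (real (Suc m))" by (simp add: inverse_eq_divide)
  then show "\<bar>grid m t - t\<bar> \<le> inverse (real (Suc m))" using 3 by linarith
qed

text \<open>On \<open>[0,T]\<close> the grid takes finitely many values, so \<open>f\<close> may be
  arbitrary: it is only evaluated at finitely many points.\<close>

lemma simple_function_grid: "simple_function (lebesgue_on {0..T}) (\<lambda>t. f (grid m t))"
proof (rule simple_function_compose1, rule simple_function_borel_measurable)
  have "grid m \<in> borel_measurable borel" unfolding grid_def by measurable
  then have "grid m \<in> borel_measurable lebesgue"
    by (simp add: measurable_completion)
  then show "grid m \<in> borel_measurable (lebesgue_on {0..T})" by (rule measurable_restrict_space1)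
  have "grid m ` space (lebesgue_on {0..T}) \<subseteq> (\<lambda>i. of_int i / real (Suc m)) ` {0..\<lfloor>real (Suc m) * T\<rfloor>}"
    unfolding grid_def by (auto intro!: imageI floor_mono mult_left_mono)
  then show "finite (grid m ` space (lebesgue_on {0..T}))" by (rule finite_subset) simp
qed

text \<open>A diagonal choice: uniform continuity gives for each \<open>f k\<close> a mesh on which
  sampling costs at most \<open>inverse (Suc k)\<close>, and the sampled functions are simple with
  the same limit.\<close>

lemma strongly_measurable_limit:
  fixes f :: "nat \<Rightarrow> real \<Rightarrow> 'a::real_normed_vector"
  assumes c: "\<And>k. continuous_on {0..T} (f k)" and lim: "AE t in lebesgue_on {0..T}. (\<lambda>k. f k t) \<longlonglongrightarrow> g t"
  shows "strongly_measurable T g"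
proof -
  have "\<exists>m. \<forall>t\<in>{0..T}. norm (f k (grid m t) - f k t) \<le> inverse (real (Suc k))" for k
  proof -
    have "uniformly_continuous_on {0..T} (f k)" using c by (simp add: compact_uniformly_continuous)
    then obtain d where d: "d > 0"
      "\<And>x y. x \<in> {0..T} \<Longrightarrow> y \<in> {0..T} \<Longrightarrow> dist y x < d \<Longrightarrow> dist (f k y) (f k x) < inverse (real (Suc k))"
      unfolding uniformly_continuous_on_def by (metis inverse_positive_iff_positive of_nat_0_less_iff zero_less_Suc)
    obtain m where m: "inverse (real (Suc m)) < d" using reals_Archimedean[OF d(1)] by blast
    have "norm (f k (grid m t) - f k t) \<le> inverse (real (Suc k))" if t: "t \<in> {0..T}" for t
      using d(2)[OF t grid(1)[OF t, of m]] grid(2)[OF t, of m] m unfolding dist_norm dist_real_def by simp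
    then show ?thesis by blast
  qed
  then obtain m where m: "\<And>k t. t \<in> {0..T} \<Longrightarrow> norm (f k (grid (m k) t) - f k t) \<le> inverse (real (Suc k))" by metis
  show ?thesis
    unfolding strongly_measurable_def
  proof (intro exI[of _ "\<lambda>k t. f k (grid (m k) t)"] conjI allI simple_function_grid)
    have sp: "AE t in lebesgue_on {0..T}. t \<in> {0..T}" by (rule AE_I2) simp
    show "AE t in lebesgue_on {0..T}. (\<lambda>k. f k (grid (m k) t)) \<longlonglongrightarrow> g t"
      using lim sp
    proof eventually_elim
      case (elim t)
      have "(\<lambda>k. f k (grid (m k) t) - f k t) \<longlonglongrightarrow> 0"
        by (rule Lim_null_comparison[OF always_eventually LIMSEQ_inverse_real_of_nat]) (use m elim in auto)
      from tendsto_add[OF this elim(1)] show ?case by simp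
    qed
  qed
qed

lemma strongly_measurable_continuous: "continuous_on {0..T} f \<Longrightarrow> strongly_measurable T f"
  by (rule strongly_measurable_limit[of T "\<lambda>_. f"]) auto

lemma L2_inner:
  assumes f: "f \<in> L2 T" and g: "g \<in> L2 T"
  shows "integrable (lebesgue_on {0..T}) (\<lambda>t. f t \<bullet> g t)"
proof (rule Bochner_Integration.integrable_bound)
  show "integrable (lebesgue_on {0..T}) (\<lambda>t. (norm (f t))\<^sup>2 + (norm (g t))\<^sup>2)"
    using assms unfolding L2_iff by auto
  show "(\<lambda>t. f t \<bullet> g t) \<in> borel_measurable (lebesgue_on {0..T})"
    using assms unfolding L2_iff by (intro strongly_measurable_real strongly_measurable_inner) auto
  have "norm (f t \<bullet> g t) \<le> norm ((norm (f t))\<^sup>2 + (norm (g t))\<^sup>2)" for t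
  proof -
    have "\<bar>f t \<bullet> g t\<bar> \<le> norm (f t) * norm (g t)" by (rule Cauchy_Schwarz_ineq2)
    also have "\<dots> \<le> (norm (f t))\<^sup>2 + (norm (g t))\<^sup>2"
      using sum_squares_bound[of "norm (f t)" "norm (g t)"] mult_nonneg_nonneg[OF norm_ge_zero norm_ge_zero, of "f t" "g t"]
      by linarith
    finally show ?thesis by simp
  qed
  then show "AE t in lebesgue_on {0..T}. norm (f t \<bullet> g t) \<le> norm ((norm (f t))\<^sup>2 + (norm (g t))\<^sup>2)" by simp
qed

lemma L2_scaleR: "f \<in> L2 T \<Longrightarrow> (\<lambda>t. c *\<^sub>R f t) \<in> L2 T"
  unfolding L2_iff by (auto simp: power_mult_distrib strongly_measurable_scaleR)

lemma L2_add:
  fixes f g :: "real \<Rightarrow> 'a::real_inner"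
  assumes f: "f \<in> L2 T" and g: "g \<in> L2 T" shows "(\<lambda>t. f t + g t) \<in> L2 T"
proof -
  have "integrable (lebesgue_on {0..T}) (\<lambda>t. (norm (f t))\<^sup>2 + (2 * (f t \<bullet> g t) + (norm (g t))\<^sup>2))"
    using assms L2_inner[OF f g] unfolding L2_iff by auto
  then show ?thesis
    using assms unfolding L2_iff
    by (auto simp: strongly_measurable_add power2_norm_eq_inner inner_add inner_commute algebra_simps)
qed

lemma L2_diff:
  fixes f g :: "real \<Rightarrow> 'a::real_inner"
  assumes f: "f \<in> L2 T" and g: "g \<in> L2 T" shows "(\<lambda>t. f t - g t) \<in> L2 T"
  using L2_add[OF f L2_scaleR[OF g, of "- 1"]] by simp

lemma L2_continuous:
  fixes f :: "real \<Rightarrow> 'a::real_inner"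
  assumes "continuous_on {0..T} f" shows "f \<in> L2 T"
  unfolding L2_iff using assms
  by (auto intro!: strongly_measurable_continuous continuous_imp_integrable_real continuous_intros)

lemma L2_norm: "f \<in> L2 T \<Longrightarrow> (\<lambda>t. norm (f t)) \<in> L2 T"
  unfolding L2_iff by (auto simp: strongly_measurable_norm)

section \<open>Inner product, seminorm and completeness in L2 of a time interval\<close>

definition inner2 :: "real \<Rightarrow> (real \<Rightarrow> 'a::real_inner) \<Rightarrow> (real \<Rightarrow> 'a) \<Rightarrow> real" where
  "inner2 T f g = (LINT t:{0..T}|lebesgue. f t \<bullet> g t)"

definition norm2 :: "real \<Rightarrow> (real \<Rightarrow> 'a::real_inner) \<Rightarrow> real" where
  "norm2 T f = sqrt (LINT t:{0..T}|lebesgue. (norm (f t))\<^sup>2)"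

lemma inner2_add:
  "f \<in> L2 T \<Longrightarrow> g \<in> L2 T \<Longrightarrow> h \<in> L2 T \<Longrightarrow> inner2 T (\<lambda>t. f t + g t) h = inner2 T f h + inner2 T g h"
  by (simp add: inner2_def set_integral_lebesgue_on inner_add_left L2_inner)

lemma inner2_scaleR: "inner2 T (\<lambda>t. c *\<^sub>R f t) h = c * inner2 T f h"
  by (simp add: inner2_def set_integral_lebesgue_on)

lemma inner2_commute: "inner2 T f g = inner2 T g f"
  by (simp add: inner2_def inner_commute)

lemma inner2_add_right:
  "f \<in> L2 T \<Longrightarrow> g \<in> L2 T \<Longrightarrow> h \<in> L2 T \<Longrightarrow> inner2 T h (\<lambda>t. f t + g t) = inner2 T h f + inner2 T h g"
  by (simp add: inner2_def set_integral_lebesgue_on inner_add_right L2_inner)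

lemma norm2_nonneg: "0 \<le> norm2 T f"
  by (simp add: norm2_def set_integral_lebesgue_on)

lemma norm2_sq: "(norm2 T f)\<^sup>2 = (LINT t:{0..T}|lebesgue. (norm (f t))\<^sup>2)"
  by (simp add: norm2_def set_integral_lebesgue_on)

lemma norm2_sq_inner2: "(norm2 T f)\<^sup>2 = inner2 T f f"
  by (simp add: norm2_sq inner2_def power2_norm_eq_inner)

lemma norm2_scaleR: "norm2 T (\<lambda>t. c *\<^sub>R f t) = \<bar>c\<bar> * norm2 T f"
  by (simp add: norm2_def set_integral_lebesgue_on power_mult_distrib real_sqrt_mult)

lemma norm2_minus_commute: "norm2 T (\<lambda>t. f t - g t) = norm2 T (\<lambda>t. g t - f t)"
  by (simp add: norm2_def norm_minus_commute)

lemma norm2_add_sq: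
  assumes "f \<in> L2 T" "g \<in> L2 T"
  shows "(norm2 T (\<lambda>t. f t + g t))\<^sup>2 = (norm2 T f)\<^sup>2 + 2 * inner2 T f g + (norm2 T g)\<^sup>2"
  using assms inner2_commute[of T g f]
  by (simp add: norm2_sq_inner2 inner2_add inner2_add_right L2_add)

lemma inner2_Cauchy_Schwarz:
  assumes "f \<in> L2 T" "g \<in> L2 T" shows "\<bar>inner2 T f g\<bar> \<le> norm2 T f * norm2 T g"
proof -
  have "(inner2 T f g)\<^sup>2 \<le> (norm2 T f)\<^sup>2 * (norm2 T g)\<^sup>2"
  proof (rule quadratic_nonneg_imp)
    fix c
    have "0 \<le> (norm2 T (\<lambda>t. f t + c *\<^sub>R g t))\<^sup>2" by simp
    also have "\<dots> = (norm2 T f)\<^sup>2 + 2 * inner2 T f (\<lambda>t. c *\<^sub>R g t) + (norm2 T (\<lambda>t. c *\<^sub>R g t))\<^sup>2"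
      by (intro norm2_add_sq L2_scaleR assms)
    also have "\<dots> = (norm2 T f)\<^sup>2 + 2 * c * inner2 T f g + c\<^sup>2 * (norm2 T g)\<^sup>2"
      by (simp add: inner2_commute[of T f] inner2_scaleR norm2_scaleR power_mult_distrib)
    finally show "0 \<le> (norm2 T f)\<^sup>2 + 2 * c * inner2 T f g + c\<^sup>2 * (norm2 T g)\<^sup>2" .
  qed simp
  then have "(inner2 T f g)\<^sup>2 \<le> (norm2 T f * norm2 T g)\<^sup>2" by (simp add: power_mult_distrib)
  then show ?thesis by (metis abs_le_square_iff abs_of_nonneg mult_nonneg_nonneg norm2_nonneg)
qed

lemma norm2_triangle:
  assumes "f \<in> L2 T" "g \<in> L2 T" shows "norm2 T (\<lambda>t. f t + g t) \<le> norm2 T f + norm2 T g"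
proof (rule power2_le_imp_le)
  show "(norm2 T (\<lambda>t. f t + g t))\<^sup>2 \<le> (norm2 T f + norm2 T g)\<^sup>2"
    using norm2_add_sq[OF assms] inner2_Cauchy_Schwarz[OF assms] by (simp add: power2_sum)
qed (simp add: norm2_nonneg)

lemma norm2_triangle_diff:
  fixes f g h :: "real \<Rightarrow> 'a::real_inner"
  assumes "f \<in> L2 T" "g \<in> L2 T" "h \<in> L2 T"
  shows "norm2 T (\<lambda>t. f t - h t) \<le> norm2 T (\<lambda>t. f t - g t) + norm2 T (\<lambda>t. g t - h t)"
  using norm2_triangle[OF L2_diff[OF assms(1,2)] L2_diff[OF assms(2,3)]] by simp

lemma norm2_norm: "norm2 T (\<lambda>t. norm (f t)) = norm2 T f"
  by (simp add: norm2_def)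

lemma integral_inner_le:
  assumes "f \<in> L2 T" "g \<in> L2 T" "0 \<le> a" "b \<le> T"
  shows "set_integrable lebesgue {a..b} (\<lambda>t. f t \<bullet> g t)"
    "\<bar>LINT t:{a..b}|lebesgue. f t \<bullet> g t\<bar> \<le> norm2 T f * norm2 T g"
proof -
  have s: "set_integrable lebesgue {0..T} (\<lambda>t. f t \<bullet> g t)"
    using L2_inner[OF assms(1,2)] by (simp add: set_integrable_lebesgue_on)
  show ab: "set_integrable lebesgue {a..b} (\<lambda>t. f t \<bullet> g t)"
    by (rule set_integrable_subset[OF s]) (use assms in auto)
  have n: "integrable (lebesgue_on {0..T}) (\<lambda>t. norm (f t) * norm (g t))"
    using L2_inner[OF L2_norm[OF assms(1)] L2_norm[OF assms(2)]] by simp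
  have "\<bar>LINT t:{a..b}|lebesgue. f t \<bullet> g t\<bar> \<le> (LINT t:{a..b}|lebesgue. \<bar>f t \<bullet> g t\<bar>)"
    using set_integral_norm_bound[OF ab] by simp
  also have "\<dots> \<le> (LINT t:{0..T}|lebesgue. norm (f t) * norm (g t))"
    unfolding set_lebesgue_integral_def
  proof (rule integral_mono)
    show "integrable lebesgue (\<lambda>t. indicat_real {a..b} t *\<^sub>R \<bar>f t \<bullet> g t\<bar>)"
      using set_integrable_abs[OF ab] unfolding set_integrable_def .
    show "integrable lebesgue (\<lambda>t. indicat_real {0..T} t *\<^sub>R (norm (f t) * norm (g t)))"
      using n unfolding set_integrable_lebesgue_on[symmetric] set_integrable_def .
    show "indicat_real {a..b} t *\<^sub>R \<bar>f t \<bullet> g t\<bar> \<le> indicat_real {0..T} t *\<^sub>R (norm (f t) * norm (g t))" for t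
      using assms Cauchy_Schwarz_ineq2[of "f t" "g t"] by (auto simp: indicator_def)
  qed
  also have "\<dots> = inner2 T (\<lambda>t. norm (f t)) (\<lambda>t. norm (g t))" by (simp add: inner2_def)
  also have "\<dots> \<le> norm2 T f * norm2 T g"
    using inner2_Cauchy_Schwarz[OF L2_norm[OF assms(1)] L2_norm[OF assms(2)]] by (simp add: norm2_norm)
  finally show "\<bar>LINT t:{a..b}|lebesgue. f t \<bullet> g t\<bar> \<le> norm2 T f * norm2 T g" .
qed


lemma nn_integral_norm2:
  assumes "f \<in> L2 T"
  shows "(\<integral>\<^sup>+t. ennreal ((norm (f t))\<^sup>2) \<partial>lebesgue_on {0..T}) = ennreal ((norm2 T f)\<^sup>2)"
  using assms unfolding L2_iff norm2_sq set_integral_lebesgue_on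
  by (intro nn_integral_eq_integral) auto

text \<open>Only limits of continuous functions are needed, for which strong measurability of the limit
  is immediate.\<close>

lemma L2_complete_continuous:
  fixes f :: "nat \<Rightarrow> real \<Rightarrow> 'a::{real_inner, complete_space}"
  assumes T: "0 < T" and c: "\<And>k. continuous_on {0..T} (f k)"
    and cauchy: "\<And>\<epsilon>. 0 < \<epsilon> \<Longrightarrow> \<exists>K. \<forall>m\<ge>K. \<forall>k\<ge>K. norm2 T (\<lambda>t. f m t - f k t) < \<epsilon>"
  obtains g where "g \<in> L2 T" "(\<lambda>k. norm2 T (\<lambda>t. f k t - g t)) \<longlonglongrightarrow> 0"
proof -
  have fL: "f k \<in> L2 T" for k using L2_continuous[OF c] .
  have "\<exists>K. \<forall>m\<ge>K. \<forall>k\<ge>K. norm2 T (\<lambda>t. f m t - f k t) < (1/2)^i" for i :: nat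
    by (rule cauchy) simp
  then obtain K where K: "\<And>i m k. m \<ge> K i \<Longrightarrow> k \<ge> K i \<Longrightarrow> norm2 T (\<lambda>t. f m t - f k t) < (1/2)^i" by metis
  \<comment> \<open>A subsequence index that is monotone, dominates every threshold
    \<open>K i\<close> and tends to infinity; summing the thresholds secures all three at
    once.\<close>
  define \<phi> where "\<phi> i = (\<Sum>j\<le>i. K j) + i" for i
  have \<phi>K: "K i \<le> \<phi> i" for i unfolding \<phi>_def by (simp add: member_le_sum trans_le_add1)
  have \<phi>m: "\<phi> i \<le> \<phi> (Suc i)" for i unfolding \<phi>_def by simp
  have \<phi>i: "i \<le> \<phi> i" for i unfolding \<phi>_def by simp
  define F where "F i = f (\<phi> i)" for i
  have Fc: "continuous_on {0..T} (F i)" for i unfolding F_def by (rule c)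
  define D where "D i t = norm (F (Suc i) t - F i t)" for i t
  have Dc: "continuous_on {0..T} (D i)" for i unfolding D_def by (intro continuous_intros Fc)
  have Dm: "D i \<in> borel_measurable (lebesgue_on {0..T})" for i
    by (intro strongly_measurable_real strongly_measurable_continuous Dc)
  have one: "norm2 T (\<lambda>_. 1 :: real) = sqrt T"
    using T by (simp add: norm2_def set_integral_lebesgue_on measure_restrict_space)
  have Dint: "(\<integral>\<^sup>+t. ennreal (D i t) \<partial>lebesgue_on {0..T}) \<le> ennreal (sqrt T * (1/2)^i)" for i
  proof -
    have "(\<integral>\<^sup>+t. ennreal (D i t) \<partial>lebesgue_on {0..T}) = ennreal (integral\<^sup>L (lebesgue_on {0..T}) (D i))"
      by (intro nn_integral_eq_integral continuous_imp_integrable_real Dc) (simp add: D_def)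
    also have "integral\<^sup>L (lebesgue_on {0..T}) (D i) = inner2 T (D i) (\<lambda>_. 1)"
      by (simp add: inner2_def set_integral_lebesgue_on)
    also have "inner2 T (D i) (\<lambda>_. 1) \<le> norm2 T (D i) * norm2 T (\<lambda>_. 1 :: real)"
      using inner2_Cauchy_Schwarz[OF L2_continuous[OF Dc] L2_continuous[OF continuous_on_const], of i 1] by linarith
    also have "norm2 T (D i) * norm2 T (\<lambda>_. 1 :: real) \<le> (1/2)^i * sqrt T"
    proof -
      have "norm2 T (D i) = norm2 T (\<lambda>t. f (\<phi> (Suc i)) t - f (\<phi> i) t)"
        unfolding D_def F_def by (rule norm2_norm)
      also have "\<dots> < (1/2)^i" by (rule K) (use \<phi>K[of i] \<phi>m[of i] in linarith)+
      finally show ?thesis unfolding one using T by (intro mult_right_mono) auto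
    qed
    finally show ?thesis by (simp add: mult.commute ennreal_leI)
  qed
  \<comment> \<open>The increments of the subsequence have summable L1 norms, so their sum is finite
    almost everywhere and the subsequence converges there.\<close>
  have "(\<integral>\<^sup>+t. (\<Sum>i. ennreal (D i t)) \<partial>lebesgue_on {0..T}) = (\<Sum>i. \<integral>\<^sup>+t. ennreal (D i t) \<partial>lebesgue_on {0..T})"
    by (rule nn_integral_suminf) (use Dm in measurable)
  also have "\<dots> \<le> (\<Sum>i. ennreal (sqrt T * (1/2)^i))" by (intro suminf_le Dint summableI)
  also have "\<dots> = ennreal (\<Sum>i. sqrt T * (1/2)^i)"
    using T by (intro suminf_ennreal2 summable_mult summable_geometric) auto
  finally have "(\<integral>\<^sup>+t. (\<Sum>i. ennreal (D i t)) \<partial>lebesgue_on {0..T}) \<noteq> \<infinity>"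
    by (metis ennreal_less_top infinity_ennreal_def leD)
  then have "AE t in lebesgue_on {0..T}. (\<Sum>i. ennreal (D i t)) \<noteq> \<infinity>"
    by (rule nn_integral_PInf_AE[rotated]) (use Dm in measurable)
  then have ae: "AE t in lebesgue_on {0..T}. (\<lambda>i. F i t) \<longlonglongrightarrow> lim (\<lambda>i. F i t)"
  proof eventually_elim
    case (elim t)
    have "summable (\<lambda>i. D i t)"
      by (rule summable_suminf_not_top) (use elim in \<open>auto simp: D_def\<close>)
    then have s: "(\<lambda>i. \<Sum>j<i. D j t) \<longlonglongrightarrow> (\<Sum>j. D j t)" by (rule summable_LIMSEQ)
    have "Cauchy (\<lambda>i. F i t)"
    proof (rule metric_CauchyI)
      fix \<epsilon> :: real assume "0 < \<epsilon>"
      then obtain M where M: "\<And>m n. m \<ge> M \<Longrightarrow> n \<ge> M \<Longrightarrow> dist (\<Sum>j<m. D j t) (\<Sum>j<n. D j t) < \<epsilon>"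
        using LIMSEQ_imp_Cauchy[OF s] unfolding Cauchy_def by meson
      have le: "norm (F m t - F n t) \<le> (\<Sum>j<m. D j t) - (\<Sum>j<n. D j t)" if "n \<le> m" for m n
        using that
      proof (induction m rule: dec_induct)
        case (step m)
        have "norm (F (Suc m) t - F n t) \<le> D m t + norm (F m t - F n t)"
          unfolding D_def using norm_triangle_ineq[of "F (Suc m) t - F m t" "F m t - F n t"] by simp
        then show ?case using step by simp
      qed simp
      have "dist (F m t) (F n t) < \<epsilon>" if "n \<le> m" "M \<le> n" for m n
        using le[OF that(1)] M[of m n] that unfolding dist_norm real_norm_def by linarith
      then show "\<exists>M. \<forall>m\<ge>M. \<forall>n\<ge>M. dist (F m t) (F n t) < \<epsilon>" by (metis dist_commute nle_le)
    qed
    then have "convergent (\<lambda>i. F i t)" by (rule Cauchy_convergent)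
    then show ?case unfolding convergent_LIMSEQ_iff .
  qed
  define g where "g t = lim (\<lambda>i. F i t)" for t
  have gm: "strongly_measurable T g"
    by (rule strongly_measurable_limit[OF Fc]) (use ae in \<open>simp add: g_def\<close>)
  \<comment> \<open>Fatou's lemma transfers a Cauchy bound between \<open>f k\<close> and the late
    subsequence terms to the distance of \<open>f k\<close> from the limit.\<close>
  have fat: "(\<integral>\<^sup>+t. ennreal ((norm (f k t - g t))\<^sup>2) \<partial>lebesgue_on {0..T}) \<le> ennreal (\<epsilon>\<^sup>2)"
    if \<epsilon>: "0 < \<epsilon>" and L: "\<And>m. m \<ge> L \<Longrightarrow> norm2 T (\<lambda>t. f k t - f m t) < \<epsilon>" for k \<epsilon> L
  proof -
    have dL: "(\<lambda>t. f k t - F i t) \<in> L2 T" for i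
      unfolding F_def by (intro L2_continuous continuous_intros c)
    have meas: "(\<lambda>t. ennreal ((norm (f k t - F i t))\<^sup>2)) \<in> borel_measurable (lebesgue_on {0..T})" for i
      using strongly_measurable_real[OF strongly_measurable_norm] dL[of i] unfolding L2_iff by auto
    have "AE t in lebesgue_on {0..T}. ennreal ((norm (f k t - g t))\<^sup>2) \<le> liminf (\<lambda>i. ennreal ((norm (f k t - F i t))\<^sup>2))"
      using ae
    proof eventually_elim
      case (elim t)
      have "(\<lambda>i. ennreal ((norm (f k t - F i t))\<^sup>2)) \<longlonglongrightarrow> ennreal ((norm (f k t - g t))\<^sup>2)"
        unfolding g_def by (intro tendsto_intros tendsto_ennrealI elim)
      then show ?case using lim_imp_Liminf[OF trivial_limit_sequentially] by (metis order_refl)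
    qed
    then have "(\<integral>\<^sup>+t. ennreal ((norm (f k t - g t))\<^sup>2) \<partial>lebesgue_on {0..T})
        \<le> (\<integral>\<^sup>+t. liminf (\<lambda>i. ennreal ((norm (f k t - F i t))\<^sup>2)) \<partial>lebesgue_on {0..T})"
      by (rule nn_integral_mono_AE)
    also have "\<dots> \<le> liminf (\<lambda>i. \<integral>\<^sup>+t. ennreal ((norm (f k t - F i t))\<^sup>2) \<partial>lebesgue_on {0..T})"
      by (rule nn_integral_liminf[OF meas])
    also have "\<dots> \<le> liminf (\<lambda>i::nat. ennreal (\<epsilon>\<^sup>2))"
    proof (rule Liminf_mono)
      show "\<forall>\<^sub>F i in sequentially. (\<integral>\<^sup>+t. ennreal ((norm (f k t - F i t))\<^sup>2) \<partial>lebesgue_on {0..T}) \<le> ennreal (\<epsilon>\<^sup>2)"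
        using eventually_ge_at_top[of L]
      proof eventually_elim
        case (elim i)
        have "norm2 T (\<lambda>t. f k t - F i t) < \<epsilon>" unfolding F_def using elim \<phi>i[of i] by (intro L) linarith
        then show ?case
          unfolding nn_integral_norm2[OF dL] using norm2_nonneg[of T "\<lambda>t. f k t - F i t"]
          by (intro ennreal_leI power_mono) auto
      qed
    qed
    also have "\<dots> = ennreal (\<epsilon>\<^sup>2)" by (simp add: Liminf_const)
    finally show ?thesis .
  qed
  have diffL: "(\<lambda>t. f k t - g t) \<in> L2 T \<and> norm2 T (\<lambda>t. f k t - g t) \<le> \<epsilon>"
    if \<epsilon>: "0 < \<epsilon>" and L: "\<And>m. m \<ge> L \<Longrightarrow> norm2 T (\<lambda>t. f k t - f m t) < \<epsilon>" for k \<epsilon> L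
  proof -
    have sm: "strongly_measurable T (\<lambda>t. f k t - g t)"
      using strongly_measurable_add[OF strongly_measurable_continuous[OF c] strongly_measurable_scaleR[OF gm, of "-1"], of k]
      by simp
    have m: "(\<lambda>t. (norm (f k t - g t))\<^sup>2) \<in> borel_measurable (lebesgue_on {0..T})"
      using strongly_measurable_real[OF strongly_measurable_norm[OF sm]] by simp
    have fin: "(\<integral>\<^sup>+t. ennreal ((norm (f k t - g t))\<^sup>2) \<partial>lebesgue_on {0..T}) \<le> ennreal (\<epsilon>\<^sup>2)"
      by (rule fat[OF \<epsilon> L])
    have "integrable (lebesgue_on {0..T}) (\<lambda>t. (norm (f k t - g t))\<^sup>2)"
      by (rule integrableI_bounded[OF m]) (use le_less_trans[OF fin ennreal_less_top] in simp)
    then have L2d: "(\<lambda>t. f k t - g t) \<in> L2 T" using sm by (simp add: L2_iff)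
    have "(norm2 T (\<lambda>t. f k t - g t))\<^sup>2 \<le> \<epsilon>\<^sup>2"
      using fin unfolding nn_integral_norm2[OF L2d] by (simp add: ennreal_le_iff)
    then show ?thesis using L2d \<epsilon> power2_le_imp_le[of _ \<epsilon>] by auto
  qed
  \<comment> \<open>One index with finite distance to \<open>g\<close> is enough to place
    \<open>g\<close> in L2.\<close>
  have "(\<lambda>t. f (K 0) t - g t) \<in> L2 T" using diffL[of 1 "K 0" "K 0"] K[of 0] by auto
  from L2_diff[OF fL[of "K 0"] this] have "g \<in> L2 T" by simp
  moreover have "(\<lambda>k. norm2 T (\<lambda>t. f k t - g t)) \<longlonglongrightarrow> 0"
  proof (rule LIMSEQ_I)
    fix \<epsilon> :: real assume \<epsilon>: "0 < \<epsilon>"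
    then obtain L where "\<forall>m\<ge>L. \<forall>k\<ge>L. norm2 T (\<lambda>t. f m t - f k t) < \<epsilon> / 2" using cauchy[of "\<epsilon> / 2"] by auto
    then have "norm (norm2 T (\<lambda>t. f k t - g t) - 0) < \<epsilon>" if "k \<ge> L" for k
      using diffL[of "\<epsilon> / 2" L k] that \<epsilon> norm2_nonneg[of T "\<lambda>t. f k t - g t"] by auto
    then show "\<exists>L. \<forall>k\<ge>L. norm (norm2 T (\<lambda>t. f k t - g t) - 0) < \<epsilon>" by blast
  qed
  ultimately show ?thesis by (rule that)
qed

lemma inner2_tendsto:
  assumes "\<And>k. f k \<in> L2 T" "g \<in> L2 T" "(\<lambda>k. norm2 T (\<lambda>t. f k t - g t)) \<longlonglongrightarrow> 0" "h \<in> L2 T" "0 \<le> a" "b \<le> T"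
  shows "(\<lambda>k. LINT t:{a..b}|lebesgue. f k t \<bullet> h t) \<longlonglongrightarrow> (LINT t:{a..b}|lebesgue. g t \<bullet> h t)"
proof (rule LIM_zero_cancel, rule Lim_null_comparison)
  have "\<bar>(LINT t:{a..b}|lebesgue. f k t \<bullet> h t) - (LINT t:{a..b}|lebesgue. g t \<bullet> h t)\<bar> \<le> norm2 T (\<lambda>t. f k t - g t) * norm2 T h" for k
  proof -
    have "(LINT t:{a..b}|lebesgue. (f k t - g t) \<bullet> h t) = (LINT t:{a..b}|lebesgue. f k t \<bullet> h t) - (LINT t:{a..b}|lebesgue. g t \<bullet> h t)"
      unfolding inner_diff_left
      by (intro set_integral_diff integral_inner_le[OF assms(1,4,5,6)] integral_inner_le[OF assms(2,4,5,6)])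
    then show ?thesis using integral_inner_le(2)[OF L2_diff[OF assms(1,2)] assms(4-6)] by metis
  qed
  then show "\<forall>\<^sub>F k in sequentially. norm ((LINT t:{a..b}|lebesgue. f k t \<bullet> h t) - (LINT t:{a..b}|lebesgue. g t \<bullet> h t))
      \<le> norm2 T (\<lambda>t. f k t - g t) * norm2 T h" by simp
  show "(\<lambda>k. norm2 T (\<lambda>t. f k t - g t) * norm2 T h) \<longlonglongrightarrow> 0"
    using tendsto_mult[OF assms(3) tendsto_const] by simp
qed

text \<open>The Hilbert uniqueness method: a functional that is bounded by the observations is
  represented by the limit of a minimising sequence.\<close>

lemma hilbert_uniqueness:
  fixes G :: "((real \<Rightarrow> 'a::real_inner) \<times> real) set"
  assumes L2: "\<And>g l. (g, l) \<in> G \<Longrightarrow> g \<in> L2 T"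
    and z: "((\<lambda>_. 0), 0) \<in> G"
    and add: "\<And>g l g' l'. (g, l) \<in> G \<Longrightarrow> (g', l') \<in> G \<Longrightarrow> ((\<lambda>t. g t + g' t), l + l') \<in> G"
    and scl: "\<And>g l a. (g, l) \<in> G \<Longrightarrow> ((\<lambda>t. a *\<^sub>R g t), a * l) \<in> G"
    and bd: "\<And>g l. (g, l) \<in> G \<Longrightarrow> \<bar>l\<bar> \<le> c * norm2 T g"
  obtains g l where "\<And>m::nat. (g m, l m) \<in> G"
    "\<And>\<epsilon>. 0 < \<epsilon> \<Longrightarrow> \<exists>K. \<forall>m\<ge>K. \<forall>k\<ge>K. norm2 T (\<lambda>t. g m t - g k t) < \<epsilon>"
    "\<And>h b. (h, b) \<in> G \<Longrightarrow> (\<lambda>m. inner2 T (g m) h) \<longlonglongrightarrow> b"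
proof -
  \<comment> \<open>The minimum of this functional, half of which is the usual dual functional, is
    attained formally at the \<open>g\<close> that represents \<open>l\<close>. Completing the
    square in \<open>bd\<close> gives the lower bound \<open>- c\<^sup>2\<close>.\<close>
  define J where "J p = (norm2 T (fst p))\<^sup>2 - 2 * snd p" for p :: "(real \<Rightarrow> 'a) \<times> real"
  have low: "- c\<^sup>2 \<le> J p" if "p \<in> G" for p
  proof -
    obtain g l where p: "p = (g, l)" by fastforce
    have "l \<le> c * norm2 T g" using bd[of g l] that p by auto
    moreover have "0 \<le> (norm2 T g - c)\<^sup>2" by simp
    ultimately show ?thesis unfolding J_def p by (simp add: power2_diff algebra_simps)
  qed
  have bb: "bdd_below (J ` G)" using low by (intro bdd_belowI[of _ "- c\<^sup>2"]) auto
  define d where "d = Inf (J ` G)"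
  have dle: "d \<le> J p" if "p \<in> G" for p unfolding d_def by (rule cInf_lower[OF _ bb]) (use that in auto)
  have "\<exists>p\<in>G. J p < d + inverse (real (Suc m))" for m
  proof -
    have "Inf (J ` G) < d + inverse (real (Suc m))" unfolding d_def[symmetric] by simp
    then show ?thesis using cInf_less_iff[OF _ bb] z by blast
  qed
  then obtain p where p: "\<And>m. p m \<in> G" "\<And>m. J (p m) < d + inverse (real (Suc m))" by metis
  define g where "g m = fst (p m)" for m
  define l where "l m = snd (p m)" for m
  have G: "(g m, l m) \<in> G" and gL: "g m \<in> L2 T" for m
    using p(1)[of m] L2[of "g m" "l m"] unfolding g_def l_def by auto
  have Jp: "(norm2 T (g m))\<^sup>2 - 2 * l m < d + inverse (real (Suc m))" for m
    using p(2)[of m] unfolding J_def g_def l_def .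
  \<comment> \<open>Parallelogram identity: the midpoint of two approximate minimisers cannot lie
    below \<open>d\<close>, which bounds their distance by their excesses.\<close>
  have par: "(norm2 T (\<lambda>t. g m t - g k t))\<^sup>2 \<le> 2 * inverse (real (Suc m)) + 2 * inverse (real (Suc k))" for m k
  proof -
    have "((\<lambda>t. (1/2) *\<^sub>R (g m t + g k t)), 1/2 * (l m + l k)) \<in> G" by (intro scl add G)
    from dle[OF this] have "d \<le> (norm2 T (\<lambda>t. g m t + g k t))\<^sup>2 / 4 - (l m + l k)"
      unfolding J_def fst_conv snd_conv norm2_scaleR by (simp add: power_mult_distrib power2_eq_square add_divide_distrib)
    moreover have "(norm2 T (\<lambda>t. g m t + g k t))\<^sup>2 = (norm2 T (g m))\<^sup>2 + 2 * inner2 T (g m) (g k) + (norm2 T (g k))\<^sup>2"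
      by (rule norm2_add_sq[OF gL gL])
    moreover have "(norm2 T (\<lambda>t. g m t - g k t))\<^sup>2 = (norm2 T (g m))\<^sup>2 - 2 * inner2 T (g m) (g k) + (norm2 T (g k))\<^sup>2"
      using norm2_add_sq[OF gL L2_scaleR[OF gL], of m "-1" k]
      by (simp add: inner2_commute[of T "g m"] norm2_scaleR[of T "-1", simplified] inner2_scaleR[of T "-1", simplified])
    ultimately show ?thesis using Jp[of m] Jp[of k] by linarith
  qed
  have cau: "\<exists>K. \<forall>m\<ge>K. \<forall>k\<ge>K. norm2 T (\<lambda>t. g m t - g k t) < \<epsilon>" if \<epsilon>: "0 < \<epsilon>" for \<epsilon>
  proof -
    obtain K where K: "inverse (real (Suc K)) < \<epsilon>\<^sup>2 / 4" using reals_Archimedean[of "\<epsilon>\<^sup>2 / 4"] \<epsilon> by auto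
    have i: "inverse (real (Suc m)) \<le> inverse (real (Suc K))" if "m \<ge> K" for m
      using that by (intro le_imp_inverse_le) auto
    have "norm2 T (\<lambda>t. g m t - g k t) < \<epsilon>" if "m \<ge> K" "k \<ge> K" for m k
    proof (rule power2_less_imp_less)
      show "(norm2 T (\<lambda>t. g m t - g k t))\<^sup>2 < \<epsilon>\<^sup>2" using par[of m k] i[OF that(1)] i[OF that(2)] K by linarith
    qed (use \<epsilon> in simp)
    then show ?thesis by blast
  qed
  have lim: "(\<lambda>m. inner2 T (g m) h) \<longlonglongrightarrow> b" if hb: "(h, b) \<in> G" for h b
  proof -
    have hL: "h \<in> L2 T" using L2[OF hb] .
    \<comment> \<open>First variation at an approximate minimiser: moving by \<open>a\<close> times
      \<open>h\<close> cannot lower \<open>J\<close> by more than the excess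
      \<open>inverse (Suc m)\<close>, for every real \<open>a\<close>. The discriminant bound turns
      this into an approximate Euler equation.\<close>
    have sq: "(inner2 T (g m) h - b)\<^sup>2 \<le> inverse (real (Suc m)) * (norm2 T h)\<^sup>2" for m
    proof (rule quadratic_nonneg_imp)
      fix a
      have "((\<lambda>t. g m t + a *\<^sub>R h t), l m + a * b) \<in> G" by (intro add scl G hb)
      from dle[OF this] have "d \<le> (norm2 T (\<lambda>t. g m t + a *\<^sub>R h t))\<^sup>2 - 2 * (l m + a * b)" unfolding J_def by simp
      moreover have "(norm2 T (\<lambda>t. g m t + a *\<^sub>R h t))\<^sup>2 = (norm2 T (g m))\<^sup>2 + 2 * a * inner2 T (g m) h + a\<^sup>2 * (norm2 T h)\<^sup>2"
        using norm2_add_sq[OF gL L2_scaleR[OF hL], of m a]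
        by (simp add: inner2_commute[of T "g m"] inner2_scaleR norm2_scaleR power_mult_distrib)
      ultimately show "0 \<le> inverse (real (Suc m)) + 2 * a * (inner2 T (g m) h - b) + a\<^sup>2 * (norm2 T h)\<^sup>2"
        using Jp[of m] by (simp add: algebra_simps)
    qed simp
    have "(\<lambda>m. inverse (real (Suc m)) * (norm2 T h)\<^sup>2) \<longlonglongrightarrow> 0 * (norm2 T h)\<^sup>2"
      by (intro tendsto_intros LIMSEQ_inverse_real_of_nat)
    then have "(\<lambda>m. (inner2 T (g m) h - b)\<^sup>2) \<longlonglongrightarrow> 0"
      by (intro Lim_null_comparison[of "\<lambda>m. (inner2 T (g m) h - b)\<^sup>2"]) (use sq in auto)
    then have "(\<lambda>m. sqrt ((inner2 T (g m) h - b)\<^sup>2)) \<longlonglongrightarrow> sqrt 0" by (rule tendsto_real_sqrt)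
    then show ?thesis by (simp add: LIM_zero_iff tendsto_rabs_zero_iff)
  qed
  show ?thesis by (rule that[OF G cau lim])
qed

section \<open>Integrals of real functions\<close>

lemma le_half_plus_half_imp_le: "x \<le> y / 2 + x / 2 \<Longrightarrow> x \<le> y" for x y :: real
  by linarith

lemma LINT_HK:
  fixes f :: "real \<Rightarrow> real"
  assumes "set_integrable lebesgue {0..T} f" "0 \<le> a" "b \<le> T"
  shows "(LINT s:{a..b}|lebesgue. f s) = integral {a..b} f" "f integrable_on {a..b}"
    "set_integrable lebesgue {a..b} f"
proof -
  show "set_integrable lebesgue {a..b} f" by (rule set_integrable_subset[OF assms(1)]) (use assms in auto)
  from set_lebesgue_integral_eq_integral[OF this]
  show "(LINT s:{a..b}|lebesgue. f s) = integral {a..b} f" "f integrable_on {a..b}" by auto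
qed

lemma LINT_split:
  fixes f :: "real \<Rightarrow> real"
  assumes "set_integrable lebesgue {0..T} f" "0 \<le> s" "s \<le> t" "t \<le> T"
  shows "(LINT u:{0..t}|lebesgue. f u) = (LINT u:{0..s}|lebesgue. f u) + (LINT u:{s..t}|lebesgue. f u)"
  using LINT_HK[OF assms(1)] assms Henstock_Kurzweil_Integration.integral_combine[of 0 s t f] by simp

lemma set_integrable_continuous:
  fixes f :: "real \<Rightarrow> real"
  shows "continuous_on {0..T} f \<Longrightarrow> set_integrable lebesgue {0..T} f"
  unfolding set_integrable_lebesgue_on by (rule continuous_imp_integrable_real)

lemma set_integrable_continuous_sub:
  fixes f :: "real \<Rightarrow> real"
  shows "continuous_on {0..T} f \<Longrightarrow> 0 \<le> a \<Longrightarrow> b \<le> T \<Longrightarrow> set_integrable lebesgue {a..b} f"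
  by (rule LINT_HK(3)[OF set_integrable_continuous])

lemma LINT_sum:
  fixes f :: "'i \<Rightarrow> real \<Rightarrow> real"
  assumes "\<And>i. i \<in> I \<Longrightarrow> set_integrable lebesgue S (f i)"
  shows "(LINT u:S|lebesgue. (\<Sum>i\<in>I. f i u)) = (\<Sum>i\<in>I. LINT u:S|lebesgue. f i u)"
  using assms unfolding set_lebesgue_integral_def set_integrable_def
  by (simp add: sum_distrib_left Bochner_Integration.integral_sum)

lemma LINT_FTC:
  fixes f :: "real \<Rightarrow> real"
  assumes F: "\<And>s. s \<in> {0..T} \<Longrightarrow> (F has_real_derivative f s) (at s within {0..T})"
    and f: "continuous_on {0..T} f" and t: "t \<in> {0..T}"
  shows "(LINT s:{0..t}|lebesgue. f s) = F t - F 0"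
proof -
  have "(f has_integral (F t - F 0)) {0..t}"
  proof (rule fundamental_theorem_of_calculus)
    show "(F has_vector_derivative f s) (at s within {0..t})" if "s \<in> {0..t}" for s
      using F[of s] that t unfolding has_real_derivative_iff_has_vector_derivative
      by (auto intro: has_vector_derivative_within_subset)
  qed (use t in auto)
  then show ?thesis using LINT_HK(1)[OF set_integrable_continuous[OF f], of 0 t] t by (simp add: integral_unique)
qed

lemma LINT_deriv:
  fixes f :: "real \<Rightarrow> real"
  assumes "continuous_on {0..T} f" "t \<in> {0..T}"
  shows "((\<lambda>t. LINT s:{0..t}|lebesgue. f s) has_real_derivative f t) (at t within {0..T})"
proof -
  have "((\<lambda>t. integral {0..t} f) has_real_derivative f t) (at t within {0..T})"
    using integral_has_vector_derivative[OF assms] by (simp add: has_real_derivative_iff_has_vector_derivative)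
  then show ?thesis
  proof (rule has_field_derivative_transform_within[OF _ zero_less_one assms(2)])
    show "integral {0..x} f = (LINT s:{0..x}|lebesgue. f s)" if "x \<in> {0..T}" for x
      using LINT_HK(1)[OF set_integrable_continuous[OF assms(1)], of 0 x] that by simp
  qed
qed

lemma LINT_continuous:
  fixes f :: "real \<Rightarrow> real"
  assumes "set_integrable lebesgue {0..T} f"
  shows "continuous_on {0..T} (\<lambda>t. LINT s:{0..t}|lebesgue. f s)"
proof -
  have "continuous_on {0..T} (\<lambda>t. integral {0..t} f)"
    by (rule indefinite_integral_continuous_1) (use LINT_HK(2)[OF assms, of 0 T] in simp)
  then show ?thesis
    by (rule continuous_on_eq) (use LINT_HK(1)[OF assms] in auto)
qed

lemma LINT_abs_le:
  fixes f :: "real \<Rightarrow> real"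
  assumes f: "set_integrable lebesgue {0..T} f" and b: "\<And>s. s \<in> {0..T} \<Longrightarrow> \<bar>f s\<bar> \<le> B" and t: "t \<in> {0..T}"
  shows "\<bar>LINT s:{0..t}|lebesgue. f s\<bar> \<le> B * T"
proof -
  have "0 \<le> \<bar>f t\<bar>" "\<bar>f t\<bar> \<le> B" using b[OF t] by auto
  then have B: "0 \<le> B" by linarith
  have i: "f integrable_on {0..t}" "(LINT s:{0..t}|lebesgue. f s) = integral {0..t} f"
    using LINT_HK[OF f, of 0 t] t by auto
  have "norm (integral {0..t} f) \<le> integral {0..t} (\<lambda>_. B)"
    by (rule integral_norm_bound_integral[OF i(1)]) (use b t in auto)
  also have "\<dots> = B * t" using t by simp
  also have "\<dots> \<le> B * T" using B t by (intro mult_left_mono) auto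
  finally show ?thesis using i(2) by simp
qed

lemma L2_inner_continuous:
  fixes v :: "real \<Rightarrow> 'a::real_inner"
  assumes v: "v \<in> L2 T" and w: "continuous_on {0..T} w" and B: "\<And>s. s \<in> {0..T} \<Longrightarrow> norm (w s) \<le> B" "0 \<le> B"
  shows "(\<lambda>s. v s \<bullet> w s) \<in> L2 T" "norm2 T (\<lambda>s. v s \<bullet> w s) \<le> B * norm2 T v"
proof -
  have sm: "strongly_measurable T (\<lambda>s. v s \<bullet> w s)"
    using v by (intro strongly_measurable_inner strongly_measurable_continuous[OF w]) (simp add: L2_iff)
  have le: "(norm (v s \<bullet> w s))\<^sup>2 \<le> B\<^sup>2 * (norm (v s))\<^sup>2" if "s \<in> {0..T}" for s
  proof -
    have "\<bar>v s \<bullet> w s\<bar> \<le> norm (v s) * norm (w s)" by (rule Cauchy_Schwarz_ineq2)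
    also have "\<dots> \<le> norm (v s) * B" by (intro mult_left_mono B that) simp
    finally have "\<bar>v s \<bullet> w s\<bar>\<^sup>2 \<le> (norm (v s) * B)\<^sup>2" by (rule power_mono) simp
    then show ?thesis by (simp add: power_mult_distrib mult.commute)
  qed
  have iv: "integrable (lebesgue_on {0..T}) (\<lambda>s. B\<^sup>2 * (norm (v s))\<^sup>2)" using v by (simp add: L2_iff)
  have i: "integrable (lebesgue_on {0..T}) (\<lambda>s. (norm (v s \<bullet> w s))\<^sup>2)"
  proof (rule Bochner_Integration.integrable_bound[OF iv])
    show "(\<lambda>s. (norm (v s \<bullet> w s))\<^sup>2) \<in> borel_measurable (lebesgue_on {0..T})"
      by (rule borel_measurable_power[OF strongly_measurable_real[OF strongly_measurable_norm[OF sm]]])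
  qed (rule AE_I2, use le in simp)
  show "(\<lambda>s. v s \<bullet> w s) \<in> L2 T" using sm i by (simp add: L2_iff)
  have "(norm2 T (\<lambda>s. v s \<bullet> w s))\<^sup>2 \<le> B\<^sup>2 * (norm2 T v)\<^sup>2"
    using integral_mono[OF i iv] le unfolding norm2_sq set_integral_lebesgue_on by simp
  then show "norm2 T (\<lambda>s. v s \<bullet> w s) \<le> B * norm2 T v"
    using B(2) norm2_nonneg[of T v] power2_le_imp_le[of "norm2 T (\<lambda>s. v s \<bullet> w s)" "B * norm2 T v"]
    by (auto simp: power_mult_distrib)
qed

text \<open>The primitive of an L2 density need not be differentiable everywhere. The formula is
  therefore proved for continuous densities and passed to the limit; by Cauchy-Schwarz against the
  constant 1 the primitives converge uniformly.\<close>

lemma integration_by_parts_L2: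
  fixes \<psi> h :: "real \<Rightarrow> real"
  assumes T: "0 < T" and \<psi>: "\<psi> \<in> L2 T" and c: "\<And>m::nat. continuous_on {0..T} (\<psi>m m)"
    and lim: "(\<lambda>m. norm2 T (\<lambda>t. \<psi>m m t - \<psi> t)) \<longlonglongrightarrow> 0"
    and h: "\<And>t. t \<in> {0..T} \<Longrightarrow> (h has_real_derivative h' t) (at t within {0..T})" and h': "continuous_on {0..T} h'"
    and t: "t \<in> {0..T}"
  shows "(x + (LINT s:{0..t}|lebesgue. \<psi> s)) * h t = x * h 0 + (LINT s:{0..t}|lebesgue. \<psi> s * h s)
    + (LINT s:{0..t}|lebesgue. (x + (LINT u:{0..s}|lebesgue. \<psi> u)) * h' s)"
proof -
  have hc: "continuous_on {0..T} h" using h by (meson DERIV_continuous continuous_on_eq_continuous_within)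
  have \<psi>mL: "\<psi>m m \<in> L2 T" for m by (rule L2_continuous[OF c])
  have L1: "(\<lambda>_. 1 :: real) \<in> L2 T" by (rule L2_continuous) simp
  have i\<psi>: "set_integrable lebesgue {0..T} \<psi>"
    using integral_inner_le(1)[OF \<psi> L1, of 0 T] by simp
  define X where "X s = x + (LINT u:{0..s}|lebesgue. \<psi> u)" for s
  define Xm where "Xm m s = x + (LINT u:{0..s}|lebesgue. \<psi>m m u)" for m s
  have Xd: "(Xm m has_real_derivative \<psi>m m s) (at s within {0..T})" if "s \<in> {0..T}" for m s
    unfolding Xm_def using LINT_deriv[OF c that] by (auto intro!: derivative_eq_intros)
  have Xc: "continuous_on {0..T} (Xm m)" for m using Xd by (meson DERIV_continuous continuous_on_eq_continuous_within)
  have XC: "continuous_on {0..T} X" unfolding X_def by (intro continuous_intros LINT_continuous i\<psi>)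
  have eq: "Xm m t * h t = x * h 0 + (LINT s:{0..t}|lebesgue. \<psi>m m s * h s) + (LINT s:{0..t}|lebesgue. Xm m s * h' s)" for m
  proof -
    have "(LINT s:{0..t}|lebesgue. \<psi>m m s * h s + Xm m s * h' s) = Xm m t * h t - Xm m 0 * h 0"
      by (rule LINT_FTC[OF _ _ t])
         (auto intro!: derivative_eq_intros Xd h continuous_intros c Xc hc h')
    moreover have "(LINT s:{0..t}|lebesgue. \<psi>m m s * h s + Xm m s * h' s)
        = (LINT s:{0..t}|lebesgue. \<psi>m m s * h s) + (LINT s:{0..t}|lebesgue. Xm m s * h' s)"
      by (intro set_integral_add(2) set_integrable_continuous_sub[where T=T] continuous_intros c Xc hc h')
         (use t in auto)
    moreover have "Xm m 0 = x" unfolding Xm_def using LINT_HK(1)[OF set_integrable_continuous[OF c], of 0 0] T by simp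
    ultimately show ?thesis by simp
  qed
  have XX: "\<bar>Xm m s - X s\<bar> \<le> norm2 T (\<lambda>t. \<psi>m m t - \<psi> t) * norm2 T (\<lambda>_. 1 :: real)" if "s \<in> {0..T}" for m s
  proof -
    have "(LINT u:{0..s}|lebesgue. (\<psi>m m u - \<psi> u) \<bullet> (1::real)) = Xm m s - X s"
      unfolding Xm_def X_def
      using set_integral_diff(2)[OF LINT_HK(3)[OF set_integrable_continuous[OF c], of 0 s m] LINT_HK(3)[OF i\<psi>, of 0 s]] that
      by simp
    then show ?thesis using integral_inner_le(2)[OF L2_diff[OF \<psi>mL \<psi>] L1, of 0 s m] that by simp
  qed
  have n0: "(\<lambda>m. norm2 T (\<lambda>t. \<psi>m m t - \<psi> t) * K) \<longlonglongrightarrow> 0" for K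
    using tendsto_mult[OF lim tendsto_const[of K]] by simp
  have X1: "(\<lambda>m. Xm m t) \<longlonglongrightarrow> X t"
    by (rule LIM_zero_cancel, rule Lim_null_comparison[OF _ n0[of "norm2 T (\<lambda>_. 1 :: real)"]]) (use XX[OF t] in auto)
  have X2: "(\<lambda>m. LINT s:{0..t}|lebesgue. \<psi>m m s * h s) \<longlonglongrightarrow> (LINT s:{0..t}|lebesgue. \<psi> s * h s)"
    using inner2_tendsto[OF \<psi>mL \<psi> lim L2_continuous[OF hc], of 0 t] t by simp
  have "compact (h' ` {0..T})" using h' by (intro compact_continuous_image) auto
  then obtain B where B: "\<And>s. s \<in> {0..T} \<Longrightarrow> \<bar>h' s\<bar> \<le> B"
    using compact_imp_bounded bounded_iff by (metis (no_types, lifting) imageI real_norm_def)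
  have X3: "(\<lambda>m. LINT s:{0..t}|lebesgue. Xm m s * h' s) \<longlonglongrightarrow> (LINT s:{0..t}|lebesgue. X s * h' s)"
  proof (rule LIM_zero_cancel, rule Lim_null_comparison[OF _ n0])
    have "\<bar>(LINT s:{0..t}|lebesgue. Xm m s * h' s) - (LINT s:{0..t}|lebesgue. X s * h' s)\<bar>
        \<le> norm2 T (\<lambda>t. \<psi>m m t - \<psi> t) * (norm2 T (\<lambda>_. 1 :: real) * B * T)" for m
    proof -
      have "(LINT s:{0..t}|lebesgue. Xm m s * h' s) - (LINT s:{0..t}|lebesgue. X s * h' s)
          = (LINT s:{0..t}|lebesgue. (Xm m s - X s) * h' s)"
        unfolding left_diff_distrib
        by (intro set_integral_diff(2)[symmetric] set_integrable_continuous_sub[where T=T] continuous_intros Xc XC h')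
           (use t in auto)
      also have "\<bar>\<dots>\<bar> \<le> (norm2 T (\<lambda>t. \<psi>m m t - \<psi> t) * norm2 T (\<lambda>_. 1 :: real) * B) * T"
      proof (rule LINT_abs_le[OF _ _ t])
        show "set_integrable lebesgue {0..T} (\<lambda>s. (Xm m s - X s) * h' s)"
          by (intro set_integrable_continuous continuous_intros Xc XC h')
        show "\<bar>(Xm m s - X s) * h' s\<bar> \<le> norm2 T (\<lambda>t. \<psi>m m t - \<psi> t) * norm2 T (\<lambda>_. 1 :: real) * B" if "s \<in> {0..T}" for s
          unfolding abs_mult using XX[OF that] B[OF that] by (intro mult_mono) (auto simp: norm2_nonneg)
      qed
      finally show ?thesis by (simp add: mult.assoc)
    qed
    then show "\<forall>\<^sub>F m in sequentially. norm ((LINT s:{0..t}|lebesgue. Xm m s * h' s) - (LINT s:{0..t}|lebesgue. X s * h' s))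
        \<le> norm2 T (\<lambda>t. \<psi>m m t - \<psi> t) * (norm2 T (\<lambda>_. 1 :: real) * B * T)" by simp
  qed
  have "(\<lambda>m. Xm m t * h t) \<longlonglongrightarrow> x * h 0 + (LINT s:{0..t}|lebesgue. \<psi> s * h s) + (LINT s:{0..t}|lebesgue. X s * h' s)"
    unfolding eq by (intro tendsto_intros X2 X3)
  moreover have "(\<lambda>m. Xm m t * h t) \<longlonglongrightarrow> X t * h t" by (intro tendsto_intros X1)
  ultimately show ?thesis using LIMSEQ_unique unfolding X_def by blast
qed

section \<open>Evolution in an eigenbasis\<close>

context eigenbasis
begin

lemma norm_mono_coef: "(\<And>j. \<bar>u \<bullet> e j\<bar> \<le> \<bar>v \<bullet> e j\<bar>) \<Longrightarrow> norm u \<le> norm v"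
proof (rule norm_le_coef)
  fix N assume "\<And>j. \<bar>u \<bullet> e j\<bar> \<le> \<bar>v \<bullet> e j\<bar>"
  then have "(\<Sum>j<N. (u \<bullet> e j)\<^sup>2) \<le> (\<Sum>j<N. (v \<bullet> e j)\<^sup>2)" by (intro sum_mono) (simp add: abs_le_square_iff)
  then show "(\<Sum>j<N. (u \<bullet> e j)\<^sup>2) \<le> (norm v)\<^sup>2" using bessel[of v N] by linarith
qed simp

text \<open>Truncations converge pointwise and are contractions, so convergence is uniform on
  compact sets, here the image of the trajectory covered by finitely many balls of radius a third of
  the tolerance.\<close>

lemma proj_uniform_limit:
  assumes "continuous_on {0..T::real} x"
  shows "uniform_limit {0..T} (\<lambda>N t. proj N (x t)) x sequentially"
proof (rule uniform_limitI)
  fix \<epsilon> :: real assume \<epsilon>: "0 < \<epsilon>"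
  have "compact (x ` {0..T})" using assms by (intro compact_continuous_image) auto
  then obtain k where k: "finite k" "x ` {0..T} \<subseteq> (\<Union>y\<in>k. ball y (\<epsilon> / 3))"
    unfolding compact_eq_totally_bounded using \<epsilon> by (metis divide_pos_pos zero_less_numeral)
  have "\<forall>\<^sub>F N in sequentially. \<forall>y\<in>k. dist (proj N y) y < \<epsilon> / 3"
    using k(1) \<epsilon> tendstoD[OF proj_tendsto, of "\<epsilon> / 3"] by (intro eventually_ball_finite) auto
  then show "\<forall>\<^sub>F N in sequentially. \<forall>t\<in>{0..T}. dist (proj N (x t)) (x t) < \<epsilon>"
  proof eventually_elim
    case (elim N)
    show ?case
    proof
      fix t assume "t \<in> {0..T}"
      then obtain y where y: "y \<in> k" "dist y (x t) < \<epsilon> / 3" using k(2) by fastforce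
      have "dist (proj N (x t)) (proj N y) \<le> dist (x t) y"
        using norm_proj_le[of N "x t - y"] linear_diff[OF linear_proj, of N "x t" y] by (simp add: dist_norm)
      then show "dist (proj N (x t)) (x t) < \<epsilon>"
        using elim y dist_triangle[of "proj N (x t)" "x t" "proj N y"] dist_triangle[of "proj N y" "x t" y]
        by (fastforce simp: dist_commute)
    qed
  qed
qed

text \<open>Rotation by unbounded frequencies is only strongly continuous in time. Continuity of the
  rotated trajectory follows since its spectral tails are dominated by those of \<open>x\<close>,
  which are uniformly small.\<close>

lemma multiplier_continuous:
  assumes x: "continuous_on {0..T::real} x" and m: "\<And>j. continuous_on {0..T} (m j)" and b: "\<And>j t. \<bar>m j t\<bar> \<le> 1"
  obtains c where "continuous_on {0..T} c" "\<And>t j. c t \<bullet> e j = m j t * (x t \<bullet> e j)"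
proof -
  have "\<exists>c. \<forall>j. c \<bullet> e j = m j t * (x t \<bullet> e j)" for t
    using ex_mult[of "\<lambda>j. m j t" 1 "\<lambda>_. 1" "x t" "x t"] b by (metis abs_one mult_1 zero_le_one)
  then obtain c where c: "\<And>t j. c t \<bullet> e j = m j t * (x t \<bullet> e j)" by metis
  have "uniform_limit {0..T} (\<lambda>N t. proj N (c t)) c sequentially"
  proof (rule uniform_limitI)
    fix \<epsilon> :: real assume "0 < \<epsilon>"
    from uniform_limitD[OF proj_uniform_limit[OF x] this]
    show "\<forall>\<^sub>F N in sequentially. \<forall>t\<in>{0..T}. dist (proj N (c t)) (c t) < \<epsilon>"
    proof eventually_elim
      case (elim N)
      have "dist (proj N (c t)) (c t) \<le> dist (proj N (x t)) (x t)" for t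
        unfolding dist_norm
        by (rule norm_mono_coef)
           (use b[of _ t] in \<open>auto simp: inner_diff_left proj_coef c abs_mult intro: mult_left_le_one_le\<close>)
      then show ?case using elim by (meson le_less_trans)
    qed
  qed
  moreover have "continuous_on {0..T} (\<lambda>t. proj N (c t))" for N
    unfolding proj_def c by (intro continuous_intros m x)
  ultimately have "continuous_on {0..T} c"
    by (intro uniform_limit_theorem[of _ "\<lambda>N t. proj N (c t)"]) auto
  then show ?thesis using c by (rule that)
qed

text \<open>Control of all coordinate increments by one continuous function \<open>\<Phi>\<close>
  yields both square summability, by comparison with time 0, and continuity in norm.\<close>

lemma riesz_fischer_continuous:
  fixes z :: "real \<Rightarrow> nat \<Rightarrow> real"
  assumes z0: "\<And>j. z 0 j = 0" and ze: "\<And>j t. e j = 0 \<Longrightarrow> z t j = 0"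
    and bd: "\<And>s t N. 0 \<le> s \<Longrightarrow> s \<le> t \<Longrightarrow> t \<le> T \<Longrightarrow> (\<Sum>j<N. (z t j - z s j)\<^sup>2) \<le> \<Phi> t - \<Phi> s"
    and \<Phi>: "continuous_on {0..T} \<Phi>"
  obtains x where "continuous_on {0..T} x" "\<And>t j. t \<in> {0..T} \<Longrightarrow> x t \<bullet> e j = z t j"
proof -
  have "\<exists>x. \<forall>j. x \<bullet> e j = z t j" if t: "t \<in> {0..T}" for t
  proof -
    have b: "(\<Sum>j<N. (z t j)\<^sup>2) \<le> \<Phi> t - \<Phi> 0" for N using bd[of 0 t N] t by (simp add: z0)
    from b[of 0] have p: "0 \<le> \<Phi> t - \<Phi> 0" by simp
    show ?thesis
      using riesz_fischer[of "z t" "sqrt (\<Phi> t - \<Phi> 0)"] ze b p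
      by (metis real_sqrt_ge_zero real_sqrt_pow2)
  qed
  then obtain x where x: "\<And>t j. t \<in> {0..T} \<Longrightarrow> x t \<bullet> e j = z t j" by metis
  have diff: "norm (x t - x s) \<le> sqrt \<bar>\<Phi> t - \<Phi> s\<bar>" if "s \<in> {0..T}" "t \<in> {0..T}" for s t
  proof (rule norm_le_coef)
    fix N
    show "(\<Sum>j<N. ((x t - x s) \<bullet> e j)\<^sup>2) \<le> (sqrt \<bar>\<Phi> t - \<Phi> s\<bar>)\<^sup>2"
    proof (cases "s \<le> t")
      case True
      then show ?thesis using bd[of s t N] that by (simp add: inner_diff_left x)
    next
      case False
      then show ?thesis using bd[of t s N] that by (simp add: inner_diff_left x power2_commute[of "z t _"])
    qed
  qed simp
  have "continuous_on {0..T} x"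
    unfolding continuous_on_def
  proof
    fix t assume t: "t \<in> {0..T}"
    show "(x \<longlongrightarrow> x t) (at t within {0..T})"
    proof (rule LIM_zero_cancel, rule Lim_null_comparison)
      show "\<forall>\<^sub>F s in at t within {0..T}. norm (x s - x t) \<le> sqrt \<bar>\<Phi> s - \<Phi> t\<bar>"
        using diff[OF t] unfolding eventually_at_filter by auto
      have "((\<lambda>s. sqrt \<bar>\<Phi> s - \<Phi> t\<bar>) \<longlongrightarrow> sqrt \<bar>\<Phi> t - \<Phi> t\<bar>) (at t within {0..T})"
        using \<Phi> t unfolding continuous_on_def by (intro tendsto_intros) auto
      then show "((\<lambda>s. sqrt \<bar>\<Phi> s - \<Phi> t\<bar>) \<longlongrightarrow> 0) (at t within {0..T})" by simp
    qed
  qed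
  then show ?thesis using x by (rule that)
qed

text \<open>Admissibility in coordinates: \<open>\<gamma> j\<close> is the observation vector of
  mode \<open>j\<close>, the numbers \<open>a j\<close> and \<open>b j\<close> are the initial
  coordinates, and the L2 norm of the observation of a free solution is bounded by its energy,
  uniformly in the number of modes.\<close>

definition admissible :: "real \<Rightarrow> (nat \<Rightarrow> 'a::real_inner) \<Rightarrow> real \<Rightarrow> bool" where
  "admissible T \<gamma> M \<longleftrightarrow> 0 < M \<and> (\<forall>j. e j = 0 \<longrightarrow> \<gamma> j = 0) \<and>
     (\<forall>N a b. (norm2 T (\<lambda>t. \<Sum>j<N. (cos (r j * t) * a j + sin (r j * t) * b j) *\<^sub>R \<gamma> j))\<^sup>2
        \<le> M * (\<Sum>j<N. (a j)\<^sup>2 + (b j)\<^sup>2))"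

text \<open>The normalised equations \<open>c' = \<Omega> d\<close>, \<open>d' = - \<Omega> c + \<phi>\<close>, where \<open>\<Omega>\<close> is diagonal with
  entries \<open>r\<close>, tested against solutions of the adjoint equations.\<close>

definition evolution :: "real \<Rightarrow> (nat \<Rightarrow> real \<Rightarrow> real) \<Rightarrow> (real \<Rightarrow> 'h) \<Rightarrow> (real \<Rightarrow> 'h) \<Rightarrow> bool" where
  "evolution T \<phi> c d \<longleftrightarrow> continuous_on {0..T} c \<and> continuous_on {0..T} d \<and>
     (\<forall>j a b G. continuous_on {0..T} G \<and>
        (\<forall>s\<in>{0..T}. (a has_real_derivative r j * b s) (at s within {0..T})) \<and>
        (\<forall>s\<in>{0..T}. (b has_real_derivative - r j * a s + G s) (at s within {0..T})) \<longrightarrow>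
        (\<forall>t\<in>{0..T}. (d t \<bullet> e j) * a t - (c t \<bullet> e j) * b t = (d 0 \<bullet> e j) * a 0 - (c 0 \<bullet> e j) * b 0
           + (LINT s:{0..t}|lebesgue. \<phi> j s * a s) - (LINT s:{0..t}|lebesgue. (c s \<bullet> e j) * G s)))"

text \<open>The input map is the transpose of the observation map. In the rotating frame the state
  is the pair of integrals \<open>X\<close>, \<open>P\<close>, and the square sum of their
  increments over \<open>[s,t]\<close> is the pairing of the control with a free observation;
  admissibility then bounds it by \<open>M\<close> times the energy of the control on
  \<open>[s,t]\<close>. The primitive of that energy serves as the modulus
  \<open>\<Phi>\<close>.\<close>

lemma duhamel:
  fixes v :: "real \<Rightarrow> 'a::real_inner"
  assumes T: "0 < T" and v: "v \<in> L2 T" and vc: "\<And>m::nat. continuous_on {0..T} (vm m)"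
    and lim: "(\<lambda>m. norm2 T (\<lambda>t. vm m t - v t)) \<longlonglongrightarrow> 0" and adm: "admissible T \<gamma> M"
  obtains c d where "continuous_on {0..T} c" "continuous_on {0..T} d" "c 0 = x0" "d 0 = p0"
    "\<And>j t. t \<in> {0..T} \<Longrightarrow> c t \<bullet> e j = cos (r j * t) * (x0 \<bullet> e j + (LINT s:{0..t}|lebesgue. (v s \<bullet> \<gamma> j) * (- sin (r j * s))))
        + sin (r j * t) * (p0 \<bullet> e j + (LINT s:{0..t}|lebesgue. (v s \<bullet> \<gamma> j) * cos (r j * s)))"
    "\<And>j t. t \<in> {0..T} \<Longrightarrow> d t \<bullet> e j = - sin (r j * t) * (x0 \<bullet> e j + (LINT s:{0..t}|lebesgue. (v s \<bullet> \<gamma> j) * (- sin (r j * s))))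
        + cos (r j * t) * (p0 \<bullet> e j + (LINT s:{0..t}|lebesgue. (v s \<bullet> \<gamma> j) * cos (r j * s)))"
    "evolution T (\<lambda>j s. v s \<bullet> \<gamma> j) c d"
proof -
  have M: "0 < M" and \<gamma>0: "\<And>j. e j = 0 \<Longrightarrow> \<gamma> j = 0" and
    ad: "\<And>N a b. (norm2 T (\<lambda>t. \<Sum>j<N. (cos (r j * t) * a j + sin (r j * t) * b j) *\<^sub>R \<gamma> j))\<^sup>2 \<le> M * (\<Sum>j<N. (a j)\<^sup>2 + (b j)\<^sup>2)"
    using adm unfolding admissible_def by auto
  have L2g: "(\<lambda>s. f s *\<^sub>R \<gamma> j) \<in> L2 T" if "continuous_on {0..T} f" for f j
    by (intro L2_continuous continuous_intros that)
  have int: "set_integrable lebesgue {0..T} (\<lambda>s. (v s \<bullet> \<gamma> j) * f s)" if "continuous_on {0..T} f" for f j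
    using integral_inner_le(1)[OF v L2g[OF that], of 0 T j] by (simp add: mult.commute)
  have int_sub: "set_integrable lebesgue {a..b} (\<lambda>s. (v s \<bullet> \<gamma> j) * f s)"
    if "continuous_on {0..T} f" "0 \<le> a" "b \<le> T" for f j a b
    by (rule LINT_HK(3)[OF int[OF that(1)] that(2,3)])
  define X where "X j t = (LINT s:{0..t}|lebesgue. (v s \<bullet> \<gamma> j) * (- sin (r j * s)))" for j t
  define P where "P j t = (LINT s:{0..t}|lebesgue. (v s \<bullet> \<gamma> j) * cos (r j * s))" for j t
  define \<Phi> where "\<Phi> t = M * (LINT s:{0..t}|lebesgue. (norm (v s))\<^sup>2)" for t
  have intv: "set_integrable lebesgue {0..T} (\<lambda>s. (norm (v s))\<^sup>2)"
    using v unfolding L2_iff set_integrable_lebesgue_on by blast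
  have \<Phi>c: "continuous_on {0..T} \<Phi>" unfolding \<Phi>_def by (intro continuous_intros LINT_continuous intv)
  have ci: "continuous_on {0..T} (\<lambda>s. - sin (r j * s))" "continuous_on {0..T} (\<lambda>s. cos (r j * s))" for j
    by (intro continuous_intros)+
  have key: "(\<Sum>j<N. (X j t - X j s)\<^sup>2 + (P j t - P j s)\<^sup>2) \<le> \<Phi> t - \<Phi> s" if st: "0 \<le> s" "s \<le> t" "t \<le> T" for s t N
  proof -
    define \<xi> where "\<xi> j = X j t - X j s" for j
    define \<eta> where "\<eta> j = P j t - P j s" for j
    have \<xi>: "\<xi> j = (LINT u:{s..t}|lebesgue. (v u \<bullet> \<gamma> j) * (- sin (r j * u)))"
      and \<eta>: "\<eta> j = (LINT u:{s..t}|lebesgue. (v u \<bullet> \<gamma> j) * cos (r j * u))" for j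
      unfolding \<xi>_def \<eta>_def X_def P_def using LINT_split[OF int[OF ci(1)] st] LINT_split[OF int[OF ci(2)] st] by auto
    define S where "S = (\<Sum>j<N. (\<xi> j)\<^sup>2 + (\<eta> j)\<^sup>2)"
    \<comment> \<open>The observation of the free solution with data \<open>\<eta>\<close> and
      \<open>- \<xi>\<close>, chosen so that its pairing with \<open>v\<close> over
      \<open>[s,t]\<close> is exactly \<open>S\<close>.\<close>
    define w where "w u = (\<Sum>j<N. (cos (r j * u) * \<eta> j + sin (r j * u) * (- \<xi> j)) *\<^sub>R \<gamma> j)" for u
    have wc: "continuous_on {0..T} w" unfolding w_def by (intro continuous_intros)
    have wL: "w \<in> L2 T" by (rule L2_continuous[OF wc])
    have wS: "(norm2 T w)\<^sup>2 \<le> M * S" unfolding w_def S_def using ad[of \<eta> "\<lambda>j. - \<xi> j" N] by (simp add: add.commute)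
    have iw: "set_integrable lebesgue {0..T} (\<lambda>s. (norm (w s))\<^sup>2)"
      using wL unfolding L2_iff set_integrable_lebesgue_on by blast
    have "S = (\<Sum>j<N. LINT u:{s..t}|lebesgue. (\<xi> j * ((v u \<bullet> \<gamma> j) * (- sin (r j * u))) + \<eta> j * ((v u \<bullet> \<gamma> j) * cos (r j * u))))"
      unfolding S_def
    proof (rule sum.cong[OF refl])
      fix j
      have i: "set_integrable lebesgue {s..t} (\<lambda>u. \<xi> j * ((v u \<bullet> \<gamma> j) * (- sin (r j * u))))"
        "set_integrable lebesgue {s..t} (\<lambda>u. \<eta> j * ((v u \<bullet> \<gamma> j) * cos (r j * u)))"
        by (intro set_integrable_mult_right LINT_HK(3)[OF int[OF ci(1)]] LINT_HK(3)[OF int[OF ci(2)]]; use st in simp)+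
      show "(\<xi> j)\<^sup>2 + (\<eta> j)\<^sup>2 = (LINT u:{s..t}|lebesgue. (\<xi> j * ((v u \<bullet> \<gamma> j) * (- sin (r j * u))) + \<eta> j * ((v u \<bullet> \<gamma> j) * cos (r j * u))))"
        unfolding set_integral_add(2)[OF i] set_integral_mult_right \<xi>[symmetric] \<eta>[symmetric] by (simp add: power2_eq_square)
    qed
    also have "\<dots> = (LINT u:{s..t}|lebesgue. (\<Sum>j<N. \<xi> j * ((v u \<bullet> \<gamma> j) * (- sin (r j * u))) + \<eta> j * ((v u \<bullet> \<gamma> j) * cos (r j * u))))"
      by (intro LINT_sum[symmetric] set_integral_add(1) set_integrable_mult_right
          LINT_HK(3)[OF int[OF ci(1)]] LINT_HK(3)[OF int[OF ci(2)]]) (use st in auto)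
    also have "\<dots> = (LINT u:{s..t}|lebesgue. v u \<bullet> w u)"
      unfolding w_def inner_sum_right by (simp add: algebra_simps)
    \<comment> \<open>Young's inequality with weight \<open>M\<close>: since the squared norm of
      \<open>w\<close> is at most \<open>M * S\<close>, its contribution is at most
      \<open>S / 2\<close> and can be absorbed.\<close>
    also have "\<dots> \<le> (LINT u:{s..t}|lebesgue. M / 2 * (norm (v u))\<^sup>2 + 1 / (2 * M) * (norm (w u))\<^sup>2)"
    proof (rule set_integral_mono)
      show "set_integrable lebesgue {s..t} (\<lambda>u. v u \<bullet> w u)" using integral_inner_le(1)[OF v wL st(1,3)] .
      show "set_integrable lebesgue {s..t} (\<lambda>u. M / 2 * (norm (v u))\<^sup>2 + 1 / (2 * M) * (norm (w u))\<^sup>2)"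
        by (intro set_integral_add(1) set_integrable_mult_right LINT_HK(3)[OF intv] LINT_HK(3)[OF iw]) (use st in auto)
      fix u
      have "v u \<bullet> w u \<le> norm (v u) * norm (w u)" by (rule norm_cauchy_schwarz)
      also have "\<dots> \<le> M / 2 * (norm (v u))\<^sup>2 + 1 / (2 * M) * (norm (w u))\<^sup>2"
      proof -
        have "0 \<le> (M * norm (v u) - norm (w u))\<^sup>2 / (2 * M)" using M by simp
        also have "\<dots> = M / 2 * (norm (v u))\<^sup>2 + 1 / (2 * M) * (norm (w u))\<^sup>2 - norm (v u) * norm (w u)"
          using M by (simp add: field_simps power2_eq_square)
        finally show ?thesis by simp
      qed
      finally show "v u \<bullet> w u \<le> M / 2 * (norm (v u))\<^sup>2 + 1 / (2 * M) * (norm (w u))\<^sup>2" .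
    qed
    also have "\<dots> = M / 2 * (LINT u:{s..t}|lebesgue. (norm (v u))\<^sup>2) + 1 / (2 * M) * (LINT u:{s..t}|lebesgue. (norm (w u))\<^sup>2)"
      by (subst set_integral_add(2))
         (auto intro!: set_integrable_mult_right LINT_HK(3)[OF intv] LINT_HK(3)[OF iw] simp: set_integral_mult_right st)
    also have "(LINT u:{s..t}|lebesgue. (norm (v u))\<^sup>2) = (\<Phi> t - \<Phi> s) / M"
      unfolding \<Phi>_def LINT_split[OF intv st] using M by (simp add: field_simps)
    also have "(LINT u:{s..t}|lebesgue. (norm (w u))\<^sup>2) \<le> (norm2 T w)\<^sup>2"
      unfolding norm2_sq set_lebesgue_integral_def
      using LINT_HK(3)[OF iw st(1,3)] iw st unfolding set_integrable_def
      by (intro integral_mono) (auto simp: indicator_def)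
    finally have "S \<le> M / 2 * ((\<Phi> t - \<Phi> s) / M) + 1 / (2 * M) * (norm2 T w)\<^sup>2" using M by (simp add: divide_right_mono)
    also have "\<dots> \<le> (\<Phi> t - \<Phi> s) / 2 + 1 / (2 * M) * (M * S)" using wS M by (intro add_mono mult_left_mono) auto
    also have "\<dots> = (\<Phi> t - \<Phi> s) / 2 + S / 2" using M by simp
    finally have "S \<le> (\<Phi> t - \<Phi> s) / 2 + S / 2" .
    then have "S \<le> \<Phi> t - \<Phi> s" by (rule le_half_plus_half_imp_le)
    then show ?thesis unfolding S_def \<xi>_def \<eta>_def .
  qed
  have z: "X j 0 = 0" "P j 0 = 0" for j
    unfolding X_def P_def using LINT_HK(1)[OF int[OF ci(1)], of 0 0] LINT_HK(1)[OF int[OF ci(2)], of 0 0] T by auto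
  have ze: "X j t = 0" "P j t = 0" if "e j = 0" for j t unfolding X_def P_def using \<gamma>0[OF that] by simp_all
  have kX: "(\<Sum>j<N. (X j t - X j s)\<^sup>2) \<le> \<Phi> t - \<Phi> s" "(\<Sum>j<N. (P j t - P j s)\<^sup>2) \<le> \<Phi> t - \<Phi> s"
    if "0 \<le> s" "s \<le> t" "t \<le> T" for s t N
    using key[OF that, of N] sum_nonneg[of "{..<N}" "\<lambda>j. (X j t - X j s)\<^sup>2"] sum_nonneg[of "{..<N}" "\<lambda>j. (P j t - P j s)\<^sup>2"]
    unfolding sum.distrib by auto
  obtain x where x: "continuous_on {0..T} x" "\<And>t j. t \<in> {0..T} \<Longrightarrow> x t \<bullet> e j = X j t"
    by (rule riesz_fischer_continuous[of "\<lambda>t j. X j t" T \<Phi>, OF z(1) ze(1) kX(1) \<Phi>c]) (assumption | (rule that; blast))+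
  obtain p where p: "continuous_on {0..T} p" "\<And>t j. t \<in> {0..T} \<Longrightarrow> p t \<bullet> e j = P j t"
    by (rule riesz_fischer_continuous[of "\<lambda>t j. P j t" T \<Phi>, OF z(2) ze(2) kX(2) \<Phi>c]) (assumption | (rule that; blast))+
  have xc: "continuous_on {0..T} (\<lambda>t. x0 + x t)" and pc: "continuous_on {0..T} (\<lambda>t. p0 + p t)"
    by (intro continuous_intros x p)+
  have cs: "continuous_on {0..T} (\<lambda>t. sin (r j * t))" "continuous_on {0..T} (\<lambda>t. cos (r j * t))"
    "continuous_on {0..T} (\<lambda>t. - sin (r j * t))" for j by (intro continuous_intros)+
  have cb: "\<bar>sin (r j * t)\<bar> \<le> 1" "\<bar>cos (r j * t)\<bar> \<le> 1" "\<bar>- sin (r j * t)\<bar> \<le> 1" for j t by simp_all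
  obtain c1 where c1: "continuous_on {0..T} c1" "\<And>t j. c1 t \<bullet> e j = cos (r j * t) * ((x0 + x t) \<bullet> e j)"
    by (rule multiplier_continuous[OF xc, of "\<lambda>j t. cos (r j * t)", OF cs(2) cb(2)]) (rule that; blast)
  obtain c2 where c2: "continuous_on {0..T} c2" "\<And>t j. c2 t \<bullet> e j = sin (r j * t) * ((p0 + p t) \<bullet> e j)"
    by (rule multiplier_continuous[OF pc, of "\<lambda>j t. sin (r j * t)", OF cs(1) cb(1)]) (rule that; blast)
  obtain d1 where d1: "continuous_on {0..T} d1" "\<And>t j. d1 t \<bullet> e j = - sin (r j * t) * ((x0 + x t) \<bullet> e j)"
    by (rule multiplier_continuous[OF xc, of "\<lambda>j t. - sin (r j * t)", OF cs(3) cb(3)]) (rule that; blast)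
  obtain d2 where d2: "continuous_on {0..T} d2" "\<And>t j. d2 t \<bullet> e j = cos (r j * t) * ((p0 + p t) \<bullet> e j)"
    by (rule multiplier_continuous[OF pc, of "\<lambda>j t. cos (r j * t)", OF cs(2) cb(2)]) (rule that; blast)
  define c where "c t = c1 t + c2 t" for t
  define d where "d t = d1 t + d2 t" for t
  have cc: "continuous_on {0..T} c" "continuous_on {0..T} d" unfolding c_def d_def by (intro continuous_intros c1 c2 d1 d2)+
  have cf: "c t \<bullet> e j = cos (r j * t) * (x0 \<bullet> e j + X j t) + sin (r j * t) * (p0 \<bullet> e j + P j t)"
    and df: "d t \<bullet> e j = - sin (r j * t) * (x0 \<bullet> e j + X j t) + cos (r j * t) * (p0 \<bullet> e j + P j t)" if "t \<in> {0..T}" for t j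
    unfolding c_def d_def inner_add_left c1 c2 d1 d2 x(2)[OF that] p(2)[OF that] by simp_all
  have T0: "0 \<in> {0..T}" using T by simp
  have ini: "c 0 = x0" "d 0 = p0" by (rule vec_eqI; simp add: cf[OF T0] df[OF T0] z)+
  have ev: "evolution T (\<lambda>j s. v s \<bullet> \<gamma> j) c d"
    unfolding evolution_def
  proof (intro conjI allI impI ballI cc; elim conjE)
    fix j a b G t
    assume Gc: "continuous_on {0..T} G" and ad: "\<forall>s\<in>{0..T}. (a has_real_derivative r j * b s) (at s within {0..T})"
      and bd: "\<forall>s\<in>{0..T}. (b has_real_derivative - r j * a s + G s) (at s within {0..T})" and t: "t \<in> {0..T}"
    have ac: "continuous_on {0..T} a" using ad by (meson DERIV_continuous continuous_on_eq_continuous_within)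
    have bc: "continuous_on {0..T} b" using bd by (meson DERIV_continuous continuous_on_eq_continuous_within)
    \<comment> \<open>The test pair turned back by the angle \<open>r j * s\<close>. The rotation
      cancels, so the derivatives of \<open>\<alpha>\<close> and \<open>\<beta>\<close> contain only
      \<open>G\<close>, and integration by parts against the primitives \<open>X\<close> and
      \<open>P\<close> applies.\<close>
    define \<alpha> where "\<alpha> s = cos (r j * s) * a s - sin (r j * s) * b s" for s
    define \<beta> where "\<beta> s = sin (r j * s) * a s + cos (r j * s) * b s" for s
    have \<alpha>d: "(\<alpha> has_real_derivative - sin (r j * s) * G s) (at s within {0..T})" if "s \<in> {0..T}" for s
      unfolding \<alpha>_def using ad bd that by (auto intro!: derivative_eq_intros simp: algebra_simps)
    have \<beta>d: "(\<beta> has_real_derivative cos (r j * s) * G s) (at s within {0..T})" if "s \<in> {0..T}" for s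
      unfolding \<beta>_def using ad bd that by (auto intro!: derivative_eq_intros simp: algebra_simps)
    define B where "B = norm (\<gamma> j)"
    have L: "(\<lambda>s. (v s \<bullet> \<gamma> j) * f s) \<in> L2 T"
        "(\<lambda>m. norm2 T (\<lambda>s. (vm m s \<bullet> \<gamma> j) * f s - (v s \<bullet> \<gamma> j) * f s)) \<longlonglongrightarrow> 0"
      if f: "continuous_on {0..T} f" "\<And>s. \<bar>f s\<bar> \<le> 1" for f
    proof -
      have w: "continuous_on {0..T} (\<lambda>s. f s *\<^sub>R \<gamma> j)" by (intro continuous_intros f)
      have b: "norm (f s *\<^sub>R \<gamma> j) \<le> B" for s
        unfolding B_def using f(2)[of s] by (simp add: mult_left_le_one_le)
      have b0: "0 \<le> B" by (simp add: B_def)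
      show "(\<lambda>s. (v s \<bullet> \<gamma> j) * f s) \<in> L2 T"
        using L2_inner_continuous(1)[OF v w b b0] by (simp add: mult.commute)
      have n1: "norm2 T (\<lambda>s. (vm m s \<bullet> \<gamma> j) * f s - (v s \<bullet> \<gamma> j) * f s) \<le> B * norm2 T (\<lambda>s. vm m s - v s)" for m
        using L2_inner_continuous(2)[OF L2_diff[OF L2_continuous[OF vc] v] w b b0, of m]
        by (simp add: inner_diff_left algebra_simps)
      have n2: "(\<lambda>m. B * norm2 T (\<lambda>s. vm m s - v s)) \<longlonglongrightarrow> 0"
        using tendsto_mult[OF tendsto_const lim, of B] by simp
      show "(\<lambda>m. norm2 T (\<lambda>s. (vm m s \<bullet> \<gamma> j) * f s - (v s \<bullet> \<gamma> j) * f s)) \<longlonglongrightarrow> 0"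
        by (rule Lim_null_comparison[OF _ n2]) (simp add: norm2_nonneg n1)
    qed
    have vmc: "continuous_on {0..T} (\<lambda>s. (vm m s \<bullet> \<gamma> j) * f s)" if "continuous_on {0..T} f" for m f
      by (intro continuous_intros vc that)
    have \<alpha>'c: "continuous_on {0..T} (\<lambda>s. - sin (r j * s) * G s)" and \<beta>'c: "continuous_on {0..T} (\<lambda>s. cos (r j * s) * G s)"
      by (intro continuous_intros Gc)+
    have \<alpha>c: "continuous_on {0..T} \<alpha>" "continuous_on {0..T} \<beta>" unfolding \<alpha>_def \<beta>_def by (intro continuous_intros ac bc)+
    have cb1: "\<bar>- sin (r j * s)\<bar> \<le> 1" and cb2: "\<bar>cos (r j * s)\<bar> \<le> 1" for s by simp_all
    have "(p0 \<bullet> e j + P j t) * \<alpha> t = p0 \<bullet> e j * \<alpha> 0 + (LINT s:{0..t}|lebesgue. (v s \<bullet> \<gamma> j) * cos (r j * s) * \<alpha> s)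
        + (LINT s:{0..t}|lebesgue. (p0 \<bullet> e j + P j s) * (- sin (r j * s) * G s))"
      unfolding P_def
      by (rule integration_by_parts_L2[OF T L(1)[OF ci(2)[of j] cb2] vmc[OF ci(2)[of j]] L(2)[OF ci(2)[of j] cb2] \<alpha>d \<alpha>'c t])
    moreover have "(LINT s:{0..t}|lebesgue. (p0 \<bullet> e j + P j s) * (- sin (r j * s) * G s))
        = - (LINT s:{0..t}|lebesgue. (p0 \<bullet> e j + P j s) * (sin (r j * s) * G s))"
      by (simp add: set_lebesgue_integral_def)
    ultimately have I1: "(p0 \<bullet> e j + P j t) * \<alpha> t = p0 \<bullet> e j * \<alpha> 0 + (LINT s:{0..t}|lebesgue. (v s \<bullet> \<gamma> j) * cos (r j * s) * \<alpha> s)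
        - (LINT s:{0..t}|lebesgue. (p0 \<bullet> e j + P j s) * (sin (r j * s) * G s))" by simp
    have "(x0 \<bullet> e j + X j t) * \<beta> t = x0 \<bullet> e j * \<beta> 0 + (LINT s:{0..t}|lebesgue. (v s \<bullet> \<gamma> j) * (- sin (r j * s)) * \<beta> s)
        + (LINT s:{0..t}|lebesgue. (x0 \<bullet> e j + X j s) * (cos (r j * s) * G s))"
      unfolding X_def
      by (rule integration_by_parts_L2[OF T L(1)[OF ci(1)[of j] cb1] vmc[OF ci(1)[of j]] L(2)[OF ci(1)[of j] cb1] \<beta>d \<beta>'c t])
    moreover have "(LINT s:{0..t}|lebesgue. (v s \<bullet> \<gamma> j) * (- sin (r j * s)) * \<beta> s)
        = - (LINT s:{0..t}|lebesgue. (v s \<bullet> \<gamma> j) * sin (r j * s) * \<beta> s)"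
      by (simp add: set_lebesgue_integral_def)
    ultimately have I2: "(x0 \<bullet> e j + X j t) * \<beta> t = x0 \<bullet> e j * \<beta> 0 - (LINT s:{0..t}|lebesgue. (v s \<bullet> \<gamma> j) * sin (r j * s) * \<beta> s)
        + (LINT s:{0..t}|lebesgue. (x0 \<bullet> e j + X j s) * (cos (r j * s) * G s))" by simp
    have ab0: "\<alpha> 0 = a 0" "\<beta> 0 = b 0" by (simp_all add: \<alpha>_def \<beta>_def)
    have XPc: "continuous_on {0..T} (X j)" "continuous_on {0..T} (P j)"
      unfolding X_def P_def by (intro LINT_continuous int ci)+
    have ph: "(v s \<bullet> \<gamma> j) * cos (r j * s) * \<alpha> s + (v s \<bullet> \<gamma> j) * sin (r j * s) * \<beta> s = (v s \<bullet> \<gamma> j) * a s" for s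
    proof -
      have "cos (r j * s) * \<alpha> s + sin (r j * s) * \<beta> s = ((cos (r j * s))\<^sup>2 + (sin (r j * s))\<^sup>2) * a s"
        unfolding \<alpha>_def \<beta>_def power2_eq_square by (simp add: algebra_simps del: sin_cos_squared_add3)
      then have "cos (r j * s) * \<alpha> s + sin (r j * s) * \<beta> s = a s"
        by (simp only: sin_cos_squared_add2 mult_1)
      then show ?thesis by (metis distrib_left mult.assoc)
    qed
    have "(LINT s:{0..t}|lebesgue. (v s \<bullet> \<gamma> j) * a s)
        = (LINT s:{0..t}|lebesgue. (v s \<bullet> \<gamma> j) * cos (r j * s) * \<alpha> s) + (LINT s:{0..t}|lebesgue. (v s \<bullet> \<gamma> j) * sin (r j * s) * \<beta> s)"
      unfolding ph[symmetric] mult.assoc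
      by (intro set_integral_add(2) int_sub continuous_intros \<alpha>c) (use t in auto)
    moreover have "(LINT s:{0..t}|lebesgue. (c s \<bullet> e j) * G s)
        = (LINT s:{0..t}|lebesgue. (x0 \<bullet> e j + X j s) * (cos (r j * s) * G s)) + (LINT s:{0..t}|lebesgue. (p0 \<bullet> e j + P j s) * (sin (r j * s) * G s))"
    proof -
      have "(LINT s:{0..t}|lebesgue. (c s \<bullet> e j) * G s) = (LINT s:{0..t}|lebesgue. (x0 \<bullet> e j + X j s) * (cos (r j * s) * G s) + (p0 \<bullet> e j + P j s) * (sin (r j * s) * G s))"
        by (rule set_lebesgue_integral_cong) (use t in \<open>auto simp: cf algebra_simps\<close>)
      also have "\<dots> = (LINT s:{0..t}|lebesgue. (x0 \<bullet> e j + X j s) * (cos (r j * s) * G s)) + (LINT s:{0..t}|lebesgue. (p0 \<bullet> e j + P j s) * (sin (r j * s) * G s))"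
        by (intro set_integral_add(2) set_integrable_continuous_sub[where T=T] continuous_intros XPc Gc) (use t in auto)
      finally show ?thesis .
    qed
    moreover have "(d t \<bullet> e j) * a t - (c t \<bullet> e j) * b t = (p0 \<bullet> e j + P j t) * \<alpha> t - (x0 \<bullet> e j + X j t) * \<beta> t"
      unfolding cf[OF t] df[OF t] \<alpha>_def \<beta>_def by (simp add: algebra_simps)
    ultimately show "(d t \<bullet> e j) * a t - (c t \<bullet> e j) * b t = (d 0 \<bullet> e j) * a 0 - (c 0 \<bullet> e j) * b 0
       + (LINT s:{0..t}|lebesgue. (v s \<bullet> \<gamma> j) * a s) - (LINT s:{0..t}|lebesgue. (c s \<bullet> e j) * G s)"
      using I1 I2 unfolding ini ab0 by linarith
  qed
  show ?thesis
    by (rule that[OF cc ini _ _ ev]) (simp_all only: cf df X_def P_def)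
qed

end

lemma norm2_le_sup:
  assumes f: "f \<in> L2 T" and T: "0 \<le> T" and b: "\<And>s. s \<in> {0..T} \<Longrightarrow> norm (f s) \<le> B" and B: "0 \<le> B"
  shows "norm2 T f \<le> B * sqrt T"
proof -
  have "(norm2 T f)\<^sup>2 \<le> integral\<^sup>L (lebesgue_on {0..T}) (\<lambda>_. B\<^sup>2)"
    unfolding norm2_sq set_integral_lebesgue_on
  proof (rule integral_mono)
    show "integrable (lebesgue_on {0..T}) (\<lambda>s. (norm (f s))\<^sup>2)" using f by (simp add: L2_iff)
    show "integrable (lebesgue_on {0..T}) (\<lambda>_. B\<^sup>2)" by (intro continuous_imp_integrable_real) simp
    show "(norm (f s))\<^sup>2 \<le> B\<^sup>2" if "s \<in> space (lebesgue_on {0..T})" for s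
      using that b by (intro power_mono) auto
  qed
  also have "\<dots> = (B * sqrt T)\<^sup>2" using T by (simp add: measure_restrict_space power_mult_distrib)
  finally show ?thesis
    using B T power2_le_imp_le[of "norm2 T f" "B * sqrt T"] by simp
qed

lemma norm2_uniform_limit:
  fixes f :: "nat \<Rightarrow> real \<Rightarrow> 'a::real_inner"
  assumes T: "0 < T" and u: "uniform_limit {0..T} f g sequentially"
    and f: "\<And>N. f N \<in> L2 T" and g: "g \<in> L2 T"
  shows "(\<lambda>N. norm2 T (\<lambda>t. f N t - g t)) \<longlonglongrightarrow> 0"
proof (rule LIMSEQ_I)
  fix \<epsilon> :: real assume \<epsilon>: "0 < \<epsilon>"
  define \<eta> where "\<eta> = \<epsilon> / (2 * sqrt T)"
  have \<eta>: "0 < \<eta>" "\<eta> * sqrt T < \<epsilon>" unfolding \<eta>_def using \<epsilon> T by (auto simp: field_simps)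
  obtain K where K: "\<And>N t. N \<ge> K \<Longrightarrow> t \<in> {0..T} \<Longrightarrow> dist (f N t) (g t) < \<eta>"
    using uniform_limitD[OF u \<eta>(1)] unfolding eventually_sequentially by blast
  have "norm (norm2 T (\<lambda>t. f N t - g t) - 0) < \<epsilon>" if "N \<ge> K" for N
  proof -
    have "norm2 T (\<lambda>t. f N t - g t) \<le> \<eta> * sqrt T"
      by (rule norm2_le_sup[OF L2_diff[OF f g]])
         (use T \<eta>(1) K[OF that] in \<open>auto simp: dist_norm less_imp_le\<close>)
    then show ?thesis using \<eta>(2) norm2_nonneg[of T "\<lambda>t. f N t - g t"] by simp
  qed
  then show "\<exists>K. \<forall>N\<ge>K. norm (norm2 T (\<lambda>t. f N t - g t) - 0) < \<epsilon>" by blast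
qed

section \<open>Classical evolutions, finite energy waves and cascades\<close>

context eigenbasis
begin

lemma norm_sum_e_le: "(norm (\<Sum>j<N. a j *\<^sub>R e j))\<^sup>2 \<le> (\<Sum>j<N. (a j)\<^sup>2)"
proof -
  have "(\<Sum>j<N. a j *\<^sub>R e j) = (\<Sum>j<N. (if e j = 0 then 0 else a j) *\<^sub>R e j)" by (intro sum.cong) auto
  then have "(norm (\<Sum>j<N. a j *\<^sub>R e j))\<^sup>2 = (\<Sum>j<N. (if e j = 0 then 0 else a j)\<^sup>2)"
    using norm_sum_e[of "\<lambda>j. if e j = 0 then 0 else a j" "{..<N}"] by simp
  also have "\<dots> \<le> (\<Sum>j<N. (a j)\<^sup>2)" by (intro sum_mono) auto
  finally show ?thesis .
qed

lemma rotation_le: "(cos x * a + sin x * b)\<^sup>2 \<le> a\<^sup>2 + b\<^sup>2" for a b x :: real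
proof -
  have "(cos x * a + sin x * b)\<^sup>2 + (- sin x * a + cos x * b)\<^sup>2 = ((cos x)\<^sup>2 + (sin x)\<^sup>2) * (a\<^sup>2 + b\<^sup>2)"
    unfolding power2_eq_square by (simp add: algebra_simps del: sin_cos_squared_add3)
  also have "\<dots> = a\<^sup>2 + b\<^sup>2" by (simp only: sin_cos_squared_add2 mult_1)
  finally show ?thesis using zero_le_power2[of "- sin x * a + cos x * b"] by linarith
qed

text \<open>Observing the full state is admissible, with constant \<open>T\<close> because the
  energy bound holds at every instant. This lets \<open>duhamel\<close> treat an H-valued source in
  the same way as a control.\<close>

lemma admissible_e:
  assumes "0 < T" shows "admissible T e T"
  unfolding admissible_def
proof (intro conjI allI assms)
  fix N and a b :: "nat \<Rightarrow> real"
  define S where "S = (\<Sum>j<N. (a j)\<^sup>2 + (b j)\<^sup>2)"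
  have S: "0 \<le> S" unfolding S_def by (intro sum_nonneg) auto
  have "norm2 T (\<lambda>t. \<Sum>j<N. (cos (r j * t) * a j + sin (r j * t) * b j) *\<^sub>R e j) \<le> sqrt S * sqrt T"
  proof (rule norm2_le_sup)
    show "(\<lambda>t. \<Sum>j<N. (cos (r j * t) * a j + sin (r j * t) * b j) *\<^sub>R e j) \<in> L2 T"
      by (intro L2_continuous continuous_intros)
    show "norm (\<Sum>j<N. (cos (r j * t) * a j + sin (r j * t) * b j) *\<^sub>R e j) \<le> sqrt S" for t
    proof (rule real_le_rsqrt)
      show "(norm (\<Sum>j<N. (cos (r j * t) * a j + sin (r j * t) * b j) *\<^sub>R e j))\<^sup>2 \<le> S"
        unfolding S_def by (rule order_trans[OF norm_sum_e_le]) (intro sum_mono rotation_le)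
    qed
  qed (use assms S in auto)
  then have "(norm2 T (\<lambda>t. \<Sum>j<N. (cos (r j * t) * a j + sin (r j * t) * b j) *\<^sub>R e j))\<^sup>2 \<le> (sqrt S * sqrt T)\<^sup>2"
    by (intro power_mono norm2_nonneg)
  then show "(norm2 T (\<lambda>t. \<Sum>j<N. (cos (r j * t) * a j + sin (r j * t) * b j) *\<^sub>R e j))\<^sup>2 \<le> T * (\<Sum>j<N. (a j)\<^sup>2 + (b j)\<^sup>2)"
    using assms S unfolding S_def[symmetric] by (simp add: power_mult_distrib mult.commute)
qed auto

definition classical_evolution :: "real \<Rightarrow> (real \<Rightarrow> 'h) \<Rightarrow> (real \<Rightarrow> 'h) \<Rightarrow> (real \<Rightarrow> 'h) \<Rightarrow> bool" where
  "classical_evolution T F c d \<longleftrightarrow> continuous_on {0..T} c \<and> continuous_on {0..T} d \<and>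
     (\<forall>j. \<forall>t\<in>{0..T}. ((\<lambda>t. c t \<bullet> e j) has_real_derivative r j * (d t \<bullet> e j)) (at t within {0..T}) \<and>
       ((\<lambda>t. d t \<bullet> e j) has_real_derivative - r j * (c t \<bullet> e j) + F t \<bullet> e j) (at t within {0..T}))"

lemma evolution_exists:
  assumes T: "0 < T" and F: "continuous_on {0..T} F"
  obtains c d where "c 0 = x0" "d 0 = p0" "evolution T (\<lambda>j s. F s \<bullet> e j) c d" "classical_evolution T F c d"
proof -
  have "(\<lambda>m::nat. norm2 T (\<lambda>t. F t - F t)) \<longlonglongrightarrow> 0" by (simp add: norm2_def set_integral_lebesgue_on)
  then obtain c d where cd: "continuous_on {0..T} c" "continuous_on {0..T} d" "c 0 = x0" "d 0 = p0"
    "\<And>j t. t \<in> {0..T} \<Longrightarrow> c t \<bullet> e j = cos (r j * t) * (x0 \<bullet> e j + (LINT s:{0..t}|lebesgue. (F s \<bullet> e j) * (- sin (r j * s))))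
        + sin (r j * t) * (p0 \<bullet> e j + (LINT s:{0..t}|lebesgue. (F s \<bullet> e j) * cos (r j * s)))"
    "\<And>j t. t \<in> {0..T} \<Longrightarrow> d t \<bullet> e j = - sin (r j * t) * (x0 \<bullet> e j + (LINT s:{0..t}|lebesgue. (F s \<bullet> e j) * (- sin (r j * s))))
        + cos (r j * t) * (p0 \<bullet> e j + (LINT s:{0..t}|lebesgue. (F s \<bullet> e j) * cos (r j * s)))"
    "evolution T (\<lambda>j s. F s \<bullet> e j) c d"
    by (rule duhamel[OF T L2_continuous[OF F] F _ admissible_e[OF T], of x0 p0]) (rule that; assumption)
  have "classical_evolution T F c d"
    unfolding classical_evolution_def
  proof (intro conjI allI ballI cd)
    fix j t assume t: "t \<in> {0..T}"
    define X where "X t = (LINT s:{0..t}|lebesgue. (F s \<bullet> e j) * (- sin (r j * s)))" for t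
    define P where "P t = (LINT s:{0..t}|lebesgue. (F s \<bullet> e j) * cos (r j * s))" for t
    have X: "(X has_real_derivative (F t \<bullet> e j) * (- sin (r j * t))) (at t within {0..T})"
      unfolding X_def by (rule LINT_deriv[OF _ t]) (intro continuous_intros F)
    have P: "(P has_real_derivative (F t \<bullet> e j) * cos (r j * t)) (at t within {0..T})"
      unfolding P_def by (rule LINT_deriv[OF _ t]) (intro continuous_intros F)
    have cf: "c t \<bullet> e j = cos (r j * t) * (x0 \<bullet> e j + X t) + sin (r j * t) * (p0 \<bullet> e j + P t)"
      and df: "d t \<bullet> e j = - sin (r j * t) * (x0 \<bullet> e j + X t) + cos (r j * t) * (p0 \<bullet> e j + P t)" if "t \<in> {0..T}" for t
      using cd(5,6)[OF that] unfolding X_def P_def by blast+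
    have "((\<lambda>t. cos (r j * t) * (x0 \<bullet> e j + X t) + sin (r j * t) * (p0 \<bullet> e j + P t)) has_real_derivative
        r j * (d t \<bullet> e j)) (at t within {0..T})"
      unfolding df[OF t] by (auto intro!: derivative_eq_intros X P simp: algebra_simps)
    then show "((\<lambda>t. c t \<bullet> e j) has_real_derivative r j * (d t \<bullet> e j)) (at t within {0..T})"
      by (rule has_field_derivative_transform_within[OF _ zero_less_one t]) (simp add: cf)
    have "((\<lambda>t. - sin (r j * t) * (x0 \<bullet> e j + X t) + cos (r j * t) * (p0 \<bullet> e j + P t)) has_real_derivative
        - r j * (c t \<bullet> e j) + (F t \<bullet> e j) * (cos (r j * t) * cos (r j * t) + sin (r j * t) * sin (r j * t))) (at t within {0..T})"
      unfolding cf[OF t] by (auto intro!: derivative_eq_intros X P simp: algebra_simps simp del: sin_cos_squared_add3)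
    then have "((\<lambda>t. - sin (r j * t) * (x0 \<bullet> e j + X t) + cos (r j * t) * (p0 \<bullet> e j + P t)) has_real_derivative
        - r j * (c t \<bullet> e j) + F t \<bullet> e j) (at t within {0..T})" by (simp only: sin_cos_squared_add3 mult_1_right)
    then show "((\<lambda>t. d t \<bullet> e j) has_real_derivative - r j * (c t \<bullet> e j) + F t \<bullet> e j) (at t within {0..T})"
      by (rule has_field_derivative_transform_within[OF _ zero_less_one t]) (simp add: df)
  qed
  then show ?thesis using that cd by blast
qed

lemma reverse_derivative:
  fixes f :: "real \<Rightarrow> real"
  assumes "(f has_real_derivative D) (at (T - t) within {0..T})" "t \<in> {0..T}"
  shows "((\<lambda>s. f (T - s)) has_real_derivative - D) (at t within {0..T})"
proof -
  have im: "(\<lambda>s. T - s) ` {0..T} = {0..T}" by (auto simp: image_iff intro: bexI[of _ "T - _"])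
  have "((\<lambda>s. T - s) has_real_derivative - 1) (at t within {0..T})" by (auto intro!: derivative_eq_intros)
  from DERIV_image_chain[OF _ this, of f D] assms(1) show ?thesis unfolding im by (simp add: o_def)
qed

text \<open>Time reversal: replacing \<open>t\<close> by \<open>T - t\<close> and changing the sign
  of the velocity coordinate preserves the equations, so final data may be prescribed instead of
  initial data.\<close>

lemma evolution_exists_backward:
  assumes T: "0 < T" and F: "continuous_on {0..T} F"
  obtains c d where "c T = xT" "d T = pT" "classical_evolution T F c d"
proof -
  have rc: "continuous_on {0..T} (\<lambda>t. f (T - t))" if "continuous_on {0..T} f" for f :: "real \<Rightarrow> 'h"
    by (rule continuous_on_compose2[OF that]) (auto intro!: continuous_intros)
  obtain c d where cd: "c 0 = xT" "d 0 = - pT" "classical_evolution T (\<lambda>t. F (T - t)) c d"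
    using evolution_exists[OF T rc[OF F], of xT "- pT"] by metis
  have c: "continuous_on {0..T} c" "continuous_on {0..T} d"
    "\<And>j t. t \<in> {0..T} \<Longrightarrow> ((\<lambda>t. c t \<bullet> e j) has_real_derivative r j * (d t \<bullet> e j)) (at t within {0..T})"
    "\<And>j t. t \<in> {0..T} \<Longrightarrow> ((\<lambda>t. d t \<bullet> e j) has_real_derivative - r j * (c t \<bullet> e j) + F (T - t) \<bullet> e j) (at t within {0..T})"
    using cd(3) unfolding classical_evolution_def by auto
  have "classical_evolution T F (\<lambda>t. c (T - t)) (\<lambda>t. - d (T - t))"
    unfolding classical_evolution_def
  proof (intro conjI allI ballI)
    fix j t assume t: "t \<in> {0..T}"
    then have t': "T - t \<in> {0..T}" by auto
    show "((\<lambda>t. c (T - t) \<bullet> e j) has_real_derivative r j * (- d (T - t) \<bullet> e j)) (at t within {0..T})"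
      using reverse_derivative[OF c(3)[OF t', of j] t] by simp
    show "((\<lambda>t. - d (T - t) \<bullet> e j) has_real_derivative - r j * (c (T - t) \<bullet> e j) + F t \<bullet> e j) (at t within {0..T})"
      using DERIV_minus[OF reverse_derivative[OF c(4)[OF t', of j] t]] by simp
  qed (intro continuous_on_minus rc c)+
  then show ?thesis using that[of "\<lambda>t. c (T - t)" "\<lambda>t. - d (T - t)"] cd by simp
qed

text \<open>Coordinatewise differentiability with a norm-continuous candidate derivative gives
  differentiability in norm. The mean value inequality is applied to the remainder tested against
  its own truncation, with a bound that does not depend on the number of modes.\<close>

lemma weak_imp_strong_derivative:
  assumes x': "continuous_on {0..T} x'"
    and d: "\<And>j t. t \<in> {0..T} \<Longrightarrow> ((\<lambda>t. x t \<bullet> e j) has_real_derivative x' t \<bullet> e j) (at t within {0..T})"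
    and t: "t \<in> {0..T::real}"
  shows "(x has_vector_derivative x' t) (at t within {0..T})"
proof -
  have est: "norm (x s - x t - (s - t) *\<^sub>R x' t) \<le> \<epsilon> * \<bar>s - t\<bar>"
    if s: "s \<in> {0..T}" and \<epsilon>: "\<And>\<sigma>. \<sigma> \<in> closed_segment s t \<Longrightarrow> norm (x' \<sigma> - x' t) \<le> \<epsilon>" "0 \<le> \<epsilon>" for s \<epsilon>
  proof -
    define y where "y = x s - x t - (s - t) *\<^sub>R x' t"
    have seg: "closed_segment s t \<subseteq> {0..T}"
      using s t closed_segment_eq_real_ivl by (auto split: if_splits)
    have pN: "norm (proj N y) \<le> \<epsilon> * \<bar>s - t\<bar>" for N
    proof (cases "proj N y = 0")
      case False
      \<comment> \<open>Its increment from \<open>t\<close> to \<open>s\<close> is the inner product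
        of the remainder \<open>y\<close> with \<open>proj N y\<close>, that is, the squared norm of
        the truncated remainder; one factor of this norm cancels afterwards.\<close>
      define g where "g \<sigma> = (x \<sigma> - \<sigma> *\<^sub>R x' t) \<bullet> proj N y" for \<sigma>
      have gd: "(g has_field_derivative (x' \<sigma> - x' t) \<bullet> proj N y) (at \<sigma> within closed_segment s t)"
        if "\<sigma> \<in> closed_segment s t" for \<sigma>
      proof -
        have "((\<lambda>\<sigma>. \<Sum>j<N. (y \<bullet> e j) * (x \<sigma> \<bullet> e j - \<sigma> * (x' t \<bullet> e j))) has_real_derivative
            (\<Sum>j<N. (y \<bullet> e j) * (x' \<sigma> \<bullet> e j - 1 * (x' t \<bullet> e j)))) (at \<sigma> within {0..T})"
          by (intro DERIV_sum DERIV_cmult DERIV_diff d DERIV_cmult_right DERIV_ident) (use that seg in blast)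
        then show ?thesis
          unfolding g_def proj_def inner_sum_right using DERIV_subset[OF _ seg] by (simp add: inner_diff_left)
      qed
      have "norm (g s - g t) \<le> (\<epsilon> * norm (proj N y)) * norm (s - t)"
      proof (rule field_differentiable_bound[OF _ gd])
        show "norm ((x' \<sigma> - x' t) \<bullet> proj N y) \<le> \<epsilon> * norm (proj N y)" if "\<sigma> \<in> closed_segment s t" for \<sigma>
          using order_trans[OF Cauchy_Schwarz_ineq2 mult_right_mono[OF \<epsilon>(1)[OF that] norm_ge_zero]] by simp
      qed auto
      moreover have "g s - g t = (norm (proj N y))\<^sup>2"
      proof -
        have "g s - g t = y \<bullet> proj N y" unfolding g_def y_def by (simp add: inner_diff_left algebra_simps)
        also have "\<dots> = (norm (proj N y))\<^sup>2"
          unfolding norm_proj by (simp add: proj_def inner_sum_right power2_eq_square)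
        finally show ?thesis .
      qed
      ultimately show ?thesis using False by (simp add: power2_eq_square mult.commute mult.left_commute)
    qed (use \<epsilon> in simp)
    show ?thesis unfolding y_def[symmetric]
      by (rule LIMSEQ_le_const2[OF tendsto_norm[OF proj_tendsto]]) (use pN in blast)
  qed
  show ?thesis
    unfolding has_vector_derivative_def has_derivative_within_alt
  proof (intro conjI allI impI bounded_linear_scaleR_left)
    fix \<epsilon> :: real assume "0 < \<epsilon>"
    then obtain \<delta>' where \<delta>': "\<delta>' > 0" "\<And>s. s \<in> {0..T} \<Longrightarrow> dist s t < \<delta>' \<Longrightarrow> dist (x' s) (x' t) < \<epsilon>"
      using x' t unfolding continuous_on_iff by metis
    have "norm (x s - x t - (s - t) *\<^sub>R x' t) \<le> \<epsilon> * norm (s - t)" if "s \<in> {0..T}" "norm (s - t) < \<delta>'" for s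
    proof -
      have "norm (x s - x t - (s - t) *\<^sub>R x' t) \<le> \<epsilon> * \<bar>s - t\<bar>"
      proof (rule est[OF that(1)])
        fix \<sigma> assume \<sigma>: "\<sigma> \<in> closed_segment s t"
        have "\<sigma> \<in> {0..T}" "dist \<sigma> t < \<delta>'"
          using \<sigma> that t by (auto simp: closed_segment_eq_real_ivl dist_real_def split: if_splits)
        then show "norm (x' \<sigma> - x' t) \<le> \<epsilon>" using \<delta>'(2)[of \<sigma>] by (simp add: dist_norm)
      qed (use \<open>0 < \<epsilon>\<close> in simp)
      then show ?thesis by simp
    qed
    then show "\<exists>d>0. \<forall>y\<in>{0..T}. norm (y - t) < d \<longrightarrow> norm (x y - x t - (y - t) *\<^sub>R x' t) \<le> \<epsilon> * norm (y - t)"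
      using \<delta>'(1) by blast
  qed
qed

text \<open>The normalised pair is \<open>A\<^sup>1\<^sup>/\<^sup>2 w\<close> together with
  \<open>w'\<close>, hence the position is recovered by \<open>Lam (- 1)\<close>. The weak equation
  is a finite sum of scalar equations for truncated test vectors, and then a limit in the number of
  modes.\<close>

lemma classical_evolution_wave_solution:
  assumes T: "0 < T" and F: "continuous_on {0..T} F" and ev: "classical_evolution T F a b"
  shows "wave_solution A T (\<lambda>t. Lam (- 1) (a t)) b F"
proof -
  have c: "continuous_on {0..T} a" "continuous_on {0..T} b"
    "\<And>j t. t \<in> {0..T} \<Longrightarrow> ((\<lambda>t. a t \<bullet> e j) has_real_derivative r j * (b t \<bullet> e j)) (at t within {0..T})"
    "\<And>j t. t \<in> {0..T} \<Longrightarrow> ((\<lambda>t. b t \<bullet> e j) has_real_derivative - r j * (a t \<bullet> e j) + F t \<bullet> e j) (at t within {0..T})"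
    using ev unfolding classical_evolution_def by auto
  interpret L: bounded_linear "Lam (- 1)" by (rule bounded_linear_Lam) simp
  have wc: "continuous_on {0..T} (\<lambda>t. Lam (- 1) (a t))" by (intro L.continuous_on c)
  have wj: "Lam (- 1) x \<bullet> e j = (x \<bullet> e j) / r j" for x j
    by (simp add: Lam_coef hdom_nonpos power_int_minus field_simps)
  show ?thesis
    unfolding wave_solution_def
  proof (intro conjI ballI L2_continuous F c(2))
    show "Lam (- 1) (a t) \<in> hdom A 1" for t using Lam_neg_in[of 1] by simp
    show "continuous_on {0..T} (\<lambda>t. Lam 1 (Lam (- 1) (a t)))" using Lam_neg_Lam[of 1] c(1) by simp
    show "((\<lambda>t. Lam (- 1) (a t)) has_vector_derivative b t) (at t within {0..T})" if "t \<in> {0..T}" for t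
    proof (rule weak_imp_strong_derivative[OF c(2) _ that])
      show "((\<lambda>t. Lam (- 1) (a t) \<bullet> e j) has_real_derivative b t \<bullet> e j) (at t within {0..T})" if "t \<in> {0..T}" for j t
        unfolding wj using DERIV_cdivide[OF c(3)[OF that, of j], of "r j"] less_imp_neq[OF r_pos[of j]] by simp
    qed
    fix p assume pA: "p \<in> A"
    obtain \<phi> \<psi> where p: "p = (\<phi>, \<psi>)" by fastforce
    have \<psi>: "\<psi> \<bullet> e j = (r j)\<^sup>2 * (\<phi> \<bullet> e j)" for j using pA A_diag unfolding p diag_def by auto
    have "b t \<bullet> \<phi> = b 0 \<bullet> \<phi> - (LINT s:{0..t}|lebesgue. Lam (- 1) (a s) \<bullet> \<psi>) + (LINT s:{0..t}|lebesgue. F s \<bullet> \<phi>)"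
      if t: "t \<in> {0..T}" for t
    proof (rule LIMSEQ_unique)
      have t0: "0 \<le> (0::real)" "t \<le> T" using t by auto
      have ip: "(\<lambda>N. LINT s:{0..t}|lebesgue. x s \<bullet> proj N z) \<longlonglongrightarrow> (LINT s:{0..t}|lebesgue. x s \<bullet> z)"
        if x: "continuous_on {0..T} x" for x z
      proof -
        have "uniform_limit {0..T} (\<lambda>N s. proj N z) (\<lambda>s. z) sequentially" by (rule proj_uniform_limit) simp
        then have "(\<lambda>N. norm2 T (\<lambda>s. proj N z - z)) \<longlonglongrightarrow> 0"
          by (rule norm2_uniform_limit[OF T]) (auto intro: L2_continuous)
        from inner2_tendsto[OF L2_continuous L2_continuous this L2_continuous[OF x] t0]
        show ?thesis by (simp add: inner_commute)
      qed
      have "b t \<bullet> proj N \<phi> = b 0 \<bullet> proj N \<phi> - (LINT s:{0..t}|lebesgue. Lam (- 1) (a s) \<bullet> proj N \<psi>) + (LINT s:{0..t}|lebesgue. F s \<bullet> proj N \<phi>)" for N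
      proof -
        have sp: "x \<bullet> proj N z = (\<Sum>j<N. (z \<bullet> e j) * (x \<bullet> e j))" for x z by (simp add: proj_def inner_sum_right)
        have dd: "((\<lambda>t. b t \<bullet> proj N \<phi>) has_real_derivative F s \<bullet> proj N \<phi> - Lam (- 1) (a s) \<bullet> proj N \<psi>) (at s within {0..T})"
          if "s \<in> {0..T}" for s
        proof -
          have "((\<lambda>t. b t \<bullet> proj N \<phi>) has_real_derivative (\<Sum>j<N. (\<phi> \<bullet> e j) * (- r j * (a s \<bullet> e j) + F s \<bullet> e j))) (at s within {0..T})"
            unfolding sp by (intro DERIV_sum DERIV_cmult c(4) that)
          moreover have "(\<phi> \<bullet> e j) * (- r j * (a s \<bullet> e j) + F s \<bullet> e j)
              = (\<phi> \<bullet> e j) * (F s \<bullet> e j) - (\<psi> \<bullet> e j) * (Lam (- 1) (a s) \<bullet> e j)" for j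
            unfolding wj \<psi> using r_pos[of j] by (simp add: field_simps power2_eq_square)
          ultimately show ?thesis unfolding sp by (simp add: sum_subtractf)
        qed
        have dc: "continuous_on {0..T} (\<lambda>s. F s \<bullet> proj N \<phi> - Lam (- 1) (a s) \<bullet> proj N \<psi>)"
          by (intro continuous_intros F wc)
        have "(LINT s:{0..t}|lebesgue. F s \<bullet> proj N \<phi> - Lam (- 1) (a s) \<bullet> proj N \<psi>) = b t \<bullet> proj N \<phi> - b 0 \<bullet> proj N \<phi>"
          by (rule LINT_FTC[OF dd dc t])
        moreover have "(LINT s:{0..t}|lebesgue. F s \<bullet> proj N \<phi> - Lam (- 1) (a s) \<bullet> proj N \<psi>)
            = (LINT s:{0..t}|lebesgue. F s \<bullet> proj N \<phi>) - (LINT s:{0..t}|lebesgue. Lam (- 1) (a s) \<bullet> proj N \<psi>)"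
          by (intro set_integral_diff(2) set_integrable_continuous_sub[where T=T] continuous_intros F wc t0)
        ultimately show ?thesis by simp
      qed
      then show "(\<lambda>N. b t \<bullet> proj N \<phi>) \<longlonglongrightarrow> b 0 \<bullet> \<phi> - (LINT s:{0..t}|lebesgue. Lam (- 1) (a s) \<bullet> \<psi>) + (LINT s:{0..t}|lebesgue. F s \<bullet> \<phi>)"
        by (simp only:) (intro tendsto_intros proj_tendsto ip wc F)
      show "(\<lambda>N. b t \<bullet> proj N \<phi>) \<longlonglongrightarrow> b t \<bullet> \<phi>" by (intro tendsto_intros proj_tendsto)
    qed
    then show "case p of (\<phi>, \<psi>) \<Rightarrow> \<forall>t\<in>{0..T}. b t \<bullet> \<phi> = b 0 \<bullet> \<phi> - (LINT s:{0..t}|lebesgue. Lam (- 1) (a s) \<bullet> \<psi>)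
        + (LINT s:{0..t}|lebesgue. F s \<bullet> \<phi>)" unfolding p prod.case by blast
  qed
qed

lemma wave_solutionD:
  assumes w: "wave_solution A T w w' f" and t: "t \<in> {0..T}"
  shows "((\<lambda>t. w t \<bullet> x) has_real_derivative w' t \<bullet> x) (at t within {0..T})"
    "continuous_on {0..T} f \<Longrightarrow> \<phi> \<in> hdom A 2 \<Longrightarrow>
      ((\<lambda>t. w' t \<bullet> \<phi>) has_real_derivative f t \<bullet> \<phi> - w t \<bullet> Lam 2 \<phi>) (at t within {0..T})"
proof -
  have wd: "(w has_vector_derivative w' t) (at t within {0..T})" if "t \<in> {0..T}" for t
    using w that unfolding wave_solution_def by blast
  have wc: "continuous_on {0..T} w"
    using wd by (meson continuous_on_eq_continuous_within has_vector_derivative_continuous)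
  show "((\<lambda>t. w t \<bullet> x) has_real_derivative w' t \<bullet> x) (at t within {0..T})"
    using bounded_linear.has_vector_derivative[OF bounded_linear_inner_left wd[OF t]]
    by (simp add: has_real_derivative_iff_has_vector_derivative)
  assume f: "continuous_on {0..T} f" and \<phi>: "\<phi> \<in> hdom A 2"
  have "(\<phi>, Lam 2 \<phi>) \<in> A" using A_iff \<phi> by blast
  then have eq: "w' t \<bullet> \<phi> = w' 0 \<bullet> \<phi> - (LINT s:{0..t}|lebesgue. w s \<bullet> Lam 2 \<phi>) + (LINT s:{0..t}|lebesgue. f s \<bullet> \<phi>)"
    if "t \<in> {0..T}" for t using w that unfolding wave_solution_def by blast
  have "((\<lambda>t. w' 0 \<bullet> \<phi> - (LINT s:{0..t}|lebesgue. w s \<bullet> Lam 2 \<phi>) + (LINT s:{0..t}|lebesgue. f s \<bullet> \<phi>)) has_real_derivative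
      0 - w t \<bullet> Lam 2 \<phi> + f t \<bullet> \<phi>) (at t within {0..T})"
    by (intro DERIV_add DERIV_diff DERIV_const LINT_deriv[OF _ t] continuous_intros wc f)
  then have "((\<lambda>t. w' t \<bullet> \<phi>) has_real_derivative 0 - w t \<bullet> Lam 2 \<phi> + f t \<bullet> \<phi>) (at t within {0..T})"
    by (rule has_field_derivative_transform_within[OF _ zero_less_one t]) (rule eq[symmetric])
  then show "((\<lambda>t. w' t \<bullet> \<phi>) has_real_derivative f t \<bullet> \<phi> - w t \<bullet> Lam 2 \<phi>) (at t within {0..T})" by simp
qed

lemma wave_solution_continuous:
  assumes w: "wave_solution A T w w' f"
  shows "continuous_on {0..T} w" "continuous_on {0..T} w'" "continuous_on {0..T} (\<lambda>t. Lam 1 (w t))"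
    "\<And>t. t \<in> {0..T} \<Longrightarrow> w t \<in> hdom A 1"
proof -
  have W: "\<forall>t\<in>{0..T}. w t \<in> hdom A 1" "continuous_on {0..T} (\<lambda>t. Lam 1 (w t))" "continuous_on {0..T} w'"
    "\<forall>t\<in>{0..T}. (w has_vector_derivative w' t) (at t within {0..T})"
    using w unfolding wave_solution_def by - (elim conjE, assumption)+
  show "continuous_on {0..T} w'" "continuous_on {0..T} (\<lambda>t. Lam 1 (w t))" "\<And>t. t \<in> {0..T} \<Longrightarrow> w t \<in> hdom A 1"
    using W by blast+
  show "continuous_on {0..T} w"
    using W(4) by (meson continuous_on_eq_continuous_within has_vector_derivative_continuous)
qed

lemma cascade_source_continuous:
  assumes W: "cascade_solution A n C T w w'" and C: "\<And>i. i \<in> {2..n} \<Longrightarrow> bounded_linear (C i)" and i: "i \<in> {1..n}"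
  shows "continuous_on {0..T} (\<lambda>t. if i = 1 then 0 else - C i (w (i - 1) t))"
proof (cases "i = 1")
  case False
  then have "i - 1 \<in> {1..n}" using i by auto
  from wave_solution_continuous(1)[OF bspec[OF W[unfolded cascade_solution_def] this]]
  have "continuous_on {0..T} (\<lambda>t. C i (w (i - 1) t))"
    using False i by (intro bounded_linear.continuous_on[OF C]) auto
  then show ?thesis using False by (simp add: continuous_on_minus)
qed simp

text \<open>The system is triangular: equation \<open>i\<close> is driven by component
  \<open>i - 1\<close> only, so solutions are built one component at a time with the previous ones
  as a given continuous source.\<close>

lemma cascade_exists_backward:
  assumes T: "0 < T" and C: "\<And>i. i \<in> {2..n} \<Longrightarrow> bounded_linear (C i)"
  shows "\<exists>w w'. cascade_solution A n C T w w' \<and> (\<forall>i\<in>{1..n}. w i T = Lam (- 1) (x i) \<and> w' i T = p i)"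
  using C
proof (induction n)
  case 0
  then show ?case by (simp add: cascade_solution_def)
next
  case (Suc n)
  then obtain w w' where w: "cascade_solution A n C T w w'" "\<And>i. i \<in> {1..n} \<Longrightarrow> w i T = Lam (- 1) (x i) \<and> w' i T = p i"
    by (meson atLeastAtMost_iff le_Suc_eq)
  define F where "F t = (if Suc n = 1 then 0 else - C (Suc n) (w (Suc n - 1) t))" for t
  have F: "continuous_on {0..T} F"
  proof (cases "n = 0")
    case False
    then have "n \<in> {1..n}" by auto
    from wave_solution_continuous(1)[OF bspec[OF w(1)[unfolded cascade_solution_def] this]]
    have "continuous_on {0..T} (\<lambda>t. C (Suc n) (w n t))"
      using False by (intro bounded_linear.continuous_on[OF Suc.prems]) auto
    then show ?thesis using False unfolding F_def by (simp add: continuous_on_minus)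
  qed (simp add: F_def)
  obtain a b where ab: "a T = x (Suc n)" "b T = p (Suc n)" "classical_evolution T F a b"
    using evolution_exists_backward[OF T F, of "x (Suc n)" "p (Suc n)"] by metis
  have ws: "wave_solution A T (\<lambda>t. Lam (- 1) (a t)) b F" by (rule classical_evolution_wave_solution[OF T F ab(3)])
  define u where "u = w(Suc n := \<lambda>t. Lam (- 1) (a t))"
  define u' where "u' = w'(Suc n := b)"
  have "wave_solution A T (u i) (u' i) (\<lambda>t. if i = 1 then 0 else - C i (u (i - 1) t))" if "i \<in> {1..Suc n}" for i
  proof (cases "i = Suc n")
    case True
    then have "(\<lambda>t. if i = 1 then 0 else - C i (u (i - 1) t)) = F" by (auto simp: F_def u_def)
    then show ?thesis using True ws by (simp add: u_def u'_def)
  next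
    case False
    then have i: "i \<in> {1..n}" using that by auto
    have eqs: "u i = w i" "u' i = w' i" "u (i - 1) = w (i - 1)" using False i by (auto simp: u_def u'_def)
    show ?thesis unfolding eqs by (rule bspec[OF w(1)[unfolded cascade_solution_def] i])
  qed
  then have "cascade_solution A (Suc n) C T u u'" unfolding cascade_solution_def by blast
  moreover have "u i T = Lam (- 1) (x i) \<and> u' i T = p i" if "i \<in> {1..Suc n}" for i
    using that ab w(2)[of i] by (cases "i = Suc n") (auto simp: u_def u'_def)
  ultimately show ?case by blast
qed

end

section \<open>Observations of finite energy solutions as limits of spectral truncations\<close>

lemma norm2_sq_tendsto: "(\<lambda>m. LINT t:{0..T}|lebesgue. (norm (f m t))\<^sup>2) \<longlonglongrightarrow> 0 \<longleftrightarrow> (\<lambda>m. norm2 T (f m)) \<longlonglongrightarrow> 0"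
proof
  assume "(\<lambda>m. LINT t:{0..T}|lebesgue. (norm (f m t))\<^sup>2) \<longlonglongrightarrow> 0"
  from tendsto_real_sqrt[OF this] show "(\<lambda>m. norm2 T (f m)) \<longlonglongrightarrow> 0" by (simp add: norm2_def)
next
  assume "(\<lambda>m. norm2 T (f m)) \<longlonglongrightarrow> 0"
  from tendsto_power[OF this, of 2] show "(\<lambda>m. LINT t:{0..T}|lebesgue. (norm (f m t))\<^sup>2) \<longlonglongrightarrow> 0"
    by (simp add: norm2_sq)
qed

context eigenbasis
begin

lemma wave_solution_weak:
  assumes "wave_solution A T w w' f" "t \<in> {0..T}" "\<phi> \<in> hdom A 2"
  shows "w' t \<bullet> \<phi> = w' 0 \<bullet> \<phi> - (LINT s:{0..t}|lebesgue. w s \<bullet> Lam 2 \<phi>) + (LINT s:{0..t}|lebesgue. f s \<bullet> \<phi>)"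
proof -
  have "(\<phi>, Lam 2 \<phi>) \<in> A" using A_iff assms(3) by blast
  then show ?thesis using assms(1,2) unfolding wave_solution_def by blast
qed

lemma wave_solutionI:
  assumes "f \<in> L2 T" "\<And>t. t \<in> {0..T} \<Longrightarrow> w t \<in> hdom A 1" "continuous_on {0..T} (\<lambda>t. Lam 1 (w t))"
    "continuous_on {0..T} w'" "\<And>t. t \<in> {0..T} \<Longrightarrow> (w has_vector_derivative w' t) (at t within {0..T})"
    "\<And>t \<phi>. t \<in> {0..T} \<Longrightarrow> \<phi> \<in> hdom A 2 \<Longrightarrow>
      w' t \<bullet> \<phi> = w' 0 \<bullet> \<phi> - (LINT s:{0..t}|lebesgue. w s \<bullet> Lam 2 \<phi>) + (LINT s:{0..t}|lebesgue. f s \<bullet> \<phi>)"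
  shows "wave_solution A T w w' f"
  unfolding wave_solution_def
proof (intro conjI ballI assms(1-5); (assumption)?)
  fix p assume p: "p \<in> A"
  obtain \<phi> \<psi> where p': "p = (\<phi>, \<psi>)" by fastforce
  have "\<phi> \<in> hdom A 2" "\<psi> = Lam 2 \<phi>" using p A_iff unfolding p' by blast+
  then show "case p of (\<phi>, \<psi>) \<Rightarrow> \<forall>t\<in>{0..T}. w' t \<bullet> \<phi> = w' 0 \<bullet> \<phi> - (LINT s:{0..t}|lebesgue. w s \<bullet> \<psi>)
        + (LINT s:{0..t}|lebesgue. f s \<bullet> \<phi>)"
    unfolding p' prod.case using assms(6) by blast
qed

lemma wave_solution_vector_derivative:
  "wave_solution A T w w' f \<Longrightarrow> t \<in> {0..T} \<Longrightarrow> (w has_vector_derivative w' t) (at t within {0..T})"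
  unfolding wave_solution_def by - (elim conjE, erule bspec)

lemma wave_solution_L2: "wave_solution A T w w' f \<Longrightarrow> f \<in> L2 T"
  unfolding wave_solution_def by - (elim conjE, assumption)

lemma wave_solution_add_scaleR:
  assumes w: "wave_solution A T w w' f" and v: "wave_solution A T v v' g"
  shows "wave_solution A T (\<lambda>t. w t + a *\<^sub>R v t) (\<lambda>t. w' t + a *\<^sub>R v' t) (\<lambda>t. f t + a *\<^sub>R g t)"
proof (rule wave_solutionI)
  note c = wave_solution_continuous[OF w] and d = wave_solution_continuous[OF v]
  note fL = wave_solution_L2[OF w] and gL = wave_solution_L2[OF v]
  show "(\<lambda>t. f t + a *\<^sub>R g t) \<in> L2 T" by (rule L2_add[OF fL L2_scaleR[OF gL]])
  have "continuous_on {0..T} (\<lambda>t. Lam 1 (w t) + a *\<^sub>R Lam 1 (v t))" by (intro continuous_intros c d)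
  then show "continuous_on {0..T} (\<lambda>t. Lam 1 (w t + a *\<^sub>R v t))"
    by (rule continuous_on_eq) (simp add: Lam_add Lam_scaleR hdom_scaleR c(4) d(4))
  show "continuous_on {0..T} (\<lambda>t. w' t + a *\<^sub>R v' t)" by (intro continuous_intros c d)
  fix t assume t: "t \<in> {0..T}"
  show "w t + a *\<^sub>R v t \<in> hdom A 1" using c(4)[OF t] d(4)[OF t] by (intro hdom_add hdom_scaleR)
  show "((\<lambda>t. w t + a *\<^sub>R v t) has_vector_derivative w' t + a *\<^sub>R v' t) (at t within {0..T})"
    by (intro has_vector_derivative_add wave_solution_vector_derivative[OF w t]
        bounded_linear.has_vector_derivative[OF bounded_linear_scaleR_right wave_solution_vector_derivative[OF v t]])
  fix \<phi> assume \<phi>: "\<phi> \<in> hdom A 2"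
  have K: "(\<lambda>_. x) \<in> L2 T" for x :: 'h by (rule L2_continuous) simp
  have tt: "0 \<le> (0::real)" "t \<le> T" using t by auto
  have lin: "(LINT s:{0..t}|lebesgue. (x s + a *\<^sub>R y s) \<bullet> z)
      = (LINT s:{0..t}|lebesgue. x s \<bullet> z) + a * (LINT s:{0..t}|lebesgue. y s \<bullet> z)"
    if "x \<in> L2 T" "y \<in> L2 T" for x y :: "real \<Rightarrow> 'h" and z
    unfolding inner_add_left inner_scaleR_left
    using integral_inner_le(1)[OF that(1) K tt] integral_inner_le(1)[OF that(2) K tt]
    by (subst set_integral_add(2)) (auto intro: set_integrable_mult_right)
  have "(LINT s:{0..t}|lebesgue. (w s + a *\<^sub>R v s) \<bullet> Lam 2 \<phi>)
      = (LINT s:{0..t}|lebesgue. w s \<bullet> Lam 2 \<phi>) + a * (LINT s:{0..t}|lebesgue. v s \<bullet> Lam 2 \<phi>)"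
    by (rule lin[OF L2_continuous[OF c(1)] L2_continuous[OF d(1)]])
  moreover have "(LINT s:{0..t}|lebesgue. (f s + a *\<^sub>R g s) \<bullet> \<phi>)
      = (LINT s:{0..t}|lebesgue. f s \<bullet> \<phi>) + a * (LINT s:{0..t}|lebesgue. g s \<bullet> \<phi>)" by (rule lin[OF fL gL])
  moreover have "(w' t + a *\<^sub>R v' t) \<bullet> \<phi> = w' t \<bullet> \<phi> + a * (v' t \<bullet> \<phi>)"
    "(w' 0 + a *\<^sub>R v' 0) \<bullet> \<phi> = w' 0 \<bullet> \<phi> + a * (v' 0 \<bullet> \<phi>)" by (simp_all add: inner_add_left)
  moreover have "a * (v' t \<bullet> \<phi>) = a * (v' 0 \<bullet> \<phi>) - a * (LINT s:{0..t}|lebesgue. v s \<bullet> Lam 2 \<phi>)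
      + a * (LINT s:{0..t}|lebesgue. g s \<bullet> \<phi>)"
    using arg_cong[OF wave_solution_weak[OF v t \<phi>], of "\<lambda>x. a * x"] by (simp only: right_diff_distrib distrib_left)
  moreover note wave_solution_weak[OF w t \<phi>]
  ultimately show "(w' t + a *\<^sub>R v' t) \<bullet> \<phi> = (w' 0 + a *\<^sub>R v' 0) \<bullet> \<phi>
      - (LINT s:{0..t}|lebesgue. (w s + a *\<^sub>R v s) \<bullet> Lam 2 \<phi>) + (LINT s:{0..t}|lebesgue. (f s + a *\<^sub>R g s) \<bullet> \<phi>)"
    by linarith
qed

lemma wave_solution_diff:
  assumes "wave_solution A T w w' f" "wave_solution A T v v' g"
  shows "wave_solution A T (\<lambda>t. w t - v t) (\<lambda>t. w' t - v' t) (\<lambda>t. f t - g t)"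
  using wave_solution_add_scaleR[OF assms, of "- 1"] by simp

lemma regular_diff:
  assumes w: "regular_solution A T w w' f" and v: "regular_solution A T v v' g"
  shows "regular_solution A T (\<lambda>t. w t - v t) (\<lambda>t. w' t - v' t) (\<lambda>t. f t - g t)"
proof -
  have "continuous_on {0..T} (\<lambda>t. Lam 2 (w t) - Lam 2 (v t))"
    using w v unfolding regular_solution_def by (intro continuous_intros) auto
  then have "continuous_on {0..T} (\<lambda>t. Lam 2 (w t - v t))"
    by (rule continuous_on_eq) (use w v in \<open>simp add: Lam_diff regular_solution_def\<close>)
  then show ?thesis
    using w v wave_solution_diff[of T w w' f v v' g] hdom_diff unfolding regular_solution_def by blast
qed

lemma proj_sym: "proj N x \<bullet> y = x \<bullet> proj N y"
  by (simp add: proj_def inner_sum_left inner_sum_right inner_commute[of "e _"] mult.commute)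

lemma Lam_proj_sum: "Lam k (proj N x) = (\<Sum>j<N. (r j powi k * (x \<bullet> e j)) *\<^sub>R e j)"
  by (rule LamI(2)) (auto simp: inner_sum_e proj_coef)

lemma continuous_proj: "continuous_on S x \<Longrightarrow> continuous_on S (\<lambda>t. proj N (x t))"
  by (rule bounded_linear.continuous_on[OF bounded_linear_proj])

text \<open>Truncation commutes with \<open>A\<close>, so it maps solutions to solutions with
  truncated source. Its values lie in a finite-dimensional spectral subspace and hence in every
  space of the scale.\<close>

lemma regular_proj:
  assumes w: "wave_solution A T w w' f" and f: "continuous_on {0..T} f"
  shows "regular_solution A T (\<lambda>t. proj N (w t)) (\<lambda>t. proj N (w' t)) (\<lambda>t. proj N (f t))"
proof -
  note c = wave_solution_continuous[OF w]
  have L: "continuous_on {0..T} (\<lambda>t. Lam k (proj N (w t)))" for k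
    unfolding Lam_proj_sum by (intro continuous_intros c)
  have "wave_solution A T (\<lambda>t. proj N (w t)) (\<lambda>t. proj N (w' t)) (\<lambda>t. proj N (f t))"
  proof (rule wave_solutionI)
    show "(\<lambda>t. proj N (f t)) \<in> L2 T" by (intro L2_continuous continuous_proj f)
    show "continuous_on {0..T} (\<lambda>t. proj N (w' t))" by (intro continuous_proj c)
    show "continuous_on {0..T} (\<lambda>t. Lam 1 (proj N (w t)))" by (rule L)
    show "proj N (w t) \<in> hdom A 1" for t by (rule hdom_proj)
    fix t assume t: "t \<in> {0..T}"
    show "((\<lambda>t. proj N (w t)) has_vector_derivative proj N (w' t)) (at t within {0..T})"
      by (rule bounded_linear.has_vector_derivative[OF bounded_linear_proj wave_solution_vector_derivative[OF w t]])
    fix \<phi> assume \<phi>: "\<phi> \<in> hdom A 2"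
    show "proj N (w' t) \<bullet> \<phi> = proj N (w' 0) \<bullet> \<phi> - (LINT s:{0..t}|lebesgue. proj N (w s) \<bullet> Lam 2 \<phi>)
        + (LINT s:{0..t}|lebesgue. proj N (f s) \<bullet> \<phi>)"
      unfolding proj_sym using wave_solution_weak[OF w t hdom_proj, of N \<phi>] by (simp only: Lam_proj[OF \<phi>])
  qed
  then show ?thesis unfolding regular_solution_def using L hdom_proj by blast
qed

context
  fixes B :: "'h \<times> 'h \<Rightarrow> 'g::{real_inner, complete_space}"
  assumes adm: "admissibility_hyp A B"
begin

lemma B_bounded:
  shows B_add: "x \<in> hdom A 2 \<Longrightarrow> y \<in> hdom A 2 \<Longrightarrow> B (x + y, x' + y') = B (x, x') + B (y, y')"
    and B_scaleR: "x \<in> hdom A 2 \<Longrightarrow> B (c *\<^sub>R x, c *\<^sub>R x') = c *\<^sub>R B (x, x')"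
    and B_bound: "\<exists>K\<ge>0. \<forall>x\<in>hdom A 2. \<forall>x'. norm (B (x, x')) \<le> K * sqrt ((norm (Lam 2 x))\<^sup>2 + (norm x')\<^sup>2)"
proof -
  have b: "bounded_op (hdom A 2 \<times> UNIV) (\<lambda>(u, v). sqrt ((hnorm A 2 u)\<^sup>2 + (norm v)\<^sup>2)) UNIV norm B"
    using adm unfolding admissibility_hyp_def by blast
  show "x \<in> hdom A 2 \<Longrightarrow> y \<in> hdom A 2 \<Longrightarrow> B (x + y, x' + y') = B (x, x') + B (y, y')"
    using b unfolding bounded_op_def by force
  show "x \<in> hdom A 2 \<Longrightarrow> B (c *\<^sub>R x, c *\<^sub>R x') = c *\<^sub>R B (x, x')"
    using b unfolding bounded_op_def by force
  obtain K where K: "\<forall>x\<in>hdom A 2 \<times> UNIV. norm (B x) \<le> K * (case x of (u, v) \<Rightarrow> sqrt ((hnorm A 2 u)\<^sup>2 + (norm v)\<^sup>2))"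
    using b unfolding bounded_op_def by blast
  show "\<exists>K\<ge>0. \<forall>x\<in>hdom A 2. \<forall>x'. norm (B (x, x')) \<le> K * sqrt ((norm (Lam 2 x))\<^sup>2 + (norm x')\<^sup>2)"
  proof (intro exI[of _ "max K 0"] conjI ballI allI)
    fix x x' assume "x \<in> hdom A 2"
    then have "norm (B (x, x')) \<le> K * sqrt ((norm (Lam 2 x))\<^sup>2 + (norm x')\<^sup>2)" using K unfolding hnorm_def by force
    also have "\<dots> \<le> max K 0 * sqrt ((norm (Lam 2 x))\<^sup>2 + (norm x')\<^sup>2)" by (intro mult_right_mono) auto
    finally show "norm (B (x, x')) \<le> max K 0 * sqrt ((norm (Lam 2 x))\<^sup>2 + (norm x')\<^sup>2)" .
  qed simp
qed

lemma B_diff: "x \<in> hdom A 2 \<Longrightarrow> y \<in> hdom A 2 \<Longrightarrow> B (x - y, x' - y') = B (x, x') - B (y, y')"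
  using B_add[of "x" "(-1) *\<^sub>R y" x' "(-1) *\<^sub>R y'"] B_scaleR[of y "-1" y'] hdom_scaleR[of y 2 "-1"] by simp

lemma B_sum: "B (\<Sum>j<N. a j *\<^sub>R e j, \<Sum>j<N. b j *\<^sub>R e j) = (\<Sum>j<N. a j *\<^sub>R B (e j, 0) + b j *\<^sub>R B (0, e j))"
proof (induction N)
  case 0
  show ?case using B_scaleR[of 0 0 0] by (simp add: hdom_zero)
next
  case (Suc N)
  have 1: "B (a N *\<^sub>R e N, b N *\<^sub>R e N) = a N *\<^sub>R B (e N, 0) + b N *\<^sub>R B (0, e N)"
    using B_add[of "a N *\<^sub>R e N" 0 0 "b N *\<^sub>R e N"] B_scaleR[of "e N" "a N" 0] B_scaleR[of 0 "b N" "e N"]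
    by (simp add: hdom_e hdom_zero hdom_scaleR)
  have "(\<Sum>j<N. a j *\<^sub>R e j) \<in> hdom A 2" by (rule LamI(1)[of "\<Sum>j<N. (r j powi 2 * a j) *\<^sub>R e j"]) (auto simp: inner_sum_e)
  then show ?case using B_add[of "\<Sum>j<N. a j *\<^sub>R e j" "a N *\<^sub>R e N" "\<Sum>j<N. b j *\<^sub>R e j" "b N *\<^sub>R e N"] Suc 1
    by (simp add: hdom_e hdom_scaleR)
qed

lemma B_proj: "B (proj N x, proj N y) = (\<Sum>j<N. (x \<bullet> e j) *\<^sub>R B (e j, 0) + (y \<bullet> e j) *\<^sub>R B (0, e j))"
  unfolding proj_def by (rule B_sum)

lemma regular_continuous:
  assumes "regular_solution A T u u' h" shows "continuous_on {0..T} (\<lambda>t. B (u t, u' t))"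
  unfolding continuous_on_def
proof
  fix t assume t: "t \<in> {0..T}"
  have u: "\<And>s. s \<in> {0..T} \<Longrightarrow> u s \<in> hdom A 2" "continuous_on {0..T} (\<lambda>t. Lam 2 (u t))" "continuous_on {0..T} u'"
    using assms wave_solution_continuous(2) unfolding regular_solution_def by blast+
  obtain K where K: "0 \<le> K" "\<And>x x'. x \<in> hdom A 2 \<Longrightarrow> norm (B (x, x')) \<le> K * sqrt ((norm (Lam 2 x))\<^sup>2 + (norm x')\<^sup>2)"
    using B_bound by blast
  define z where "z s = K * sqrt ((norm (Lam 2 (u s) - Lam 2 (u t)))\<^sup>2 + (norm (u' s - u' t))\<^sup>2)" for s
  have "(z \<longlongrightarrow> K * sqrt ((norm (Lam 2 (u t) - Lam 2 (u t)))\<^sup>2 + (norm (u' t - u' t))\<^sup>2)) (at t within {0..T})"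
    unfolding z_def using u(2,3) t unfolding continuous_on_def by (intro tendsto_intros) auto
  then have z0: "(z \<longlongrightarrow> 0) (at t within {0..T})" by simp
  show "((\<lambda>t. B (u t, u' t)) \<longlongrightarrow> B (u t, u' t)) (at t within {0..T})"
  proof (rule LIM_zero_cancel, rule Lim_null_comparison[OF _ z0])
    have "norm (B (u s, u' s) - B (u t, u' t)) \<le> z s" if "s \<in> {0..T}" for s
      unfolding z_def using K(2)[OF hdom_diff[OF u(1)[OF that] u(1)[OF t]], of "u' s - u' t"]
      by (simp only: B_diff[OF u(1)[OF that] u(1)[OF t]] Lam_diff[OF u(1)[OF that] u(1)[OF t]])
    then show "\<forall>\<^sub>F s in at t within {0..T}. norm (B (u s, u' s) - B (u t, u' t)) \<le> z s"
      unfolding eventually_at_filter by auto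
  qed
qed

lemma regular_is_observation:
  assumes "regular_solution A T u u' h" shows "is_observation A B T u u' h (\<lambda>t. B (u t, u' t))"
  unfolding is_observation_def
proof (intro conjI)
  show "wave_solution A T u u' h" using assms unfolding regular_solution_def by blast
  show "(\<lambda>t. B (u t, u' t)) \<in> L2 T" by (rule L2_continuous[OF regular_continuous[OF assms]])
  show "\<exists>v v' k. (\<forall>m::nat. regular_solution A T (v m) (v' m) (k m)) \<and>
      uniform_limit {0..T} (\<lambda>m t. Lam 1 (v m t)) (\<lambda>t. Lam 1 (u t)) sequentially \<and>
      uniform_limit {0..T} v' u' sequentially \<and>
      (\<lambda>m. LINT t:{0..T}|lebesgue. (norm (k m t - h t))\<^sup>2) \<longlonglongrightarrow> 0 \<and>
      (\<lambda>m. LINT t:{0..T}|lebesgue. (norm (B (v m t, v' m t) - B (u t, u' t)))\<^sup>2) \<longlonglongrightarrow> 0"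
    by (rule exI[of _ "\<lambda>_. u"], rule exI[of _ "\<lambda>_. u'"], rule exI[of _ "\<lambda>_. h"])
       (simp add: assms uniform_limit_const set_integral_lebesgue_on)
qed

text \<open>Admissibility in the form of continuity: a solution that is uniformly small in energy
  norm and has a small source has a small observation. It will be applied to differences of
  approximating solutions.\<close>

lemma admissibility_estimate:
  assumes T: "0 < T"
  obtains D where "0 < D" "\<And>u u' h \<eta>. regular_solution A T u u' h \<Longrightarrow> 0 \<le> \<eta> \<Longrightarrow>
    (\<And>t. t \<in> {0..T} \<Longrightarrow> norm (Lam 1 (u t)) \<le> \<eta>) \<Longrightarrow> (\<And>t. t \<in> {0..T} \<Longrightarrow> norm (u' t) \<le> \<eta>) \<Longrightarrow> norm2 T h \<le> \<eta> \<Longrightarrow>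
    norm2 T (\<lambda>t. B (u t, u' t)) \<le> D * \<eta>"
proof -
  obtain D0 where D0: "0 < D0" "\<And>w w' f g. wave_solution A T w w' f \<Longrightarrow> is_observation A B T w w' f g \<Longrightarrow>
        (LINT t:{0..T}|lebesgue. (norm (g t))\<^sup>2) \<le>
          D0 * (energy A 1 (w 0) (w' 0) + energy A 1 (w T) (w' T)
               + (LINT t:{0..T}|lebesgue. energy A 1 (w t) (w' t))
               + (LINT t:{0..T}|lebesgue. (norm (f t))\<^sup>2))"
    using adm T unfolding admissibility_hyp_def by meson
  show ?thesis
  \<comment> \<open>The two boundary energies and the source contribute at most
    \<open>\<eta>\<^sup>2\<close> each, and the time integral of the energy at most
    \<open>T * \<eta>\<^sup>2\<close>.\<close>
  proof (rule that[of "sqrt (D0 * (3 + T))"])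
    show "0 < sqrt (D0 * (3 + T))" using D0 T by simp
    fix u u' h \<eta>
    assume reg: "regular_solution A T u u' h" and \<eta>: "0 \<le> \<eta>"
      and u: "\<And>t. t \<in> {0..T} \<Longrightarrow> norm (Lam 1 (u t)) \<le> \<eta>" and u': "\<And>t. t \<in> {0..T} \<Longrightarrow> norm (u' t) \<le> \<eta>"
      and h: "norm2 T h \<le> \<eta>"
    have ws: "wave_solution A T u u' h" using reg unfolding regular_solution_def by blast
    note c = wave_solution_continuous[OF ws]
    have en: "energy A 1 (u t) (u' t) = ((norm (Lam 1 (u t)))\<^sup>2 + (norm (u' t))\<^sup>2) / 2" for t
      by (simp add: energy_def hnorm_def Lam_0)
    have e: "\<bar>energy A 1 (u t) (u' t)\<bar> \<le> \<eta>\<^sup>2" if "t \<in> {0..T}" for t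
      unfolding en using power_mono[OF u[OF that] norm_ge_zero, of 2] power_mono[OF u'[OF that] norm_ge_zero, of 2] by simp
    have "\<bar>LINT t:{0..T}|lebesgue. energy A 1 (u t) (u' t)\<bar> \<le> \<eta>\<^sup>2 * T"
    proof (rule LINT_abs_le[OF _ e])
      show "set_integrable lebesgue {0..T} (\<lambda>t. energy A 1 (u t) (u' t))"
        unfolding en by (intro set_integrable_continuous continuous_intros c) simp
    qed (use T in auto)
    moreover have "(LINT t:{0..T}|lebesgue. (norm (h t))\<^sup>2) \<le> \<eta>\<^sup>2"
      unfolding norm2_sq[symmetric] by (rule power_mono[OF h norm2_nonneg])
    moreover have "energy A 1 (u 0) (u' 0) \<le> \<eta>\<^sup>2" "energy A 1 (u T) (u' T) \<le> \<eta>\<^sup>2" using e[of 0] e[of T] T by auto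
    ultimately have "energy A 1 (u 0) (u' 0) + energy A 1 (u T) (u' T) + (LINT t:{0..T}|lebesgue. energy A 1 (u t) (u' t))
        + (LINT t:{0..T}|lebesgue. (norm (h t))\<^sup>2) \<le> (3 + T) * \<eta>\<^sup>2" by (simp add: algebra_simps)
    then have "D0 * (energy A 1 (u 0) (u' 0) + energy A 1 (u T) (u' T) + (LINT t:{0..T}|lebesgue. energy A 1 (u t) (u' t))
        + (LINT t:{0..T}|lebesgue. (norm (h t))\<^sup>2)) \<le> D0 * ((3 + T) * \<eta>\<^sup>2)" by (rule mult_left_mono) (use D0 in simp)
    with D0(2)[OF ws regular_is_observation[OF reg]]
    have "(norm2 T (\<lambda>t. B (u t, u' t)))\<^sup>2 \<le> D0 * ((3 + T) * \<eta>\<^sup>2)" unfolding norm2_sq by (rule order_trans)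
    also have "\<dots> = (sqrt (D0 * (3 + T)) * \<eta>)\<^sup>2" using D0 T by (simp add: power_mult_distrib)
    finally show "norm2 T (\<lambda>t. B (u t, u' t)) \<le> sqrt (D0 * (3 + T)) * \<eta>"
      by (rule power2_le_imp_le) (use D0 T \<eta> in simp)
  qed
qed

lemma truncation_limits:
  assumes T: "0 < T" and w: "wave_solution A T w w' f" and f: "continuous_on {0..T} f"
  shows "uniform_limit {0..T} (\<lambda>N t. Lam 1 (proj N (w t))) (\<lambda>t. Lam 1 (w t)) sequentially"
    "uniform_limit {0..T} (\<lambda>N t. proj N (w' t)) w' sequentially"
    "(\<lambda>N. norm2 T (\<lambda>t. proj N (f t) - f t)) \<longlonglongrightarrow> 0"
proof -
  note c = wave_solution_continuous[OF w]
  show "uniform_limit {0..T} (\<lambda>N t. Lam 1 (proj N (w t))) (\<lambda>t. Lam 1 (w t)) sequentially"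
    using proj_uniform_limit[OF c(3)]
    by (rule uniform_limit_cong'[THEN iffD1, rotated 2]) (simp_all add: Lam_proj c(4))
  show "uniform_limit {0..T} (\<lambda>N t. proj N (w' t)) w' sequentially" by (rule proj_uniform_limit[OF c(2)])
  show "(\<lambda>N. norm2 T (\<lambda>t. proj N (f t) - f t)) \<longlonglongrightarrow> 0"
    by (rule norm2_uniform_limit[OF T proj_uniform_limit[OF f]]) (intro L2_continuous continuous_proj f)+
qed

lemma is_observation_truncation:
  assumes T: "0 < T" and w: "wave_solution A T w w' f" and f: "continuous_on {0..T} f"
    and g: "g \<in> L2 T" "(\<lambda>N. norm2 T (\<lambda>t. B (proj N (w t), proj N (w' t)) - g t)) \<longlonglongrightarrow> 0"
  shows "is_observation A B T w w' f g"
  unfolding is_observation_def norm2_sq_tendsto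
proof (intro conjI w g(1))
  show "\<exists>u u' h. (\<forall>m::nat. regular_solution A T (u m) (u' m) (h m)) \<and>
      uniform_limit {0..T} (\<lambda>m t. Lam 1 (u m t)) (\<lambda>t. Lam 1 (w t)) sequentially \<and>
      uniform_limit {0..T} u' w' sequentially \<and> (\<lambda>m. norm2 T (\<lambda>t. h m t - f t)) \<longlonglongrightarrow> 0 \<and>
      (\<lambda>m. norm2 T (\<lambda>t. B (u m t, u' m t) - g t)) \<longlonglongrightarrow> 0"
    by (rule exI[of _ "\<lambda>N t. proj N (w t)"], rule exI[of _ "\<lambda>N t. proj N (w' t)"], rule exI[of _ "\<lambda>N t. proj N (f t)"])
       (intro conjI allI truncation_limits[OF T w f] regular_proj[OF w f] g(2))
qed

text \<open>Existence of the extension by density: the difference of two truncations is a regular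
  solution with small energy and source, so its observation is small and the observed truncations
  are Cauchy.\<close>

lemma truncation_converges:
  assumes T: "0 < T" and w: "wave_solution A T w w' f" and f: "continuous_on {0..T} f"
  obtains g where "g \<in> L2 T" "(\<lambda>N. norm2 T (\<lambda>t. B (proj N (w t), proj N (w' t)) - g t)) \<longlonglongrightarrow> 0"
proof -
  note tl = truncation_limits[OF T w f]
  obtain D where D: "0 < D" "\<And>u u' h \<eta>. regular_solution A T u u' h \<Longrightarrow> 0 \<le> \<eta> \<Longrightarrow>
    (\<And>t. t \<in> {0..T} \<Longrightarrow> norm (Lam 1 (u t)) \<le> \<eta>) \<Longrightarrow> (\<And>t. t \<in> {0..T} \<Longrightarrow> norm (u' t) \<le> \<eta>) \<Longrightarrow> norm2 T h \<le> \<eta> \<Longrightarrow>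
    norm2 T (\<lambda>t. B (u t, u' t)) \<le> D * \<eta>" by (rule admissibility_estimate[OF T]) blast
  have fL: "f \<in> L2 T" and pfL: "(\<lambda>t. proj N (f t)) \<in> L2 T" for N by (intro L2_continuous continuous_proj f)+
  have cau: "\<exists>K. \<forall>m\<ge>K. \<forall>k\<ge>K. norm2 T (\<lambda>t. B (proj m (w t), proj m (w' t)) - B (proj k (w t), proj k (w' t))) < \<epsilon>"
    if \<epsilon>: "0 < \<epsilon>" for \<epsilon>
  proof -
    \<comment> \<open>Two truncations each within \<open>\<eta>\<close> of the solution differ by at
      most \<open>2 * \<eta>\<close>, and \<open>D * (2 * \<eta>)\<close> is half of the
      tolerance.\<close>
    define \<eta> where "\<eta> = \<epsilon> / (4 * D)"
    have \<eta>: "0 < \<eta>" "D * (2 * \<eta>) < \<epsilon>" unfolding \<eta>_def using \<epsilon> D by auto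
    obtain K1 where K1: "\<And>N t. N \<ge> K1 \<Longrightarrow> t \<in> {0..T} \<Longrightarrow> dist (Lam 1 (proj N (w t))) (Lam 1 (w t)) < \<eta>"
      using uniform_limitD[OF tl(1) \<eta>(1)] unfolding eventually_sequentially by blast
    obtain K2 where K2: "\<And>N t. N \<ge> K2 \<Longrightarrow> t \<in> {0..T} \<Longrightarrow> dist (proj N (w' t)) (w' t) < \<eta>"
      using uniform_limitD[OF tl(2) \<eta>(1)] unfolding eventually_sequentially by blast
    obtain K3 where K3: "\<And>N. N \<ge> K3 \<Longrightarrow> norm2 T (\<lambda>t. proj N (f t) - f t) < \<eta>"
      using order_tendstoD(2)[OF tl(3) \<eta>(1)] unfolding eventually_sequentially by blast
    have "norm2 T (\<lambda>t. B (proj m (w t), proj m (w' t)) - B (proj k (w t), proj k (w' t))) < \<epsilon>"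
      if m: "m \<ge> K1 + K2 + K3" and k: "k \<ge> K1 + K2 + K3" for m k
    proof -
      have "norm2 T (\<lambda>t. B (proj m (w t) - proj k (w t), proj m (w' t) - proj k (w' t))) \<le> D * (2 * \<eta>)"
      proof (rule D(2)[OF regular_diff[OF regular_proj[OF w f] regular_proj[OF w f]]])
        show "norm (Lam 1 (proj m (w t) - proj k (w t))) \<le> 2 * \<eta>" if t: "t \<in> {0..T}" for t
          using K1[of m t] K1[of k t] m k t dist_triangle2[of "Lam 1 (proj m (w t))" "Lam 1 (proj k (w t))" "Lam 1 (w t)"]
          by (simp add: Lam_diff hdom_proj dist_norm)
        show "norm (proj m (w' t) - proj k (w' t)) \<le> 2 * \<eta>" if t: "t \<in> {0..T}" for t
          using K2[of m t] K2[of k t] m k t dist_triangle2[of "proj m (w' t)" "proj k (w' t)" "w' t"]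
          by (simp add: dist_norm)
        show "norm2 T (\<lambda>t. proj m (f t) - proj k (f t)) \<le> 2 * \<eta>"
          using norm2_triangle_diff[OF pfL fL pfL, of m k] K3[of m] K3[of k] m k norm2_minus_commute[of T f "\<lambda>t. proj k (f t)"]
          by simp
      qed (use \<eta> in simp)
      then show ?thesis using \<eta>(2) by (simp add: B_diff hdom_proj)
    qed
    then show ?thesis by blast
  qed
  show ?thesis
    by (rule L2_complete_continuous[OF T regular_continuous[OF regular_proj[OF w f]] cau]) (assumption | rule that)+
qed

text \<open>Independence of the approximating sequence: whichever regular solutions define the
  observation, their difference to the truncations is small in energy norm, so the observed
  truncations have the same limit. An observation is thus a limit of finite modal sums.\<close>

lemma is_observation_converges:
  assumes T: "0 < T" and w: "wave_solution A T w w' f" and f: "continuous_on {0..T} f"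
    and g: "is_observation A B T w w' f g"
  shows "(\<lambda>N. norm2 T (\<lambda>t. B (proj N (w t), proj N (w' t)) - g t)) \<longlonglongrightarrow> 0"
proof -
  note tl = truncation_limits[OF T w f]
  obtain D where D: "0 < D" "\<And>u u' h \<eta>. regular_solution A T u u' h \<Longrightarrow> 0 \<le> \<eta> \<Longrightarrow>
    (\<And>t. t \<in> {0..T} \<Longrightarrow> norm (Lam 1 (u t)) \<le> \<eta>) \<Longrightarrow> (\<And>t. t \<in> {0..T} \<Longrightarrow> norm (u' t) \<le> \<eta>) \<Longrightarrow> norm2 T h \<le> \<eta> \<Longrightarrow>
    norm2 T (\<lambda>t. B (u t, u' t)) \<le> D * \<eta>" by (rule admissibility_estimate[OF T]) blast
  obtain u u' h where u: "\<And>m. regular_solution A T (u m) (u' m) (h m)"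
    "uniform_limit {0..T} (\<lambda>m t. Lam 1 (u m t)) (\<lambda>t. Lam 1 (w t)) sequentially"
    "uniform_limit {0..T} u' w' sequentially"
    "(\<lambda>m. norm2 T (\<lambda>t. h m t - f t)) \<longlonglongrightarrow> 0" "(\<lambda>m. norm2 T (\<lambda>t. B (u m t, u' m t) - g t)) \<longlonglongrightarrow> 0"
    and gL: "g \<in> L2 T"
    using g unfolding is_observation_def norm2_sq_tendsto by blast
  have fL: "f \<in> L2 T" and pfL: "(\<lambda>t. proj N (f t)) \<in> L2 T" for N by (intro L2_continuous continuous_proj f)+
  have hL: "h m \<in> L2 T" for m using u(1)[of m] wave_solution_L2 unfolding regular_solution_def by blast
  have uL: "(\<lambda>t. B (u m t, u' m t)) \<in> L2 T" for m by (rule L2_continuous[OF regular_continuous[OF u(1)]])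
  have pL: "(\<lambda>t. B (proj m (w t), proj m (w' t))) \<in> L2 T" for m
    by (rule L2_continuous[OF regular_continuous[OF regular_proj[OF w f]]])
  have h2: "u m t \<in> hdom A 2" if "t \<in> {0..T}" for m t using u(1)[of m] that unfolding regular_solution_def by blast
  have d0: "(\<lambda>m. norm2 T (\<lambda>t. B (proj m (w t), proj m (w' t)) - B (u m t, u' m t))) \<longlonglongrightarrow> 0"
  proof (rule LIMSEQ_I)
    fix \<epsilon> :: real assume \<epsilon>: "0 < \<epsilon>"
    define \<eta> where "\<eta> = \<epsilon> / (4 * D)"
    have \<eta>: "0 < \<eta>" "D * (2 * \<eta>) < \<epsilon>" unfolding \<eta>_def using \<epsilon> D by auto
    have "\<forall>\<^sub>F m in sequentially. norm2 T (\<lambda>t. B (proj m (w t), proj m (w' t)) - B (u m t, u' m t)) < \<epsilon>"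
      using uniform_limitD[OF tl(1) \<eta>(1)] uniform_limitD[OF tl(2) \<eta>(1)] order_tendstoD(2)[OF tl(3) \<eta>(1)]
        uniform_limitD[OF u(2) \<eta>(1)] uniform_limitD[OF u(3) \<eta>(1)] order_tendstoD(2)[OF u(4) \<eta>(1)]
    proof eventually_elim
      case (elim m)
      have hd1: "u m t \<in> hdom A 1" if "t \<in> {0..T}" for t using hdom_le(1)[of 1 2] h2[OF that] by simp
      have "norm2 T (\<lambda>t. B (proj m (w t) - u m t, proj m (w' t) - u' m t)) \<le> D * (2 * \<eta>)"
      proof (rule D(2)[OF regular_diff[OF regular_proj[OF w f] u(1)]])
        show "norm (Lam 1 (proj m (w t) - u m t)) \<le> 2 * \<eta>" if t: "t \<in> {0..T}" for t
          using elim(1,4) t dist_triangle2[of "Lam 1 (proj m (w t))" "Lam 1 (u m t)" "Lam 1 (w t)"]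
          by (fastforce simp: Lam_diff hdom_proj hd1 dist_norm)
        show "norm (proj m (w' t) - u' m t) \<le> 2 * \<eta>" if t: "t \<in> {0..T}" for t
          using elim(2,5) t dist_triangle2[of "proj m (w' t)" "u' m t" "w' t"]
          by (fastforce simp: dist_norm)
        show "norm2 T (\<lambda>t. proj m (f t) - h m t) \<le> 2 * \<eta>"
          using norm2_triangle_diff[OF pfL fL hL, of m m] elim(3,6) norm2_minus_commute[of T f "h m"] by simp
      qed (use \<eta> in simp)
      moreover have "norm2 T (\<lambda>t. B (proj m (w t), proj m (w' t)) - B (u m t, u' m t))
          = norm2 T (\<lambda>t. B (proj m (w t) - u m t, proj m (w' t) - u' m t))"
      proof -
        have "(LINT t:{0..T}|lebesgue. (norm (B (proj m (w t), proj m (w' t)) - B (u m t, u' m t)))\<^sup>2)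
            = (LINT t:{0..T}|lebesgue. (norm (B (proj m (w t) - u m t, proj m (w' t) - u' m t)))\<^sup>2)"
          by (rule set_lebesgue_integral_cong) (simp_all add: B_diff hdom_proj h2)
        then show ?thesis by (simp add: norm2_def)
      qed
      ultimately show ?case using \<eta>(2) by simp
    qed
    then show "\<exists>K. \<forall>m\<ge>K. norm (norm2 T (\<lambda>t. B (proj m (w t), proj m (w' t)) - B (u m t, u' m t)) - 0) < \<epsilon>"
      unfolding eventually_sequentially by (simp add: norm2_nonneg)
  qed
  have s0: "(\<lambda>m. norm2 T (\<lambda>t. B (proj m (w t), proj m (w' t)) - B (u m t, u' m t)) + norm2 T (\<lambda>t. B (u m t, u' m t) - g t)) \<longlonglongrightarrow> 0"
    using tendsto_add[OF d0 u(5)] by simp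
  show ?thesis
    by (rule Lim_null_comparison[OF _ s0]) (simp add: norm2_nonneg norm2_triangle_diff[OF pL uL gL])
qed

end

end

section \<open>The transposition identity in normalised coordinates\<close>

lemma telescope_1: "(\<Sum>k=1..n. \<Theta> k - \<Theta> (Suc k)) = \<Theta> 1 - \<Theta> (Suc n)" for \<Theta> :: "nat \<Rightarrow> real"
  by (induction n) auto

lemma norm2_cong: "(\<And>t. t \<in> {0..T} \<Longrightarrow> f t = g t) \<Longrightarrow> norm2 T f = norm2 T g"
  unfolding norm2_def by (intro arg_cong[where f=sqrt] set_lebesgue_integral_cong) auto

context eigenbasis
begin

lemma dual_Lam: "x \<in> hdom A q \<Longrightarrow> \<phi> \<in> hdom A (- q) \<Longrightarrow> dual q (Lam q x) \<phi> = x \<bullet> \<phi>"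
  using Lam_Lam_neg[of \<phi> "- q"] Lam_sym[of x q "Lam (- q) \<phi>"] by (simp add: dual_def)

context
  fixes n :: nat and s :: int and C :: "nat \<Rightarrow> 'h \<Rightarrow> 'h" and T :: real
  assumes T: "0 < T" and n: "2 \<le> n" and s: "0 \<le> s" "s \<le> 1"
    and coupling_linear: "\<And>i. i \<in> {2..n} \<Longrightarrow> bounded_linear (C i)"
    and coupling_adjoint: "\<And>i k. i \<in> {2..n} \<Longrightarrow> k \<in> {0..int n - int i + 1} \<Longrightarrow>
        bounded_op (hdom A k) (hnorm A k) (hdom A k) (hnorm A k) (adjoint (C i))"
begin

text \<open>The coupling \<open>C\<^sub>k\<^sup>*\<close> in the coordinates \<open>c\<^sub>k\<close> with \<open>y\<^sub>k = dual (n - k + s) c\<^sub>k\<close>;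
  \<open>s = 1\<close> is case (i), \<open>s = 0\<close> is case (ii).\<close>

definition Rop :: "nat \<Rightarrow> 'h \<Rightarrow> 'h" where
  "Rop k x = Lam (int n - int k + s) (adjoint (C k) (Lam (int k - int n - s) x))"

lemma bounded_linear_Rop:
  assumes k: "k \<in> {2..n}" shows "bounded_linear (Rop k)"
proof -
  define q where "q = int n - int k + s"
  have q: "0 \<le> q" "q \<in> {0..int n - int k + 1}" "int k - int n - s = - q" using k s by (auto simp: q_def)
  have bo: "bounded_op (hdom A q) (hnorm A q) (hdom A q) (hnorm A q) (adjoint (C k))" by (rule coupling_adjoint[OF k q(2)])
  have in1: "x \<in> hdom A q \<Longrightarrow> adjoint (C k) x \<in> hdom A q" for x using bo unfolding bounded_op_def by blast
  have add: "x \<in> hdom A q \<Longrightarrow> y \<in> hdom A q \<Longrightarrow> adjoint (C k) (x + y) = adjoint (C k) x + adjoint (C k) y" for x y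
    using bo unfolding bounded_op_def by blast
  have scl: "x \<in> hdom A q \<Longrightarrow> adjoint (C k) (c *\<^sub>R x) = c *\<^sub>R adjoint (C k) x" for x c
    using bo unfolding bounded_op_def by blast
  obtain K where K: "\<And>x. x \<in> hdom A q \<Longrightarrow> norm (Lam q (adjoint (C k) x)) \<le> K * norm (Lam q x)"
    using bo unfolding bounded_op_def hnorm_def by blast
  have L: "Lam (- q) x \<in> hdom A q" for x by (rule Lam_neg_in[OF q(1)])
  have Ln: "Lam (- q) (x + y) = Lam (- q) x + Lam (- q) y" "Lam (- q) (c *\<^sub>R x) = c *\<^sub>R Lam (- q) x" for x y c
    using q(1) by (simp_all add: Lam_add Lam_scaleR hdom_nonpos)
  have R: "Rop k x = Lam q (adjoint (C k) (Lam (- q) x))" for x unfolding Rop_def q(3)[symmetric] by (simp add: q_def)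
  show ?thesis
  proof (rule bounded_linear_intro[where K=K])
    show "Rop k (x + y) = Rop k x + Rop k y" for x y unfolding R Ln by (simp add: add L Lam_add in1)
    show "Rop k (c *\<^sub>R x) = c *\<^sub>R Rop k x" for c x unfolding R Ln by (simp add: scl L Lam_scaleR in1)
    show "norm (Rop k x) \<le> norm x * K" for x
      using K[OF L, of x] unfolding R by (simp add: Lam_neg_Lam[OF q(1)] mult.commute)
  qed
qed

lemma Rop_e:
  assumes k: "k \<in> {2..n}"
  shows "r j powi (int k - int n - s) * (x \<bullet> Lam (int n - int k + s) (adjoint (C k) (e j))) = x \<bullet> Rop k (e j)"
proof -
  define q where "q = int n - int k + s"
  have q: "q \<in> {0..int n - int k + 1}" "int k - int n - s = - q" using k s by (auto simp: q_def)
  have bo: "bounded_op (hdom A q) (hnorm A q) (hdom A q) (hnorm A q) (adjoint (C k))" by (rule coupling_adjoint[OF k q(1)])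
  have "adjoint (C k) (e j) \<in> hdom A q" using bo hdom_e unfolding bounded_op_def by blast
  moreover have "adjoint (C k) (c *\<^sub>R e j) = c *\<^sub>R adjoint (C k) (e j)" for c
    using bo hdom_e unfolding bounded_op_def by blast
  ultimately show ?thesis unfolding Rop_def q(2) q_def[symmetric] by (simp add: Lam_e Lam_scaleR)
qed

text \<open>Position and velocity coordinates of the dual system, both with values in H. The
  coupling enters transposed: the inner product with \<open>Rop k (e j)\<close> is the
  \<open>j\<close>-th coordinate of the adjoint of \<open>Rop k\<close> applied to
  \<open>a (k - 1)\<close>, which is the form that cancels against the control system.\<close>

definition normal_dual :: "(nat \<Rightarrow> real \<Rightarrow> 'h) \<Rightarrow> (nat \<Rightarrow> real \<Rightarrow> 'h) \<Rightarrow> bool" where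
  "normal_dual a b \<longleftrightarrow> (\<forall>k\<in>{1..n}. continuous_on {0..T} (a k) \<and> continuous_on {0..T} (b k) \<and>
     (\<forall>j. \<forall>t\<in>{0..T}. ((\<lambda>t. a k t \<bullet> e j) has_real_derivative r j * (b k t \<bullet> e j)) (at t within {0..T}) \<and>
       ((\<lambda>t. b k t \<bullet> e j) has_real_derivative - r j * (a k t \<bullet> e j)
          + (if k = 1 then 0 else - (a (k - 1) t \<bullet> Rop k (e j)))) (at t within {0..T})))"

lemma normal_dualD:
  assumes "normal_dual a b" "k \<in> {1..n}"
  shows "continuous_on {0..T} (a k)" "continuous_on {0..T} (b k)"
    "t \<in> {0..T} \<Longrightarrow> ((\<lambda>t. a k t \<bullet> e j) has_real_derivative r j * (b k t \<bullet> e j)) (at t within {0..T})"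
    "t \<in> {0..T} \<Longrightarrow> ((\<lambda>t. b k t \<bullet> e j) has_real_derivative - r j * (a k t \<bullet> e j)
          + (if k = 1 then 0 else - (a (k - 1) t \<bullet> Rop k (e j)))) (at t within {0..T})"
  using assms unfolding normal_dual_def by blast+

lemma Rop_last: "s = 0 \<Longrightarrow> Rop n x = adjoint (C n) x"
  unfolding Rop_def by (simp add: Lam_0)

text \<open>Eigenvectors are test vectors of every order, so both weak equations may be tested with
  \<open>e j\<close>. Multiplying by the power of \<open>r j\<close> that belongs to the order of
  the component turns values of functionals into coordinates in H.\<close>

lemma dual_solution_normal:
  assumes ds: "dual_solution A n s C T w w'"
  obtains a b where "normal_dual a b"
    "\<And>k t. k \<in> {1..n} \<Longrightarrow> t \<in> {0..T} \<Longrightarrow> w k t = dual (int k - int n - s + 1) (a k t)"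
    "\<And>k t. k \<in> {1..n} \<Longrightarrow> t \<in> {0..T} \<Longrightarrow> w' k t = dual (int k - int n - s) (b k t)"
proof -
  note D = ds[unfolded dual_solution_def]
  have "\<forall>k\<in>{1..n}. \<exists>x. continuous_on {0..T} x \<and> (\<forall>t\<in>{0..T}. w k t = dual (int k - int n - s + 1) (x t))"
    using D Hs_continuousE by (metis (no_types, lifting))
  then obtain a where a: "\<And>k. k \<in> {1..n} \<Longrightarrow> continuous_on {0..T} (a k)"
    "\<And>k t. k \<in> {1..n} \<Longrightarrow> t \<in> {0..T} \<Longrightarrow> w k t = dual (int k - int n - s + 1) (a k t)" by metis
  have "\<forall>k\<in>{1..n}. \<exists>x. continuous_on {0..T} x \<and> (\<forall>t\<in>{0..T}. w' k t = dual (int k - int n - s) (x t))"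
    using D Hs_continuousE by (metis (no_types, lifting))
  then obtain b where b: "\<And>k. k \<in> {1..n} \<Longrightarrow> continuous_on {0..T} (b k)"
    "\<And>k t. k \<in> {1..n} \<Longrightarrow> t \<in> {0..T} \<Longrightarrow> w' k t = dual (int k - int n - s) (b k t)" by metis
  have pw: "r j powi (x + y) = r j powi x * r j powi y" for j x y
    using r_pos[of j] by (intro power_int_add) auto
  have "normal_dual a b"
    unfolding normal_dual_def
  proof (intro ballI conjI allI a b)
    fix k j t assume k: "k \<in> {1..n}" and t: "t \<in> {0..T}"
    define m where "m = int k - int n - s"
    have wa: "r j powi (m + 1) * w k t (e j) = a k t \<bullet> e j" if "t \<in> {0..T}" for t
      using a(2)[OF k that] pw[of j "m + 1" "- (m + 1)"] unfolding m_def[symmetric] by (simp add: dual_e mult.assoc[symmetric])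
    have wb: "r j powi m * w' k t (e j) = b k t \<bullet> e j" if "t \<in> {0..T}" for t
      using b(2)[OF k that] pw[of j "m" "- m"] unfolding m_def[symmetric] by (simp add: dual_e mult.assoc[symmetric])
    have r1: "r j powi (m + 1) = r j * r j powi m" using pw[of j 1 m] by (simp add: add.commute)
    have Dk: "((\<lambda>t. w k t \<phi>) has_real_derivative w' k t \<phi>) (at t within {0..T})" if "\<phi> \<in> hdom A (int n - int k + s)" for \<phi>
      using D k t that by blast
    have "((\<lambda>t. r j powi (m + 1) * w k t (e j)) has_real_derivative r j powi (m + 1) * w' k t (e j)) (at t within {0..T})"
      by (rule DERIV_cmult[OF Dk[OF hdom_e]])
    moreover have "r j powi (m + 1) * w' k t (e j) = r j * (b k t \<bullet> e j)" unfolding r1 using wb[OF t] by (simp add: mult.assoc)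
    ultimately have "((\<lambda>t. r j powi (m + 1) * w k t (e j)) has_real_derivative r j * (b k t \<bullet> e j)) (at t within {0..T})" by simp
    then show "((\<lambda>t. a k t \<bullet> e j) has_real_derivative r j * (b k t \<bullet> e j)) (at t within {0..T})"
      by (rule has_field_derivative_transform_within[OF _ zero_less_one t]) (rule wa)
    define G where "G = (if k = 1 then 0 else - (a (k - 1) t \<bullet> Rop k (e j)))"
    have "((\<lambda>t. w' k t (e j)) has_real_derivative
        - w k t (app A (e j)) - (if k = 1 then 0 else w (k - 1) t (adjoint (C k) (e j)))) (at t within {0..T})"
      using D k t hdom_e by blast
    from DERIV_cmult[OF this, of "r j powi m"]
    have "((\<lambda>t. r j powi m * w' k t (e j)) has_real_derivative
        r j powi m * (- w k t (app A (e j)) - (if k = 1 then 0 else w (k - 1) t (adjoint (C k) (e j))))) (at t within {0..T})" .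
    moreover have "r j powi m * w k t (app A (e j)) = r j * (a k t \<bullet> e j)"
    proof -
      have "app A (e j) = (r j)\<^sup>2 *\<^sub>R e j" by (rule self_adjoint_app[OF sa eig])
      moreover have "w k t ((r j)\<^sup>2 *\<^sub>R e j) = (r j)\<^sup>2 * w k t (e j)"
        unfolding a(2)[OF k t] dual_def by (simp add: hdom_e hdom_scaleR Lam_scaleR)
      ultimately show ?thesis using wa[OF t] r1 by (simp add: power2_eq_square algebra_simps)
    qed
    moreover have "r j powi m * (if k = 1 then 0 else w (k - 1) t (adjoint (C k) (e j))) = - G"
    proof (cases "k = 1")
      case False
      then have k2: "k \<in> {2..n}" and k1: "k - 1 \<in> {1..n}" and ik: "int (k - 1) = int k - 1" using k by auto
      have o: "- (int k - 1 - int n - s + 1) = int n - int k + s" by simp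
      have "int n - int k + s \<in> {0..int n - int k + 1}" using k s by auto
      from coupling_adjoint[OF k2 this] have "adjoint (C k) (e j) \<in> hdom A (int n - int k + s)"
        using hdom_e unfolding bounded_op_def by blast
      then have "w (k - 1) t (adjoint (C k) (e j)) = a (k - 1) t \<bullet> Lam (int n - int k + s) (adjoint (C k) (e j))"
        unfolding a(2)[OF k1 t] dual_def ik o by simp
      then show ?thesis using Rop_e[OF k2, of j "a (k - 1) t"] False unfolding G_def m_def by simp
    qed (simp add: G_def)
    ultimately have "((\<lambda>t. r j powi m * w' k t (e j)) has_real_derivative - r j * (a k t \<bullet> e j) + G) (at t within {0..T})"
      by (simp add: right_diff_distrib)
    then show "((\<lambda>t. b k t \<bullet> e j) has_real_derivative - r j * (a k t \<bullet> e j)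
          + (if k = 1 then 0 else - (a (k - 1) t \<bullet> Rop k (e j)))) (at t within {0..T})"
      unfolding G_def by (rule has_field_derivative_transform_within[OF _ zero_less_one t]) (rule wb)
  qed
  then show ?thesis using that a b by blast
qed

text \<open>Sources are given coordinate by coordinate, because for an unbounded control operator
  the term \<open>B_n v\<close> is not a vector of the space in which the normalised equation
  lives.\<close>

definition control_source :: "(real \<Rightarrow> 'g::real_inner) \<Rightarrow> (nat \<Rightarrow> 'g) \<Rightarrow> (nat \<Rightarrow> real \<Rightarrow> 'h) \<Rightarrow> nat \<Rightarrow> nat \<Rightarrow> real \<Rightarrow> real" where
  "control_source v \<gamma> c k j t = (if k = n then v t \<bullet> \<gamma> j else (- Rop (Suc k) (c (Suc k) t)) \<bullet> e j)"

lemma Rop_proj_tendsto: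
  assumes k: "k \<in> {2..n}" and x: "continuous_on {0..T} x" and y: "continuous_on {0..T} y" and t: "t \<in> {0..T}"
  shows "(\<lambda>N. LINT u:{0..t}|lebesgue. x u \<bullet> Rop k (proj N (y u))) \<longlonglongrightarrow> (LINT u:{0..t}|lebesgue. x u \<bullet> Rop k (y u))"
    "(\<lambda>N. LINT u:{0..t}|lebesgue. proj N (x u) \<bullet> Rop k (y u)) \<longlonglongrightarrow> (LINT u:{0..t}|lebesgue. x u \<bullet> Rop k (y u))"
proof -
  interpret R: bounded_linear "Rop k" by (rule bounded_linear_Rop[OF k])
  have tt: "0 \<le> (0::real)" "t \<le> T" using t by auto
  have yl: "uniform_limit {0..T} (\<lambda>N u. Rop k (proj N (y u))) (\<lambda>u. Rop k (y u)) sequentially"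
    by (rule R.uniform_limit[OF proj_uniform_limit[OF y]])
  have "(\<lambda>N. norm2 T (\<lambda>u. Rop k (proj N (y u)) - Rop k (y u))) \<longlonglongrightarrow> 0"
    by (rule norm2_uniform_limit[OF T yl]) (intro L2_continuous R.continuous_on continuous_proj y)+
  from inner2_tendsto[OF _ _ this L2_continuous[OF x] tt]
  show "(\<lambda>N. LINT u:{0..t}|lebesgue. x u \<bullet> Rop k (proj N (y u))) \<longlonglongrightarrow> (LINT u:{0..t}|lebesgue. x u \<bullet> Rop k (y u))"
    by (simp add: inner_commute[of "x _"] L2_continuous R.continuous_on continuous_proj y)
  have "(\<lambda>N. norm2 T (\<lambda>u. proj N (x u) - x u)) \<longlonglongrightarrow> 0"
    by (rule norm2_uniform_limit[OF T proj_uniform_limit[OF x]]) (intro L2_continuous continuous_proj x)+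
  from inner2_tendsto[OF _ _ this L2_continuous[OF R.continuous_on[OF y]] tt]
  show "(\<lambda>N. LINT u:{0..t}|lebesgue. proj N (x u) \<bullet> Rop k (y u)) \<longlonglongrightarrow> (LINT u:{0..t}|lebesgue. x u \<bullet> Rop k (y u))"
    by (simp add: L2_continuous continuous_proj x)
qed

text \<open>Each mode of each equation is tested with the dual coordinates and the result is summed
  over modes by Parseval. The coupling in equation \<open>k\<close> of the dual system and the one
  in equation \<open>k - 1\<close> of the control system are the same integral with opposite roles,
  so they cancel in the sum over \<open>k\<close> and only the control term survives.\<close>

lemma transposition_identity:
  assumes v: "v \<in> L2 T" and ev: "\<And>k. k \<in> {1..n} \<Longrightarrow> evolution T (control_source v \<gamma> c k) (c k) (d k)"
    and ab: "normal_dual a b" and g: "g \<in> L2 T"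
    and lim: "(\<lambda>N. norm2 T (\<lambda>t. (\<Sum>j<N. (a n t \<bullet> e j) *\<^sub>R \<gamma> j) - g t)) \<longlonglongrightarrow> 0" and t: "t \<in> {0..T}"
  shows "(LINT u:{0..t}|lebesgue. v u \<bullet> g u) =
     (\<Sum>k=1..n. d k t \<bullet> a k t - c k t \<bullet> b k t) - (\<Sum>k=1..n. d k 0 \<bullet> a k 0 - c k 0 \<bullet> b k 0)"
proof -
  have tt: "0 \<le> (0::real)" "t \<le> T" using t by auto
  have cc: "continuous_on {0..T} (c k)" "continuous_on {0..T} (d k)" if "k \<in> {1..n}" for k
    using ev[OF that] unfolding evolution_def by blast+
  have ac: "continuous_on {0..T} (a k)" "continuous_on {0..T} (b k)" if "k \<in> {1..n}" for k
    using normal_dualD(1,2)[OF ab that] by blast+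
  note abd = normal_dualD(3,4)[OF ab]
  \<comment> \<open>The coupling integral between components \<open>k - 1\<close> and
    \<open>k\<close>. There is none below the first component, and the value beyond the last one
    stores minus the control term, so that the sum telescopes to it.\<close>
  define \<Theta> where "\<Theta> k = (if k = 1 then 0 else if k \<le> n then LINT u:{0..t}|lebesgue. a (k - 1) u \<bullet> Rop k (c k u)
      else - (LINT u:{0..t}|lebesgue. v u \<bullet> g u))" for k
  have main: "(d k t \<bullet> a k t - c k t \<bullet> b k t) - (d k 0 \<bullet> a k 0 - c k 0 \<bullet> b k 0) = \<Theta> k - \<Theta> (Suc k)"
    if k: "k \<in> {1..n}" for k
  proof -
    define G where "G j u = (if k = 1 then 0 else - (a (k - 1) u \<bullet> Rop k (e j)))" for j u
    have k1: "k \<noteq> 1 \<Longrightarrow> k - 1 \<in> {1..n}" "k \<noteq> 1 \<Longrightarrow> k \<in> {2..n}" using k by auto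
    have Gc: "continuous_on {0..T} (G j)" for j
    proof (cases "k = 1")
      case False
      then have "continuous_on {0..T} (\<lambda>u. - (a (k - 1) u \<bullet> Rop k (e j)))" by (intro continuous_intros ac k1)
      then show ?thesis using False by (simp add: G_def)
    qed (simp add: G_def)
    have ej: "(d k t \<bullet> e j) * (a k t \<bullet> e j) - (c k t \<bullet> e j) * (b k t \<bullet> e j) - ((d k 0 \<bullet> e j) * (a k 0 \<bullet> e j) - (c k 0 \<bullet> e j) * (b k 0 \<bullet> e j))
        = (LINT u:{0..t}|lebesgue. control_source v \<gamma> c k j u * (a k u \<bullet> e j)) - (LINT u:{0..t}|lebesgue. (c k u \<bullet> e j) * G j u)" for j
    proof -
      have "\<forall>j a b G. continuous_on {0..T} G \<and> (\<forall>s\<in>{0..T}. (a has_real_derivative r j * b s) (at s within {0..T})) \<and>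
        (\<forall>s\<in>{0..T}. (b has_real_derivative - r j * a s + G s) (at s within {0..T})) \<longrightarrow>
        (\<forall>t\<in>{0..T}. (d k t \<bullet> e j) * a t - (c k t \<bullet> e j) * b t = (d k 0 \<bullet> e j) * a 0 - (c k 0 \<bullet> e j) * b 0
           + (LINT s:{0..t}|lebesgue. control_source v \<gamma> c k j s * a s) - (LINT s:{0..t}|lebesgue. (c k s \<bullet> e j) * G s))"
        using ev[OF k] unfolding evolution_def by blast
      from this[rule_format, of "G j" "\<lambda>t. a k t \<bullet> e j" j "\<lambda>t. b k t \<bullet> e j" t]
      have "(d k t \<bullet> e j) * (a k t \<bullet> e j) - (c k t \<bullet> e j) * (b k t \<bullet> e j) = (d k 0 \<bullet> e j) * (a k 0 \<bullet> e j) - (c k 0 \<bullet> e j) * (b k 0 \<bullet> e j)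
        + (LINT u:{0..t}|lebesgue. control_source v \<gamma> c k j u * (a k u \<bullet> e j)) - (LINT u:{0..t}|lebesgue. (c k u \<bullet> e j) * G j u)"
        using Gc abd[OF k] t unfolding G_def by blast
      then show ?thesis by linarith
    qed
    have sumlim: "(\<lambda>N. \<Sum>j<N. (d k t \<bullet> e j) * (a k t \<bullet> e j) - (c k t \<bullet> e j) * (b k t \<bullet> e j) - ((d k 0 \<bullet> e j) * (a k 0 \<bullet> e j) - (c k 0 \<bullet> e j) * (b k 0 \<bullet> e j)))
        \<longlonglongrightarrow> (d k t \<bullet> a k t - c k t \<bullet> b k t) - (d k 0 \<bullet> a k 0 - c k 0 \<bullet> b k 0)"
      using sums_diff[OF sums_diff[OF inner_sums[of "d k t" "a k t"] inner_sums[of "c k t" "b k t"]]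
          sums_diff[OF inner_sums[of "d k 0" "a k 0"] inner_sums[of "c k 0" "b k 0"]]]
      unfolding sums_def .
    have L1: "(\<lambda>N. \<Sum>j<N. LINT u:{0..t}|lebesgue. (c k u \<bullet> e j) * G j u) \<longlonglongrightarrow> - \<Theta> k"
    proof (cases "k = 1")
      case False
      interpret R: bounded_linear "Rop k" by (rule bounded_linear_Rop[OF k1(2)[OF False]])
      have "(\<Sum>j<N. LINT u:{0..t}|lebesgue. (c k u \<bullet> e j) * G j u) = - (LINT u:{0..t}|lebesgue. a (k - 1) u \<bullet> Rop k (proj N (c k u)))" for N
      proof -
        have "(\<Sum>j<N. LINT u:{0..t}|lebesgue. (c k u \<bullet> e j) * G j u) = (LINT u:{0..t}|lebesgue. (\<Sum>j<N. (c k u \<bullet> e j) * G j u))"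
          by (intro LINT_sum[symmetric] set_integrable_continuous_sub[where T=T] continuous_intros cc k Gc tt)
        also have "\<dots> = (LINT u:{0..t}|lebesgue. - (a (k - 1) u \<bullet> Rop k (proj N (c k u))))"
          unfolding proj_def R.sum R.scaleR G_def using False by (simp add: inner_sum_right sum_negf)
        finally show ?thesis by (simp add: set_lebesgue_integral_def)
      qed
      then show ?thesis
        using tendsto_minus[OF Rop_proj_tendsto(1)[OF k1(2)[OF False] ac(1)[OF k1(1)[OF False]] cc(1)[OF k] t]] False k
        by (simp add: \<Theta>_def)
    qed (simp add: \<Theta>_def G_def set_lebesgue_integral_def)
    have L2: "(\<lambda>N. \<Sum>j<N. LINT u:{0..t}|lebesgue. control_source v \<gamma> c k j u * (a k u \<bullet> e j)) \<longlonglongrightarrow> - \<Theta> (Suc k)"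
    proof (cases "k = n")
      case True
      have aL: "(\<lambda>u. (a n u \<bullet> e j) *\<^sub>R \<gamma> j) \<in> L2 T" for j
        using ac(1)[OF k] True by (intro L2_continuous continuous_intros) simp
      have "(\<Sum>j<N. LINT u:{0..t}|lebesgue. control_source v \<gamma> c k j u * (a k u \<bullet> e j))
          = (LINT u:{0..t}|lebesgue. (\<Sum>j<N. (a n u \<bullet> e j) *\<^sub>R \<gamma> j) \<bullet> v u)" for N
      proof -
        have "(\<Sum>j<N. LINT u:{0..t}|lebesgue. control_source v \<gamma> c k j u * (a k u \<bullet> e j))
          = (\<Sum>j<N. LINT u:{0..t}|lebesgue. ((a n u \<bullet> e j) *\<^sub>R \<gamma> j) \<bullet> v u)"
          using True by (simp add: control_source_def inner_commute mult.commute)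
        also have "\<dots> = (LINT u:{0..t}|lebesgue. (\<Sum>j<N. ((a n u \<bullet> e j) *\<^sub>R \<gamma> j) \<bullet> v u))"
          by (intro LINT_sum[symmetric] integral_inner_le(1)[OF aL v tt])
        finally show ?thesis by (simp add: inner_sum_left)
      qed
      moreover have "(\<lambda>N. LINT u:{0..t}|lebesgue. (\<Sum>j<N. (a n u \<bullet> e j) *\<^sub>R \<gamma> j) \<bullet> v u) \<longlonglongrightarrow> (LINT u:{0..t}|lebesgue. g u \<bullet> v u)"
        using ac(1)[OF k] True by (intro inner2_tendsto[OF _ g lim v tt] L2_continuous continuous_intros) simp
      ultimately show ?thesis using True n by (simp add: \<Theta>_def inner_commute)
    next
      case False
      then have k': "Suc k \<in> {2..n}" "Suc k \<in> {1..n}" using k by auto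
      interpret R: bounded_linear "Rop (Suc k)" by (rule bounded_linear_Rop[OF k'(1)])
      have "(\<Sum>j<N. LINT u:{0..t}|lebesgue. control_source v \<gamma> c k j u * (a k u \<bullet> e j))
          = - (LINT u:{0..t}|lebesgue. proj N (a k u) \<bullet> Rop (Suc k) (c (Suc k) u))" for N
      proof -
        have "(\<Sum>j<N. LINT u:{0..t}|lebesgue. control_source v \<gamma> c k j u * (a k u \<bullet> e j))
            = (LINT u:{0..t}|lebesgue. (\<Sum>j<N. ((- Rop (Suc k) (c (Suc k) u)) \<bullet> e j) * (a k u \<bullet> e j)))"
          unfolding control_source_def if_not_P[OF False]
          by (intro LINT_sum[symmetric] set_integrable_continuous_sub[where T=T] continuous_intros R.continuous_on cc k' ac k tt)
        also have "\<dots> = (LINT u:{0..t}|lebesgue. - (proj N (a k u) \<bullet> Rop (Suc k) (c (Suc k) u)))"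
          unfolding proj_def by (simp add: inner_sum_left sum_negf inner_commute[of "e _"] mult.commute)
        finally show ?thesis by (simp add: set_lebesgue_integral_def)
      qed
      then show ?thesis
        using tendsto_minus[OF Rop_proj_tendsto(2)[OF k'(1) ac(1)[OF k] cc(1)[OF k'(2)] t]] k k'
        by (simp add: \<Theta>_def)
    qed
    have "(\<lambda>N. (\<Sum>j<N. LINT u:{0..t}|lebesgue. control_source v \<gamma> c k j u * (a k u \<bullet> e j)) - (\<Sum>j<N. LINT u:{0..t}|lebesgue. (c k u \<bullet> e j) * G j u))
        \<longlonglongrightarrow> - \<Theta> (Suc k) - - \<Theta> k" by (intro tendsto_diff L1 L2)
    with sumlim show ?thesis unfolding ej sum_subtractf using LIMSEQ_unique by fastforce
  qed
  have "(\<Sum>k=1..n. d k t \<bullet> a k t - c k t \<bullet> b k t) - (\<Sum>k=1..n. d k 0 \<bullet> a k 0 - c k 0 \<bullet> b k 0) = (\<Sum>k=1..n. \<Theta> k - \<Theta> (Suc k))"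
    by (subst sum_subtractf[symmetric]) (rule sum.cong[OF refl main])
  also have "\<dots> = (LINT u:{0..t}|lebesgue. v u \<bullet> g u)" unfolding telescope_1 using n by (simp add: \<Theta>_def)
  finally show ?thesis by simp
qed

text \<open>The control system is triangular in the opposite direction: the control drives component
  \<open>n\<close>, and component \<open>k\<close> is driven by \<open>k + 1\<close>. The induction
  therefore descends from \<open>n\<close>, and at stage \<open>i\<close> all components from
  \<open>n - i\<close> on are available.\<close>

lemma control_evolution_exists:
  assumes v: "v \<in> L2 T" and vc: "\<And>m::nat. continuous_on {0..T} (vm m)"
    and lim: "(\<lambda>m. norm2 T (\<lambda>t. vm m t - v t)) \<longlonglongrightarrow> 0" and adm: "admissible T \<gamma> M"
  shows "\<exists>c d. \<forall>k\<in>{1..n}. c k 0 = c0 k \<and> d k 0 = d0 k \<and> evolution T (control_source v \<gamma> c k) (c k) (d k)"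
proof -
  have "\<exists>c d. \<forall>k\<in>{n - i..n}. c k 0 = c0 k \<and> d k 0 = d0 k \<and> evolution T (control_source v \<gamma> c k) (c k) (d k)" if "i < n" for i
    using that
  proof (induction i)
    case 0
    obtain c d where cd: "c 0 = c0 n" "d 0 = d0 n" "evolution T (\<lambda>j s. v s \<bullet> \<gamma> j) c d"
      by (rule duhamel[OF T v vc lim adm, of "c0 n" "d0 n"]) (rule that; assumption)
    have "control_source v \<gamma> (\<lambda>_. c) n = (\<lambda>j s. v s \<bullet> \<gamma> j)" by (auto simp: control_source_def fun_eq_iff)
    then have "\<forall>k\<in>{n - 0..n}. (\<lambda>_. c) k 0 = c0 k \<and> (\<lambda>_. d) k 0 = d0 k
        \<and> evolution T (control_source v \<gamma> (\<lambda>_. c) k) ((\<lambda>_. c) k) ((\<lambda>_. d) k)" using cd by simp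
    then show ?case by (rule exI[of _ "\<lambda>_. c", OF exI[of _ "\<lambda>_. d"]])
  next
    case (Suc i)
    obtain c d where cd': "\<forall>k\<in>{n - i..n}. c k 0 = c0 k \<and> d k 0 = d0 k \<and> evolution T (control_source v \<gamma> c k) (c k) (d k)"
      using Suc.IH[OF Suc_lessD[OF Suc.prems]] by (elim exE)
    note cd = bspec[OF cd']
    define k where "k = n - Suc i"
    have k: "Suc k = n - i" "k \<noteq> n" "Suc k \<in> {2..n}" "Suc k \<in> {n - i..n}" using Suc.prems unfolding k_def by auto
    have "continuous_on {0..T} (c (Suc k))" using cd[OF k(4)] unfolding evolution_def by blast
    then have F: "continuous_on {0..T} (\<lambda>t. - Rop (Suc k) (c (Suc k) t))"
      by (intro continuous_on_minus bounded_linear.continuous_on[OF bounded_linear_Rop[OF k(3)]])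
    obtain c1 d1 where c1: "c1 0 = c0 k" "d1 0 = d0 k" "evolution T (\<lambda>j s. (- Rop (Suc k) (c (Suc k) s)) \<bullet> e j) c1 d1"
      by (rule evolution_exists[OF T F, of "c0 k" "d0 k"]) (rule that; assumption)
    have "(c(k := c1)) l 0 = c0 l \<and> (d(k := d1)) l 0 = d0 l \<and> evolution T (control_source v \<gamma> (c(k := c1)) l) ((c(k := c1)) l) ((d(k := d1)) l)"
      if l: "l \<in> {n - Suc i..n}" for l
    proof (cases "l = k")
      case True
      have "control_source v \<gamma> (c(k := c1)) k = (\<lambda>j s. (- Rop (Suc k) (c (Suc k) s)) \<bullet> e j)"
        using k(2) by (auto simp: control_source_def fun_eq_iff)
      then show ?thesis using True c1 by simp
    next
      case False
      then have l': "l \<in> {n - i..n}" using l k_def by auto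
      have "control_source v \<gamma> (c(k := c1)) l = control_source v \<gamma> c l"
        using l' k(1) by (auto simp: control_source_def fun_eq_iff)
      then show ?thesis using False cd[OF l'] by simp
    qed
    then have "\<forall>l\<in>{n - Suc i..n}. (c(k := c1)) l 0 = c0 l \<and> (d(k := d1)) l 0 = d0 l
        \<and> evolution T (control_source v \<gamma> (c(k := c1)) l) ((c(k := c1)) l) ((d(k := d1)) l)" by (rule ballI)
    then show ?case by (rule exI[of _ "c(k := c1)", OF exI[of _ "d(k := d1)"]])
  qed
  from this[of "n - 1"] n show ?thesis by simp
qed

text \<open>Finite energy cascades, for which the observability inequality is stated, are test
  solutions for the transposition identity. The embedding exists because the orders k - n - s + 1
  and k - n - s never exceed 1 and 0, the orders of a finite energy pair.\<close>

lemma cascade_dual_solution: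
  assumes W: "cascade_solution A n C T W W'"
  shows "dual_solution A n s C T (\<lambda>k t. dual (int k - int n - s + 1) (Lam (int k - int n - s + 1) (W k t)))
     (\<lambda>k t. dual (int k - int n - s) (Lam (int k - int n - s) (W' k t)))"
  unfolding dual_solution_def
proof (intro ballI conjI)
  fix k assume k: "k \<in> {1..n}"
  define m where "m = int k - int n - s"
  have m: "m \<le> 0" using k s by (auto simp: m_def)
  define f where "f t = (if k = 1 then 0 else - C k (W (k - 1) t))" for t
  have ws: "wave_solution A T (W k) (W' k) f" using W k unfolding cascade_solution_def f_def by blast
  have fc: "continuous_on {0..T} f" unfolding f_def by (rule cascade_source_continuous[OF W coupling_linear k])
  note c = wave_solution_continuous[OF ws]
  have Wd: "W k t \<in> hdom A (m + 1)" if "t \<in> {0..T}" for t using hdom_le(1)[OF _ c(4)[OF that], of "m + 1"] m by simp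
  have "continuous_on {0..T} (\<lambda>t. Lam m (Lam 1 (W k t)))"
    by (rule bounded_linear.continuous_on[OF bounded_linear_Lam[OF m] c(3)])
  then have "continuous_on {0..T} (\<lambda>t. Lam (m + 1) (W k t))"
    by (rule continuous_on_eq) (simp add: hdom_Lam(2) c(4) Wd)
  then show "Hs_continuous A (int k - int n - s + 1) T (\<lambda>t. dual (int k - int n - s + 1) (Lam (int k - int n - s + 1) (W k t)))"
    unfolding m_def[symmetric] by (rule Hs_continuousI) simp
  have "continuous_on {0..T} (\<lambda>t. Lam m (W' k t))"
    by (rule bounded_linear.continuous_on[OF bounded_linear_Lam[OF m] c(2)])
  then show "Hs_continuous A (int k - int n - s) T (\<lambda>t. dual (int k - int n - s) (Lam (int k - int n - s) (W' k t)))"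
    unfolding m_def[symmetric] by (rule Hs_continuousI) simp
  fix t assume t: "t \<in> {0..T}"
  have W1: "dual (m + 1) (Lam (m + 1) (W k t)) \<phi> = W k t \<bullet> \<phi>" if "t \<in> {0..T}" "\<phi> \<in> hdom A (- m - 1)" for t \<phi>
    using dual_Lam[OF Wd[OF that(1)], of \<phi>] that(2) by simp
  have W2: "dual m (Lam m (W' k t)) \<phi> = W' k t \<bullet> \<phi>" if "\<phi> \<in> hdom A (- m)" for t \<phi>
    using dual_Lam[OF hdom_nonpos[OF m] that] .
  have up: "\<phi> \<in> hdom A j" if "\<phi> \<in> hdom A i" "j \<le> i" for \<phi> i j using hdom_le(1)[OF that(2,1)] .
  {
    fix \<phi> assume "\<phi> \<in> hdom A (int n - int k + s)"
    moreover have "int n - int k + s = - m" by (simp add: m_def)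
    ultimately have \<phi>: "\<phi> \<in> hdom A (- m)" by simp
    have "((\<lambda>t. W k t \<bullet> \<phi>) has_real_derivative W' k t \<bullet> \<phi>) (at t within {0..T})" by (rule wave_solutionD(1)[OF ws t])
    then have "((\<lambda>t. dual (m + 1) (Lam (m + 1) (W k t)) \<phi>) has_real_derivative W' k t \<bullet> \<phi>) (at t within {0..T})"
      by (rule has_field_derivative_transform_within[OF _ zero_less_one t]) (rule W1[symmetric], assumption, rule up[OF \<phi>], simp)
    then show "((\<lambda>r. dual (int k - int n - s + 1) (Lam (int k - int n - s + 1) (W k r)) \<phi>) has_real_derivative
        dual (int k - int n - s) (Lam (int k - int n - s) (W' k t)) \<phi>) (at t within {0..T})"
      unfolding m_def[symmetric] W2[OF \<phi>] .
  next
    fix \<phi> assume \<phi>: "\<phi> \<in> hdom A (int n - int k + 2)"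
    have \<phi>2: "\<phi> \<in> hdom A 2" by (rule up[OF \<phi>]) (use k in auto)
    have \<phi>m: "\<phi> \<in> hdom A (- m)" by (rule up[OF \<phi>]) (use s in \<open>auto simp: m_def\<close>)
    \<comment> \<open>Applying \<open>A\<close> costs two orders and leaves n - k, which suffices
      for a functional of order k - n - s + 1 since \<open>s \<le> 1\<close>.\<close>
    have L2: "Lam 2 \<phi> \<in> hdom A (- m - 1)"
    proof -
      have "\<phi> \<in> hdom A ((int n - int k) + 2)" using \<phi> by simp
      from hdom_Lam(1)[OF \<phi>2 this] show ?thesis by (rule up) (use s in \<open>simp add: m_def\<close>)
    qed
    have h: "((\<lambda>t. W' k t \<bullet> \<phi>) has_real_derivative f t \<bullet> \<phi> - W k t \<bullet> Lam 2 \<phi>) (at t within {0..T})"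
      by (rule wave_solutionD(2)[OF ws t fc \<phi>2])
    have "W k t \<bullet> Lam 2 \<phi> = dual (m + 1) (Lam (m + 1) (W k t)) (app A \<phi>)"
      unfolding app_A[OF \<phi>2] by (rule W1[OF t L2, symmetric])
    moreover have "f t \<bullet> \<phi> = - (if k = 1 then 0 else dual (int (k - 1) - int n - s + 1) (Lam (int (k - 1) - int n - s + 1) (W (k - 1) t)) (adjoint (C k) \<phi>))"
    proof (cases "k = 1")
      case False
      then have k2: "k \<in> {2..n}" and k1: "k - 1 \<in> {1..n}" and o: "int (k - 1) - int n - s + 1 = m" using k by (auto simp: m_def)
      have "wave_solution A T (W (k - 1)) (W' (k - 1)) (\<lambda>t. if k - 1 = 1 then 0 else - C (k - 1) (W (k - 1 - 1) t))"
        by (rule bspec[OF W[unfolded cascade_solution_def] k1])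
      have "int n - int k + 1 \<in> {0..int n - int k + 1}" using k by auto
      from coupling_adjoint[OF k2 this] have "\<phi> \<in> hdom A (int n - int k + 1) \<Longrightarrow> adjoint (C k) \<phi> \<in> hdom A (int n - int k + 1)"
        unfolding bounded_op_def by blast
      then have "adjoint (C k) \<phi> \<in> hdom A (int n - int k + 1)" using up[OF \<phi>] by simp
      then have ad: "adjoint (C k) \<phi> \<in> hdom A (- m)" by (rule up) (use s in \<open>simp add: m_def\<close>)
      have "C k (W (k - 1) t) \<bullet> \<phi> = W (k - 1) t \<bullet> adjoint (C k) \<phi>" by (rule adjoint_inner[OF coupling_linear[OF k2]])
      then show ?thesis unfolding o dual_Lam[OF hdom_nonpos[OF m] ad] using False by (simp add: f_def)
    qed (simp add: f_def)
    ultimately have "f t \<bullet> \<phi> - W k t \<bullet> Lam 2 \<phi> = - dual (m + 1) (Lam (m + 1) (W k t)) (app A \<phi>)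
        - (if k = 1 then 0 else dual (int (k - 1) - int n - s + 1) (Lam (int (k - 1) - int n - s + 1) (W (k - 1) t)) (adjoint (C k) \<phi>))"
      by linarith
    note h[unfolded this]
    then have "((\<lambda>t. dual m (Lam m (W' k t)) \<phi>) has_real_derivative
        - dual (m + 1) (Lam (m + 1) (W k t)) (app A \<phi>)
        - (if k = 1 then 0 else dual (int (k - 1) - int n - s + 1) (Lam (int (k - 1) - int n - s + 1) (W (k - 1) t)) (adjoint (C k) \<phi>)))
        (at t within {0..T})"
      by (rule has_field_derivative_transform_within[OF _ zero_less_one t]) (rule W2[OF \<phi>m, symmetric])
    then show "((\<lambda>r. dual (int k - int n - s) (Lam (int k - int n - s) (W' k r)) \<phi>) has_real_derivative
        - dual (int k - int n - s + 1) (Lam (int k - int n - s + 1) (W k t)) (app A \<phi>)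
        - (if k = 1 then 0 else dual (int (k - 1) - int n - s + 1) (Lam (int (k - 1) - int n - s + 1) (W (k - 1) t)) (adjoint (C k) \<phi>)))
        (at t within {0..T})" unfolding m_def[symmetric] .
  }
qed

section \<open>Exact controllability from observability\<close>

lemma pairing_dual_1: "pairing (int n - int k + s - 1) (dual (int n - int k + s - 1) x) (dual (int k - int n - s + 1) y) = x \<bullet> y"
proof -
  have "int k - int n - s + 1 = - (int n - int k + s - 1)" by simp
  then show ?thesis by (simp only: pairing_dual)
qed

lemma pairing_dual_0: "pairing (int n - int k + s) (dual (int n - int k + s) x) (dual (int k - int n - s) y) = x \<bullet> y"
proof -
  have "int k - int n - s = - (int n - int k + s)" by simp
  then show ?thesis by (simp only: pairing_dual)
qed

lemma cascade_add_scaleR: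
  assumes W: "cascade_solution A n C T W W'" and V: "cascade_solution A n C T V V'"
  shows "cascade_solution A n C T (\<lambda>i t. W i t + a *\<^sub>R V i t) (\<lambda>i t. W' i t + a *\<^sub>R V' i t)"
  unfolding cascade_solution_def
proof
  fix i assume i: "i \<in> {1..n}"
  have "(\<lambda>t. (if i = 1 then 0 else - C i (W (i - 1) t)) + a *\<^sub>R (if i = 1 then 0 else - C i (V (i - 1) t)))
      = (\<lambda>t. if i = 1 then 0 else - C i (W (i - 1) t + a *\<^sub>R V (i - 1) t))"
  proof (cases "i = 1")
    case False
    then interpret L: bounded_linear "C i" using coupling_linear[of i] i by auto
    show ?thesis using False by (simp add: L.add L.scaleR)
  qed simp
  then show "wave_solution A T (\<lambda>t. W i t + a *\<^sub>R V i t) (\<lambda>t. W' i t + a *\<^sub>R V' i t)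
      (\<lambda>t. if i = 1 then 0 else - C i (W (i - 1) t + a *\<^sub>R V (i - 1) t))"
    using wave_solution_add_scaleR[OF bspec[OF W[unfolded cascade_solution_def] i] bspec[OF V[unfolded cascade_solution_def] i], of a]
    by simp
qed

text \<open>The common core of both cases. The observation enters only through the modal vectors
  \<open>\<beta> j\<close>: \<open>ob_lim\<close> says that every observation is the limit of its
  modal sums, \<open>adm\<close> provides the controlled solution, and \<open>obs\<close> is the
  observability inequality in the norms dual to the space of \<open>Y_0\<close>.\<close>

lemma exact_control:
  fixes ob :: "(nat \<Rightarrow> real \<Rightarrow> 'h \<Rightarrow> real) \<Rightarrow> (nat \<Rightarrow> real \<Rightarrow> 'h \<Rightarrow> real) \<Rightarrow> (real \<Rightarrow> 'g::{real_inner, complete_space}) \<Rightarrow> bool"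
    and \<beta> :: "nat \<Rightarrow> 'g"
  assumes ob_ex: "\<And>w w'. dual_solution A n s C T w w' \<Longrightarrow> \<exists>g. ob w w' g"
    and ob_lim: "\<And>w w' g. dual_solution A n s C T w w' \<Longrightarrow> ob w w' g \<Longrightarrow>
      g \<in> L2 T \<and> (\<lambda>N. norm2 T (\<lambda>t. (\<Sum>j<N. w n t (e j) *\<^sub>R \<beta> j) - g t)) \<longlonglongrightarrow> 0"
    and adm: "admissible T (\<lambda>j. (r j powi (s - 1)) *\<^sub>R \<beta> j) M"
    and K: "0 \<le> K"
    and obs: "\<And>W W' g k. cascade_solution A n C T W W' \<Longrightarrow> g \<in> L2 T \<Longrightarrow>
      (\<lambda>N. norm2 T (\<lambda>t. (\<Sum>j<N. (W n t \<bullet> e j) *\<^sub>R \<beta> j) - g t)) \<longlonglongrightarrow> 0 \<Longrightarrow> k \<in> {1..n} \<Longrightarrow>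
      norm (Lam (int k - int n - s + 1) (W k 0)) \<le> K * norm2 T g \<and> norm (Lam (int k - int n - s) (W' k 0)) \<le> K * norm2 T g"
    and Y: "(y0, y1) \<in> state_space A n s"
  shows "\<exists>v\<in>L2 T. driven_to_zero A n s C ob T y0 y1 v"
proof -
  have "\<forall>k\<in>{1..n}. \<exists>x. y0 k = dual (int n - int k + s) x" "\<forall>k\<in>{1..n}. \<exists>x. y1 k = dual (int n - int k + s - 1) x"
    using Y unfolding state_space_def Hs_eq by blast+
  then obtain c0 d0 where y0: "\<And>k. k \<in> {1..n} \<Longrightarrow> y0 k = dual (int n - int k + s) (c0 k)"
    and y1: "\<And>k. k \<in> {1..n} \<Longrightarrow> y1 k = dual (int n - int k + s - 1) (d0 k)" by metis
  have cex: "\<exists>W W'. cascade_solution A n C T W W' \<and> (\<forall>i\<in>{1..n}. W i T = Lam (- 1) (x i) \<and> W' i T = p i)" for x p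
    by (rule cascade_exists_backward[OF T coupling_linear])
  define Obs where "Obs W g \<longleftrightarrow> g \<in> L2 T \<and> (\<lambda>N. norm2 T (\<lambda>t. (\<Sum>j<N. (W n t \<bullet> e j) *\<^sub>R \<beta> j) - g t)) \<longlonglongrightarrow> 0"
    for W :: "nat \<Rightarrow> real \<Rightarrow> 'h" and g
  \<comment> \<open>If Y(T) vanishes, the identity at time T reads: the pairing of the control with
    the observation is minus the pairing of the initial data. This is the functional that the
    control has to represent.\<close>
  define ell where "ell W W' = - (\<Sum>k=1..n. d0 k \<bullet> Lam (int k - int n - s + 1) (W k 0) - c0 k \<bullet> Lam (int k - int n - s) (W' k 0))"
    for W W' :: "nat \<Rightarrow> real \<Rightarrow> 'h"
  \<comment> \<open>A relation instead of a functional on observations: two cascades with the same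
    observation are handled by the bound \<open>bd\<close>, which makes \<open>l\<close> depend on
    \<open>g\<close> alone.\<close>
  define G where "G = {(g, ell W W') | g W W'. cascade_solution A n C T W W' \<and> Obs W g}"
  have T0: "0 \<in> {0..T}" "T \<in> {0..T}" using T by auto
  have nn: "n \<in> {1..n}" using n by auto
  have W1: "W k t \<in> hdom A 1" if "cascade_solution A n C T W W'" "k \<in> {1..n}" "t \<in> {0..T}" for W W' k t
    by (rule wave_solution_continuous(4)[OF bspec[OF that(1)[unfolded cascade_solution_def] that(2)] that(3)])
  have Wm: "W k t \<in> hdom A (int k - int n - s + 1)" if "cascade_solution A n C T W W'" "k \<in> {1..n}" "t \<in> {0..T}" for W W' k t
    by (rule hdom_le(1)[OF _ W1[OF that]]) (use that(2) s in auto)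
  have W'm: "x \<in> hdom A (int k - int n - s)" if "k \<in> {1..n}" for x k
    by (rule hdom_nonpos) (use that s in auto)
  have SL: "(\<lambda>t. \<Sum>j<N. (W n t \<bullet> e j) *\<^sub>R \<beta> j) \<in> L2 T" "continuous_on {0..T} (\<lambda>t. \<Sum>j<N. (W n t \<bullet> e j) *\<^sub>R \<beta> j)"
    if "cascade_solution A n C T W W'" for W W' N
  proof -
    have "continuous_on {0..T} (W n)"
      by (rule wave_solution_continuous(1)[OF bspec[OF that(1)[unfolded cascade_solution_def] nn]])
    then show "continuous_on {0..T} (\<lambda>t. \<Sum>j<N. (W n t \<bullet> e j) *\<^sub>R \<beta> j)" by (intro continuous_intros)
    then show "(\<lambda>t. \<Sum>j<N. (W n t \<bullet> e j) *\<^sub>R \<beta> j) \<in> L2 T" by (rule L2_continuous)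
  qed
  have GI: "(g, l) \<in> G" if "cascade_solution A n C T W W'" "Obs W g" "l = ell W W'" for g l W W'
    unfolding G_def using that by blast
  have Gadd: "((\<lambda>t. g t + a *\<^sub>R g' t), l + a * l') \<in> G" if gl: "(g, l) \<in> G" "(g', l') \<in> G" for g l g' l' a
  proof -
    obtain W W' where W: "cascade_solution A n C T W W'" "Obs W g" "l = ell W W'" using gl(1) unfolding G_def by blast
    obtain V V' where V: "cascade_solution A n C T V V'" "Obs V g'" "l' = ell V V'" using gl(2) unfolding G_def by blast
    have gL: "g \<in> L2 T" "g' \<in> L2 T" using W(2) V(2) unfolding Obs_def by blast+
    have eq: "(\<lambda>t. (\<Sum>j<N. ((W n t + a *\<^sub>R V n t) \<bullet> e j) *\<^sub>R \<beta> j) - (g t + a *\<^sub>R g' t))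
        = (\<lambda>t. ((\<Sum>j<N. (W n t \<bullet> e j) *\<^sub>R \<beta> j) - g t) + a *\<^sub>R ((\<Sum>j<N. (V n t \<bullet> e j) *\<^sub>R \<beta> j) - g' t))" for N
      by (simp add: inner_add_left scaleR_add_left sum.distrib scaleR_diff_right scaleR_sum_right fun_eq_iff)
    have "(\<lambda>N. norm2 T (\<lambda>t. (\<Sum>j<N. ((W n t + a *\<^sub>R V n t) \<bullet> e j) *\<^sub>R \<beta> j) - (g t + a *\<^sub>R g' t))) \<longlonglongrightarrow> 0"
    proof (rule Lim_null_comparison)
      show "(\<lambda>N. norm2 T (\<lambda>t. (\<Sum>j<N. (W n t \<bullet> e j) *\<^sub>R \<beta> j) - g t) + \<bar>a\<bar> * norm2 T (\<lambda>t. (\<Sum>j<N. (V n t \<bullet> e j) *\<^sub>R \<beta> j) - g' t)) \<longlonglongrightarrow> 0"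
        using W(2) V(2) unfolding Obs_def by (auto intro!: tendsto_eq_intros)
      have "norm2 T (\<lambda>t. (\<Sum>j<N. ((W n t + a *\<^sub>R V n t) \<bullet> e j) *\<^sub>R \<beta> j) - (g t + a *\<^sub>R g' t))
          \<le> norm2 T (\<lambda>t. (\<Sum>j<N. (W n t \<bullet> e j) *\<^sub>R \<beta> j) - g t) + \<bar>a\<bar> * norm2 T (\<lambda>t. (\<Sum>j<N. (V n t \<bullet> e j) *\<^sub>R \<beta> j) - g' t)" for N
        unfolding eq norm2_scaleR[symmetric]
        by (rule norm2_triangle[OF L2_diff[OF SL(1)[OF W(1)] gL(1)] L2_scaleR[OF L2_diff[OF SL(1)[OF V(1)] gL(2)]]])
      then show "\<forall>\<^sub>F N in sequentially. norm (norm2 T (\<lambda>t. (\<Sum>j<N. ((W n t + a *\<^sub>R V n t) \<bullet> e j) *\<^sub>R \<beta> j) - (g t + a *\<^sub>R g' t)))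
          \<le> norm2 T (\<lambda>t. (\<Sum>j<N. (W n t \<bullet> e j) *\<^sub>R \<beta> j) - g t) + \<bar>a\<bar> * norm2 T (\<lambda>t. (\<Sum>j<N. (V n t \<bullet> e j) *\<^sub>R \<beta> j) - g' t)"
        by (simp add: norm2_nonneg)
    qed
    then have ob: "Obs (\<lambda>i t. W i t + a *\<^sub>R V i t) (\<lambda>t. g t + a *\<^sub>R g' t)" unfolding Obs_def using L2_add[OF gL(1) L2_scaleR[OF gL(2)]] by blast
    have el: "ell (\<lambda>i t. W i t + a *\<^sub>R V i t) (\<lambda>i t. W' i t + a *\<^sub>R V' i t) = l + a * l'"
    proof -
      have "(\<Sum>k=1..n. d0 k \<bullet> Lam (int k - int n - s + 1) (W k 0 + a *\<^sub>R V k 0) - c0 k \<bullet> Lam (int k - int n - s) (W' k 0 + a *\<^sub>R V' k 0))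
          = (\<Sum>k=1..n. (d0 k \<bullet> Lam (int k - int n - s + 1) (W k 0) - c0 k \<bullet> Lam (int k - int n - s) (W' k 0))
             + a * (d0 k \<bullet> Lam (int k - int n - s + 1) (V k 0) - c0 k \<bullet> Lam (int k - int n - s) (V' k 0)))"
      proof (rule sum.cong[OF refl])
        fix k assume k: "k \<in> {1..n}"
        show "d0 k \<bullet> Lam (int k - int n - s + 1) (W k 0 + a *\<^sub>R V k 0) - c0 k \<bullet> Lam (int k - int n - s) (W' k 0 + a *\<^sub>R V' k 0)
          = (d0 k \<bullet> Lam (int k - int n - s + 1) (W k 0) - c0 k \<bullet> Lam (int k - int n - s) (W' k 0))
             + a * (d0 k \<bullet> Lam (int k - int n - s + 1) (V k 0) - c0 k \<bullet> Lam (int k - int n - s) (V' k 0))"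
          unfolding Lam_add[OF Wm[OF W(1) k T0(1)] hdom_scaleR[OF Wm[OF V(1) k T0(1)]]] Lam_scaleR[OF Wm[OF V(1) k T0(1)]]
              Lam_add[OF W'm[OF k] W'm[OF k]] Lam_scaleR[OF W'm[OF k]] by (simp add: inner_add_right algebra_simps)
      qed
      then show ?thesis unfolding W(3) V(3) ell_def by (simp add: sum.distrib sum_distrib_left)
    qed
    show ?thesis by (rule GI[OF cascade_add_scaleR[OF W(1) V(1), of a] ob el[symmetric]])
  qed
  have toObs: "\<exists>g. ob w w' g \<and> Obs W g"
    if W: "cascade_solution A n C T W W'" and w: "w = (\<lambda>k t. dual (int k - int n - s + 1) (Lam (int k - int n - s + 1) (W k t)))"
      "w' = (\<lambda>k t. dual (int k - int n - s) (Lam (int k - int n - s) (W' k t)))" for W W' w w'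
  proof -
    have ds: "dual_solution A n s C T w w'" unfolding w by (rule cascade_dual_solution[OF W])
    obtain g where g: "ob w w' g" using ob_ex[OF ds] by blast
    have e: "w n t (e j) = W n t \<bullet> e j" if "t \<in> {0..T}" for t j
      unfolding w by (rule dual_Lam[OF Wm[OF W nn that] hdom_e])
    have "norm2 T (\<lambda>t. (\<Sum>j<N. w n t (e j) *\<^sub>R \<beta> j) - g t) = norm2 T (\<lambda>t. (\<Sum>j<N. (W n t \<bullet> e j) *\<^sub>R \<beta> j) - g t)" for N
      by (rule norm2_cong) (simp add: e)
    then show ?thesis unfolding Obs_def using ob_lim[OF ds g] g by auto
  qed
  have Obs_ob: "Obs W g" if W: "cascade_solution A n C T W W'"
    and g: "ob (\<lambda>k t. dual (int k - int n - s + 1) (Lam (int k - int n - s + 1) (W k t)))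
      (\<lambda>k t. dual (int k - int n - s) (Lam (int k - int n - s) (W' k t))) g" for W W' g
  proof -
    have e: "dual (int n - int n - s + 1) (Lam (int n - int n - s + 1) (W n t)) (e j) = W n t \<bullet> e j" if "t \<in> {0..T}" for t j
      by (rule dual_Lam[OF Wm[OF W nn that] hdom_e])
    have "norm2 T (\<lambda>t. (\<Sum>j<N. dual (int n - int n - s + 1) (Lam (int n - int n - s + 1) (W n t)) (e j) *\<^sub>R \<beta> j) - g t)
        = norm2 T (\<lambda>t. (\<Sum>j<N. (W n t \<bullet> e j) *\<^sub>R \<beta> j) - g t)" for N
      by (rule norm2_cong) (simp only: e)
    then show ?thesis unfolding Obs_def using ob_lim[OF cascade_dual_solution[OF W] g] by simp
  qed
  \<comment> \<open>The zero pair is obtained as an element minus itself, using only the linear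
    structure of \<open>G\<close>.\<close>
  have G0: "((\<lambda>_. 0), 0) \<in> G"
  proof -
    obtain W W' where W: "cascade_solution A n C T W W'"
      using cex[of "\<lambda>_. 0" "\<lambda>_. 0"] by blast
    obtain g where "Obs W g" using toObs[OF W refl refl] by blast
    then have "(g, ell W W') \<in> G" unfolding G_def using W by blast
    from Gadd[OF this this, of "- 1"] show ?thesis by simp
  qed
  define c where "c = (\<Sum>k=1..n. (norm (d0 k) + norm (c0 k)) * K)"
  have bd: "\<bar>l\<bar> \<le> c * norm2 T g" if gl: "(g, l) \<in> G" for g l
  proof -
    obtain W W' where W: "cascade_solution A n C T W W'" "Obs W g" "l = ell W W'" using gl unfolding G_def by blast
    have "\<bar>d0 k \<bullet> Lam (int k - int n - s + 1) (W k 0) - c0 k \<bullet> Lam (int k - int n - s) (W' k 0)\<bar>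
        \<le> (norm (d0 k) + norm (c0 k)) * K * norm2 T g" if k: "k \<in> {1..n}" for k
    proof -
      have o: "norm (Lam (int k - int n - s + 1) (W k 0)) \<le> K * norm2 T g" "norm (Lam (int k - int n - s) (W' k 0)) \<le> K * norm2 T g"
        using obs[OF W(1) _ _ k, of g] W(2) unfolding Obs_def by blast+
      have "\<bar>d0 k \<bullet> Lam (int k - int n - s + 1) (W k 0)\<bar> \<le> norm (d0 k) * (K * norm2 T g)"
        by (rule order_trans[OF Cauchy_Schwarz_ineq2 mult_left_mono[OF o(1) norm_ge_zero]])
      moreover have "\<bar>c0 k \<bullet> Lam (int k - int n - s) (W' k 0)\<bar> \<le> norm (c0 k) * (K * norm2 T g)"
        by (rule order_trans[OF Cauchy_Schwarz_ineq2 mult_left_mono[OF o(2) norm_ge_zero]])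
      moreover have "(norm (d0 k) + norm (c0 k)) * K * norm2 T g = norm (d0 k) * (K * norm2 T g) + norm (c0 k) * (K * norm2 T g)"
        by (simp add: algebra_simps)
      ultimately show ?thesis by linarith
    qed
    then have "\<bar>\<Sum>k=1..n. d0 k \<bullet> Lam (int k - int n - s + 1) (W k 0) - c0 k \<bullet> Lam (int k - int n - s) (W' k 0)\<bar>
        \<le> (\<Sum>k=1..n. (norm (d0 k) + norm (c0 k)) * K * norm2 T g)"
      by (intro order_trans[OF sum_abs] sum_mono)
    then show ?thesis unfolding W(3) ell_def c_def sum_distrib_right by simp
  qed
  have GL2: "g \<in> L2 T" if "(g, l) \<in> G" for g l using that unfolding G_def Obs_def by blast
  have Gadd1: "((\<lambda>t. g t + g' t), l + l') \<in> G" if "(g, l) \<in> G" "(g', l') \<in> G" for g l g' l'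
    using Gadd[OF that, of 1] by simp
  have Gscl: "((\<lambda>t. a *\<^sub>R g t), a * l) \<in> G" if "(g, l) \<in> G" for g l a
    using Gadd[OF G0 that, of a] by simp
  obtain gm lm where gm: "\<And>m::nat. (gm m, lm m) \<in> G"
    "\<And>\<epsilon>. 0 < \<epsilon> \<Longrightarrow> \<exists>K. \<forall>m\<ge>K. \<forall>k\<ge>K. norm2 T (\<lambda>t. gm m t - gm k t) < \<epsilon>"
    "\<And>h b. (h, b) \<in> G \<Longrightarrow> (\<lambda>m. inner2 T (gm m) h) \<longlonglongrightarrow> b"
    by (rule hilbert_uniqueness[of G T c, OF GL2 G0 Gadd1 Gscl bd]) (assumption | (rule that; assumption))+
  have gL: "gm m \<in> L2 T" for m by (rule GL2[OF gm(1)])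
  \<comment> \<open>Observations are mere L2 functions, so each is replaced by a finite modal sum,
    which is continuous in time, within \<open>inverse (Suc m)\<close>. These sums converge to the
    control and also serve as the continuous approximation required by the Duhamel
    construction.\<close>
  have "\<exists>x. continuous_on {0..T} x \<and> norm2 T (\<lambda>t. x t - gm m t) < inverse (real (Suc m))" for m
  proof -
    obtain W W' where W: "cascade_solution A n C T W W'" "Obs W (gm m)" using gm(1)[of m] unfolding G_def by blast
    have "\<forall>\<^sub>F N in sequentially. norm2 T (\<lambda>t. (\<Sum>j<N. (W n t \<bullet> e j) *\<^sub>R \<beta> j) - gm m t) < inverse (real (Suc m))"
      by (rule order_tendstoD(2)) (use W(2) in \<open>auto simp: Obs_def\<close>)
    then show ?thesis using SL(2)[OF W(1)] unfolding eventually_sequentially by blast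
  qed
  then obtain vm where vm: "\<And>m. continuous_on {0..T} (vm m)" "\<And>m. norm2 T (\<lambda>t. vm m t - gm m t) < inverse (real (Suc m))"
    by metis
  have vL: "vm m \<in> L2 T" for m by (rule L2_continuous[OF vm(1)])
  have cau: "\<exists>K. \<forall>m\<ge>K. \<forall>k\<ge>K. norm2 T (\<lambda>t. vm m t - vm k t) < \<epsilon>" if \<epsilon>: "0 < \<epsilon>" for \<epsilon>
  proof -
    obtain K1 where K1: "\<And>m k. m \<ge> K1 \<Longrightarrow> k \<ge> K1 \<Longrightarrow> norm2 T (\<lambda>t. gm m t - gm k t) < \<epsilon> / 3" using gm(2)[of "\<epsilon> / 3"] \<epsilon> by auto
    obtain K2 where K2: "inverse (real (Suc K2)) < \<epsilon> / 3" using reals_Archimedean[of "\<epsilon> / 3"] \<epsilon> by auto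
    have v3: "norm2 T (\<lambda>t. vm m t - gm m t) < \<epsilon> / 3" if "m \<ge> K2" for m
    proof -
      have "inverse (real (Suc m)) \<le> inverse (real (Suc K2))" using that by (intro le_imp_inverse_le) auto
      then show ?thesis using vm(2)[of m] K2 by linarith
    qed
    have "norm2 T (\<lambda>t. vm m t - vm k t) < \<epsilon>" if "m \<ge> K1 + K2" "k \<ge> K1 + K2" for m k
    proof -
      have "norm2 T (\<lambda>t. vm m t - vm k t) \<le> norm2 T (\<lambda>t. vm m t - gm m t) + norm2 T (\<lambda>t. gm m t - vm k t)"
        by (rule norm2_triangle_diff[OF vL gL vL])
      moreover have "norm2 T (\<lambda>t. gm m t - vm k t) \<le> norm2 T (\<lambda>t. gm m t - gm k t) + norm2 T (\<lambda>t. gm k t - vm k t)"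
        by (rule norm2_triangle_diff[OF gL gL vL])
      moreover have "norm2 T (\<lambda>t. gm k t - vm k t) = norm2 T (\<lambda>t. vm k t - gm k t)" by (rule norm2_minus_commute)
      moreover have "norm2 T (\<lambda>t. vm m t - gm m t) < \<epsilon> / 3" "norm2 T (\<lambda>t. vm k t - gm k t) < \<epsilon> / 3"
        "norm2 T (\<lambda>t. gm m t - gm k t) < \<epsilon> / 3" using v3 K1 that by auto
      ultimately show ?thesis by linarith
    qed
    then show ?thesis by blast
  qed
  obtain v where v: "v \<in> L2 T" "(\<lambda>m. norm2 T (\<lambda>t. vm m t - v t)) \<longlonglongrightarrow> 0"
    by (rule L2_complete_continuous[OF T vm(1) cau]) (assumption | (rule that; assumption))+
  have vlim: "(\<lambda>m. norm2 T (\<lambda>t. gm m t - v t)) \<longlonglongrightarrow> 0"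
  proof (rule Lim_null_comparison)
    show "(\<lambda>m. inverse (real (Suc m)) + norm2 T (\<lambda>t. vm m t - v t)) \<longlonglongrightarrow> 0"
      using tendsto_add[OF LIMSEQ_inverse_real_of_nat v(2)] by simp
    have "norm2 T (\<lambda>t. gm m t - v t) \<le> inverse (real (Suc m)) + norm2 T (\<lambda>t. vm m t - v t)" for m
      using norm2_triangle_diff[OF gL vL v(1), of m m] norm2_minus_commute[of T "gm m" "vm m"] vm(2)[of m] by linarith
    then show "\<forall>\<^sub>F m in sequentially. norm (norm2 T (\<lambda>t. gm m t - v t)) \<le> inverse (real (Suc m)) + norm2 T (\<lambda>t. vm m t - v t)"
      by (simp add: norm2_nonneg)
  qed
  have vG: "(LINT t:{0..T}|lebesgue. v t \<bullet> h t) = b" if hb: "(h, b) \<in> G" for h b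
  proof (rule LIMSEQ_unique)
    show "(\<lambda>m. LINT t:{0..T}|lebesgue. gm m t \<bullet> h t) \<longlonglongrightarrow> (LINT t:{0..T}|lebesgue. v t \<bullet> h t)"
      by (rule inner2_tendsto[OF gL v(1) vlim GL2[OF hb]]) auto
    show "(\<lambda>m. LINT t:{0..T}|lebesgue. gm m t \<bullet> h t) \<longlonglongrightarrow> b" using gm(3)[OF hb] unfolding inner2_def .
  qed
  \<comment> \<open>The value of \<open>w n t\<close> on \<open>e j\<close> is
    \<open>r j powi (s - 1)\<close> times the normalised coordinate; the factor is moved into the
    observation vector.\<close>
  define \<gamma> where "\<gamma> j = (r j powi (s - 1)) *\<^sub>R \<beta> j" for j
  have adm': "admissible T \<gamma> M" using adm unfolding \<gamma>_def .
  have exists: "\<exists>y y'. transposition_solution A n s C ob T y0 y1 v y y'"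
  proof -
    obtain cc dd where cd: "\<forall>k\<in>{1..n}. cc k 0 = c0 k \<and> dd k 0 = d0 k \<and> evolution T (control_source v \<gamma> cc k) (cc k) (dd k)"
      using control_evolution_exists[OF v(1) vm(1) v(2) adm', of c0 d0] by (elim exE)
    have ev: "evolution T (control_source v \<gamma> cc k) (cc k) (dd k)" if "k \<in> {1..n}" for k using cd that by blast
    have "transposition_solution A n s C ob T y0 y1 v (\<lambda>k t. dual (int n - int k + s) (cc k t)) (\<lambda>k t. dual (int n - int k + s - 1) (dd k t))"
      unfolding transposition_solution_def
    proof (intro conjI ballI allI impI)
      fix k assume k: "k \<in> {1..n}"
      have "continuous_on {0..T} (cc k)" "continuous_on {0..T} (dd k)" using ev[OF k] unfolding evolution_def by blast+
      then show "Hs_continuous A (int n - int k + s) T (\<lambda>t. dual (int n - int k + s) (cc k t))"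
        "Hs_continuous A (int n - int k + s - 1) T (\<lambda>t. dual (int n - int k + s - 1) (dd k t))"
        by (auto intro: Hs_continuousI)
    next
      fix t w w' assume t: "t \<in> {0..T}" and ds: "dual_solution A n s C T w w'"
      obtain g where g: "ob w w' g" using ob_ex[OF ds] by blast
      note gl = ob_lim[OF ds g]
      obtain a b where ab: "normal_dual a b"
        "\<And>k t. k \<in> {1..n} \<Longrightarrow> t \<in> {0..T} \<Longrightarrow> w k t = dual (int k - int n - s + 1) (a k t)"
        "\<And>k t. k \<in> {1..n} \<Longrightarrow> t \<in> {0..T} \<Longrightarrow> w' k t = dual (int k - int n - s) (b k t)"
        by (rule dual_solution_normal[OF ds]) (rule that; assumption)
      have we: "w n t (e j) *\<^sub>R \<beta> j = (a n t \<bullet> e j) *\<^sub>R \<gamma> j" if "t \<in> {0..T}" for t j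
      proof -
        have "- (int n - int n - s + 1) = s - 1" by simp
        then have "w n t (e j) = r j powi (s - 1) * (a n t \<bullet> e j)" unfolding ab(2)[OF nn that] dual_e by simp
        then show ?thesis by (simp add: \<gamma>_def mult.commute)
      qed
      have "norm2 T (\<lambda>t. (\<Sum>j<N. w n t (e j) *\<^sub>R \<beta> j) - g t) = norm2 T (\<lambda>t. (\<Sum>j<N. (a n t \<bullet> e j) *\<^sub>R \<gamma> j) - g t)" for N
        by (rule norm2_cong) (simp only: we)
      then have lim: "(\<lambda>N. norm2 T (\<lambda>t. (\<Sum>j<N. (a n t \<bullet> e j) *\<^sub>R \<gamma> j) - g t)) \<longlonglongrightarrow> 0" and gL2: "g \<in> L2 T" using gl by auto
      have id: "(LINT u:{0..t}|lebesgue. v u \<bullet> g u) =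
         (\<Sum>k=1..n. dd k t \<bullet> a k t - cc k t \<bullet> b k t) - (\<Sum>k=1..n. dd k 0 \<bullet> a k 0 - cc k 0 \<bullet> b k 0)"
        by (rule transposition_identity[OF v(1) ev ab(1) gL2 lim t])
      have s1: "(\<Sum>k=1..n. pairing (int n - int k + s - 1) (dual (int n - int k + s - 1) (dd k t)) (w k t)
          - pairing (int n - int k + s) (dual (int n - int k + s) (cc k t)) (w' k t)) = (\<Sum>k=1..n. dd k t \<bullet> a k t - cc k t \<bullet> b k t)"
        by (rule sum.cong[OF refl]) (simp only: ab(2,3) t pairing_dual_0 pairing_dual_1)
      have s2: "(\<Sum>k=1..n. pairing (int n - int k + s - 1) (y1 k) (w k 0)
          - pairing (int n - int k + s) (y0 k) (w' k 0)) = (\<Sum>k=1..n. dd k 0 \<bullet> a k 0 - cc k 0 \<bullet> b k 0)"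
      proof (rule sum.cong[OF refl])
        fix k assume k: "k \<in> {1..n}"
        have "cc k 0 = c0 k" "dd k 0 = d0 k" using cd k by blast+
        then show "pairing (int n - int k + s - 1) (y1 k) (w k 0) - pairing (int n - int k + s) (y0 k) (w' k 0)
            = dd k 0 \<bullet> a k 0 - cc k 0 \<bullet> b k 0"
          by (simp only: ab(2,3)[OF k T0(1)] y0[OF k] y1[OF k] pairing_dual_0 pairing_dual_1)
      qed
      show "\<exists>g. ob w w' g \<and> (LINT r:{0..t}|lebesgue. v r \<bullet> g r) =
             (\<Sum>k=1..n. pairing (int n - int k + s - 1) (dual (int n - int k + s - 1) (dd k t)) (w k t)
                       - pairing (int n - int k + s) (dual (int n - int k + s) (cc k t)) (w' k t))
           - (\<Sum>k=1..n. pairing (int n - int k + s - 1) (y1 k) (w k 0)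
                       - pairing (int n - int k + s) (y0 k) (w' k 0))"
        unfolding s1 s2 using g id by blast
    qed
    then show ?thesis by blast
  qed
  have zero: "y k T = (\<lambda>_. 0) \<and> y' k T = (\<lambda>_. 0)"
    if ts: "transposition_solution A n s C ob T y0 y1 v y y'" and k: "k \<in> {1..n}" for y y' k
  proof -
    have "\<forall>k\<in>{1..n}. \<exists>x. y k T = dual (int n - int k + s) x" "\<forall>k\<in>{1..n}. \<exists>x. y' k T = dual (int n - int k + s - 1) x"
      using ts T0(2) unfolding transposition_solution_def Hs_continuous_def Hs_eq by blast+
    then obtain ck dk where yT: "\<And>k. k \<in> {1..n} \<Longrightarrow> y k T = dual (int n - int k + s) (ck k)"
      "\<And>k. k \<in> {1..n} \<Longrightarrow> y' k T = dual (int n - int k + s - 1) (dk k)" by metis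
    \<comment> \<open>The choice of the control makes its pairing with the observation equal to
      \<open>ell\<close>, so the initial terms cancel and only the pairing of Y(T) with the final
      data of the cascade is left.\<close>
    have S0: "(\<Sum>k=1..n. dk k \<bullet> Lam (int k - int n - s + 1) (W k T) - ck k \<bullet> Lam (int k - int n - s) (W' k T)) = 0"
      if W: "cascade_solution A n C T W W'" for W W'
    proof -
      define w where "w = (\<lambda>k t. dual (int k - int n - s + 1) (Lam (int k - int n - s + 1) (W k t)))"
      define w' where "w' = (\<lambda>k t. dual (int k - int n - s) (Lam (int k - int n - s) (W' k t)))"
      have ds: "dual_solution A n s C T w w'" unfolding w_def w'_def by (rule cascade_dual_solution[OF W])
      obtain g where g: "ob w w' g" "(LINT r:{0..T}|lebesgue. v r \<bullet> g r) =
             (\<Sum>k=1..n. pairing (int n - int k + s - 1) (y' k T) (w k T)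
                       - pairing (int n - int k + s) (y k T) (w' k T))
           - (\<Sum>k=1..n. pairing (int n - int k + s - 1) (y1 k) (w k 0)
                       - pairing (int n - int k + s) (y0 k) (w' k 0))"
        using ts ds T0(2) unfolding transposition_solution_def by blast
      have "Obs W g" by (rule Obs_ob[OF W]) (use g(1) in \<open>simp only: w_def w'_def\<close>)
      then have "(g, ell W W') \<in> G" unfolding G_def using W by blast
      then have vg: "(LINT r:{0..T}|lebesgue. v r \<bullet> g r) = ell W W'" by (rule vG)
      have s1: "(\<Sum>k=1..n. pairing (int n - int k + s - 1) (y' k T) (w k T) - pairing (int n - int k + s) (y k T) (w' k T))
          = (\<Sum>k=1..n. dk k \<bullet> Lam (int k - int n - s + 1) (W k T) - ck k \<bullet> Lam (int k - int n - s) (W' k T))"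
        by (rule sum.cong[OF refl]) (simp only: w_def w'_def yT pairing_dual_0 pairing_dual_1)
      have s2: "(\<Sum>k=1..n. pairing (int n - int k + s - 1) (y1 k) (w k 0) - pairing (int n - int k + s) (y0 k) (w' k 0))
          = (\<Sum>k=1..n. d0 k \<bullet> Lam (int k - int n - s + 1) (W k 0) - c0 k \<bullet> Lam (int k - int n - s) (W' k 0))"
        by (rule sum.cong[OF refl]) (simp only: w_def w'_def y0 y1 pairing_dual_0 pairing_dual_1)
      show ?thesis using g(2) unfolding vg s1 s2 ell_def by simp
    qed
    have pe: "Lam i (Lam (- 1) (e j)) = (r j powi i * r j powi (- 1)) *\<^sub>R e j" for i j
      by (simp add: Lam_e Lam_scaleR hdom_e)
    have rp: "r j \<noteq> 0" for j using r_pos[of j] by simp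
    \<comment> \<open>Final data with a single nonzero position, an eigenvector in component
      \<open>k\<close>, isolates one coordinate of \<open>dk k\<close> up to a nonzero power of
      \<open>r j\<close>; the next step does the same for the velocities.\<close>
    have dk0: "dk k \<bullet> e j = 0" for j
    proof -
      obtain W W' where W: "cascade_solution A n C T W W'"
        "\<forall>i\<in>{1..n}. W i T = Lam (- 1) (if i = k then e j else 0) \<and> W' i T = 0"
        using cex[of "\<lambda>i. if i = k then e j else 0" "\<lambda>_. 0"] by blast
      have "(\<Sum>i=1..n. dk i \<bullet> Lam (int i - int n - s + 1) (W i T) - ck i \<bullet> Lam (int i - int n - s) (W' i T))
          = (\<Sum>i=1..n. if i = k then r j powi (int k - int n - s + 1) * r j powi (- 1) * (dk k \<bullet> e j) else 0)"
        using W(2) by (intro sum.cong[OF refl]) (auto simp: pe Lam_zero)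
      then show ?thesis using S0[OF W(1)] k rp by (simp add: sum.delta)
    qed
    have ck0: "ck k \<bullet> e j = 0" for j
    proof -
      obtain W W' where W: "cascade_solution A n C T W W'"
        "\<forall>i\<in>{1..n}. W i T = Lam (- 1) 0 \<and> W' i T = (if i = k then e j else 0)"
        using cex[of "\<lambda>_. 0" "\<lambda>i. if i = k then e j else 0"] by blast
      have "(\<Sum>i=1..n. dk i \<bullet> Lam (int i - int n - s + 1) (W i T) - ck i \<bullet> Lam (int i - int n - s) (W' i T))
          = (\<Sum>i=1..n. if i = k then - (r j powi (int k - int n - s) * (ck k \<bullet> e j)) else 0)"
        using W(2) by (intro sum.cong[OF refl]) (auto simp: Lam_e Lam_zero)
      then show ?thesis using S0[OF W(1)] k rp by (simp add: sum.delta)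
    qed
    have "ck k = 0" "dk k = 0" using total ck0 dk0 by blast+
    then show ?thesis using yT[OF k] by (simp add: dual_zero)
  qed
  show ?thesis unfolding driven_to_zero_def using v(1) exists zero by blast
qed

end

end

section \<open>The two types of control operators\<close>

context eigenbasis
begin

text \<open>The vectors recovered by \<open>riesz\<close> from functionals are known only for times
  in \<open>[0,T]\<close>, so solutions must be insensitive to changes elsewhere.\<close>

lemma wave_solution_cong:
  assumes w: "wave_solution A T w w' f" and f: "continuous_on {0..T} f"
    and eq: "\<And>t. t \<in> {0..T} \<Longrightarrow> v t = w t" "\<And>t. t \<in> {0..T} \<Longrightarrow> v' t = w' t" "\<And>t. t \<in> {0..T} \<Longrightarrow> g t = f t"
  shows "wave_solution A T v v' g" "continuous_on {0..T} g"
proof -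
  note c = wave_solution_continuous[OF w]
  show gc: "continuous_on {0..T} g" by (rule continuous_on_eq[OF f]) (simp add: eq(3))
  show "wave_solution A T v v' g"
  proof (rule wave_solutionI[OF L2_continuous[OF gc]])
    show "continuous_on {0..T} v'" by (rule continuous_on_eq[OF c(2)]) (simp add: eq(2))
    show "continuous_on {0..T} (\<lambda>t. Lam 1 (v t))" by (rule continuous_on_eq[OF c(3)]) (simp add: eq(1))
    fix t assume t: "t \<in> {0..T}"
    then have t0: "0 \<in> {0..T}" by simp
    show "v t \<in> hdom A 1" using c(4)[OF t] eq(1)[OF t] by simp
    show "(v has_vector_derivative v' t) (at t within {0..T})"
      unfolding eq(2)[OF t] by (rule has_vector_derivative_transform[OF t eq(1) wave_solution_vector_derivative[OF w t]])
    fix \<phi> assume \<phi>: "\<phi> \<in> hdom A 2"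
    have "(LINT s:{0..t}|lebesgue. v s \<bullet> Lam 2 \<phi>) = (LINT s:{0..t}|lebesgue. w s \<bullet> Lam 2 \<phi>)"
      "(LINT s:{0..t}|lebesgue. g s \<bullet> \<phi>) = (LINT s:{0..t}|lebesgue. f s \<bullet> \<phi>)"
      by (rule set_lebesgue_integral_cong; use t eq in auto)+
    then show "v' t \<bullet> \<phi> = v' 0 \<bullet> \<phi> - (LINT s:{0..t}|lebesgue. v s \<bullet> Lam 2 \<phi>) + (LINT s:{0..t}|lebesgue. g s \<bullet> \<phi>)"
      unfolding eq(2)[OF t] eq(2)[OF t0] using wave_solution_weak[OF w t \<phi>] by (simp only:)
  qed
qed

lemma is_observation_operator_congD:
  assumes B: "\<And>x x'. x \<in> hdom A 2 \<Longrightarrow> B (x, x') = B' (x, x')" and ob: "is_observation A B T w w' f g"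
  shows "is_observation A B' T w w' f g"
proof -
  obtain u u' h where u: "\<And>m::nat. regular_solution A T (u m) (u' m) (h m)"
    "uniform_limit {0..T} (\<lambda>m t. Lam 1 (u m t)) (\<lambda>t. Lam 1 (w t)) sequentially" "uniform_limit {0..T} u' w' sequentially"
    "(\<lambda>m. LINT t:{0..T}|lebesgue. (norm (h m t - f t))\<^sup>2) \<longlonglongrightarrow> 0"
    "(\<lambda>m. LINT t:{0..T}|lebesgue. (norm (B (u m t, u' m t) - g t))\<^sup>2) \<longlonglongrightarrow> 0"
    and wg: "wave_solution A T w w' f" "g \<in> L2 T"
    using ob unfolding is_observation_def by blast
  have "(LINT t:{0..T}|lebesgue. (norm (B (u m t, u' m t) - g t))\<^sup>2) = (LINT t:{0..T}|lebesgue. (norm (B' (u m t, u' m t) - g t))\<^sup>2)" for m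
    by (rule set_lebesgue_integral_cong) (use u(1)[of m] B in \<open>simp_all add: regular_solution_def\<close>)
  then have u5: "(\<lambda>m. LINT t:{0..T}|lebesgue. (norm (B' (u m t, u' m t) - g t))\<^sup>2) \<longlonglongrightarrow> 0" using u(5) by simp
  have "\<exists>u u' h. (\<forall>m::nat. regular_solution A T (u m) (u' m) (h m)) \<and>
        uniform_limit {0..T} (\<lambda>m t. Lam 1 (u m t)) (\<lambda>t. Lam 1 (w t)) sequentially \<and>
        uniform_limit {0..T} u' w' sequentially \<and>
        (\<lambda>m. LINT t:{0..T}|lebesgue. (norm (h m t - f t))\<^sup>2) \<longlonglongrightarrow> 0 \<and>
        (\<lambda>m. LINT t:{0..T}|lebesgue. (norm (B' (u m t, u' m t) - g t))\<^sup>2) \<longlonglongrightarrow> 0"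
    by (rule exI[of _ u], rule exI[of _ u'], rule exI[of _ h]) (intro conjI allI u(1-4) u5)
  then show ?thesis unfolding is_observation_def using wg by blast
qed

lemma is_observation_operator_cong:
  assumes "\<And>x x'. x \<in> hdom A 2 \<Longrightarrow> B (x, x') = B' (x, x')"
  shows "is_observation A B T w w' f g \<longleftrightarrow> is_observation A B' T w w' f g"
  using is_observation_operator_congD[of B B'] is_observation_operator_congD[of B' B] assms by metis

text \<open>Boundedness passes by duality from the adjoint on order \<open>q\<close> to
  \<open>L\<close> itself on order \<open>- q\<close>.\<close>

lemma adjoint_bounded_negative:
  assumes L: "bounded_linear L" and q: "0 \<le> q"
    and bo: "bounded_op (hdom A q) (hnorm A q) (hdom A q) (hnorm A q) (adjoint L)"
  obtains c where "0 \<le> c" "\<And>x. norm (Lam (- q) (L x)) \<le> c * norm (Lam (- q) x)"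
proof -
  have ad: "x \<in> hdom A q \<Longrightarrow> adjoint L x \<in> hdom A q" for x using bo unfolding bounded_op_def by blast
  obtain c0 where c0: "\<And>x. x \<in> hdom A q \<Longrightarrow> norm (Lam q (adjoint L x)) \<le> c0 * norm (Lam q x)"
    using bo unfolding bounded_op_def hnorm_def by blast
  define c where "c = max c0 0"
  have c: "norm (Lam q (adjoint L x)) \<le> c * norm (Lam q x)" if "x \<in> hdom A q" for x
    using order_trans[OF c0[OF that] mult_right_mono[of c0 c "norm (Lam q x)"]] by (simp add: c_def)
  have "norm (Lam (- q) (L x)) \<le> c * norm (Lam (- q) x)" for x
  proof (cases "Lam (- q) (L x) = 0")
    case False
    define y where "y = Lam (- q) (L x)"
    \<comment> \<open>With this \<open>u\<close> the squared norm of \<open>y\<close> is the inner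
      product of \<open>L x\<close> with \<open>u\<close>; moving \<open>L\<close> to the other side
      leaves a bound with one factor \<open>norm y\<close>, which cancels.\<close>
    define u where "u = Lam (- q) y"
    have N: "z \<in> hdom A (- q)" for z using q by (simp add: hdom_nonpos)
    have u: "u \<in> hdom A q" "Lam q u = y" unfolding u_def using Lam_neg_in[OF q] Lam_neg_Lam[OF q] by auto
    have "y \<bullet> y = L x \<bullet> u" using Lam_sym[OF N N, of "L x" y] unfolding u_def y_def by simp
    also have "\<dots> = x \<bullet> adjoint L u" by (rule adjoint_inner[OF L])
    also have "\<dots> = Lam (- q) x \<bullet> Lam q (adjoint L u)"
      using Lam_sym[OF N N, of x "Lam q (adjoint L u)"] Lam_Lam_neg[OF ad[OF u(1)]] by simp
    also have "\<dots> \<le> norm (Lam (- q) x) * norm (Lam q (adjoint L u))" by (rule norm_cauchy_schwarz)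
    also have "\<dots> \<le> norm (Lam (- q) x) * (c * norm y)" using c[OF u(1)] unfolding u(2) by (intro mult_left_mono) auto
    finally have "norm y * norm y \<le> (c * norm (Lam (- q) x)) * norm y"
      by (simp add: power2_norm_eq_inner[symmetric] power2_eq_square algebra_simps)
    then show ?thesis using False unfolding y_def[symmetric] by (simp add: mult_le_cancel_right)
  qed (simp add: c_def)
  then show ?thesis using that[of c] by (simp add: c_def)
qed

lemma rotation_evolution:
  defines "x a b N \<equiv> \<lambda>t. \<Sum>j<N. (cos (r j * t) * a j + sin (r j * t) * b j) *\<^sub>R e j"
    and "y a b N \<equiv> \<lambda>t. \<Sum>j<N. (- sin (r j * t) * a j + cos (r j * t) * b j) *\<^sub>R e j"
  shows "classical_evolution T (\<lambda>_. 0) (x a b N) (y a b N)"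
    "(norm (x a b N t))\<^sup>2 \<le> (\<Sum>j<N. (a j)\<^sup>2 + (b j)\<^sup>2)" "(norm (y a b N t))\<^sup>2 \<le> (\<Sum>j<N. (a j)\<^sup>2 + (b j)\<^sup>2)"
proof -
  show "classical_evolution T (\<lambda>_. 0) (x a b N) (y a b N)"
    unfolding classical_evolution_def
  proof (intro conjI allI ballI)
    show "continuous_on {0..T} (x a b N)" "continuous_on {0..T} (y a b N)" unfolding x_def y_def by (intro continuous_intros)+
    fix j t
    show "((\<lambda>t. x a b N t \<bullet> e j) has_real_derivative r j * (y a b N t \<bullet> e j)) (at t within {0..T})"
      unfolding x_def y_def inner_sum_e
      by (cases "j < N \<and> e j \<noteq> 0") (auto intro!: derivative_eq_intros simp: algebra_simps)
    show "((\<lambda>t. y a b N t \<bullet> e j) has_real_derivative - r j * (x a b N t \<bullet> e j) + 0 \<bullet> e j) (at t within {0..T})"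
      unfolding x_def y_def inner_sum_e
      by (cases "j < N \<and> e j \<noteq> 0") (auto intro!: derivative_eq_intros simp: algebra_simps)
  qed
  show "(norm (x a b N t))\<^sup>2 \<le> (\<Sum>j<N. (a j)\<^sup>2 + (b j)\<^sup>2)"
    unfolding x_def by (rule order_trans[OF norm_sum_e_le]) (intro sum_mono rotation_le)
  have "(- sin z * p + cos z * q)\<^sup>2 \<le> p\<^sup>2 + q\<^sup>2" for z p q :: real
    using rotation_le[of z q "- p"] by (simp add: algebra_simps)
  then show "(norm (y a b N t))\<^sup>2 \<le> (\<Sum>j<N. (a j)\<^sup>2 + (b j)\<^sup>2)"
    unfolding y_def by (intro order_trans[OF norm_sum_e_le] sum_mono)
qed

context
  fixes n :: nat and C P :: "nat \<Rightarrow> 'h \<Rightarrow> 'h" and B :: "'h \<times> 'h \<Rightarrow> 'g::{real_inner, complete_space}"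
    and T Tstar :: real
  assumes n: "2 \<le> n" and coup: "coupling_hyp A n C P" and adm: "admissibility_hyp A B"
    and ot: "observability_time A n C B Tstar" and TT: "Tstar < T"
begin

lemma coupling_linear: "i \<in> {2..n} \<Longrightarrow> bounded_linear (C i)"
  using coup unfolding coupling_hyp_def by blast

lemma coupling_adjoint: "i \<in> {2..n} \<Longrightarrow> k \<in> {0..int n - int i + 1} \<Longrightarrow>
    bounded_op (hdom A k) (hnorm A k) (hdom A k) (hnorm A k) (adjoint (C i))"
  using coup unfolding coupling_hyp_def by blast

lemma T_pos: "0 < T"
  using ot TT unfolding observability_time_def by linarith

lemma observability_inequality:
  obtains K where "0 \<le> K" "\<And>W W' g i. cascade_solution A n C T W W' \<Longrightarrow>
      is_observation A B T (W n) (W' n) (\<lambda>t. if n = 1 then 0 else - C n (W (n - 1) t)) g \<Longrightarrow> i \<in> {1..n} \<Longrightarrow>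
      norm (Lam (int i - int n + 1) (W i 0)) \<le> K * norm2 T g \<and> norm (Lam (int i - int n) (W' i 0)) \<le> K * norm2 T g"
proof -
  obtain d where d: "\<And>i. i \<in> {1..n} \<Longrightarrow> 0 < d i T"
    "\<And>i W W' g. i \<in> {1..n} \<Longrightarrow> cascade_solution A n C T W W' \<Longrightarrow>
      is_observation A B T (W n) (W' n) (\<lambda>t. if n = 1 then 0 else - C n (W (n - 1) t)) g \<Longrightarrow>
      energy A (1 + int i - int n) (W i 0) (W' i 0) \<le> d i T * (LINT t:{0..T}|lebesgue. (norm (g t))\<^sup>2)"
    using ot TT unfolding observability_time_def by blast
  \<comment> \<open>One constant for all components: the sum dominates each term, and the factor 2
    undoes the one half in the energy.\<close>
  define K where "K = (\<Sum>i=1..n. sqrt (2 * d i T))"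
  have dK: "sqrt (2 * d i T) \<le> K" if "i \<in> {1..n}" for i
    unfolding K_def by (rule member_le_sum[OF that]) (use d(1) in \<open>auto simp: less_imp_le\<close>)
  show ?thesis
  proof (rule that)
    show "0 \<le> K" unfolding K_def by (rule sum_nonneg) (use d(1) in \<open>auto simp: less_imp_le\<close>)
    fix W W' g i
    assume W: "cascade_solution A n C T W W'"
      "is_observation A B T (W n) (W' n) (\<lambda>t. if n = 1 then 0 else - C n (W (n - 1) t)) g" and i: "i \<in> {1..n}"
    have o: "1 + int i - int n = int i - int n + 1" "1 + int i - int n - 1 = int i - int n" by simp_all
    have "energy A (1 + int i - int n) (W i 0) (W' i 0) \<le> d i T * (norm2 T g)\<^sup>2" using d(2)[OF i W] by (simp only: norm2_sq)
    then have le: "(norm (Lam (int i - int n + 1) (W i 0)))\<^sup>2 + (norm (Lam (int i - int n) (W' i 0)))\<^sup>2 \<le> 2 * d i T * (norm2 T g)\<^sup>2"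
      unfolding energy_def hnorm_def o(2) unfolding o(1) by simp
    have "2 * d i T * (norm2 T g)\<^sup>2 = (sqrt (2 * d i T) * norm2 T g)\<^sup>2" using d(1)[OF i] by (simp add: power_mult_distrib)
    also have "\<dots> \<le> (K * norm2 T g)\<^sup>2"
      by (intro power_mono mult_right_mono dK[OF i] mult_nonneg_nonneg) (use d(1)[OF i] norm2_nonneg[of T g] in auto)
    finally have bd: "2 * d i T * (norm2 T g)\<^sup>2 \<le> (K * norm2 T g)\<^sup>2" .
    have "0 \<le> K * norm2 T g" using \<open>0 \<le> K\<close> norm2_nonneg[of T g] by (rule mult_nonneg_nonneg)
    then show "norm (Lam (int i - int n + 1) (W i 0)) \<le> K * norm2 T g \<and> norm (Lam (int i - int n) (W' i 0)) \<le> K * norm2 T g"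
      using le bd zero_le_power2[of "norm (Lam (int i - int n + 1) (W i 0))"] zero_le_power2[of "norm (Lam (int i - int n) (W' i 0))"]
        power2_le_imp_le[of "norm (Lam (int i - int n + 1) (W i 0))" "K * norm2 T g"]
        power2_le_imp_le[of "norm (Lam (int i - int n) (W' i 0))" "K * norm2 T g"] by linarith
  qed
qed

text \<open>Case (ii). Admissibility acts twice: it defines the observation of the last component,
  which has finite energy although the others need not, and it gives the modal bound
  \<open>admissible\<close>.\<close>

lemma control_unbounded:
  fixes Bn :: "'g \<Rightarrow> 'h \<Rightarrow> real"
  assumes Bn: "\<And>w w'. w \<in> hdom A 2 \<Longrightarrow> B (w, w') = dual_adjoint Bn w" and Y: "(y0, y1) \<in> state_space A n 0"
  shows "\<exists>v\<in>L2 T. driven_to_zero A n 0 C (unbounded_obs A C Bn T n) T y0 y1 v"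
proof -
  note T = T_pos
  define \<beta> where "\<beta> j = B (e j, 0)" for j
  \<comment> \<open>The observation ignores the velocity, so \<open>B (0, y)\<close> equals
    \<open>B (0, 0)\<close>, which vanishes by homogeneity.\<close>
  have B0: "B (0, y) = 0" for y
    using Bn[OF hdom_zero, of y] Bn[OF hdom_zero, of 0] B_scaleR[OF adm hdom_zero, of 0 0] by simp
  have Bp: "B (proj N x, proj N y) = (\<Sum>j<N. (x \<bullet> e j) *\<^sub>R \<beta> j)" for N x y
    unfolding B_proj[OF adm] \<beta>_def by (simp add: B0)
  have \<beta>0: "\<beta> j = 0" if "e j = 0" for j unfolding \<beta>_def that by (rule B0)
  have ob: "unbounded_obs A C Bn T n w w' g \<longleftrightarrow> is_observation A B T (\<lambda>t. riesz (w n t)) (\<lambda>t. riesz (w' n t))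
       (\<lambda>t. if n = 1 then 0 else - C n (riesz (w (n - 1) t))) g" for w w' g
    unfolding unbounded_obs_def by (rule is_observation_operator_cong) (simp add: Bn)
  have nn: "n \<in> {1..n}" "n - 1 \<in> {1..n}" "n \<in> {2..n}" using n by auto
  \<comment> \<open>For \<open>s = 0\<close> the last component has orders 1 and 0, and the one
    before it takes values in H. Moreover \<open>Rop n\<close> is the adjoint of \<open>C n\<close>
    itself, so the last equation is a wave equation with continuous H-valued source.\<close>
  have ws: "wave_solution A T (\<lambda>t. riesz (w n t)) (\<lambda>t. riesz (w' n t)) (\<lambda>t. if n = 1 then 0 else - C n (riesz (w (n - 1) t)))"
    "continuous_on {0..T} (\<lambda>t. if n = 1 then 0 else - C n (riesz (w (n - 1) t)))"
    "\<And>t j. t \<in> {0..T} \<Longrightarrow> w n t (e j) = riesz (w n t) \<bullet> e j"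
    if ds: "dual_solution A n 0 C T w w'" for w w'
  proof -
    obtain a b where ab: "normal_dual n 0 C T a b"
        "\<And>k t. k \<in> {1..n} \<Longrightarrow> t \<in> {0..T} \<Longrightarrow> w k t = dual (int k - int n - 0 + 1) (a k t)"
        "\<And>k t. k \<in> {1..n} \<Longrightarrow> t \<in> {0..T} \<Longrightarrow> w' k t = dual (int k - int n - 0) (b k t)"
      by (rule dual_solution_normal[OF T n _ _ coupling_linear coupling_adjoint ds]) (assumption | simp | (rule that; assumption))+
    have ac: "continuous_on {0..T} (a k)" "continuous_on {0..T} (b k)" if "k \<in> {1..n}" for k
      by (rule normal_dualD(1,2)[OF T n order_refl zero_le_one coupling_linear coupling_adjoint ab(1) that]; assumption)+
    have wn: "w n t = inner (Lam (- 1) (a n t))" "w' n t = inner (b n t)" "w (n - 1) t = inner (a (n - 1) t)" if "t \<in> {0..T}" for t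
      using ab(2)[OF nn(1) that] ab(3)[OF nn(1) that] ab(2)[OF nn(2) that] n by (simp_all add: dual_nonneg Lam_0)
    define f where "f t = - C n (a (n - 1) t)" for t
    have fc: "continuous_on {0..T} f" unfolding f_def
      by (intro continuous_on_minus bounded_linear.continuous_on[OF coupling_linear[OF nn(3)] ac(1)[OF nn(2)]])
    have "classical_evolution T f (a n) (b n)"
      unfolding classical_evolution_def
    proof (intro conjI allI ballI ac nn)
      fix j t assume t: "t \<in> {0..T}"
      have D: "((\<lambda>t. a n t \<bullet> e j) has_real_derivative r j * (b n t \<bullet> e j)) (at t within {0..T})"
        "((\<lambda>t. b n t \<bullet> e j) has_real_derivative - r j * (a n t \<bullet> e j)
          + (if n = 1 then 0 else - (a (n - 1) t \<bullet> Rop n 0 C n (e j)))) (at t within {0..T})"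
        by (rule normal_dualD(3,4)[OF T n order_refl zero_le_one coupling_linear coupling_adjoint ab(1) nn(1) t]; assumption)+
      show "((\<lambda>t. a n t \<bullet> e j) has_real_derivative r j * (b n t \<bullet> e j)) (at t within {0..T})" by (rule D(1))
      have "a (n - 1) t \<bullet> Rop n 0 C n (e j) = C n (a (n - 1) t) \<bullet> e j"
        by (subst Rop_last[OF T n order_refl zero_le_one coupling_linear coupling_adjoint refl]; (assumption | simp add: adjoint_inner[OF coupling_linear[OF nn(3)]]))
      then show "((\<lambda>t. b n t \<bullet> e j) has_real_derivative - r j * (a n t \<bullet> e j) + f t \<bullet> e j) (at t within {0..T})"
        using D(2) n by (simp add: f_def)
    qed
    from classical_evolution_wave_solution[OF T fc this]
    have w0: "wave_solution A T (\<lambda>t. Lam (- 1) (a n t)) (b n) f" .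
    have eq: "riesz (w n t) = Lam (- 1) (a n t)" "riesz (w' n t) = b n t" "(if n = 1 then 0 else - C n (riesz (w (n - 1) t))) = f t"
      if "t \<in> {0..T}" for t
      unfolding wn(1,2)[OF that] riesz_inner by (rule refl)+ (use n wn(3)[OF that] in \<open>auto simp: riesz_inner f_def simp del: One_nat_def\<close>)
    show "wave_solution A T (\<lambda>t. riesz (w n t)) (\<lambda>t. riesz (w' n t)) (\<lambda>t. if n = 1 then 0 else - C n (riesz (w (n - 1) t)))"
      "continuous_on {0..T} (\<lambda>t. if n = 1 then 0 else - C n (riesz (w (n - 1) t)))"
      by (rule wave_solution_cong[OF w0 fc eq]; assumption)+
    show "w n t (e j) = riesz (w n t) \<bullet> e j" if "t \<in> {0..T}" for t j
      unfolding eq(1)[OF that] using wn(1)[OF that] by simp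
  qed
  obtain D where D: "0 < D" "\<And>u u' h \<eta>. regular_solution A T u u' h \<Longrightarrow> 0 \<le> \<eta> \<Longrightarrow>
    (\<And>t. t \<in> {0..T} \<Longrightarrow> norm (Lam 1 (u t)) \<le> \<eta>) \<Longrightarrow> (\<And>t. t \<in> {0..T} \<Longrightarrow> norm (u' t) \<le> \<eta>) \<Longrightarrow> norm2 T h \<le> \<eta> \<Longrightarrow>
    norm2 T (\<lambda>t. B (u t, u' t)) \<le> D * \<eta>" by (rule admissibility_estimate[OF adm T]) blast
  \<comment> \<open>The estimate is applied to the free solution with coordinates \<open>a\<close>
    and \<open>b\<close>, whose position is \<open>Lam (- 1) (x t)\<close>; this is where the factor
    \<open>r j powi (0 - 1)\<close> arises. Its energy norm is at most \<open>sqrt S\<close> at all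
    times, whence the constant \<open>D\<^sup>2\<close>.\<close>
  have admT: "admissible T (\<lambda>j. (r j powi (0 - 1)) *\<^sub>R \<beta> j) (D\<^sup>2)"
    unfolding admissible_def
  proof (intro conjI allI impI)
    show "0 < D\<^sup>2" using D by simp
    show "e j = 0 \<Longrightarrow> (r j powi (0 - 1)) *\<^sub>R \<beta> j = 0" for j by (simp add: \<beta>0)
    fix N and a b :: "nat \<Rightarrow> real"
    define S where "S = (\<Sum>j<N. (a j)\<^sup>2 + (b j)\<^sup>2)"
    have S: "0 \<le> S" unfolding S_def by (intro sum_nonneg) auto
    define x where "x t = (\<Sum>j<N. (cos (r j * t) * a j + sin (r j * t) * b j) *\<^sub>R e j)" for t
    define y where "y t = (\<Sum>j<N. (- sin (r j * t) * a j + cos (r j * t) * b j) *\<^sub>R e j)" for t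
    have ev: "classical_evolution T (\<lambda>_. 0) x y" and xS: "(norm (x t))\<^sup>2 \<le> S" and yS: "(norm (y t))\<^sup>2 \<le> S" for t
      using rotation_evolution[where N=N and a=a and b=b] unfolding x_def y_def S_def by auto
    have zc: "continuous_on {0..T} (\<lambda>_. 0 :: 'h)" by simp
    note reg = regular_proj[OF classical_evolution_wave_solution[OF T zc ev] zc, of N]
    have "norm2 T (\<lambda>t. B (proj N (Lam (- 1) (x t)), proj N (y t))) \<le> D * sqrt S"
    proof (rule D(2)[OF reg])
      show "norm (Lam 1 (proj N (Lam (- 1) (x t)))) \<le> sqrt S" for t
        using Lam_neg_in[of 1] Lam_neg_Lam[of 1] norm_proj_le[of N "x t"] real_le_rsqrt[OF xS[of t]] by (simp add: Lam_proj)
      show "norm (proj N (y t)) \<le> sqrt S" for t using norm_proj_le[of N "y t"] real_le_rsqrt[OF yS[of t]] by linarith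
      show "norm2 T (\<lambda>t. proj N 0) \<le> sqrt S" using S by (simp add: proj_def norm2_def set_integral_lebesgue_on)
    qed (use S in simp)
    moreover have "B (proj N (Lam (- 1) (x t)), proj N (y t))
        = (\<Sum>j<N. (cos (r j * t) * a j + sin (r j * t) * b j) *\<^sub>R (r j powi (0 - 1)) *\<^sub>R \<beta> j)" for t
      unfolding Bp
      by (rule sum.cong[OF refl]) (auto simp: Lam_coef hdom_nonpos x_def inner_sum_e \<beta>0 mult.commute)
    ultimately have "norm2 T (\<lambda>t. \<Sum>j<N. (cos (r j * t) * a j + sin (r j * t) * b j) *\<^sub>R (r j powi (0 - 1)) *\<^sub>R \<beta> j) \<le> D * sqrt S"
      by simp
    then have "(norm2 T (\<lambda>t. \<Sum>j<N. (cos (r j * t) * a j + sin (r j * t) * b j) *\<^sub>R (r j powi (0 - 1)) *\<^sub>R \<beta> j))\<^sup>2 \<le> (D * sqrt S)\<^sup>2"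
      by (intro power_mono norm2_nonneg)
    also have "\<dots> = D\<^sup>2 * S" using S by (simp add: power_mult_distrib)
    finally show "(norm2 T (\<lambda>t. \<Sum>j<N. (cos (r j * t) * a j + sin (r j * t) * b j) *\<^sub>R (r j powi (0 - 1)) *\<^sub>R \<beta> j))\<^sup>2
        \<le> D\<^sup>2 * (\<Sum>j<N. (a j)\<^sup>2 + (b j)\<^sup>2)" unfolding S_def .
  qed
  obtain K where K: "0 \<le> K" "\<And>W W' g i. cascade_solution A n C T W W' \<Longrightarrow>
      is_observation A B T (W n) (W' n) (\<lambda>t. if n = 1 then 0 else - C n (W (n - 1) t)) g \<Longrightarrow> i \<in> {1..n} \<Longrightarrow>
      norm (Lam (int i - int n + 1) (W i 0)) \<le> K * norm2 T g \<and> norm (Lam (int i - int n) (W' i 0)) \<le> K * norm2 T g"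
    by (rule observability_inequality) blast
  show ?thesis
  proof (rule exact_control[OF T n order_refl zero_le_one coupling_linear coupling_adjoint _ _ admT K(1) _ Y])
    fix w w' assume ds: "dual_solution A n 0 C T w w'"
    obtain g where "g \<in> L2 T" "(\<lambda>N. norm2 T (\<lambda>t. B (proj N (riesz (w n t)), proj N (riesz (w' n t))) - g t)) \<longlonglongrightarrow> 0"
      by (rule truncation_converges[OF adm T ws(1,2)[OF ds]])
    from is_observation_truncation[OF adm T ws(1,2)[OF ds] this]
    show "\<exists>g. unbounded_obs A C Bn T n w w' g" unfolding ob by blast
  next
    fix w w' g assume ds: "dual_solution A n 0 C T w w'" and "unbounded_obs A C Bn T n w w' g"
    then have g: "is_observation A B T (\<lambda>t. riesz (w n t)) (\<lambda>t. riesz (w' n t))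
       (\<lambda>t. if n = 1 then 0 else - C n (riesz (w (n - 1) t))) g" unfolding ob by blast
    have "norm2 T (\<lambda>t. (\<Sum>j<N. w n t (e j) *\<^sub>R \<beta> j) - g t) = norm2 T (\<lambda>t. B (proj N (riesz (w n t)), proj N (riesz (w' n t))) - g t)" for N
      unfolding Bp by (rule norm2_cong) (simp only: ws(3)[OF ds])
    then show "g \<in> L2 T \<and> (\<lambda>N. norm2 T (\<lambda>t. (\<Sum>j<N. w n t (e j) *\<^sub>R \<beta> j) - g t)) \<longlonglongrightarrow> 0"
      using is_observation_converges[OF adm T ws(1,2)[OF ds] g] g unfolding is_observation_def by simp
  next
    fix W W' g k
    assume W: "cascade_solution A n C T W W'" and g: "g \<in> L2 T" "(\<lambda>N. norm2 T (\<lambda>t. (\<Sum>j<N. (W n t \<bullet> e j) *\<^sub>R \<beta> j) - g t)) \<longlonglongrightarrow> 0"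
      and k: "k \<in> {1..n}"
    have "is_observation A B T (W n) (W' n) (\<lambda>t. if n = 1 then 0 else - C n (W (n - 1) t)) g"
      by (rule is_observation_truncation[OF adm T bspec[OF W[unfolded cascade_solution_def] nn(1)]
            cascade_source_continuous[OF W coupling_linear nn(1)] g(1)]) (simp_all only: Bp g(2))
    from K(2)[OF W this k]
    show "norm (Lam (int k - int n - 0 + 1) (W k 0)) \<le> K * norm2 T g \<and> norm (Lam (int k - int n - 0) (W' k 0)) \<le> K * norm2 T g"
      by simp
  qed
qed

text \<open>In case (i) the observability inequality is applied to the cascade solution \<open>Z\<close> with
  \<open>Z' = W\<close>, whose energy is that of \<open>W\<close> one order lower.\<close>

lemma cascade_antiderivative:
  assumes W: "cascade_solution A n C T W W'"
  obtains z where "cascade_solution A n C T z W" "regular_solution A T (z n) (W n) (\<lambda>t. if n = 1 then 0 else - C n (z (n - 1) t))"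
    "\<And>i t. i \<in> {1..n} \<Longrightarrow> z i t \<in> hdom A 2"
    "\<And>i t. i \<in> {1..n} \<Longrightarrow> W' i t = - Lam 2 (z i t) - (if i = 1 then 0 else C i (z (i - 1) t))"
proof -
  note T = T_pos
  \<comment> \<open>The antiderivative is obtained by solving the cascade equation for it:
    \<open>Z'' = W'\<close> forces \<open>A z_i = - W_i' - C_i z_(i-1)\<close>, an elliptic problem
    at each time. The recursion step from \<open>i\<close> builds component \<open>i + 1\<close>;
    component 0 is a dummy and component 1 has no coupling.\<close>
  define z where "z = rec_nat (\<lambda>_::real. 0) (\<lambda>i x t. - Lam (- 2) (W' (Suc i) t + (if i = 0 then 0 else C (Suc i) (x t))))"
  have zS: "z (Suc i) t = - Lam (- 2) (W' (Suc i) t + (if i = 0 then 0 else C (Suc i) (z i t)))" for i t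
    by (simp add: z_def)
  have zi: "z i t = - Lam (- 2) (W' i t + (if i = 1 then 0 else C i (z (i - 1) t)))" if "i \<in> {1..n}" for i t
    using zS[of "i - 1" t] that by auto
  have z2: "z i t \<in> hdom A 2" if "i \<in> {1..n}" for i t
    unfolding zi[OF that] using hdom_scaleR[OF Lam_neg_in[of 2], of "- 1"] by simp
  have zL: "W' i t = - Lam 2 (z i t) - (if i = 1 then 0 else C i (z (i - 1) t))" if "i \<in> {1..n}" for i t
  proof -
    define y where "y = W' i t + (if i = 1 then 0 else C i (z (i - 1) t))"
    have "Lam 2 (z i t) = Lam 2 ((- 1) *\<^sub>R Lam (- 2) y)" unfolding zi[OF that] y_def by simp
    also have "\<dots> = - y" unfolding Lam_scaleR[OF Lam_neg_in[of 2, simplified]] using Lam_neg_Lam[of 2 y] by simp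
    finally have "Lam 2 (z i t) = - y" .
    moreover have "W' i t = y - (if i = 1 then 0 else C i (z (i - 1) t))" by (simp add: y_def)
    ultimately show ?thesis by (simp only: minus_minus)
  qed
  have ws: "wave_solution A T (W i) (W' i) (\<lambda>t. if i = 1 then 0 else - C i (W (i - 1) t))" if "i \<in> {1..n}" for i
    by (rule bspec[OF W[unfolded cascade_solution_def] that])
  have Wc: "continuous_on {0..T} (W i)" "continuous_on {0..T} (W' i)" if "i \<in> {1..n}" for i
    using wave_solution_continuous(1,2)[OF ws[OF that]] .
  \<comment> \<open>Differentiating the defining relation, the derivative of the coupling term is
    known from the previous component and cancels the source in the equation of \<open>W'\<close>;
    what remains is \<open>A\<close> applied to \<open>W\<close>, which the inverse of
    \<open>A\<close> removes.\<close>
  have zd: "\<forall>t\<in>{0..T}. (z i has_vector_derivative W i t) (at t within {0..T})" if "i \<in> {1..n}" for i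
    using that
  proof (induction i)
    case (Suc i)
    show ?case
    proof
      fix t assume t: "t \<in> {0..T}"
      show "(z (Suc i) has_vector_derivative W (Suc i) t) (at t within {0..T})"
      proof (rule weak_imp_strong_derivative[OF Wc(1)[OF Suc.prems] _ t])
        fix j t assume t: "t \<in> {0..T}"
        define f where "f t = (if Suc i = 1 then 0 else - C (Suc i) (W (Suc i - 1) t))" for t
        have fc: "continuous_on {0..T} f" unfolding f_def by (rule cascade_source_continuous[OF W coupling_linear Suc.prems])
        have d1: "((\<lambda>t. W' (Suc i) t \<bullet> e j) has_real_derivative f t \<bullet> e j - W (Suc i) t \<bullet> Lam 2 (e j)) (at t within {0..T})"
          by (rule wave_solutionD(2)[OF ws[OF Suc.prems, folded f_def] t fc hdom_e])
        have d2: "((\<lambda>t. (if i = 0 then 0 else C (Suc i) (z i t)) \<bullet> e j) has_real_derivative - f t \<bullet> e j) (at t within {0..T})"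
        proof (cases "i = 0")
          case False
          then have i: "i \<in> {1..n}" "Suc i \<in> {2..n}" using Suc.prems by auto
          have "bounded_linear (\<lambda>x. C (Suc i) x \<bullet> e j)"
            by (rule bounded_linear_compose[OF bounded_linear_inner_left coupling_linear[OF i(2)]])
          from bounded_linear.has_vector_derivative[OF this bspec[OF Suc.IH[OF i(1)] t]]
          show ?thesis using False by (simp add: f_def has_real_derivative_iff_has_vector_derivative)
        qed (simp add: f_def)
        have zj: "z (Suc i) t \<bullet> e j = (W' (Suc i) t \<bullet> e j + (if i = 0 then 0 else C (Suc i) (z i t)) \<bullet> e j) * (- 1 / (r j)\<^sup>2)" for t
          unfolding zS by (simp add: Lam_coef hdom_nonpos power_int_def inner_add_left field_simps)
        have "((\<lambda>t. (W' (Suc i) t \<bullet> e j + (if i = 0 then 0 else C (Suc i) (z i t)) \<bullet> e j) * (- 1 / (r j)\<^sup>2)) has_real_derivative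
            (f t \<bullet> e j - W (Suc i) t \<bullet> Lam 2 (e j) + - f t \<bullet> e j) * (- 1 / (r j)\<^sup>2)) (at t within {0..T})"
          by (rule DERIV_cmult_right[OF DERIV_add[OF d1 d2]])
        moreover have "(f t \<bullet> e j - W (Suc i) t \<bullet> Lam 2 (e j) + - f t \<bullet> e j) * (- 1 / (r j)\<^sup>2) = W (Suc i) t \<bullet> e j"
          using r_pos[of j] by (simp add: Lam_e)
        ultimately show "((\<lambda>t. z (Suc i) t \<bullet> e j) has_real_derivative W (Suc i) t \<bullet> e j) (at t within {0..T})"
          unfolding zj by simp
      qed
    qed
  qed simp
  have zc: "continuous_on {0..T} (z i)" if "i \<in> {1..n}" for i
    using zd[OF that] by (meson continuous_on_eq_continuous_within has_vector_derivative_continuous)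
  have Fc: "continuous_on {0..T} (\<lambda>t. if i = 1 then 0 else - C i (z (i - 1) t))" if i: "i \<in> {1..n}" for i
  proof (cases "i = 1")
    case False
    then have "continuous_on {0..T} (\<lambda>t. - C i (z (i - 1) t))"
      using i by (intro continuous_on_minus bounded_linear.continuous_on[OF coupling_linear zc]) auto
    then show ?thesis using False by simp
  qed simp
  have L2c: "continuous_on {0..T} (\<lambda>t. Lam 2 (z i t))" if i: "i \<in> {1..n}" for i
  proof -
    have "Lam 2 (z i t) = (if i = 1 then 0 else - C i (z (i - 1) t)) - W' i t" for t using zL[OF i, of t] by auto
    then show ?thesis by (simp only:) (intro continuous_on_diff Fc Wc i)
  qed
  have wz: "wave_solution A T (z i) (W i) (\<lambda>t. if i = 1 then 0 else - C i (z (i - 1) t))" if i: "i \<in> {1..n}" for i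
  proof -
    define F where "F t = (if i = 1 then 0 else - C i (z (i - 1) t))" for t
    have h1: "z i t \<in> hdom A 1" for t using hdom_le(1)[OF _ z2[OF i], of 1] by simp
    have L1: "Lam 1 (z i t) = Lam (- 1) (Lam 2 (z i t))" for t using hdom_Lam(2)[OF z2[OF i, of t], of "- 1"] h1 by simp
    have "classical_evolution T F (\<lambda>t. Lam 1 (z i t)) (W i)"
      unfolding classical_evolution_def
    proof (intro conjI allI ballI Wc i)
      show "continuous_on {0..T} (\<lambda>t. Lam 1 (z i t))"
        unfolding L1 by (rule bounded_linear.continuous_on[OF bounded_linear_Lam L2c[OF i]]) simp
      fix j t assume t: "t \<in> {0..T}"
      have "((\<lambda>t. z i t \<bullet> e j) has_real_derivative W i t \<bullet> e j) (at t within {0..T})"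
        using bounded_linear.has_vector_derivative[OF bounded_linear_inner_left bspec[OF zd[OF i] t]]
        by (simp add: has_real_derivative_iff_has_vector_derivative)
      from DERIV_cmult[OF this, of "r j"]
      show "((\<lambda>t. Lam 1 (z i t) \<bullet> e j) has_real_derivative r j * (W i t \<bullet> e j)) (at t within {0..T})"
        by (simp add: Lam_coef h1)
      have "- r j * (Lam 1 (z i t) \<bullet> e j) + F t \<bullet> e j = W' i t \<bullet> e j"
      proof -
        have "W' i t = - Lam 2 (z i t) + F t" using zL[OF i, of t] by (simp add: F_def)
        then show ?thesis by (simp add: Lam_coef h1 z2[OF i] inner_add_left inner_diff_left power2_eq_square)
      qed
      then show "((\<lambda>t. W i t \<bullet> e j) has_real_derivative - r j * (Lam 1 (z i t) \<bullet> e j) + F t \<bullet> e j) (at t within {0..T})"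
        using wave_solutionD(1)[OF ws[OF i] t, of "e j"] by simp
    qed
    from classical_evolution_wave_solution[OF T Fc[OF i, folded F_def] this]
    show ?thesis using Lam_Lam_neg[OF h1] unfolding F_def by simp
  qed
  have nn: "n \<in> {1..n}" using n by auto
  show ?thesis
  proof (rule that)
    show "cascade_solution A n C T z W" unfolding cascade_solution_def using wz by blast
    show "regular_solution A T (z n) (W n) (\<lambda>t. if n = 1 then 0 else - C n (z (n - 1) t))"
      unfolding regular_solution_def using wz[OF nn] z2[OF nn] L2c[OF nn] by blast
  qed (rule z2 zL, assumption)+
qed

text \<open>Case (i). The observation of the position is bounded on H, so modal sums converge
  directly by continuity; the order of the data is repaired by applying observability to the time
  antiderivative.\<close>

lemma control_bounded:
  fixes Bn :: "'g \<Rightarrow> 'h"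
  assumes Bn: "\<And>w w'. w \<in> hdom A 2 \<Longrightarrow> B (w, w') = adjoint Bn w'" and Y: "(y0, y1) \<in> state_space A n 1"
  shows "\<exists>v\<in>L2 T. driven_to_zero A n 1 C (bounded_obs Bn n) T y0 y1 v"
proof -
  note T = T_pos
  define \<beta> where "\<beta> x = B (0, x)" for x
  have Ba: "adjoint Bn x = \<beta> x" for x unfolding \<beta>_def by (rule Bn[OF hdom_zero, symmetric])
  have BB: "B (w, w') = \<beta> w'" if "w \<in> hdom A 2" for w w' using Bn[OF that] Ba by simp
  obtain Kb where Kb: "0 \<le> Kb" "\<And>x x'. x \<in> hdom A 2 \<Longrightarrow> norm (B (x, x')) \<le> Kb * sqrt ((norm (Lam 2 x))\<^sup>2 + (norm x')\<^sup>2)"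
    using B_bound[OF adm] by blast
  have \<beta>b: "norm (\<beta> x) \<le> Kb * norm x" for x using Kb(2)[OF hdom_zero, of x] by (simp add: \<beta>_def Lam_zero)
  have bl: "bounded_linear \<beta>"
  proof (rule bounded_linear_intro[where K=Kb])
    show "\<beta> (x + y) = \<beta> x + \<beta> y" for x y using B_add[OF adm hdom_zero hdom_zero, of x y] by (simp add: \<beta>_def)
    show "\<beta> (c *\<^sub>R x) = c *\<^sub>R \<beta> x" for c x using B_scaleR[OF adm hdom_zero, of c x] by (simp add: \<beta>_def)
    show "norm (\<beta> x) \<le> norm x * Kb" for x using \<beta>b[of x] by (simp add: mult.commute)
  qed
  interpret \<beta>: bounded_linear \<beta> by (rule bl)
  have \<beta>p: "(\<Sum>j<N. (x \<bullet> e j) *\<^sub>R \<beta> (e j)) = \<beta> (proj N x)" for N x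
    unfolding proj_def by (simp add: \<beta>.sum \<beta>.scaleR)
  have \<beta>lim: "(\<lambda>N. norm2 T (\<lambda>t. \<beta> (proj N (x t)) - \<beta> (x t))) \<longlonglongrightarrow> 0" if x: "continuous_on {0..T} x" for x
    by (rule norm2_uniform_limit[OF T \<beta>.uniform_limit[OF proj_uniform_limit[OF x]]])
       (intro L2_continuous \<beta>.continuous_on continuous_proj x)+
  have nn: "n \<in> {1..n}" using n by auto
  \<comment> \<open>The pointwise bound integrated over \<open>[0,T]\<close> gives
    \<open>Kb\<^sup>2 * T\<close>; adding 1 keeps the constant positive when the operator
    vanishes.\<close>
  have admT: "admissible T (\<lambda>j. (r j powi (1 - 1)) *\<^sub>R \<beta> (e j)) (Kb\<^sup>2 * T + 1)"
    unfolding admissible_def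
  proof (intro conjI allI impI)
    show "0 < Kb\<^sup>2 * T + 1" using T by (simp add: add_nonneg_pos)
    show "e j = 0 \<Longrightarrow> (r j powi (1 - 1)) *\<^sub>R \<beta> (e j) = 0" for j by (simp add: \<beta>.zero)
    fix N and a b :: "nat \<Rightarrow> real"
    define S where "S = (\<Sum>j<N. (a j)\<^sup>2 + (b j)\<^sup>2)"
    have S: "0 \<le> S" unfolding S_def by (intro sum_nonneg) auto
    define x where "x t = (\<Sum>j<N. (cos (r j * t) * a j + sin (r j * t) * b j) *\<^sub>R e j)" for t
    have xS: "(norm (x t))\<^sup>2 \<le> S" for t using rotation_evolution(2)[where N=N and a=a and b=b and t=t] unfolding x_def S_def .
    have xc: "continuous_on {0..T} x" unfolding x_def by (intro continuous_intros)
    have "norm2 T (\<lambda>t. \<beta> (x t)) \<le> (Kb * sqrt S) * sqrt T"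
    proof (rule norm2_le_sup)
      show "(\<lambda>t. \<beta> (x t)) \<in> L2 T" by (intro L2_continuous \<beta>.continuous_on xc)
      show "norm (\<beta> (x t)) \<le> Kb * sqrt S" for t
        by (rule order_trans[OF \<beta>b mult_left_mono[OF real_le_rsqrt[OF xS] Kb(1)]])
    qed (use T S Kb(1) in auto)
    then have "(norm2 T (\<lambda>t. \<beta> (x t)))\<^sup>2 \<le> ((Kb * sqrt S) * sqrt T)\<^sup>2" by (intro power_mono norm2_nonneg)
    also have "\<dots> \<le> (Kb\<^sup>2 * T + 1) * S" using S T by (simp add: power_mult_distrib algebra_simps)
    finally show "(norm2 T (\<lambda>t. \<Sum>j<N. (cos (r j * t) * a j + sin (r j * t) * b j) *\<^sub>R (r j powi (1 - 1)) *\<^sub>R \<beta> (e j)))\<^sup>2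
        \<le> (Kb\<^sup>2 * T + 1) * (\<Sum>j<N. (a j)\<^sup>2 + (b j)\<^sup>2)"
      unfolding S_def[symmetric] by (simp add: x_def \<beta>.sum \<beta>.scaleR)
  qed
  obtain K where K: "0 \<le> K" "\<And>W W' g i. cascade_solution A n C T W W' \<Longrightarrow>
      is_observation A B T (W n) (W' n) (\<lambda>t. if n = 1 then 0 else - C n (W (n - 1) t)) g \<Longrightarrow> i \<in> {1..n} \<Longrightarrow>
      norm (Lam (int i - int n + 1) (W i 0)) \<le> K * norm2 T g \<and> norm (Lam (int i - int n) (W' i 0)) \<le> K * norm2 T g"
    by (rule observability_inequality) blast
  have "\<forall>i\<in>{2..n}. \<exists>c\<ge>0. \<forall>x. norm (Lam (- (int n - int i + 1)) (C i x)) \<le> c * norm (Lam (- (int n - int i + 1)) x)"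
  proof
    fix i assume i: "i \<in> {2..n}"
    have q: "0 \<le> int n - int i + 1" "int n - int i + 1 \<in> {0..int n - int i + 1}" using i by auto
    show "\<exists>c\<ge>0. \<forall>x. norm (Lam (- (int n - int i + 1)) (C i x)) \<le> c * norm (Lam (- (int n - int i + 1)) x)"
      by (rule adjoint_bounded_negative[OF coupling_linear[OF i] q(1) coupling_adjoint[OF i q(2)]]) blast
  qed
  then obtain cc where cc: "\<And>i. i \<in> {2..n} \<Longrightarrow> 0 \<le> cc i"
    "\<And>i x. i \<in> {2..n} \<Longrightarrow> norm (Lam (- (int n - int i + 1)) (C i x)) \<le> cc i * norm (Lam (- (int n - int i + 1)) x)" by metis
  define c where "c = (\<Sum>i=2..n. cc i)"
  have c: "0 \<le> c" "\<And>i. i \<in> {2..n} \<Longrightarrow> cc i \<le> c"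
    unfolding c_def by (auto intro!: sum_nonneg member_le_sum cc(1))
  \<comment> \<open>\<open>W'\<close> is recovered from \<open>z\<close> by the equation. The term
    with \<open>A\<close> costs two orders and is measured by \<open>K\<close>; the coupling term
    costs the bound \<open>c\<close> and the embedding constant \<open>\<delta> powi (- 1)\<close>,
    since \<open>z (k - 1)\<close> is controlled one order higher than the norm that is
    needed.\<close>
  define K' where "K' = K + c * (\<delta> powi (- 1) * K)"
  have dp: "0 \<le> \<delta> powi (- 1)" using delta_pos by simp
  have K': "0 \<le> K'" "K \<le> K'" unfolding K'_def using K(1) c(1) dp by auto
  show ?thesis
  proof (rule exact_control[OF T n zero_le_one order_refl coupling_linear coupling_adjoint _ _ admT K'(1) _ Y])
    show "\<exists>g. bounded_obs Bn n w w' g" for w w' unfolding bounded_obs_def by blast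
  next
    fix w w' g assume ds: "dual_solution A n 1 C T w w'" and "bounded_obs Bn n w w' g"
    then have g: "g t = \<beta> (riesz (w n t))" for t unfolding bounded_obs_def Ba by simp
    obtain a where a: "continuous_on {0..T} a" "\<And>t. t \<in> {0..T} \<Longrightarrow> w n t = dual (int n - int n - 1 + 1) (a t)"
      using ds nn Hs_continuousE[of "int n - int n - 1 + 1" T "w n"] unfolding dual_solution_def by blast
    have wn: "w n t = inner (a t)" if "t \<in> {0..T}" for t using a(2)[OF that] by (simp add: dual_nonneg Lam_0)
    have ga: "g t = \<beta> (a t)" if "t \<in> {0..T}" for t unfolding g wn[OF that] riesz_inner ..
    have "continuous_on {0..T} g" by (rule continuous_on_eq[OF \<beta>.continuous_on[OF a(1)]]) (simp add: ga)
    moreover have "norm2 T (\<lambda>t. (\<Sum>j<N. w n t (e j) *\<^sub>R \<beta> (e j)) - g t) = norm2 T (\<lambda>t. \<beta> (proj N (a t)) - \<beta> (a t))" for N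
      by (rule norm2_cong) (simp only: wn ga \<beta>p)
    ultimately show "g \<in> L2 T \<and> (\<lambda>N. norm2 T (\<lambda>t. (\<Sum>j<N. w n t (e j) *\<^sub>R \<beta> (e j)) - g t)) \<longlonglongrightarrow> 0"
      using \<beta>lim[OF a(1)] L2_continuous by simp
  next
    fix W W' g k
    assume W: "cascade_solution A n C T W W'" and g: "g \<in> L2 T" "(\<lambda>N. norm2 T (\<lambda>t. (\<Sum>j<N. (W n t \<bullet> e j) *\<^sub>R \<beta> (e j)) - g t)) \<longlonglongrightarrow> 0"
      and k: "k \<in> {1..n}"
    obtain z where z: "cascade_solution A n C T z W"
      "regular_solution A T (z n) (W n) (\<lambda>t. if n = 1 then 0 else - C n (z (n - 1) t))"
      "\<And>i t. i \<in> {1..n} \<Longrightarrow> z i t \<in> hdom A 2"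
      "\<And>i t. i \<in> {1..n} \<Longrightarrow> W' i t = - Lam 2 (z i t) - (if i = 1 then 0 else C i (z (i - 1) t))"
      by (rule cascade_antiderivative[OF W]) (rule that; assumption)
    have Wn: "continuous_on {0..T} (W n)"
      by (rule wave_solution_continuous(1)[OF bspec[OF W[unfolded cascade_solution_def] nn]])
    have BzW: "B (z n t, W n t) = \<beta> (W n t)" for t by (rule BB[OF z(3)[OF nn]])
    \<comment> \<open>The modal sums of \<open>W n\<close> converge both to \<open>g\<close> and to
      the bounded observation of \<open>W n\<close>; the triangle inequality compares the norms of
      these two limits.\<close>
    have gle: "norm2 T (\<lambda>t. B (z n t, W n t)) \<le> norm2 T g"
    proof -
      have \<beta>W: "(\<lambda>t. \<beta> (W n t)) \<in> L2 T" "(\<lambda>t. \<beta> (proj N (W n t))) \<in> L2 T" for N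
        by (intro L2_continuous \<beta>.continuous_on continuous_proj Wn)+
      have "(\<lambda>N. norm2 T (\<lambda>t. \<beta> (proj N (W n t)) - \<beta> (W n t)) + norm2 T (\<lambda>t. \<beta> (proj N (W n t)) - g t) + norm2 T g) \<longlonglongrightarrow> 0 + 0 + norm2 T g"
        using g(2) unfolding \<beta>p by (intro tendsto_add tendsto_const \<beta>lim[OF Wn])
      moreover have "norm2 T (\<lambda>t. \<beta> (W n t)) \<le> norm2 T (\<lambda>t. \<beta> (proj N (W n t)) - \<beta> (W n t)) + norm2 T (\<lambda>t. \<beta> (proj N (W n t)) - g t) + norm2 T g" for N
        using norm2_triangle_diff[OF \<beta>W(1) \<beta>W(2) g(1), of N] norm2_triangle[OF L2_diff[OF \<beta>W(1) g(1)] g(1)]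
          norm2_minus_commute[of T "\<lambda>t. \<beta> (W n t)" "\<lambda>t. \<beta> (proj N (W n t))"] by simp
      ultimately have "norm2 T (\<lambda>t. \<beta> (W n t)) \<le> 0 + 0 + norm2 T g" by (intro LIMSEQ_le_const) auto
      then show ?thesis unfolding BzW by simp
    qed
    \<comment> \<open>Observability for the pair formed by \<open>z\<close> and its derivative
      \<open>W\<close>. The second estimate is already the bound on \<open>W\<close> at the order
      required in case (i).\<close>
    have ok: "norm (Lam (int i - int n + 1) (z i 0)) \<le> K * norm2 T g" "norm (Lam (int i - int n) (W i 0)) \<le> K * norm2 T g"
      if i: "i \<in> {1..n}" for i
      using K(2)[OF z(1) regular_is_observation[OF adm z(2)] i] mult_left_mono[OF gle K(1)] by linarith+
    have g0: "0 \<le> norm2 T g" by (rule norm2_nonneg)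
    have "norm (Lam (int k - int n - 1) (W' k 0)) \<le> K' * norm2 T g"
    proof -
      define y where "y = (if k = 1 then 0 else C k (z (k - 1) 0))"
      have m: "int k - int n - 1 \<le> 0" using k by auto
      have up: "z k 0 \<in> hdom A (int k - int n - 1 + 2)" using hdom_le(1)[OF _ z(3)[OF k, of 0], of "int k - int n - 1 + 2"] k by auto
      have "W' k 0 = (- 1) *\<^sub>R (Lam 2 (z k 0) + y)" using z(4)[OF k, of 0] by (simp add: y_def)
      then have "norm (Lam (int k - int n - 1) (W' k 0)) = norm (Lam (int k - int n - 1) (Lam 2 (z k 0)) + Lam (int k - int n - 1) y)"
        using hdom_nonpos[OF m] by (simp only: Lam_scaleR Lam_add norm_scaleR abs_minus abs_one mult_1 abs_minus_cancel)
      also have "\<dots> \<le> norm (Lam (int k - int n - 1) (Lam 2 (z k 0))) + norm (Lam (int k - int n - 1) y)" by (rule norm_triangle_ineq)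
      also have "Lam (int k - int n - 1) (Lam 2 (z k 0)) = Lam (int k - int n + 1) (z k 0)"
        using hdom_Lam(2)[OF z(3)[OF k] up] by (simp add: algebra_simps)
      also have "norm (Lam (int k - int n - 1) y) \<le> c * (\<delta> powi (- 1) * (K * norm2 T g))"
      proof (cases "k = 1")
        case False
        then have k2: "k \<in> {2..n}" and k1: "k - 1 \<in> {1..n}" and o: "int (k - 1) - int n + 1 = int k - int n"
            "- (int n - int k + 1) = int k - int n - 1" "int k - int n - 1 - (int k - int n) = - 1" using k by auto
        have zk: "z (k - 1) 0 \<in> hdom A (int k - int n)" by (rule hdom_nonpos) (use k in auto)
        have "norm (Lam (int k - int n - 1) (C k (z (k - 1) 0))) \<le> cc k * norm (Lam (int k - int n - 1) (z (k - 1) 0))"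
          using cc(2)[OF k2] unfolding o .
        also have "\<dots> \<le> c * norm (Lam (int k - int n - 1) (z (k - 1) 0))" by (rule mult_right_mono[OF c(2)[OF k2]]) simp
        also have "norm (Lam (int k - int n - 1) (z (k - 1) 0)) \<le> \<delta> powi (- 1) * norm (Lam (int k - int n) (z (k - 1) 0))"
          using hdom_le(2)[OF _ zk, of "int k - int n - 1"] unfolding o by simp
        also have "norm (Lam (int k - int n) (z (k - 1) 0)) \<le> K * norm2 T g" using ok(1)[OF k1] unfolding o .
        finally show ?thesis using False c(1) dp by (simp add: y_def mult_left_mono)
      qed (use c(1) dp K(1) g0 in \<open>simp add: y_def Lam_zero\<close>)
      finally show ?thesis using ok(1)[OF k] unfolding K'_def by (simp add: algebra_simps)
    qed
    moreover have "norm (Lam (int k - int n - 1 + 1) (W k 0)) \<le> K' * norm2 T g"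
      using ok(2)[OF k] mult_right_mono[OF K'(2) g0] by simp
    ultimately show "norm (Lam (int k - int n - 1 + 1) (W k 0)) \<le> K' * norm2 T g \<and> norm (Lam (int k - int n - 1) (W' k 0)) \<le> K' * norm2 T g"
      by blast
  qed
qed

end

end

theorem theorem2p23:
  fixes A :: "('h::{real_inner, complete_space} \<times> 'h) set"
    and C P :: "nat \<Rightarrow> 'h \<Rightarrow> 'h"
    and B :: "'h \<times> 'h \<Rightarrow> 'g::{real_inner, complete_space}"
    and n :: nat
    and Tstar :: real
  assumes "2 \<le> n"
    and "admissible_generator A"
    and "coupling_hyp A n C P"
    and "coupling_observability_hyp A n P"
    and "admissibility_hyp A B"
    and "observability_hyp A B"
    and "observability_time A n C B Tstar"
  shows
    "(\<forall>Bn :: 'g \<Rightarrow> 'h.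
        bounded_linear Bn \<and> (\<forall>w\<in>hdom A 2. \<forall>w'. B (w, w') = adjoint Bn w') \<longrightarrow>
        (\<forall>T>Tstar. \<forall>(y0, y1) \<in> state_space A n 1.
           \<exists>v\<in>L2 T. driven_to_zero A n 1 C (bounded_obs Bn n) T y0 y1 v))
     \<and>
     (\<forall>Bn :: 'g \<Rightarrow> 'h \<Rightarrow> real.
        bounded_into_dual A 2 Bn \<and> (\<forall>w\<in>hdom A 2. \<forall>w'. B (w, w') = dual_adjoint Bn w) \<longrightarrow>
        (\<forall>T>Tstar. \<forall>(y0, y1) \<in> state_space A n 0.
           \<exists>v\<in>L2 T. driven_to_zero A n 0 C (unbounded_obs A C Bn T n) T y0 y1 v))"
proof (rule admissible_generator_eigenbasis[OF assms(2)])
  fix e :: "nat \<Rightarrow> 'h" and r :: "nat \<Rightarrow> real" and \<delta> :: real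
  assume e: "\<And>i j. i \<noteq> j \<Longrightarrow> e i \<bullet> e j = 0" "\<And>j. e j \<noteq> 0 \<Longrightarrow> norm (e j) = 1"
    "\<And>x. (\<And>j. x \<bullet> e j = 0) \<Longrightarrow> x = 0"
    "\<And>j. (e j, (r j)\<^sup>2 *\<^sub>R e j) \<in> A" "0 < \<delta>" "\<And>j. \<delta> \<le> r j"
  have sa: "self_adjoint A" using assms(2) unfolding admissible_generator_def by blast
  interpret eigenbasis A e r \<delta> by (rule eigenbasis.intro[OF sa e])
  show ?thesis
  proof (intro conjI allI impI ballI; clarify)
    fix Bn :: "'g \<Rightarrow> 'h" and T y0 y1
    assume "\<forall>w\<in>hdom A 2. \<forall>w'. B (w, w') = adjoint Bn w'" "Tstar < T" "(y0, y1) \<in> state_space A n 1"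
    then show "\<exists>v\<in>L2 T. driven_to_zero A n 1 C (bounded_obs Bn n) T y0 y1 v"
      by (intro control_bounded[OF assms(1,3,5,7)]) simp_all
  next
    fix Bn :: "'g \<Rightarrow> 'h \<Rightarrow> real" and T y0 y1
    assume "\<forall>w\<in>hdom A 2. \<forall>w'. B (w, w') = dual_adjoint Bn w" "Tstar < T" "(y0, y1) \<in> state_space A n 0"
    then show "\<exists>v\<in>L2 T. driven_to_zero A n 0 C (unbounded_obs A C Bn T n) T y0 y1 v"
      by (intro control_unbounded[OF assms(1,3,5,7)]) simp_all
  qed
qed

end
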